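(* Let $d\in\mathbf{Z}\setminus\{0\}$. For $g\ge g_\infty^*$, the normal core solution $(\tilde f_\infty,0)$ is the only admissible solution of $(GL)_{\infty,g}$. For $0<g<g_\infty^*$ there is a unique admissible solution of $(GL)_{\infty,g}$ with $m>0$, and this solution is the global minimizer of $\mathcal{E}_{\infty,g}$ (i.e. $\mathcal{E}_{\infty,g}$ attains its minimum over $Z$ at it).
   Context: All functions are real-valued functions of $r$, and $\int u\,r\,dr=\int_0^\infty u(r)\,r\,dr$. $H$ is the space of radial functions in $H^1(\mathbf{R}^2)$, with $\|u\|_H^2=\int[(u')^2+u^2]\,r\,dr$; $X=\{u\in H:\int\frac{u^2}{r^2}\,r\,dr<\infty\}$. $\tilde f_\infty$ is the unique positive solution of $-f''-\frac1rf'+\frac{d^2}{r^2}f=(1-f^2)f$ on $(0,\infty)$ with $f(0)=0$, $f(r)\to1$ as $r\to\infty$. $Z=\{(\tilde f_\infty+u,m):u\in X,\ m\in H\}$. $(GL)_{\infty,g}$ is the system $-f''-\frac1r f'+\frac{d^2}{r^2}f=(1-f^2-m^2)f$, $\;-m''-\frac1r m'+gm=(1-f^2-m^2)m$, with energy $$\mathcal{E}_{\infty,g}(f,m)=\frac12\int\Big\{(f')^2+(m')^2+gm^2+\tfrac{d^2}{r^2}[f^2-\tilde f_\infty^2]+\tfrac12(1-f^2-m^2)^2\Big\}r\,dr.$$ $(f,m)$ is an admissible solution if: the system holds for all $r\in(0,\infty)$; $\mathcal{E}_{\infty,g}(f,m)<\infty$; $f\ge0$ and $m\ge0$ for all $r\ge0$;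 $m'(0)=0$. Finally $$g_\infty^*=-\inf_{w\in H\setminus\{0\}}\frac{\int[(w')^2-(1-\tilde f_\infty^2)w^2]\,r\,dr}{\int w^2\,r\,dr}>0.$$ *)

theory Defs
  imports "HOL-Analysis.Analysis"
begin

section \<open>Weak gradients and the radial Sobolev spaces\<close>

text \<open>Test functions are compactly supported \<open>C\<^sup>1\<close> functions on an open set \<open>\<Omega>\<close>; \<open>D\<phi>\<close> is
  the classical gradient.  (By mollification, \<open>C\<^sup>1\<close> and \<open>C\<^sup>\<infinity>\<close> test functions give the same
  weak gradients.)\<close>

definition test_function_on ::
  "'a::euclidean_space set \<Rightarrow> ('a \<Rightarrow> real) \<Rightarrow> ('a \<Rightarrow> 'a) \<Rightarrow> bool" where
  "test_function_on \<Omega> \<phi> D\<phi> \<longleftrightarrow>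
     (\<forall>x. GDERIV \<phi> x :> D\<phi> x) \<and> continuous_on UNIV D\<phi> \<and>
     compact (closure {x. \<phi> x \<noteq> 0}) \<and> closure {x. \<phi> x \<noteq> 0} \<subseteq> \<Omega>"

definition weak_gradient_on ::
  "'a::euclidean_space set \<Rightarrow> ('a \<Rightarrow> real) \<Rightarrow> ('a \<Rightarrow> 'a) \<Rightarrow> bool" where
  "weak_gradient_on \<Omega> w G \<longleftrightarrow>
     (\<forall>K. compact K \<and> K \<subseteq> \<Omega> \<longrightarrow> set_integrable lborel K w \<and> set_integrable lborel K G) \<and>
     (\<forall>\<phi> D\<phi>. test_function_on \<Omega> \<phi> D\<phi> \<longrightarrow>
        (\<forall>i\<in>Basis. (LINT x:\<Omega>|lborel. w x * (D\<phi> x \<bullet> i)) = - (LINT x:\<Omega>|lborel. (G x \<bullet> i) * \<phi> x)))"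

definition H1 :: "('a::euclidean_space \<Rightarrow> real) set" where
  "H1 = {w. w \<in> borel_measurable lborel \<and> integrable lborel (\<lambda>x. (w x)\<^sup>2) \<and>
           (\<exists>G. G \<in> borel_measurable lborel \<and> integrable lborel (\<lambda>x. (norm (G x))\<^sup>2) \<and>
                weak_gradient_on UNIV w G)}"

text \<open>A radial function on the plane is represented by its profile \<open>u\<close>, a function of \<open>r = |x|\<close>.
  Only the values of \<open>u\<close> on \<open>[0,\<infinity>)\<close> matter.\<close>

definition H_rad :: "(real \<Rightarrow> real) set" where
  "H_rad = {u. (\<lambda>x::real^2. u (norm x)) \<in> H1}"

text \<open>The derivative \<open>u'\<close> of a profile: its weak derivative on \<open>(0,\<infinity>)\<close>, determined almost
  everywhere there.  For \<open>C\<^sup>1\<close> functions on \<open>(0,\<infinity>)\<close> it agrees almost everywhere with the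
  classical derivative.\<close>

definition wderiv :: "(real \<Rightarrow> real) \<Rightarrow> real \<Rightarrow> real" where
  "wderiv u = (SOME v. weak_gradient_on {0<..} u v)"

definition X_rad :: "(real \<Rightarrow> real) set" where
  "X_rad = {u \<in> H_rad. set_integrable lborel {0<..} (\<lambda>r. (u r)\<^sup>2 / r\<^sup>2 * r)}"

section \<open>The normal core profile and the system\<close>

definition C0_twice_diff :: "(real \<Rightarrow> real) \<Rightarrow> bool" where
  "C0_twice_diff f \<longleftrightarrow> continuous_on {0..} f \<and>
     (\<forall>r>0. f differentiable (at r) \<and> deriv f differentiable (at r))"

definition normal_core_profile :: "int \<Rightarrow> (real \<Rightarrow> real) \<Rightarrow> bool" where
  "normal_core_profile d f \<longleftrightarrow> C0_twice_diff f \<and>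
     (\<forall>r>0. f r > 0 \<and>
        - deriv (deriv f) r - 1 / r * deriv f r + (of_int d)\<^sup>2 / r\<^sup>2 * f r = (1 - (f r)\<^sup>2) * f r) \<and>
     f 0 = 0 \<and> (f \<longlongrightarrow> 1) at_top"

definition Z_rad :: "(real \<Rightarrow> real) \<Rightarrow> ((real \<Rightarrow> real) \<times> (real \<Rightarrow> real)) set" where
  "Z_rad finf = {(\<lambda>r. finf r + u r, m) | u m. u \<in> X_rad \<and> m \<in> H_rad}"

definition GL_system :: "int \<Rightarrow> real \<Rightarrow> (real \<Rightarrow> real) \<Rightarrow> (real \<Rightarrow> real) \<Rightarrow> bool" where
  "GL_system d g f m \<longleftrightarrow>
     (\<forall>r>0.
        - deriv (deriv f) r - 1 / r * deriv f r + (of_int d)\<^sup>2 / r\<^sup>2 * f r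
            = (1 - (f r)\<^sup>2 - (m r)\<^sup>2) * f r \<and>
        - deriv (deriv m) r - 1 / r * deriv m r + g * m r
            = (1 - (f r)\<^sup>2 - (m r)\<^sup>2) * m r)"

text \<open>The energy density has no sign, so the energy is the extended-real integral, positive part
  minus negative part.  Negative parts are integrable on \<open>Z_rad\<close> and, if \<open>g > 0\<close>, for all
  pairs \<open>(f,m)\<close>, so the \<open>ereal\<close> convention for \<open>\<infinity> - \<infinity>\<close> plays no role.\<close>

definition ext_integral :: "real set \<Rightarrow> (real \<Rightarrow> real) \<Rightarrow> ereal" where
  "ext_integral A h =
     enn2ereal (\<integral>\<^sup>+r\<in>A. ennreal (h r) \<partial>lborel) - enn2ereal (\<integral>\<^sup>+r\<in>A. ennreal (- h r) \<partial>lborel)"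

definition GL_energy ::
  "int \<Rightarrow> (real \<Rightarrow> real) \<Rightarrow> real \<Rightarrow> (real \<Rightarrow> real) \<Rightarrow> (real \<Rightarrow> real) \<Rightarrow> ereal" where
  "GL_energy d finf g f m = ereal (1 / 2) * ext_integral {0<..} (\<lambda>r.
     ((wderiv f r)\<^sup>2 + (wderiv m r)\<^sup>2 + g * (m r)\<^sup>2
        + (of_int d)\<^sup>2 / r\<^sup>2 * ((f r)\<^sup>2 - (finf r)\<^sup>2)
        + 1 / 2 * (1 - (f r)\<^sup>2 - (m r)\<^sup>2)\<^sup>2) * r)"

text \<open>Solutions are functions on \<open>[0,\<infinity>)\<close>, continuous up to \<open>r = 0\<close> so that \<open>f(0)\<close> and \<open>m(0)\<close>
  have a meaning; \<open>m'(0)\<close> is the one-sided derivative.\<close>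

definition admissible_solution ::
  "int \<Rightarrow> (real \<Rightarrow> real) \<Rightarrow> real \<Rightarrow> (real \<Rightarrow> real) \<Rightarrow> (real \<Rightarrow> real) \<Rightarrow> bool" where
  "admissible_solution d finf g f m \<longleftrightarrow>
     C0_twice_diff f \<and> C0_twice_diff m \<and> GL_system d g f m \<and>
     GL_energy d finf g f m < \<infinity> \<and>
     (\<forall>r\<ge>0. f r \<ge> 0 \<and> m r \<ge> 0) \<and>
     (m has_real_derivative 0) (at 0 within {0..})"

text \<open>The infimum is over \<open>w \<noteq> 0\<close> in \<open>H_rad\<close>, that is, not almost everywhere zero.\<close>

definition g_star :: "(real \<Rightarrow> real) \<Rightarrow> real" where
  "g_star finf = - (INF w \<in> {w \<in> H_rad. \<not> (AE r in lborel. 0 < r \<longrightarrow> w r = 0)}.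
     (LINT r:{0<..}|lborel. ((wderiv w r)\<^sup>2 - (1 - (finf r)\<^sup>2) * (w r)\<^sup>2) * r)
       / (LINT r:{0<..}|lborel. (w r)\<^sup>2 * r))"

end

theory Submission
 imports Defs "HOL-Analysis.Analysis"
begin

text \<open>Let \<open>(f, m)\<close> be a solution with \<open>f > 0\<close>, and put \<open>s = f^2 + m^2\<close>. For a competitor \<open>(f + V, q)\<close> with
\<open>S = (f + V)^2 + q^2\<close> the energy difference is exactly half of the sum of the second variation in \<open>V\<close>, the
second variation in \<open>q\<close> and half the integral of \<open>(S - s)^2\<close>, because the first variation vanishes. The form in \<open>V\<close>
is nonnegative by Picone's identity with the positive solution \<open>f\<close>; the form in \<open>q\<close> is nonnegative by Picone's
identity with \<open>m\<close> if \<open>m > 0\<close>, and by the definition of \<open>g_star\<close> if \<open>m = 0\<close> and \<open>g >= g_star\<close>. This gives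
minimality. Applied both ways to two solutions it forces \<open>s\<close> to agree; then \<open>f\<close> satisfies the same linear
equation for both, the Wronskian vanishes and the solutions coincide. For \<open>g < g_star\<close> a solution is the limit
of a monotone iteration along which the second variation in \<open>q\<close> stays nonnegative, so the limit cannot be
the core solution. Solutions of finite energy satisfy the decay bounds needed for these integrations by
parts, by comparison arguments at the origin and at infinity.\<close>

text \<open>The obstacle behind every identity on the half-line is the boundary term: f vanishes at
  the origin, m decays at infinity, and Picone's terms contain r f'/f and r m'/m. In these
  identities no boundary term is shown to tend to zero. It is enough that it is at most C r H(r)
  with H integrable: as 1/r is integrable at neither end, r H(r) is small along some sequence at
  each end. The predicate \<open>nice\<close> collects the pointwise bounds that provide such H.
  Existence does not minimise the energy. The system is competitive, so f can be iterated upwards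
  and m downwards; the start sqrt(1 - g) for m is available because \<open>g_star\<close> is at most
  1. The limit of m may collapse to zero, and no bound on m excludes this. What survives the limit
  is the sign of the quadratic form, since each iterate m is a positive supersolution of a linear
  equation with the coefficients of the step before. Below \<open>g_star\<close> this sign is
  incompatible with the core solution.\<close>

abbreviation integrable_pos :: "(real => real) => bool" where
 "integrable_pos \<equiv> set_integrable lborel {0<..}"

abbreviation measurable_pos :: "(real => real) => bool" where
 "measurable_pos h \<equiv> (\<lambda>r. indicator {0<..} r *\<^sub>R h r) \<in> borel_measurable borel"


section \<open>Absolutely continuous functions and boundary terms\<close>

text \<open>Local absolute continuity on (0, oo), encoded by the fundamental theorem of calculus
  with \<open>u\<close> as density. Nothing is asked at 0, so \<open>U\<close> may be singular
  there, and \<open>u\<close> matters only almost everywhere, which is what weak derivatives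
  provide.\<close>

definition acd :: "(real => real) => (real => real) => bool" where
 "acd U u \<longleftrightarrow> (\<forall>a b. 0 < a --> a <= b -->
   set_integrable lborel {a..b} u \<and> (LBINT x:{a..b}. u x) = U b - U a)"

lemma acdD:
 assumes "acd U u" "0 < a" "a <= b"
 shows "set_integrable lborel {a..b} u" "(LBINT x:{a..b}. u x) = U b - U a"
 using assms by (auto simp: acd_def)

lemma acd_C1:
 assumes d: "!!x. x > 0 ==> DERIV f x :> f' x"
  and c: "continuous_on {0<..} f'"
 shows "acd f f'"
 unfolding acd_def
proof (intro allI impI conjI)
 fix a b :: real assume ab: "0 < a" "a <= b"
 have cc: "continuous_on {a..b} f'"
  using c by (rule continuous_on_subset) (use ab in auto)
 show "set_integrable lborel {a..b} f'"
  using cc by (rule borel_integrable_atLeastAtMost')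
 show "(LBINT x:{a..b}. f' x) = f b - f a"
  unfolding set_lebesgue_integral_def
 proof (rule integral_FTC_atLeastAtMost[OF ab(2) _ cc])
  fix x assume "a <= x" "x <= b"
  then show "(f has_vector_derivative f' x) (at x within {a..b})"
   using d[of x] ab
   by (metis has_field_derivative_at_within has_real_derivative_iff_has_vector_derivative less_le_trans)
 qed
qed

lemma acd_continuous:
 assumes "acd U u"
 shows "continuous_on {0<..} U"
proof -
 have "continuous (at x within {0<..}) U" if x: "x > 0" for x
 proof -
  let ?a = "x/2" and ?b = "x+1"
  have ab: "0 < ?a" "?a <= ?b" using x by auto
  have i: "u integrable_on {?a..?b}"
   using acdD(1)[OF assms ab] by (rule set_borel_integral_eq_integral)
  have "continuous_on {?a..?b} (\<lambda>y. U ?a + integral {?a..y} u)"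
   by (intro continuous_intros indefinite_integral_continuous_1 i)
  moreover have "U ?a + integral {?a..y} u = U y" if "y \<in> {?a..?b}" for y
   using acdD[OF assms ab(1), of y] that set_borel_integral_eq_integral(2)[of "{?a..y}" u] by auto
  ultimately have "continuous_on {?a..?b} U" using continuous_on_cong by (metis (no_types, lifting))
  then have "isCont U x"
   using x by (intro continuous_on_interior[of "{?a..?b}"]) (auto)
  then show ?thesis by (simp add: continuous_at_imp_continuous_at_within)
 qed
 then show ?thesis by (auto simp: continuous_on_eq_continuous_within)
qed

lemma acd_add: "acd U u ==> acd W w ==> acd (\<lambda>x. U x + W x) (\<lambda>x. u x + w x)"
 unfolding acd_def by (auto intro!: set_integral_add)

lemma acd_diff: "acd U u ==> acd W w ==> acd (\<lambda>x. U x - W x) (\<lambda>x. u x - w x)"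
 unfolding acd_def by (auto intro!: set_integral_diff)

lemma set_integrable_mult_continuous:
 fixes u W :: "real => real"
 assumes u: "set_integrable lborel {a..b} u" and W: "continuous_on {a..b} W"
 shows "set_integrable lborel {a..b} (\<lambda>x. u x * W x)"
proof -
 obtain M where M: "!!x. x \<in> {a..b} ==> \<bar>W x\<bar> <= M"
  using compact_continuous_image[OF W] compact_imp_bounded bounded_real
  by (metis (no_types, lifting) compact_Icc image_eqI)
 have m: "(\<lambda>x. indicator {a..b} x *\<^sub>R W x) \<in> borel_measurable borel"
  by (rule borel_measurable_continuous_on_indicator[OF _ W]) auto
 show ?thesis unfolding set_integrable_def
 proof (rule Bochner_Integration.integrable_bound)
  show "integrable lborel (\<lambda>x. M * (indicator {a..b} x *\<^sub>R u x))"
   using u unfolding set_integrable_def by (rule integrable_mult_right)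
  have "(\<lambda>x. (indicator {a..b} x *\<^sub>R u x) * (indicator {a..b} x *\<^sub>R W x)) \<in> borel_measurable lborel"
   using u m unfolding set_integrable_def by (intro borel_measurable_times) auto
  also have "(\<lambda>x. (indicator {a..b} x *\<^sub>R u x) * (indicator {a..b} x *\<^sub>R W x))
    = (\<lambda>x. indicator {a..b} x *\<^sub>R (u x * W x))"
   by (auto simp: indicator_def)
  finally show "(\<lambda>x. indicator {a..b} x *\<^sub>R (u x * W x)) \<in> borel_measurable lborel" .
  show "AE x in lborel. norm (indicator {a..b} x *\<^sub>R (u x * W x)) <= norm (M * (indicator {a..b} x *\<^sub>R u x))"
   using M by (intro AE_I2) (auto simp: indicator_def abs_mult mult.commute intro!: mult_right_mono intro: order_trans[OF _ abs_ge_self])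
 qed
qed

text \<open>Integrating u(x) w(y) over the triangle y <= x in [a,b]^2 in both orders gives the two
  sides of the integration by parts formula; no differentiability of the factors enters.\<close>

lemma acd_mult:
 assumes U: "acd U u" and W: "acd W w"
 shows "acd (\<lambda>x. U x * W x) (\<lambda>x. u x * W x + U x * w x)"
 unfolding acd_def
proof (intro allI impI)
 fix a b :: real assume a: "0 < a" and ab: "a <= b"
 let ?I = "{a..b}"
 have cU: "continuous_on ?I U" and cW: "continuous_on ?I W"
  using acd_continuous[OF U] acd_continuous[OF W] a by (auto elim!: continuous_on_subset)
 note u = acdD[OF U a ab] and w = acdD[OF W a ab]
 have i1: "set_integrable lborel ?I (\<lambda>x. u x * W x)"
  by (rule set_integrable_mult_continuous[OF u(1) cW])
 have i2: "set_integrable lborel ?I (\<lambda>x. U x * w x)"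
  using set_integrable_mult_continuous[OF w(1) cU] by (simp add: mult.commute)
 define ut where "ut x = indicator ?I x * u x" for x
 define wt where "wt x = indicator ?I x * w x" for x
 have iu: "integrable lborel ut" and iw: "integrable lborel wt"
  using u(1) w(1) by (auto simp: set_integrable_def ut_def[abs_def] wt_def[abs_def])
 note [measurable] = borel_measurable_integrable[OF iu] borel_measurable_integrable[OF iw]
 \<comment> \<open>The indicator of y <= x turns the triangle into a kernel on the plane;
   \<open>A\<close> and \<open>B\<close> evaluate the inner integral for either order.\<close>
 define g where "g x y = ut x * (wt y * indicator {..x} y)" for x y :: real
 have iwi: "integrable lborel (\<lambda>y. wt y * indicator {..x} y)" for x
  using integrable_mult_indicator[OF _ iw, of "{..x}"] by (simp add: mult.commute)
 have iui: "integrable lborel (\<lambda>x. ut x * indicator {..x} y)" for y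
 proof -
  have "integrable lborel (\<lambda>x. indicator {y..} x *\<^sub>R ut x)"
   by (rule integrable_mult_indicator[OF _ iu]) simp
  moreover have "(\<lambda>x. indicator {y..} x *\<^sub>R ut x) = (\<lambda>x. ut x * indicator {..x} y)"
   by (auto simp: indicator_def)
  ultimately show ?thesis by simp
 qed
 have mi: "(\<lambda>p::real\<times>real. indicator {..fst p} (snd p) :: real) \<in> borel_measurable (borel \<Otimes>\<^sub>M borel)"
 proof -
  have "Measurable.pred (borel \<Otimes>\<^sub>M borel) (\<lambda>p::real\<times>real. snd p <= fst p)" by measurable
  then have "(\<lambda>p::real\<times>real. if snd p <= fst p then 1 else 0::real) \<in> borel_measurable (borel \<Otimes>\<^sub>M borel)"
   by (intro measurable_If) auto
  moreover have "(\<lambda>p::real\<times>real. if snd p <= fst p then 1 else 0::real) = (\<lambda>p::real\<times>real. indicator {..fst p} (snd p))"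
   by (auto simp: indicator_def)
  ultimately show ?thesis by simp
 qed
 have gm: "(\<lambda>(x,y). g x y) \<in> borel_measurable (lborel \<Otimes>\<^sub>M lborel)"
  unfolding g_def case_prod_beta using mi by measurable
 have gi: "integrable (lborel \<Otimes>\<^sub>M lborel) (\<lambda>(x,y). g x y)"
 proof (rule lborel_pair.Fubini_integrable[OF gm])
  have gm': "(\<lambda>p. g (fst p) (snd p)) \<in> borel_measurable (lborel \<Otimes>\<^sub>M lborel)"
   using gm by (simp add: case_prod_beta)
  have mm: "(\<lambda>x. \<integral>y. norm (g x y) \<partial>lborel) \<in> borel_measurable lborel"
   using gm by measurable
  show "integrable lborel (\<lambda>x. \<integral>y. norm (case (x,y) of (x,y) => g x y) \<partial>lborel)"
  proof (rule Bochner_Integration.integrable_bound)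
   show "integrable lborel (\<lambda>x. ut x * (\<integral>y. \<bar>wt y\<bar> \<partial>lborel))"
    using iu by (intro integrable_mult_left)
   show "(\<lambda>x. \<integral>y. norm (case (x,y) of (x,y) => g x y) \<partial>lborel) \<in> borel_measurable lborel"
    using mm by simp
   show "AE x in lborel. norm (\<integral>y. norm (case (x,y) of (x,y) => g x y) \<partial>lborel)
     <= norm (ut x * (\<integral>y. \<bar>wt y\<bar> \<partial>lborel))"
   proof (rule AE_I2)
    fix x :: real
    have "(\<integral>y. norm (g x y) \<partial>lborel) = \<bar>ut x\<bar> * (\<integral>y. \<bar>wt y * indicator {..x} y\<bar> \<partial>lborel)"
     by (simp add: g_def abs_mult)
    also have "... <= \<bar>ut x\<bar> * (\<integral>y. \<bar>wt y\<bar> \<partial>lborel)"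
     using iw iwi[of x] by (intro mult_left_mono integral_mono) (auto simp: indicator_def)
    finally show "norm (\<integral>y. norm (case (x,y) of (x,y) => g x y) \<partial>lborel)
     <= norm (ut x * (\<integral>y. \<bar>wt y\<bar> \<partial>lborel))"
     by (simp add: abs_mult)
   qed
  qed
  show "AE x in lborel. integrable lborel (\<lambda>y. case (x,y) of (x,y) => g x y)"
   using iwi by (auto simp: g_def)
 qed
 have F: "(\<integral>y. (\<integral>x. g x y \<partial>lborel) \<partial>lborel) = (\<integral>x. (\<integral>y. g x y \<partial>lborel) \<partial>lborel)"
  by (rule lborel_pair.Fubini_integral[OF gi])
 have A: "(\<integral>y. g x y \<partial>lborel) = ut x * (W x - W a)" for x
 proof (cases "x \<in> ?I")
  case True
  have "(\<integral>y. wt y * indicator {..x} y \<partial>lborel) = (LBINT y:{a..x}. w y)"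
   unfolding set_lebesgue_integral_def wt_def
   by (rule Bochner_Integration.integral_cong) (use True in \<open>auto simp: indicator_def\<close>)
  then show ?thesis using acdD(2)[OF W a, of x] True by (simp add: g_def)
 qed (simp add: g_def ut_def)
 have B: "(\<integral>x. g x y \<partial>lborel) = wt y * (U b - U y)" for y
 proof (cases "y \<in> ?I")
  case True
  have "(\<integral>x. ut x * indicator {..x} y \<partial>lborel) = (LBINT x:{y..b}. u x)"
   unfolding set_lebesgue_integral_def ut_def
   by (rule Bochner_Integration.integral_cong) (use True in \<open>auto simp: indicator_def\<close>)
  moreover have "(\<integral>x. g x y \<partial>lborel) = (\<integral>x. wt y * (ut x * indicator {..x} y) \<partial>lborel)"
   by (simp add: g_def mult.left_commute)
  then have "(\<integral>x. g x y \<partial>lborel) = wt y * (\<integral>x. ut x * indicator {..x} y \<partial>lborel)"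
   by simp
  ultimately show ?thesis using acdD(2)[OF U, of y b] True a by simp
 qed (simp add: g_def wt_def)
 have E1: "(\<integral>x. ut x * (W x - W a) \<partial>lborel) = (LBINT x:?I. u x * W x) - W a * (U b - U a)"
 proof -
  have "(\<integral>x. ut x * (W x - W a) \<partial>lborel) = (LBINT x:?I. u x * W x - W a * u x)"
   unfolding set_lebesgue_integral_def ut_def
   by (rule Bochner_Integration.integral_cong) (auto simp: indicator_def algebra_simps)
  also have "... = (LBINT x:?I. u x * W x) - (LBINT x:?I. W a * u x)"
   using i1 u(1) by (intro set_integral_diff) auto
  finally show ?thesis using u(2) by simp
 qed
 have E2: "(\<integral>y. wt y * (U b - U y) \<partial>lborel) = U b * (W b - W a) - (LBINT x:?I. U x * w x)"
 proof -
  have "(\<integral>y. wt y * (U b - U y) \<partial>lborel) = (LBINT x:?I. U b * w x - U x * w x)"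
   unfolding set_lebesgue_integral_def wt_def
   by (rule Bochner_Integration.integral_cong) (auto simp: indicator_def algebra_simps)
  also have "... = (LBINT x:?I. U b * w x) - (LBINT x:?I. U x * w x)"
   using i2 w(1) by (intro set_integral_diff) auto
  finally show ?thesis using w(2) by simp
 qed
 have "(LBINT x:?I. u x * W x) + (LBINT x:?I. U x * w x) = U b * W b - U a * W a"
  using F unfolding A B E1 E2 by (simp add: algebra_simps)
 then show "set_integrable lborel ?I (\<lambda>x. u x * W x + U x * w x) \<and>
   (LBINT x:?I. u x * W x + U x * w x) = U b * W b - U a * W a"
  using i1 i2 by (simp add: set_integral_add)
qed

lemma set_integral_mono_subset:
 fixes h :: "real => real"
 assumes h: "set_integrable lborel B h" and A: "A \<in> sets lborel" "A \<subseteq> B"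
  and p: "!!r. r \<in> B ==> 0 <= h r"
 shows "(LBINT r:A. h r) <= (LBINT r:B. h r)"
 unfolding set_lebesgue_integral_def
proof (rule integral_mono)
 show "integrable lborel (\<lambda>r. indicator A r *\<^sub>R h r)" "integrable lborel (\<lambda>r. indicator B r *\<^sub>R h r)"
  using h set_integrable_subset[OF h A] by (auto simp only: set_integrable_def)
 show "indicator A r *\<^sub>R h r <= indicator B r *\<^sub>R h r" for r
  using A p[of r] by (auto simp: indicator_def)
qed

text \<open>If r h(r) >= e on [a,b], then the integral of h is at least e ln(b/a), and the logarithm
  is unbounded at both ends of the half-line. This replaces pointwise decay of boundary
  terms.\<close>

lemma integrable_frequently_small:
 fixes h :: "real => real"
 assumes h: "integrable_pos h" and p: "!!r. r > 0 ==> 0 <= h r" and e: "e > 0"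
 shows "R > 0 ==> \<exists>r>R. r * h r < e" and "d > 0 ==> \<exists>r>0. r < d \<and> r * h r < e"
proof -
 have key: False if ab: "0 < a" "a <= b" and big: "ln (b/a) > (LBINT r:{0<..}. h r) / e"
  and f: "!!r. a <= r ==> r <= b ==> r * h r >= e" for a b
 proof -
  have "acd ln (\<lambda>r. 1/r)"
   by (rule acd_C1) (auto intro!: continuous_intros derivative_eq_intros)
  note l = acdD[OF this ab]
  have "ln b - ln a = (LBINT r:{a..b}. 1/r)" using l by simp
  also have "... <= (LBINT r:{a..b}. h r / e)"
  proof (rule set_integral_mono[OF l(1)])
   show "set_integrable lborel {a..b} (\<lambda>r. h r / e)"
    using h by (intro set_integrable_divide) (rule set_integrable_subset[OF h], use ab in auto)
   fix r assume "r \<in> {a..b}"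
   then show "1/r <= h r / e" using f[of r] ab e by (auto simp: field_simps)
  qed
  also have "... <= (LBINT r:{0<..}. h r) / e"
  proof -
   have "(LBINT r:{a..b}. h r) <= (LBINT r:{0<..}. h r)"
    by (rule set_integral_mono_subset[OF h]) (use ab p in auto)
   then show ?thesis using e by (simp add: divide_right_mono)
  qed
  finally show False using big ab by (simp add: ln_div)
 qed
 \<comment> \<open>An interval of logarithmic length \<open>K\<close> is too long for
   \<open>key\<close>; it is placed to the right of R or to the left of d.\<close>
 define K where "K = (LBINT r:{0<..}. h r) / e + 1"
 show "\<exists>r>R. r * h r < e" if "R > 0"
 proof (rule ccontr)
  assume "\<not> ?thesis"
  then have n: "!!r. r > R ==> r * h r >= e" by (meson not_less)
  have K: "K > 0" unfolding K_def using e p 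
   by (auto intro!: add_nonneg_pos divide_nonneg_pos simp: set_lebesgue_integral_def intro!: Bochner_Integration.integral_nonneg_AE simp: indicator_def)
  have "ln (((R+1) * exp K) / (R+1)) > (LBINT r:{0<..}. h r) / e"
   using that by (simp add: K_def)
  then show False using n that K by (intro key[of "R+1" "(R+1) * exp K"]) (auto simp: not_less)
 qed
 show "\<exists>r>0. r < d \<and> r * h r < e" if "d > 0"
 proof (rule ccontr)
  assume "\<not> ?thesis"
  then have n: "!!r. 0 < r ==> r < d ==> r * h r >= e" by (meson not_less)
  have K: "K > 0" unfolding K_def using e p 
   by (auto intro!: add_nonneg_pos divide_nonneg_pos simp: set_lebesgue_integral_def intro!: Bochner_Integration.integral_nonneg_AE simp: indicator_def)
  have "ln ((d/2) / ((d/2) / exp K)) > (LBINT r:{0<..}. h r) / e"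
   using that by (simp add: K_def)
  moreover have "(d/2) / exp K <= d/2" using K that by (simp add: field_simps)
  moreover have p0: "0 < (d/2) / exp K" using that by simp
  moreover have "r * h r >= e" if "(d/2) / exp K <= r" "r <= d/2" for r
   using n[of r] that p0 \<open>d > 0\<close> by linarith
  ultimately show False by (intro key[of "(d/2) / exp K" "d/2"]) auto
 qed
qed

text \<open>The boundary terms are evaluated only along sequences a_n -> 0 and b_n -> oo on which r
  H(r) tends to zero; dominated convergence carries the bound from [a_n, b_n] to the
  half-line.\<close>

lemma integral_nonneg_of_boundary:
 fixes h B H :: "real => real"
 assumes h: "integrable_pos h"
  and ge: "!!a b. 0 < a ==> a <= b ==> (LBINT r:{a..b}. h r) >= B b - B a"
  and H: "integrable_pos H" "!!r. r > 0 ==> 0 <= H r"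
  and B0: "eventually (\<lambda>r. \<bar>B r\<bar> <= C * (r * H r)) (at_right 0)"
  and Bi: "eventually (\<lambda>r. \<bar>B r\<bar> <= C * (r * H r)) at_top"
 shows "(LBINT r:{0<..}. h r) >= 0"
proof -
 obtain d where d: "d > 0" "!!r. 0 < r ==> r < d ==> \<bar>B r\<bar> <= C * (r * H r)"
  using B0 unfolding eventually_at_right_field by auto
 obtain R where R: "!!r. r >= R ==> \<bar>B r\<bar> <= C * (r * H r)"
  using Bi unfolding eventually_at_top_linorder by auto
 \<comment> \<open>C may be nonpositive, and the thresholds below divide by it.\<close>
 define C' where "C' = max C 1"
 have C': "C' > 0" "C <= C'" by (auto simp: C'_def)
 have up: "C * (r * H r) <= C' * (r * H r)" if "r > 0" for r
  using that H(2) C' by (intro mult_right_mono) auto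
 have "\<exists>a>0. a < min d (1 / (Suc n)) \<and> a * H a < 1 / (C' * Suc n)" for n
  using integrable_frequently_small(2)[OF H, of "1 / (C' * Suc n)" "min d (1/Suc n)"] d C' by auto
 then obtain a where a: "!!n::nat. 0 < a n \<and> a n < min d (1 / (Suc n)) \<and> a n * H (a n) < 1 / (C' * Suc n)" by metis
 have "\<exists>b>max \<bar>R\<bar> (Suc n). b * H b < 1 / (C' * Suc n)" for n
  using integrable_frequently_small(1)[OF H, of "1 / (C' * Suc n)" "max \<bar>R\<bar> (Suc n)"] C' by auto
 then obtain b where b: "!!n::nat. b n > max \<bar>R\<bar> (Suc n) \<and> b n * H (b n) < 1 / (C' * Suc n)" by metis
 have ab: "0 < a n" "a n <= b n" for n
 proof -
  have "1 / real (Suc n) <= 1" by simp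
  moreover have "a n < 1 / real (Suc n)" "real (Suc n) < b n" "1 <= real (Suc n)"
   using a[of n] b[of n] by auto
  ultimately show "0 < a n" "a n <= b n" using a[of n] by linarith+
 qed
 have "(\<lambda>n. LINT r|lborel. indicator {a n..b n} r *\<^sub>R h r) \<longlonglongrightarrow> (LINT r|lborel. indicator {0<..} r *\<^sub>R h r)"
 proof (rule integral_dominated_convergence)
  show "integrable lborel (\<lambda>r. \<bar>indicator {0<..} r *\<^sub>R h r\<bar>)"
   using h by (auto simp: set_integrable_def)
  show "(\<lambda>r. indicator {0<..} r *\<^sub>R h r) \<in> borel_measurable lborel"
   using h by (auto simp: set_integrable_def)
  show "(\<lambda>r. indicator {a n..b n} r *\<^sub>R h r) \<in> borel_measurable lborel" for n
  proof -
   have "set_integrable lborel {a n..b n} h"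
    by (rule set_integrable_subset[OF h]) (use ab[of n] in auto)
   then show ?thesis by (auto simp: set_integrable_def)
  qed
  show "AE r in lborel. norm (indicator {a n..b n} r *\<^sub>R h r) <= \<bar>indicator {0<..} r *\<^sub>R h r\<bar>" for n
   using ab[of n] by (intro AE_I2) (auto simp: indicator_def)
  show "AE r in lborel. (\<lambda>n. indicator {a n..b n} r *\<^sub>R h r) \<longlonglongrightarrow> indicator {0<..} r *\<^sub>R h r"
  proof (rule AE_I2)
   fix r :: real
   show "(\<lambda>n. indicator {a n..b n} r *\<^sub>R h r) \<longlonglongrightarrow> indicator {0<..} r *\<^sub>R h r"
   proof (cases "r > 0")
    case True
    have "eventually (\<lambda>n::nat. 1/Suc n < r) sequentially"
     using LIMSEQ_inverse_real_of_nat True by (auto dest!: order_tendstoD(2) simp: inverse_eq_divide)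
    moreover have "eventually (\<lambda>n::nat. r <= n) sequentially"
     using eventually_ge_at_top[of "nat \<lceil>r\<rceil>"] by eventually_elim linarith
    ultimately have "eventually (\<lambda>n. indicator {a n..b n} r *\<^sub>R h r = indicator {0<..} r *\<^sub>R h r) sequentially"
    proof eventually_elim
     case (elim n)
     then have "a n <= r" "r <= b n" using a[of n] b[of n] by auto
     then show ?case using True by simp
    qed
    then show ?thesis by (rule tendsto_eventually)
   next
    case False
    then have "(\<lambda>n. indicator {a n..b n} r *\<^sub>R h r) = (\<lambda>n. 0)"
     using ab by (auto simp: indicator_def fun_eq_iff) (metis less_le_trans)
    then show ?thesis using False by simp
   qed
  qed
 qed
 then have lim: "(\<lambda>n. LBINT r:{a n..b n}. h r) \<longlonglongrightarrow> (LBINT r:{0<..}. h r)"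
  by (simp add: set_lebesgue_integral_def)
 have ev: "- (2 / Suc n) <= (LBINT r:{a n..b n}. h r)" for n
 proof -
  have s: "C' * (r * H r) <= 1 / Suc n" if "r * H r < 1 / (C' * Suc n)" for r
   using mult_left_mono[OF less_imp_le[OF that], of C'] C' by simp
  have bp: "b n > 0" using ab[of n] by linarith
  have bR: "R <= b n" using b[of n] by auto
  have "\<bar>B (a n)\<bar> <= C' * (a n * H (a n))"
   using d(2)[of "a n"] a[of n] up[of "a n"] by linarith
  then have "\<bar>B (a n)\<bar> <= 1 / Suc n" using s[of "a n"] a[of n] by linarith
  moreover have "\<bar>B (b n)\<bar> <= C' * (b n * H (b n))"
   using R[OF bR] up[OF bp] by linarith
  then have "\<bar>B (b n)\<bar> <= 1 / Suc n" using s[of "b n"] b[of n] by linarith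
  ultimately show ?thesis using ge[OF ab[of n]] by (simp add: abs_le_iff)
 qed
 have "(\<lambda>n. - (2 / real (Suc n))) \<longlonglongrightarrow> - 0"
  using tendsto_mult_left[OF LIMSEQ_inverse_real_of_nat, of 2] by (intro tendsto_minus) (simp add: inverse_eq_divide)
 from LIMSEQ_le[OF this lim] ev show ?thesis by auto
qed

lemma integral_zero_of_boundary:
 fixes h B H :: "real => real"
 assumes h: "integrable_pos h"
  and eq: "!!a b. 0 < a ==> a <= b ==> (LBINT r:{a..b}. h r) = B b - B a"
  and H: "integrable_pos H" "!!r. r > 0 ==> 0 <= H r"
  and B0: "eventually (\<lambda>r. \<bar>B r\<bar> <= C * (r * H r)) (at_right 0)"
  and Bi: "eventually (\<lambda>r. \<bar>B r\<bar> <= C * (r * H r)) at_top"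
 shows "(LBINT r:{0<..}. h r) = 0"
proof -
 have "(LBINT r:{0<..}. h r) >= 0"
  by (rule integral_nonneg_of_boundary[OF h _ H B0 Bi]) (simp add: eq)
 moreover have "(LBINT r:{0<..}. - h r) >= 0"
 proof (rule integral_nonneg_of_boundary[OF _ _ H])
  show "integrable_pos (\<lambda>r. - h r)" using h by (simp add: set_integrable_def)
  fix a b :: real assume ab: "0 < a" "a <= b"
  have "set_integrable lborel {a..b} h" by (rule set_integrable_subset[OF h]) (use ab in auto)
  then show "(LBINT r:{a..b}. - h r) >= - B b - - B a"
   using eq[OF ab] by (simp add: set_integral_uminus)
 qed (use B0 Bi in auto)
 ultimately show ?thesis using h by (simp add: set_integral_uminus)
qed

text \<open>With y = u'/u the product Q^2 r y has derivative at most (q^2 + c Q^2) r - r (q - Q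
  y)^2. A positive supersolution suffices, so the lemma serves exact solutions as well as the
  iterates of the monotone scheme.\<close>

lemma picone:
 fixes Q q u u' u'' c H :: "real => real"
 assumes Q: "acd Q q"
  and up: "!!r. r > 0 ==> u r > 0"
  and du: "!!r. r > 0 ==> DERIV u r :> u' r"
  and du': "!!r. r > 0 ==> DERIV u' r :> u'' r"
  and cu'': "continuous_on {0<..} u''"
  and sup: "!!r. r > 0 ==> u'' r + u' r / r <= c r * u r"
  and int: "integrable_pos (\<lambda>r. ((q r)^2 + c r * (Q r)^2) * r)"
  and H: "integrable_pos H" "!!r. r > 0 ==> 0 <= H r"
  and B0: "eventually (\<lambda>r. \<bar>(Q r)^2 * (r * u' r / u r)\<bar> <= C * (r * H r)) (at_right 0)"
  and Bi: "eventually (\<lambda>r. \<bar>(Q r)^2 * (r * u' r / u r)\<bar> <= C * (r * H r)) at_top"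
 shows "(LBINT r:{0<..}. ((q r)^2 + c r * (Q r)^2) * r) >= 0"
proof (rule integral_nonneg_of_boundary[OF int _ H B0 Bi])
 fix a b :: real assume ab: "0 < a" "a <= b"
 have cu: "continuous_on {0<..} u" and cu': "continuous_on {0<..} u'"
  using du du' by (auto intro!: continuous_at_imp_continuous_on DERIV_isCont)
 define p where "p r = r * u' r / u r" for r
 define p' where "p' r = (u' r + r * u'' r) / u r - r * (u' r)^2 / (u r)^2" for r
 have "DERIV p r :> p' r" if "r > 0" for r
 proof -
  have "u r ~= 0" using up[OF that] by simp
  then show ?thesis unfolding p_def p'_def
   by (auto intro!: derivative_eq_intros du[OF that] du'[OF that] simp: field_simps power2_eq_square)
 qed
 moreover have "continuous_on {0<..} p'"
  unfolding p'_def by (intro continuous_intros cu cu' cu'') (use up in \<open>force+\<close>)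
 ultimately have p: "acd p p'" by (rule acd_C1)
 have "acd (\<lambda>x. (Q x * Q x) * p x) (\<lambda>x. (q x * Q x + Q x * q x) * p x + (Q x * Q x) * p' x)"
  by (intro acd_mult Q p)
 note A = acdD[OF this ab]
 have "Q b * Q b * p b - Q a * Q a * p a = (LBINT x:{a..b}. (q x * Q x + Q x * q x) * p x + (Q x * Q x) * p' x)"
  using A by simp
 also have "... <= (LBINT r:{a..b}. ((q r)^2 + c r * (Q r)^2) * r)"
 proof (rule set_integral_mono[OF A(1)])
  show "set_integrable lborel {a..b} (\<lambda>r. ((q r)^2 + c r * (Q r)^2) * r)"
   by (rule set_integrable_subset[OF int]) (use ab in auto)
  fix r assume "r \<in> {a..b}"
  then have r: "r > 0" using ab by auto
  define y where "y = u' r / u r"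
  have u0: "u r > 0" using up r by auto
  have "(u' r + r * u'' r) / u r <= r * c r"
   using sup[OF r] r u0 by (simp add: field_simps)
  then have p'le: "p' r <= r * c r - r * y^2"
   by (simp add: p'_def y_def power_divide)
  have pe: "p r = r * y" by (simp add: p_def y_def)
  have "(q r * Q r + Q r * q r) * p r + (Q r * Q r) * p' r
    <= (q r * Q r + Q r * q r) * (r * y) + (Q r * Q r) * (r * c r - r * y^2)"
   using p'le by (auto simp: pe intro: mult_left_mono)
  also have "... = ((q r)^2 + c r * (Q r)^2) * r - r * (q r - Q r * y)^2"
   by (simp add: power2_eq_square algebra_simps)
  also have "... <= ((q r)^2 + c r * (Q r)^2) * r" using r by simp
  finally show "(q r * Q r + Q r * q r) * p r + (Q r * Q r) * p' r <= ((q r)^2 + c r * (Q r)^2) * r" .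
 qed
 finally show "(LBINT r:{a..b}. ((q r)^2 + c r * (Q r)^2) * r)
  >= (Q b)^2 * (b * u' b / u b) - (Q a)^2 * (a * u' a / u a)"
  by (simp add: p_def power2_eq_square)
qed


section \<open>Weak gradients on the half-line\<close>

text \<open>Squaring removes the corner of the positive part at 0. Both the bump of
  \<open>c1c_bump\<close> and the cut-off of \<open>g_star_range\<close> are squares of this
  form.\<close>

lemma DERIV_max0_square: "DERIV (\<lambda>y::real. (max 0 y)^2) y :> 2 * max 0 y"
proof -
 consider "y > 0" | "y < 0" | "y = 0" by linarith
 then show ?thesis
 proof cases
  case 1
  have "DERIV (\<lambda>y::real. y^2) y :> 2 * max 0 y"
   using 1 by (auto intro!: derivative_eq_intros)
  moreover have "\<forall>\<^sub>F x in nhds y. (max 0 x)^2 = x^2"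
   using eventually_nhds_in_open[of "{0<..}" y] 1 by (auto elim: eventually_mono)
  ultimately show ?thesis by (subst DERIV_cong_ev[OF refl _ refl])
 next
  case 2
  have "DERIV (\<lambda>y::real. 0) y :> 2 * max 0 y"
   using 2 by (auto intro!: derivative_eq_intros)
  moreover have "\<forall>\<^sub>F x in nhds y. (max 0 x)^2 = 0"
   using eventually_nhds_in_open[of "{..<0}" y] 2 by (auto elim: eventually_mono)
  ultimately show ?thesis by (subst DERIV_cong_ev[OF refl _ refl])
 next
  case 3
  have "((\<lambda>h. ((max 0 (0+h))^2 - (max 0 (0::real))^2) / h) \<longlongrightarrow> 0) (at 0)"
  proof (rule Lim_null_comparison)
   show "\<forall>\<^sub>F h in at (0::real). norm (((max 0 (0+h))^2 - (max 0 (0::real))^2) / h) <= \<bar>h\<bar>"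
    by (intro always_eventually) (auto simp: max_def power2_eq_square)
   show "((\<lambda>h::real. \<bar>h\<bar>) \<longlongrightarrow> 0) (at 0)" by (auto intro!: tendsto_eq_intros)
  qed
  then show ?thesis using 3 by (simp add: DERIV_def)
 qed
qed

text \<open>One-dimensional test functions with an explicit support interval, so that integrals over
  the half-line become integrals over [a,b]. The vanishing of \<open>D\<close> outside is recorded
  here and derived from the support in \<open>test_c1c\<close>.\<close>

definition c1c :: "(real => real) => (real => real) => real => real => bool" where
 "c1c \<phi> D a b \<longleftrightarrow> 0 < a \<and> a <= b \<and> (\<forall>x. DERIV \<phi> x :> D x) \<and>
   continuous_on UNIV D \<and> (\<forall>x. x \<notin> {a..b} --> \<phi> x = 0 \<and> D x = 0)"

lemma c1c_cont:
 assumes "c1c \<phi> D a b"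
 shows "continuous_on S \<phi>" "continuous_on S D"
proof -
 show "continuous_on S \<phi>"
  using assms by (intro continuous_at_imp_continuous_on) (auto simp: c1c_def intro: DERIV_isCont)
 show "continuous_on S D"
  using assms continuous_on_subset[of UNIV D S] by (simp add: c1c_def)
qed

lemma c1c_test: "c1c \<phi> D a b ==> test_function_on {0<..} \<phi> D"
proof -
 assume c: "c1c \<phi> D a b"
 have s: "{x. \<phi> x ~= 0} \<subseteq> {a..b}" using c by (auto simp: c1c_def)
 then have cl: "closure {x. \<phi> x ~= 0} \<subseteq> {a..b}" by (rule closure_minimal) simp
 have "bounded {x. \<phi> x ~= 0}" using s by (rule bounded_subset[rotated]) simp
 then show ?thesis using c cl by (auto simp: test_function_on_def c1c_def)
qed

lemma test_c1c:
 assumes t: "test_function_on {0<..} \<phi> D"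
 obtains a b where "c1c \<phi> D a b"
proof -
 let ?K = "closure {x. \<phi> x ~= 0}"
 have K: "compact ?K" "?K \<subseteq> {0<..}" using t by (auto simp: test_function_on_def)
 obtain a b where ab: "0 < a" "a <= b" "?K \<subseteq> {a..b}"
 proof (cases "?K = {}")
  \<comment> \<open>The zero function has empty support; any interval serves.\<close>
  case True then show ?thesis using that[of 1 1] by simp
 next
  case False
  obtain a b where "a \<in> ?K" "\<forall>x\<in>?K. a <= x" "b \<in> ?K" "\<forall>x\<in>?K. x <= b"
   using compact_attains_inf[OF K(1) False] compact_attains_sup[OF K(1) False] by blast
  then show ?thesis using K(2) by (intro that[of a b]) auto
 qed
 have d: "!!x. DERIV \<phi> x :> D x" using t by (auto simp: test_function_on_def)
 have z: "\<phi> x = 0" if "x \<notin> {a..b}" for x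
  using that ab(3) closure_subset[of "{x. \<phi> x ~= 0}"] by auto
 have "D x = 0" if x: "x \<notin> {a..b}" for x
 proof -
  have "\<forall>\<^sub>F y in nhds x. y \<in> - {a..b}"
   using x by (intro eventually_nhds_in_open) auto
  then have "\<forall>\<^sub>F y in nhds x. \<phi> y = 0"
   by eventually_elim (use z in auto)
  then have "DERIV \<phi> x :> D x \<longleftrightarrow> DERIV (\<lambda>x. 0) x :> D x"
   by (intro DERIV_cong_ev) auto
  then show ?thesis using d[of x] by (metis DERIV_const DERIV_unique)
 qed
 then have "c1c \<phi> D a b" using ab d z t by (auto simp: c1c_def test_function_on_def)
 then show ?thesis by (rule that)
qed

lemma loc_integrable_compact:
 fixes w :: "real => real"
 assumes w: "!!a b. 0 < a ==> a <= b ==> set_integrable lborel {a..b} w"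
  and K: "compact K" "K \<subseteq> {0<..}"
 shows "set_integrable lborel K w"
proof (cases "K = {}")
 case False
 obtain a b where ab: "a \<in> K" "\<forall>x\<in>K. a <= x" "b \<in> K" "\<forall>x\<in>K. x <= b"
  using compact_attains_inf[OF K(1) False] compact_attains_sup[OF K(1) False] by blast
 have "set_integrable lborel {a..b} w" using ab K by (intro w) auto
 then show ?thesis
  by (rule set_integrable_subset) (use ab K in \<open>auto intro: borel_compact\<close>)
qed simp

lemma weak_gradient_real_iff:
 "weak_gradient_on {0<..} (w::real=>real) v \<longleftrightarrow>
   (\<forall>a b. 0 < a --> a <= b --> set_integrable lborel {a..b} w \<and> set_integrable lborel {a..b} v) \<and>
   (\<forall>\<phi> D a b. c1c \<phi> D a b -->
    (LBINT x:{0<..}. w x * D x) = - (LBINT x:{0<..}. v x * \<phi> x))" (is "?A \<longleftrightarrow> ?B \<and> ?C")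
proof
 assume A: ?A
 have "?B"
 proof (intro allI impI)
  fix a b :: real assume "0 < a" "a <= b"
  then have "compact {a..b} \<and> {a..b} \<subseteq> {0<..}" by auto
  then show "set_integrable lborel {a..b} w \<and> set_integrable lborel {a..b} v"
   by (rule A[unfolded weak_gradient_on_def, THEN conjunct1, rule_format])
 qed
 moreover have ?C
 proof (intro allI impI)
  fix \<phi> D a b assume "c1c \<phi> D a b"
  then have "test_function_on {0<..} \<phi> D" by (rule c1c_test)
  from A[unfolded weak_gradient_on_def, THEN conjunct2, rule_format, OF this, of 1]
  show "(LBINT x:{0<..}. w x * D x) = - (LBINT x:{0<..}. v x * \<phi> x)" by simp
 qed
 ultimately show "?B \<and> ?C" by (rule conjI)
next
 assume BC: "?B \<and> ?C"
 show ?A unfolding weak_gradient_on_def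
 proof (intro conjI allI impI ballI)
  fix K :: "real set" assume K: "compact K \<and> K \<subseteq> {0<..}"
  note B = BC[THEN conjunct1, rule_format]
  show "set_integrable lborel K w" "set_integrable lborel K v"
   using K by (blast intro: loc_integrable_compact[OF B[THEN conjunct1]] loc_integrable_compact[OF B[THEN conjunct2]])+
 next
  fix \<phi> D :: "real => real" and i :: real
  assume "test_function_on {0<..} \<phi> D" and i: "i \<in> Basis"
  then obtain a b where "c1c \<phi> D a b" using test_c1c by metis
  then have "(LBINT x:{0<..}. w x * D x) = - (LBINT x:{0<..}. v x * \<phi> x)"
   by (rule BC[THEN conjunct2, rule_format])
  then show "(LBINT x:{0<..}. w x * (D x \<bullet> i)) = - (LBINT x:{0<..}. v x \<bullet> i * \<phi> x)"
   using i by simp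
 qed
qed

lemma weak_gradient_realD:
 assumes "weak_gradient_on {0<..} (w::real=>real) v"
 shows "0 < a ==> a <= b ==> set_integrable lborel {a..b} w"
  "0 < a ==> a <= b ==> set_integrable lborel {a..b} v"
  "c1c \<phi> D a b ==> (LBINT x:{0<..}. w x * D x) = - (LBINT x:{0<..}. v x * \<phi> x)"
proof -
 note A = assms[unfolded weak_gradient_real_iff]
 show "0 < a ==> a <= b ==> set_integrable lborel {a..b} w"
  "0 < a ==> a <= b ==> set_integrable lborel {a..b} v"
  using A[THEN conjunct1, rule_format, of a b] by simp_all
 show "c1c \<phi> D a b ==> (LBINT x:{0<..}. w x * D x) = - (LBINT x:{0<..}. v x * \<phi> x)"
  by (rule A[THEN conjunct2, rule_format])
qed

lemma set_integral_support:
 fixes f :: "real => real"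
 assumes "!!x. x \<in> A ==> x \<notin> B ==> f x = 0" "B \<subseteq> A"
 shows "(LBINT x:A. f x) = (LBINT x:B. f x)"
  "set_integrable lborel A f \<longleftrightarrow> set_integrable lborel B f"
proof -
 have "(\<lambda>x. indicator A x *\<^sub>R f x) = (\<lambda>x. indicator B x *\<^sub>R f x)"
  using assms by (auto simp: indicator_def fun_eq_iff)
 then show "(LBINT x:A. f x) = (LBINT x:B. f x)"
  "set_integrable lborel A f \<longleftrightarrow> set_integrable lborel B f"
  by (simp_all add: set_lebesgue_integral_def set_integrable_def)
qed

lemma c1c_integrable:
 assumes c: "c1c \<phi> D a b" and w: "!!a b. 0 < a ==> a <= b ==> set_integrable lborel {a..b} w"
 shows "integrable_pos (\<lambda>x. w x * \<phi> x)" "integrable_pos (\<lambda>x. w x * D x)"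
  "(LBINT x:{0<..}. w x * \<phi> x) = (LBINT x:{a..b}. w x * \<phi> x)"
  "(LBINT x:{0<..}. w x * D x) = (LBINT x:{a..b}. w x * D x)"
proof -
 have ab: "0 < a" "a <= b" using c by (auto simp: c1c_def)
 have "set_integrable lborel {a..b} (\<lambda>x. w x * \<phi> x)" "set_integrable lborel {a..b} (\<lambda>x. w x * D x)"
  using set_integrable_mult_continuous[OF w[OF ab]] c1c_cont[OF c] by auto
 moreover have "integrable_pos (\<lambda>x. w x * \<phi> x) \<longleftrightarrow> set_integrable lborel {a..b} (\<lambda>x. w x * \<phi> x)"
  "integrable_pos (\<lambda>x. w x * D x) \<longleftrightarrow> set_integrable lborel {a..b} (\<lambda>x. w x * D x)"
  by (rule set_integral_support; use c in \<open>auto simp: c1c_def\<close>)+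
 ultimately show "integrable_pos (\<lambda>x. w x * \<phi> x)" "integrable_pos (\<lambda>x. w x * D x)"
  by auto
 show "(LBINT x:{0<..}. w x * \<phi> x) = (LBINT x:{a..b}. w x * \<phi> x)"
  "(LBINT x:{0<..}. w x * D x) = (LBINT x:{a..b}. w x * D x)"
  by (rule set_integral_support; use c in \<open>auto simp: c1c_def\<close>)+
qed

section \<open>The fundamental lemma of the calculus of variations\<close>

lemma c1c_bump:
 assumes ab: "0 < a" "a < b"
 obtains \<phi> D where "c1c \<phi> D a b" "!!x. 0 <= \<phi> x" "!!x. \<phi> x <= 1"
  "!!x. a < x ==> x < b ==> 0 < \<phi> x"
proof -
 \<comment> \<open>An upper bound for the square on [a,b], so that the bump has values in [0,1] and
   the powers of 1 - phi in \<open>fundamental_lemma\<close> stay bounded.\<close>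
 define M where "M = ((b-a)*(b-a))^2"
 have M: "M > 0" using ab by (simp add: M_def)
 define \<phi> where "\<phi> x = (max 0 ((x-a)*(b-x)))^2 / M" for x
 define D where "D x = 2 * max 0 ((x-a)*(b-x)) * (b - x - (x - a)) / M" for x
 have "DERIV \<phi> x :> D x" for x
 proof -
  have "DERIV (\<lambda>x. (x-a)*(b-x)) x :> (b - x - (x - a))"
   by (auto intro!: derivative_eq_intros)
  from DERIV_chain2[OF DERIV_max0_square this] show ?thesis
   unfolding \<phi>_def D_def by (auto intro!: DERIV_cdivide)
 qed
 moreover have "continuous_on UNIV D" unfolding D_def using M by (auto intro!: continuous_intros)
 moreover have z: "max 0 ((x-a)*(b-x)) = 0" if "x \<notin> {a..b}" for x
  using that ab by (auto simp: max_def not_le zero_le_mult_iff)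
 ultimately have "c1c \<phi> D a b" using ab by (auto simp: c1c_def \<phi>_def D_def)
 moreover have "\<phi> x <= 1" for x
 proof (cases "x \<in> {a..b}")
  case True
  then have "(x-a)*(b-x) <= (b-a)*(b-a)" by (intro mult_mono) auto
  then have "(max 0 ((x-a)*(b-x)))^2 <= M" unfolding M_def by (intro power_mono) auto
  then show ?thesis using M by (simp add: \<phi>_def)
 qed (simp add: \<phi>_def z)
 moreover have "0 < \<phi> x" if "a < x" "x < b" for x
  using that M by (simp add: \<phi>_def max_def)
 moreover have "0 <= \<phi> x" for x using M by (simp add: \<phi>_def)
 ultimately show ?thesis using that by blast
qed

text \<open>The positive and the negative part of z on (a,b) are densities of two finite measures
  that agree on every half-line, hence are equal, and densities are unique almost everywhere.
  Countably many intervals exhaust the half-line.\<close>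

lemma AE_zero_of_interval_integrals:
 fixes z :: "real => real"
 assumes int: "!!a b. 0 < a ==> a < b ==> set_integrable lborel {a<..<b} z"
  and zero: "!!a b. 0 < a ==> a < b ==> (LBINT x:{a<..<b}. z x) = 0"
 shows "AE x in lborel. 0 < x --> z x = 0"
proof -
 have *: "AE x in lborel. a < x --> x < b --> z x = 0" if ab: "0 < a" "a < b" for a b
 proof -
  define y where "y x = indicator {a<..<b} x * z x" for x
  have iy: "integrable lborel y" using int[OF ab] by (simp add: y_def[abs_def] set_integrable_def)
  note [measurable] = borel_measurable_integrable[OF iy]
  have p: "integrable lborel (\<lambda>x. max 0 (y x))" "integrable lborel (\<lambda>x. max 0 (- y x))"
   using iy by auto
  have ly: "(LINT x|lborel. y x * indicator {t<..} x) = 0" for t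
  proof -
   have "(LINT x|lborel. y x * indicator {t<..} x) = (LBINT x:{max a t<..<b}. z x)"
    unfolding set_lebesgue_integral_def y_def
    by (rule Bochner_Integration.integral_cong) (auto simp: indicator_def)
   also have "... = 0"
   proof (cases "max a t < b")
    case True then show ?thesis using zero[of "max a t" b] ab by auto
   next
    case False
    then have "{max a t<..<b} = {}" by (auto simp: max_def split: if_splits)
    then show ?thesis by (simp add: set_lebesgue_integral_def)
   qed
   finally show ?thesis .
  qed
  have em: "emeasure (density lborel (\<lambda>x. ennreal (max 0 (s * y x)))) {t<..}
    = ennreal (LINT x|lborel. max 0 (s * y x) * indicator {t<..} x)" if "s = 1 \<or> s = -1" for s t
  proof -
   have i: "integrable lborel (\<lambda>x. max 0 (s * y x) * indicator {t<..} x)"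
    using p that integrable_mult_indicator[of "{t<..}" lborel "\<lambda>x. max 0 (s * y x)"] by (auto simp: mult.commute)
   have "emeasure (density lborel (\<lambda>x. ennreal (max 0 (s * y x)))) {t<..}
    = (\<integral>\<^sup>+x. ennreal (max 0 (s * y x)) * indicator {t<..} x \<partial>lborel)"
    by (subst emeasure_density) auto
   also have "... = (\<integral>\<^sup>+x. ennreal (max 0 (s * y x) * indicator {t<..} x) \<partial>lborel)"
    by (intro nn_integral_cong) (auto simp: indicator_def)
   also have "... = ennreal (LINT x|lborel. max 0 (s * y x) * indicator {t<..} x)"
    using i by (intro nn_integral_eq_integral) auto
   finally show ?thesis .
  qed
  have "density lborel (\<lambda>x. ennreal (max 0 (1 * y x))) = density lborel (\<lambda>x. ennreal (max 0 (-1 * y x)))"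
  proof (rule measure_eqI_lessThan)
   fix t :: real
   have i: "integrable lborel (\<lambda>x. max 0 (y x) * indicator {t<..} x)" "integrable lborel (\<lambda>x. max 0 (- y x) * indicator {t<..} x)"
    using p integrable_mult_indicator[of "{t<..}" lborel "\<lambda>x. max 0 (y x)"]
      integrable_mult_indicator[of "{t<..}" lborel "\<lambda>x. max 0 (- y x)"] by (auto simp: mult.commute)
   have "(LINT x|lborel. max 0 (y x) * indicator {t<..} x) - (LINT x|lborel. max 0 (- y x) * indicator {t<..} x)
     = (LINT x|lborel. max 0 (y x) * indicator {t<..} x - max 0 (- y x) * indicator {t<..} x)"
    using i by simp
   also have "... = (LINT x|lborel. y x * indicator {t<..} x)"
    by (rule Bochner_Integration.integral_cong) (auto simp: max_def algebra_simps)
   finally have "(LINT x|lborel. max 0 (y x) * indicator {t<..} x) = (LINT x|lborel. max 0 (- y x) * indicator {t<..} x)"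
    using ly by simp
   then show "emeasure (density lborel (\<lambda>x. ennreal (max 0 (1 * y x)))) {t<..}
    = emeasure (density lborel (\<lambda>x. ennreal (max 0 (-1 * y x)))) {t<..}"
    using em[of 1 t] em[of "-1" t] by simp
   show "emeasure (density lborel (\<lambda>x. ennreal (max 0 (1 * y x)))) {t<..} < \<infinity>"
    using em[of 1 t] by simp
  qed auto
  then have "AE x in lborel. ennreal (max 0 (1 * y x)) = ennreal (max 0 (-1 * y x))"
   by (intro sigma_finite_measure.density_unique[OF sigma_finite_lborel]) auto
  then show ?thesis
   by eventually_elim (auto simp: y_def indicator_def max_def split: if_splits)
 qed
 have "AE x in lborel. \<forall>n::nat. 1 / Suc n < x --> x < Suc (Suc n) --> z x = 0"
  unfolding AE_all_countable
 proof
  fix n :: nat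
  have "1 / real (Suc n) <= 1" "1 < real (Suc (Suc n))" by simp_all
  then show "AE x in lborel. 1 / real (Suc n) < x --> x < real (Suc (Suc n)) --> z x = 0"
   by (intro *) (simp, linarith)
 qed
 then show ?thesis
 proof eventually_elim
  case (elim x)
  show ?case
  proof
   assume x: "0 < x"
   have "eventually (\<lambda>n::nat. 1/Suc n < x) sequentially"
    using LIMSEQ_inverse_real_of_nat x by (auto dest!: order_tendstoD(2) simp: inverse_eq_divide)
   moreover have "eventually (\<lambda>n::nat. x < real (Suc (Suc n))) sequentially"
    using eventually_ge_at_top[of "nat \<lceil>x\<rceil>"] by eventually_elim linarith
   ultimately have "eventually (\<lambda>n::nat. z x = 0) sequentially"
    by eventually_elim (use elim in blast)
   then show "z x = 0" by simp
  qed
 qed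
qed

text \<open>For a bump phi on [a,b] the function 1 - (1 - phi)^n is again a test function on [a,b],
  and it tends boundedly to the indicator of (a,b) as n grows. This yields interval integrals
  without mollifiers.\<close>

lemma fundamental_lemma:
 fixes z :: "real => real"
 assumes int: "!!a b. 0 < a ==> a <= b ==> set_integrable lborel {a..b} z"
  and zero: "!!\<phi> D a b. c1c \<phi> D a b ==> (LBINT x:{0<..}. z x * \<phi> x) = 0"
 shows "AE x in lborel. 0 < x --> z x = 0"
proof (rule AE_zero_of_interval_integrals)
 fix a b :: real assume ab: "0 < a" "a < b"
 have iab: "set_integrable lborel {a..b} z" using ab by (intro int) auto
 show "set_integrable lborel {a<..<b} z"
  by (rule set_integrable_subset[OF iab]) auto
 obtain \<phi> D where c: "c1c \<phi> D a b" and r: "!!x. 0 <= \<phi> x" "!!x. \<phi> x <= 1"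
  and p: "!!x. a < x ==> x < b ==> 0 < \<phi> x"
  using c1c_bump[OF ab] by blast
 define \<psi> where "\<psi> n x = 1 - (1 - \<phi> x) ^ n" for n x
 have cn: "c1c (\<psi> n) (\<lambda>x. real n * (1 - \<phi> x) ^ (n - 1) * D x) a b" for n
 proof -
  have "DERIV (\<psi> n) x :> (real n * (1 - \<phi> x) ^ (n - 1) * D x)" for x
   unfolding \<psi>_def using c by (auto simp: c1c_def intro!: derivative_eq_intros)
  moreover have "continuous_on UNIV (\<lambda>x. real n * (1 - \<phi> x) ^ (n - 1) * D x)"
   using c1c_cont[OF c] by (intro continuous_intros)
  ultimately show ?thesis using c by (auto simp: c1c_def \<psi>_def)
 qed
 have z0: "(LBINT x:{a..b}. z x * \<psi> n x) = 0" for n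
  using zero[OF cn, of n] c1c_integrable(3)[OF cn int, of n] by simp
 have bnd: "\<bar>\<psi> n x\<bar> <= 1" for n x
  using r[of x] power_le_one[of "1 - \<phi> x" n] zero_le_power[of "1 - \<phi> x" n] by (auto simp: \<psi>_def)
 have "(\<lambda>n. LINT x|lborel. indicator {a..b} x *\<^sub>R (z x * \<psi> n x)) \<longlonglongrightarrow> (LINT x|lborel. indicator {a<..<b} x *\<^sub>R z x)"
 proof (rule integral_dominated_convergence)
  show "integrable lborel (\<lambda>x. \<bar>indicator {a..b} x *\<^sub>R z x\<bar>)"
   using iab by (auto simp: set_integrable_def)
  show "(\<lambda>x. indicator {a<..<b} x *\<^sub>R z x) \<in> borel_measurable lborel"
   using \<open>set_integrable lborel {a<..<b} z\<close> by (auto simp: set_integrable_def)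
  show "(\<lambda>x. indicator {a..b} x *\<^sub>R (z x * \<psi> n x)) \<in> borel_measurable lborel" for n
   using set_integrable_mult_continuous[OF iab c1c_cont(1)[OF cn[of n]]] by (auto simp: set_integrable_def)
  show "AE x in lborel. norm (indicator {a..b} x *\<^sub>R (z x * \<psi> n x)) <= \<bar>indicator {a..b} x *\<^sub>R z x\<bar>" for n
   using bnd[of n] by (intro AE_I2) (auto simp: indicator_def abs_mult mult_left_le)
  show "AE x in lborel. (\<lambda>n. indicator {a..b} x *\<^sub>R (z x * \<psi> n x)) \<longlonglongrightarrow> indicator {a<..<b} x *\<^sub>R z x"
   using AE_lborel_singleton[of a] AE_lborel_singleton[of b]
  proof eventually_elim
   case (elim x)
   show ?case
   proof (cases "x \<in> {a<..<b}")
    case True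
    then have "(\<lambda>n. (1 - \<phi> x) ^ n) \<longlonglongrightarrow> 0"
     using p[of x] r(2)[of x] by (intro LIMSEQ_power_zero) (auto simp: abs_less_iff)
    then have "(\<lambda>n. z x * \<psi> n x) \<longlonglongrightarrow> z x * (1 - 0)" unfolding \<psi>_def
     by (rule tendsto_mult[OF tendsto_const tendsto_diff[OF tendsto_const]])
    then show ?thesis using True by simp
   next
    case False
    then show ?thesis using elim by (auto simp: indicator_def)
   qed
  qed
 qed
 then have "(\<lambda>n. LBINT x:{a..b}. z x * \<psi> n x) \<longlonglongrightarrow> (LBINT x:{a<..<b}. z x)"
  by (simp add: set_lebesgue_integral_def)
 then show "(LBINT x:{a<..<b}. z x) = 0" unfolding z0 by (simp add: LIMSEQ_const_iff)
qed

lemma weak_gradient_AE_unique: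
 assumes "weak_gradient_on {0<..} (w::real=>real) v1" "weak_gradient_on {0<..} w v2"
 shows "AE x in lborel. 0 < x --> v1 x = v2 x"
proof -
 have "AE x in lborel. 0 < x --> v1 x - v2 x = 0"
 proof (rule fundamental_lemma)
  fix a b :: real assume "0 < a" "a <= b"
  then show "set_integrable lborel {a..b} (\<lambda>x. v1 x - v2 x)"
   by (intro set_integral_diff(1) weak_gradient_realD(2)[OF assms(1)] weak_gradient_realD(2)[OF assms(2)])
 next
  fix \<phi> D a b assume c: "c1c \<phi> D a b"
  have i: "integrable_pos (\<lambda>x. v1 x * \<phi> x)" "integrable_pos (\<lambda>x. v2 x * \<phi> x)"
   using c1c_integrable(1)[OF c weak_gradient_realD(2)[OF assms(1)]]
    c1c_integrable(1)[OF c weak_gradient_realD(2)[OF assms(2)]] by blast+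
  have "(LBINT x:{0<..}. v1 x * \<phi> x) = (LBINT x:{0<..}. v2 x * \<phi> x)"
   using weak_gradient_realD(3)[OF assms(1) c] weak_gradient_realD(3)[OF assms(2) c] by simp
  then show "(LBINT x:{0<..}. (v1 x - v2 x) * \<phi> x) = 0"
   using set_integral_diff(2)[OF i] by (simp add: left_diff_distrib)
 qed
 then show ?thesis by eventually_elim auto
qed

text \<open>\<open>wderiv\<close> is a choice among all weak derivatives; almost everywhere
  uniqueness is what makes its values usable.\<close>

lemma wderiv_AE:
 assumes "weak_gradient_on {0<..} (w::real=>real) v"
 shows "AE x in lborel. 0 < x --> wderiv w x = v x"
proof -
 have "weak_gradient_on {0<..} w (wderiv w)"
  unfolding wderiv_def by (rule someI_ex[of "weak_gradient_on {0<..} w"]) (use assms in blast)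
 then show ?thesis using assms by (rule weak_gradient_AE_unique)
qed

lemma acd_weak_gradient:
 assumes U: "acd U v"
 shows "weak_gradient_on {0<..} U v"
 unfolding weak_gradient_real_iff
proof (intro conjI allI impI)
 fix a b :: real assume ab: "0 < a" "a <= b"
 show v: "set_integrable lborel {a..b} v" using acdD[OF U ab] by simp
 show "set_integrable lborel {a..b} U"
  using ab by (intro borel_integrable_atLeastAtMost' continuous_on_subset[OF acd_continuous[OF U]]) auto
next
 fix \<phi> D a b assume c: "c1c \<phi> D a b"
 have ab: "0 < a" "a <= b" using c by (auto simp: c1c_def)
 have p: "acd \<phi> D" using c c1c_cont[OF c] by (intro acd_C1) (auto simp: c1c_def)
 have v: "!!a b. 0 < a ==> a <= b ==> set_integrable lborel {a..b} v" using acdD[OF U] by simp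
 have u: "!!a b. 0 < a ==> a <= b ==> set_integrable lborel {a..b} U"
  by (intro borel_integrable_atLeastAtMost' continuous_on_subset[OF acd_continuous[OF U]]) auto
 note i = c1c_integrable(1)[OF c v] c1c_integrable(2)[OF c u]
 have "(LBINT x:{0<..}. v x * \<phi> x) + (LBINT x:{0<..}. U x * D x) = (LBINT x:{0<..}. v x * \<phi> x + U x * D x)"
  using i by (simp add: set_integral_add)
 also have "... = (LBINT x:{a/2..b+1}. v x * \<phi> x + U x * D x)"
  by (rule set_integral_support) (use c ab in \<open>auto simp: c1c_def\<close>)
 also have "... = U (b+1) * \<phi> (b+1) - U (a/2) * \<phi> (a/2)"
  using ab by (intro acdD(2)[OF acd_mult[OF U p]]) auto
 also have "... = 0" using c ab by (auto simp: c1c_def)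
 finally show "(LBINT x:{0<..}. U x * D x) = - (LBINT x:{0<..}. v x * \<phi> x)" by simp
qed

lemma weak_gradient_cong_AE:
 assumes v: "weak_gradient_on {0<..} (U::real=>real) v" and e: "AE x in lborel. 0 < x --> u x = U x"
  and m: "!!a b. 0 < a ==> a <= b ==> set_integrable lborel {a..b} u"
 shows "weak_gradient_on {0<..} u v"
 unfolding weak_gradient_real_iff
proof (intro conjI allI impI)
 fix a b :: real assume ab: "0 < a" "a <= b"
 then show "set_integrable lborel {a..b} v" "set_integrable lborel {a..b} u"
  using weak_gradient_realD(2)[OF v] m by blast+
next
 fix \<phi> D a b assume c: "c1c \<phi> D a b"
 have "!!a b. 0 < a ==> a <= b ==> set_integrable lborel {a..b} U" by (fact weak_gradient_realD(1)[OF v])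
 note i = c1c_integrable(2)[OF c m] c1c_integrable(2)[OF c this]
 have "(LBINT x:{0<..}. u x * D x) = (LBINT x:{0<..}. U x * D x)"
  unfolding set_lebesgue_integral_def
  using i e by (intro integral_cong_AE) (auto simp: set_integrable_def indicator_def)
 also have "... = - (LBINT x:{0<..}. v x * \<phi> x)"
  by (rule weak_gradient_realD(3)[OF v c])
 finally show "(LBINT x:{0<..}. u x * D x) = - (LBINT x:{0<..}. v x * \<phi> x)" .
qed

text \<open>A test function with vanishing integral is the derivative of a test function.
  Subtracting from phi the multiple of a fixed bump with the same integral reduces the claim to
  \<open>fundamental_lemma\<close>.\<close>

lemma du_bois_reymond:
 assumes z: "!!a b. 0 < a ==> a <= b ==> set_integrable lborel {a..b} z"
  and zero: "!!\<phi> D a b. c1c \<phi> D a b ==> (LBINT x:{0<..}. z x * D x) = 0"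
 shows "\<exists>c. AE x in lborel. 0 < x --> z x = c"
proof -
 obtain \<phi>0 D0 where c0: "c1c \<phi>0 D0 1 2" and p0: "!!x. 0 <= \<phi>0 x"
  "!!x. 1 < x ==> x < 2 ==> 0 < \<phi>0 x" by (rule c1c_bump[of 1 2]) auto
 have one: "!!a b. 0 < a ==> a <= b ==> set_integrable lborel {a..b::real} (\<lambda>x. 1::real)"
  by (intro borel_integrable_atLeastAtMost') auto
 define I where "I \<phi> = (LBINT x:{0<..}. 1 * \<phi> x)" for \<phi> :: "real => real"
 have I0: "I \<phi>0 > 0"
 proof -
  have "I \<phi>0 >= 0" unfolding I_def set_lebesgue_integral_def
   by (intro Bochner_Integration.integral_nonneg_AE AE_I2) (auto simp: p0)
  moreover have "I \<phi>0 ~= 0"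
  proof
   assume "I \<phi>0 = 0"
   then have "AE x in lborel. indicator {0<..} x *\<^sub>R (1 * \<phi>0 x) = 0"
    using integral_nonneg_eq_0_iff_AE[of lborel "\<lambda>x. indicator {0<..} x *\<^sub>R (1 * \<phi>0 x)"] p0
     c1c_integrable(1)[OF c0 one] by (simp add: I_def set_lebesgue_integral_def set_integrable_def)
   then have "AE x in lborel. x \<notin> {1<..<2::real}"
   proof eventually_elim
    case (elim x)
    then show ?case using p0(2)[of x] by auto
   qed
   then have "emeasure lborel {1<..<2::real} = 0"
    using AE_iff_null_sets[of "{1<..<2::real}" lborel] by (auto simp: null_sets_def)
   then show False by simp
  qed
  ultimately show ?thesis by simp
 qed
 define c where "c = (LBINT x:{0<..}. z x * \<phi>0 x) / I \<phi>0"
 have "AE x in lborel. 0 < x --> z x - c = 0"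
 proof (rule fundamental_lemma)
  fix a b :: real assume ab: "0 < a" "a <= b"
  show "set_integrable lborel {a..b} (\<lambda>x. z x - c)"
   using z[OF ab] one[OF ab] by (intro set_integral_diff) (auto simp: set_integrable_def dest: integrable_mult_left)
 next
  fix \<phi> D a b assume cp: "c1c \<phi> D a b"
  define k where "k = I \<phi> / I \<phi>0"
  define h where "h x = \<phi> x - k * \<phi>0 x" for x
  have hc: "continuous_on UNIV h" unfolding h_def using c1c_cont[OF cp] c1c_cont[OF c0] by (intro continuous_intros)
  obtain F where F: "!!x. (F has_vector_derivative h x) (at x)"
   using einterval_antiderivative[of "-\<infinity>" \<infinity> h] hc by (auto simp: continuous_on_eq_continuous_at)
  have dF: "DERIV F x :> h x" for x
   using F by (simp add: has_real_derivative_iff_has_vector_derivative)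
  \<comment> \<open>The support of the primitive has to contain the supports of both phi and the
    fixed bump on [1,2].\<close>
  define A where "A = min a 1" define B where "B = max b 2"
  have AB: "0 < A" "A <= B" "A <= a" "A <= 1" "b <= B" "2 <= B" using cp by (auto simp: A_def B_def c1c_def)
  have h0: "h x = 0" if "x < A \<or> B < x" for x
   using that AB cp c0 by (auto simp: h_def c1c_def)
  have aF: "acd F h" by (rule acd_C1) (use dF hc in \<open>auto intro: continuous_on_subset\<close>)
  have iI: "(LBINT x:{0<..}. h x) = 0"
  proof -
   have "(LBINT x:{0<..}. h x) = (LBINT x:{0<..}. 1 * \<phi> x) - (LBINT x:{0<..}. k * (1 * \<phi>0 x))"
    unfolding h_def using c1c_integrable(1)[OF cp one] c1c_integrable(1)[OF c0 one]
    by (subst set_integral_diff(2)[symmetric]) auto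
   also have "... = I \<phi> - k * I \<phi>0" unfolding I_def by simp
   finally show ?thesis using I0 by (simp add: k_def)
  qed
  have FAB: "F B = F A"
  proof -
   have "(LBINT x:{0<..}. h x) = (LBINT x:{A..B}. h x)"
    by (rule set_integral_support) (use h0 AB in \<open>auto simp: not_le\<close>)
   then show ?thesis using iI acdD(2)[OF aF AB(1,2)] by simp
  qed
  have Fl: "F x = F A" if "x < A" for x
  proof -
   have "\<exists>z. x < z \<and> z < A \<and> F A - F x = (A - x) * h z" using that dF by (intro MVT2) auto
   then show ?thesis using h0 by auto
  qed
  have Fr: "F x = F A" if "x > B" for x
  proof -
   have "\<exists>z. B < z \<and> z < x \<and> F x - F B = (x - B) * h z" using that dF by (intro MVT2) auto
   then show ?thesis using h0 FAB by auto
  qed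
  have "c1c (\<lambda>x. F x - F A) h A B"
   unfolding c1c_def using AB dF hc h0 Fl Fr
   by (auto intro!: derivative_eq_intros simp: not_le)
  then have "(LBINT x:{0<..}. z x * h x) = 0" by (rule zero)
  moreover note i1 = c1c_integrable(1)[OF cp z] and i2 = c1c_integrable(1)[OF c0 z]
  have "(LBINT x:{0<..}. z x * h x) = (LBINT x:{0<..}. z x * \<phi> x) - k * (LBINT x:{0<..}. z x * \<phi>0 x)"
  proof -
   have "(LBINT x:{0<..}. z x * h x) = (LBINT x:{0<..}. z x * \<phi> x - k * (z x * \<phi>0 x))"
    by (simp add: h_def algebra_simps)
   also have "... = (LBINT x:{0<..}. z x * \<phi> x) - (LBINT x:{0<..}. k * (z x * \<phi>0 x))"
    using i1 i2 by (intro set_integral_diff) auto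
   finally show ?thesis by simp
  qed
  ultimately have e: "(LBINT x:{0<..}. z x * \<phi> x) = c * I \<phi>"
   by (simp add: k_def c_def)
  have "(LBINT x:{0<..}. (z x - c) * \<phi> x) = (LBINT x:{0<..}. z x * \<phi> x - c * (1 * \<phi> x))"
   by (simp add: algebra_simps)
  also have "... = (LBINT x:{0<..}. z x * \<phi> x) - (LBINT x:{0<..}. c * (1 * \<phi> x))"
   using i1 c1c_integrable(1)[OF cp one] by (intro set_integral_diff) auto
  also have "... = 0" using e unfolding I_def by simp
  finally show "(LBINT x:{0<..}. (z x - c) * \<phi> x) = 0" .
 qed
 then have "AE x in lborel. 0 < x --> z x = c" by eventually_elim auto
 then show ?thesis ..
qed

lemma weak_gradient_acd_representative:
 assumes w: "weak_gradient_on {0<..} (u::real=>real) v"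
 obtains U where "acd U v" "AE x in lborel. 0 < x --> u x = U x"
proof -
 have iu: "!!a b. 0 < a ==> a <= b ==> set_integrable lborel {a..b} u"
  and iv: "!!a b. 0 < a ==> a <= b ==> set_integrable lborel {a..b} v"
  by (fact weak_gradient_realD(1,2)[OF w])+
 \<comment> \<open>The base point is 1 because v need not be integrable near 0.\<close>
 define U where "U x = (if 1 <= x then (LBINT y:{1..x}. v y) else - (LBINT y:{x..1}. v y))" for x
 have split: "(LBINT y:{a..c}. v y) = (LBINT y:{a..b}. v y) + (LBINT y:{b..c}. v y)"
  if "0 < a" "a <= b" "b <= c" for a b c
 proof -
  have i: "v integrable_on {a..c}" using set_borel_integral_eq_integral(1)[OF iv] that by auto
  have "integral {a..c} v = (LBINT y:{a..c}. v y)" "integral {a..b} v = (LBINT y:{a..b}. v y)"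
   "integral {b..c} v = (LBINT y:{b..c}. v y)"
   by (rule set_borel_integral_eq_integral(2)[OF iv, symmetric]; use that in linarith)+
  then show ?thesis
   using Henstock_Kurzweil_Integration.integral_combine[OF that(2,3) i] by simp
 qed
 have aU: "acd U v" unfolding acd_def
 proof (intro allI impI conjI)
  fix a b :: real assume ab: "0 < a" "a <= b"
  show "set_integrable lborel {a..b} v" using iv ab by simp
  consider "1 <= a" | "a < 1" "1 <= b" | "b < 1" by linarith
  then show "(LBINT x:{a..b}. v x) = U b - U a"
  proof cases
   case 1 then show ?thesis using ab split[of 1 a b] by (simp add: U_def)
  next
   case 2 then show ?thesis using ab split[of a 1 b] by (simp add: U_def)
  next
   case 3 then show ?thesis using ab split[of a b 1] by (simp add: U_def)
  qed
 qed
 have iU: "!!a b. 0 < a ==> a <= b ==> set_integrable lborel {a..b} U"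
  by (intro borel_integrable_atLeastAtMost' continuous_on_subset[OF acd_continuous[OF aU]]) auto
 have "\<exists>c. AE x in lborel. 0 < x --> u x - U x = c"
 proof (rule du_bois_reymond)
  fix a b :: real assume "0 < a" "a <= b"
  then show "set_integrable lborel {a..b} (\<lambda>x. u x - U x)" using iu iU by (intro set_integral_diff) auto
 next
  fix \<phi> D a b assume c: "c1c \<phi> D a b"
  have "(LBINT x:{0<..}. (u x - U x) * D x) = (LBINT x:{0<..}. u x * D x) - (LBINT x:{0<..}. U x * D x)"
   using c1c_integrable(2)[OF c iu] c1c_integrable(2)[OF c iU]
   by (subst set_integral_diff(2)[symmetric]) (auto simp: algebra_simps)
  also have "... = 0"
   using weak_gradient_realD(3)[OF w c] weak_gradient_realD(3)[OF acd_weak_gradient[OF aU] c] by simp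
  finally show "(LBINT x:{0<..}. (u x - U x) * D x) = 0" .
 qed
 then obtain c where c: "AE x in lborel. 0 < x --> u x - U x = c" by blast
 have "acd (\<lambda>x. U x + c) v" using aU by (auto simp: acd_def)
 moreover have "AE x in lborel. 0 < x --> u x = U x + c" using c by eventually_elim auto
 ultimately show ?thesis using that by blast
qed

text \<open>The sign of f turns convergence of the primitive into integrability of f, which
  therefore need not be known beforehand.\<close>

lemma FTC_tail:
 fixes F f :: "real => real"
 assumes F: "!!x. a < x ==> DERIV F x :> f x" and c: "!!x. a < x ==> isCont f x"
  and p: "!!x. a < x ==> 0 <= f x" and A: "(F \<longlongrightarrow> A) (at_right a)" and B: "(F \<longlongrightarrow> B) at_top"
 shows "set_integrable lborel {a<..} f" "(LBINT x:{a<..}. f x) = B - A"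
proof -
 have A': "((F \<circ> real_of_ereal) \<longlongrightarrow> A) (at_right (ereal a))" using A by (simp add: ereal_tendsto_simps)
 have B': "((F \<circ> real_of_ereal) \<longlongrightarrow> B) (at_left \<infinity>)" using B by (simp add: ereal_tendsto_simps)
 have n: "AE x in lborel. ereal a < ereal x --> ereal x < \<infinity> --> 0 <= f x" using p by (intro AE_I2) auto
 note T = interval_integral_FTC_nonneg[of "ereal a" \<infinity> F f A B, OF _ _ _ n A' B']
 show "set_integrable lborel {a<..} f" using T(1) F c by auto
 have "(LBINT x=ereal a..\<infinity>. f x) = B - A" using T(2) F c by auto
 then show "(LBINT x:{a<..}. f x) = B - A" by (simp add: interval_integral_to_infinity_eq)
qed

lemma set_integrable_bounded_by:
 fixes h G :: "real => real"
 assumes G: "integrable_pos G" and m: "measurable_pos h"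
  and b: "!!r. 0 < r ==> \<bar>h r\<bar> <= G r"
 shows "integrable_pos h"
 unfolding set_integrable_def
proof (rule Bochner_Integration.integrable_bound)
 show "integrable lborel (\<lambda>r. indicator {0<..} r *\<^sub>R G r)" using G by (simp add: set_integrable_def)
 show "(\<lambda>r. indicator {0<..} r *\<^sub>R h r) \<in> borel_measurable lborel" using m by simp
 show "AE r in lborel. norm (indicator {0<..} r *\<^sub>R h r) <= norm (indicator {0<..} r *\<^sub>R G r)"
 proof (rule AE_I2)
  fix r :: real
  show "norm (indicator {0<..} r *\<^sub>R h r) <= norm (indicator {0<..} r *\<^sub>R G r)"
   using b[of r] by (cases "0 < r") auto
 qed
qed

text \<open>The common majorant of the development: 1/(1 + r^2) is the derivative of arctan, and
  most bounds in \<open>nice\<close> are stated with this weight.\<close>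

lemma decay_integrable:
 fixes h :: "real => real"
 assumes c: "continuous_on {0<..} h" and b: "!!r. 0 < r ==> \<bar>h r\<bar> <= K / (1 + r^2)"
 shows "integrable_pos h"
proof -
 have i: "integrable_pos (\<lambda>r::real. 1 / (1 + r^2))"
 proof (rule FTC_tail(1)[where F = arctan and A = 0 and B = "pi / 2"])
  show "DERIV arctan x :> 1 / (1 + x^2)" for x
   using DERIV_arctan[of x] by (simp add: inverse_eq_divide)
  show "isCont (\<lambda>r::real. 1 / (1 + r^2)) x" for x
   by (intro continuous_intros) (simp add: add_nonneg_eq_0_iff)
  have "(arctan \<longlongrightarrow> arctan 0) (at_right 0)" by (intro tendsto_intros)
  then show "(arctan \<longlongrightarrow> 0) (at_right 0)" by simp
  show "(arctan \<longlongrightarrow> pi / 2) at_top" by (rule tendsto_arctan_at_top)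
 qed auto
 then have "integrable_pos (\<lambda>r. K * (1 / (1 + r^2)))" by (intro set_integrable_mult_right)
 then show ?thesis
  by (rule set_integrable_bounded_by[OF _ borel_measurable_continuous_on_indicator[OF _ c]]) (use b in auto)
qed


section \<open>Radial Sobolev functions on the plane\<close>

type_synonym plane = "real^2"

text \<open>Polar coordinates for radial integrands. Both measures give the half-line up to a the
  mass pi a^2 of a disc, and these half-lines generate the Borel sets.\<close>

lemma distr_norm_plane:
 "distr lborel borel (norm :: plane => real) = density lborel (\<lambda>r. ennreal (2 * pi * r * indicator {0<..} r))"
proof (rule measure_eqI_generator_eq_countable[where \<Omega>=UNIV and E="range (\<lambda>a::real. {..a})" and A="range (\<lambda>n::nat. {..real n})"])
 let ?M = "distr lborel borel (norm :: plane => real)"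
 let ?N = "density lborel (\<lambda>r::real. ennreal (2 * pi * r * indicator {0<..} r))"
 have M: "emeasure ?M {..a} = ennreal (pi * (max 0 a)^2)" for a
 proof -
  have "emeasure ?M {..a} = emeasure lborel (norm -` {..a} \<inter> space lborel :: plane set)"
   by (subst emeasure_distr) auto
  also have "norm -` {..a} \<inter> space lborel = (cball 0 a :: plane set)" by (auto simp: dist_norm)
  also have "emeasure lborel (cball 0 a :: plane set) = ennreal (pi * (max 0 a)^2)"
  proof (cases "a >= 0")
   case True
   then show ?thesis by (simp add: emeasure_cball unit_ball_vol_2)
  next
   case False
   then have "cball (0::plane) a = {}" by auto
   then show ?thesis using False by (simp only: emeasure_empty) simp
  qed
  finally show ?thesis .
 qed
 have N: "emeasure ?N {..a} = ennreal (pi * (max 0 a)^2)" for a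
 proof -
  have "emeasure ?N {..a} = (\<integral>\<^sup>+r. ennreal (2 * pi * r * indicator {0<..} r) * indicator {..a} r \<partial>lborel)"
   by (subst emeasure_density) auto
  also have "... = (\<integral>\<^sup>+r. ennreal (2 * pi * r) * indicator {0..max 0 a} r \<partial>lborel)"
   by (intro nn_integral_cong) (auto simp: indicator_def)
  also have "... = ennreal (pi * (max 0 a)^2 - pi * 0^2)"
   by (rule nn_integral_FTC_Icc) (auto intro!: derivative_eq_intros)
  finally show ?thesis by simp
 qed
 show "!!X. X \<in> range (\<lambda>a::real. {..a}) ==> emeasure ?M X = emeasure ?N X" using M N by auto
 show "Int_stable (range (\<lambda>a::real. {..a}))"
  by (auto simp: Int_stable_def)
 show "sets ?M = sigma_sets UNIV (range (\<lambda>a::real. {..a}))" by (simp add: borel_eq_atMost)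
 show "sets ?N = sigma_sets UNIV (range (\<lambda>a::real. {..a}))" by (simp add: borel_eq_atMost)
 show "\<Union> (range (\<lambda>n::nat. {..real n})) = UNIV" by (auto simp: real_arch_simple)
 show "!!a. a \<in> range (\<lambda>n::nat. {..real n}) ==> emeasure ?M a ~= \<infinity>" using M by auto
qed auto

text \<open>The profile is recovered on a ray. The absolute value appears because values of F at
  negative arguments are invisible in the plane.\<close>

lemma radial_measurable:
 assumes "(\<lambda>x::plane. F (norm x)) \<in> borel_measurable borel"
 shows "(\<lambda>r::real. F \<bar>r\<bar> :: real) \<in> borel_measurable borel"
proof -
 have "(\<lambda>r::real. r *\<^sub>R (axis 1 1 :: plane)) \<in> borel \<rightarrow>\<^sub>M borel" by simp
 from measurable_compose[OF this assms] show ?thesis by (simp add: norm_axis_1)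
qed

lemma radial_measurable_set:
 assumes "(\<lambda>x::plane. F (norm x)) \<in> borel_measurable borel" and A: "A \<in> sets borel" "A \<subseteq> {0<..}"
 shows "(\<lambda>r::real. indicator A r * F r :: real) \<in> borel_measurable borel"
proof -
 have [measurable]: "A \<in> sets borel" by fact
 note [measurable] = radial_measurable[OF assms(1)]
 have "(\<lambda>r. indicator A r * F r) = (\<lambda>r. indicator A r * F \<bar>r\<bar>)"
  using A by (auto simp: indicator_def fun_eq_iff)
 then show ?thesis by simp
qed

lemma radial_integral:
 assumes m: "(\<lambda>x::plane. F (norm x) :: real) \<in> borel_measurable borel"
 shows "integrable lborel (\<lambda>x::plane. F (norm x)) \<longleftrightarrow> integrable_pos (\<lambda>r. F r * r)"
  "(LINT x|lborel. F (norm (x::plane))) = 2 * pi * (LBINT r:{0<..}. F r * r)"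
proof -
 let ?F = "\<lambda>r. F \<bar>r\<bar>"
 note [measurable] = radial_measurable[OF m]
 have e: "(\<lambda>r. (2 * pi * r * indicator {0<..} r) *\<^sub>R ?F r) = (\<lambda>r. (2 * pi) * (indicator {0<..} r *\<^sub>R (F r * r)))"
  by (auto simp: fun_eq_iff indicator_def)
 have "integrable lborel (\<lambda>x::plane. ?F (norm x)) \<longleftrightarrow> integrable (distr lborel borel (norm :: plane => real)) ?F"
  by (subst integrable_distr_eq) auto
 also have "... \<longleftrightarrow> integrable lborel (\<lambda>r. (2 * pi * r * indicator {0<..} r) *\<^sub>R ?F r)"
  unfolding distr_norm_plane by (subst integrable_density) (auto simp: indicator_def)
 also have "... \<longleftrightarrow> integrable lborel (\<lambda>r. indicator {0<..} r *\<^sub>R (F r * r))"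
  unfolding e by (subst integrable_mult_left_iff) auto
 finally show "integrable lborel (\<lambda>x::plane. F (norm x)) \<longleftrightarrow> integrable_pos (\<lambda>r. F r * r)"
  by (simp add: set_integrable_def)
 have "(LINT x|lborel. ?F (norm (x::plane))) = integral\<^sup>L (distr lborel borel (norm :: plane => real)) ?F"
  by (subst integral_distr) auto
 also have "... = (LINT r|lborel. (2 * pi * r * indicator {0<..} r) *\<^sub>R ?F r)"
  unfolding distr_norm_plane by (subst integral_density) (auto simp: indicator_def)
 finally show "(LINT x|lborel. F (norm (x::plane))) = 2 * pi * (LBINT r:{0<..}. F r * r)"
  unfolding e by (simp add: set_lebesgue_integral_def)
qed

text \<open>The measure with density g is pushed forward by the norm. By
  \<open>distr_norm_plane\<close> a null set of radii has a null preimage, so the image has a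
  Radon-Nikodym density: the angular integral of g, obtained without polar coordinates for nonradial
  functions.\<close>

lemma radial_projection_nonneg:
 fixes g :: "plane => real"
 assumes g: "integrable lborel g" "!!x. 0 <= g x"
 obtains D where "D \<in> borel_measurable borel"
  "!!F B. F \<in> borel_measurable borel ==> (!!r. \<bar>F r\<bar> <= B) ==>
    integrable lborel (\<lambda>r. D r * F r) \<and> (LINT x|lborel. g x * F (norm x)) = (LINT r|lborel. D r * F r)"
proof -
 note [measurable] = borel_measurable_integrable[OF g(1)]
 define N where "N = distr (density lborel g) borel norm"
 have fin: "finite_measure N"
 proof
  have "emeasure N (space N) = (\<integral>\<^sup>+x. ennreal (g x) \<partial>lborel)"
   unfolding N_def by (subst emeasure_distr) (auto simp: emeasure_density)
  also have "... = ennreal (LINT x|lborel. g x)" using g by (intro nn_integral_eq_integral) auto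
  finally show "emeasure N (space N) ~= \<infinity>" by simp
 qed
 then have sf: "sigma_finite_measure N" by (simp add: finite_measure_def)
 have sN: "sets N = sets lborel" by (simp add: N_def)
 have ac: "absolutely_continuous lborel N"
  unfolding absolutely_continuous_def
 proof
  fix A :: "real set" assume A: "A \<in> null_sets lborel"
  then have [measurable]: "A \<in> sets borel" by auto
  have "emeasure lborel (norm -` A :: plane set) = emeasure (distr lborel borel (norm :: plane => real)) A"
   by (subst emeasure_distr) auto
  also have "... = 0"
   unfolding distr_norm_plane using A
   by (subst emeasure_density) (auto simp: nn_integral_0_iff_AE dest!: AE_not_in elim: eventually_mono)
  moreover have "norm -` A \<in> sets (borel :: plane measure)"
   using measurable_sets[of "norm :: plane => real" borel borel A] by simp
  ultimately have "norm -` A \<in> null_sets (lborel :: plane measure)" by (auto simp: null_sets_def)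
  then have "AE x in lborel. norm (x::plane) \<notin> A" by (auto dest: AE_not_in)
  then have "emeasure N A = 0"
   unfolding N_def using \<open>norm -` A \<in> sets (borel :: plane measure)\<close>
   by (subst emeasure_distr) (auto simp: emeasure_density nn_integral_0_iff_AE indicator_def elim: eventually_mono)
  then show "A \<in> null_sets N" using A sN by (auto simp: null_sets_def)
 qed
 define D where "D r = enn2real (RN_deriv lborel N r)" for r
 have Dm: "D \<in> borel_measurable borel" unfolding D_def by simp
 show ?thesis
 proof (rule that[OF Dm])
  fix F :: "real => real" and B :: real assume F[measurable]: "F \<in> borel_measurable borel" and b: "!!r. \<bar>F r\<bar> <= B"
  have F': "F \<in> borel_measurable lborel" by simp
  have "integrable N F"
   by (rule finite_measure.integrable_const_bound[OF fin, of _ B]) (use b in \<open>auto simp: N_def\<close>)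
  then have 1: "integrable lborel (\<lambda>r. D r * F r)"
   unfolding D_def using sigma_finite_measure.RN_deriv_integrable[OF sigma_finite_lborel sf ac sN F'] by simp
  have "(LINT x|lborel. g x * F (norm x)) = integral\<^sup>L N F"
   unfolding N_def by (subst integral_distr) (auto simp: integral_density g)
  also have "... = (LINT r|lborel. D r * F r)"
   unfolding D_def by (rule sigma_finite_measure.RN_deriv_integral[OF sigma_finite_lborel sf ac sN F'])
  finally show "integrable lborel (\<lambda>r. D r * F r) \<and> (LINT x|lborel. g x * F (norm x)) = (LINT r|lborel. D r * F r)"
   using 1 by simp
 qed
qed

lemma radial_projection:
 fixes g :: "plane => real"
 assumes g: "integrable lborel g"
 obtains D where "D \<in> borel_measurable borel"
  "!!F B. F \<in> borel_measurable borel ==> (!!r. \<bar>F r\<bar> <= B) ==>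
    integrable lborel (\<lambda>r. D r * F r) \<and> (LINT x|lborel. g x * F (norm x)) = (LINT r|lborel. D r * F r)"
proof -
 have i: "integrable lborel (\<lambda>x. max 0 (g x))" "integrable lborel (\<lambda>x. max 0 (- g x))" using g by auto
 obtain D1 where D1: "D1 \<in> borel_measurable borel"
  "!!F B. F \<in> borel_measurable borel ==> (!!r. \<bar>F r\<bar> <= B) ==>
    integrable lborel (\<lambda>r. D1 r * F r) \<and> (LINT x|lborel. max 0 (g x) * F (norm x)) = (LINT r|lborel. D1 r * F r)"
  using radial_projection_nonneg[OF i(1)] by auto
 obtain D2 where D2: "D2 \<in> borel_measurable borel"
  "!!F B. F \<in> borel_measurable borel ==> (!!r. \<bar>F r\<bar> <= B) ==>
    integrable lborel (\<lambda>r. D2 r * F r) \<and> (LINT x|lborel. max 0 (- g x) * F (norm x)) = (LINT r|lborel. D2 r * F r)"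
  using radial_projection_nonneg[OF i(2)] by auto
 show ?thesis
 proof (rule that[of "\<lambda>r. D1 r - D2 r"])
  show "(\<lambda>r. D1 r - D2 r) \<in> borel_measurable borel" using D1(1) D2(1) by measurable
  fix F :: "real => real" and B :: real assume F[measurable]: "F \<in> borel_measurable borel" and b: "!!r. \<bar>F r\<bar> <= B"
  note h1 = D1(2)[OF F b] and h2 = D2(2)[OF F b]
  have bF: "integrable lborel (\<lambda>x. w x * F (norm x))" if w: "integrable lborel w" for w :: "plane => real"
  proof (rule Bochner_Integration.integrable_bound)
   note [measurable] = borel_measurable_integrable[OF w]
   show "integrable lborel (\<lambda>x. B * w x)" using w by simp
   show "(\<lambda>x. w x * F (norm x)) \<in> borel_measurable lborel" by measurable
   have "\<bar>F r\<bar> <= \<bar>B\<bar>" for r using b[of r] by linarith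
   then show "AE x in lborel. norm (w x * F (norm x)) <= norm (B * w x)"
    by (intro AE_I2) (simp add: abs_mult, metis abs_ge_zero mult.commute mult_right_mono)
  qed
  have "(LINT x|lborel. g x * F (norm x)) = (LINT x|lborel. max 0 (g x) * F (norm x) - max 0 (- g x) * F (norm x))"
   by (rule Bochner_Integration.integral_cong) (auto simp: max_def)
  also have "... = (LINT r|lborel. D1 r * F r) - (LINT r|lborel. D2 r * F r)"
   using bF[OF i(1)] bF[OF i(2)] h1 h2 by simp
  also have "... = (LINT r|lborel. (D1 r - D2 r) * F r)"
   using h1 h2 by (simp add: left_diff_distrib)
  finally show "integrable lborel (\<lambda>r. (D1 r - D2 r) * F r) \<and> (LINT x|lborel. g x * F (norm x)) = (LINT r|lborel. (D1 r - D2 r) * F r)"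
   using h1 h2 by (simp add: left_diff_distrib)
 qed
qed

lemma integrable_product_of_squares:
 fixes f g :: "'a => real"
 assumes "f \<in> borel_measurable M" "g \<in> borel_measurable M"
  "integrable M (\<lambda>x. (f x)^2)" "integrable M (\<lambda>x. (g x)^2)"
 shows "integrable M (\<lambda>x. f x * g x)"
proof (rule Bochner_Integration.integrable_bound)
 show "integrable M (\<lambda>x. (f x)^2 + (g x)^2)" using assms by simp
 show "(\<lambda>x. f x * g x) \<in> borel_measurable M" using assms by measurable
 have "\<bar>a * b\<bar> <= a^2 + b^2" for a b :: real
  using sum_squares_bound[of "\<bar>a\<bar>" "\<bar>b\<bar>"] mult_nonneg_nonneg[of "\<bar>a\<bar>" "\<bar>b\<bar>"] unfolding abs_mult power2_abs by linarith
 then show "AE x in M. norm (f x * g x) <= norm ((f x)^2 + (g x)^2)"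
  by (intro AE_I2) simp
qed

text \<open>These are the components of the vector field eta(|x|) x. As eta vanishes near the
  origin, the singularity of the norm is cut off.\<close>

lemma radial_vector_test_function:
 assumes c: "c1c \<eta> D a b" and i: "i \<in> (Basis :: plane set)"
 shows "test_function_on UNIV (\<lambda>x. \<eta> (norm x) * (x \<bullet> i)) (\<lambda>x. (D (norm x) * (x \<bullet> i)) *\<^sub>R sgn x + \<eta> (norm x) *\<^sub>R i)"
  (is "test_function_on UNIV ?f ?G")
 unfolding test_function_on_def
proof (intro conjI allI)
 have ab: "0 < a" using c by (simp add: c1c_def)
 have z: "\<eta> r = 0" "D r = 0" if "r < a" for r using c that by (auto simp: c1c_def)
 have zb: "\<eta> r = 0" if "r > b" for r using c that by (auto simp: c1c_def)
 have near0: "?f x = 0" "?G x = 0" if "norm x < a" for x using z[OF that] by simp_all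
 show "GDERIV ?f x :> ?G x" for x
 proof (cases "x = 0")
  case False
  have 1: "GDERIV (\<lambda>x. \<eta> (norm x)) x :> D (norm x) *\<^sub>R sgn x"
   by (rule GDERIV_DERIV_compose[OF GDERIV_norm[OF False]]) (use c in \<open>simp add: c1c_def\<close>)
  have 2: "GDERIV (\<lambda>x. x \<bullet> i) x :> i"
   unfolding gderiv_def by (auto intro!: derivative_eq_intros)
  show ?thesis
   using GDERIV_mult[OF 1 2] by (simp add: mult.commute add.commute)
 next
  case True
  have "((\<lambda>x. 0) has_derivative (\<lambda>h. h \<bullet> ?G 0)) (at (0::plane))"
   using near0(2)[of 0] ab has_derivative_const[of "0::real" "at (0::plane)"] by (simp only: norm_zero inner_zero_right)
  then have "(?f has_derivative (\<lambda>h. h \<bullet> ?G 0)) (at 0)"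
   by (rule has_derivative_transform_within_open[of _ _ _ _ "ball 0 a"]) (use ab near0 in auto)
  then show ?thesis using True by (simp add: gderiv_def)
 qed
 show "continuous_on UNIV ?G"
 proof -
  have "continuous_on (ball 0 a) ?G"
   using continuous_on_const[of "ball 0 a" "0::plane"] by (rule continuous_on_eq) (use near0 in auto)
  moreover have "continuous_on (- {0}) ?G"
  proof -
   have n: "continuous_on (- {0::plane}) norm" by (intro continuous_on_norm continuous_on_id)
   have 1: "continuous_on (- {0::plane}) (\<lambda>x. \<eta> (norm x))" "continuous_on (- {0::plane}) (\<lambda>x. D (norm x))"
    using continuous_on_compose2[OF c1c_cont(1)[OF c, of UNIV] n] continuous_on_compose2[OF c1c_cont(2)[OF c, of UNIV] n] by auto
   have 2: "continuous_on (- {0::plane}) (\<lambda>x. x \<bullet> i)" "continuous_on (- {0::plane}) sgn"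
    by (auto intro: continuous_on_inner continuous_on_sgn continuous_on_id continuous_on_const)
   show ?thesis
    by (intro continuous_on_add continuous_on_scaleR continuous_on_mult 1 2 continuous_on_const)
  qed
  ultimately have "continuous_on (ball 0 a \<union> - {0}) ?G"
   by (intro continuous_on_open_Un) auto
  moreover have "ball 0 a \<union> - {0} = (UNIV :: plane set)" using ab by auto
  ultimately show ?thesis by simp
 qed
 have "{x. ?f x ~= 0} \<subseteq> cball 0 b"
 proof
  fix x assume "x \<in> {x. ?f x ~= 0}"
  then have "\<eta> (norm x) ~= 0" by auto
  then have "\<not> b < norm x" using zb by blast
  then show "x \<in> cball 0 b" by simp
 qed
 then have "bounded {x. ?f x ~= 0}" by (rule bounded_subset[rotated]) simp
 then show "compact (closure {x. ?f x ~= 0})" by simp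
qed auto

text \<open>The potential is frozen at s = f^2 + m^2, so this is the form of the second equation
  read as a linear equation for m. It is not the full Hessian: the rest of the quartic part of the
  energy is the separate square in \<open>energy_comparison\<close>.\<close>

abbreviation second_variation :: "real => (real => real) => (real => real) => (real => real) => (real => real) => real" where
 "second_variation g f m U v \<equiv> LBINT r:{0<..}. ((v r)^2 + (g - (1 - (f r)^2 - (m r)^2)) * (U r)^2) * r"

text \<open>Working form of the radial Sobolev space: a locally absolutely continuous representative
  together with its derivative. \<open>H_rad_radH\<close> reaches it from \<open>H_rad\<close>, and
  \<open>radH_C1_H_rad\<close> goes back for C1 profiles.\<close>

definition radH :: "(real => real) => (real => real) => bool" where
 "radH U v \<longleftrightarrow> acd U v \<and> integrable_pos (\<lambda>r. (U r)^2 * r) \<and>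
   integrable_pos (\<lambda>r. (v r)^2 * r)"

lemma L2_loc_integrable:
 assumes m: "!!a b. 0 < a ==> (\<lambda>r. indicator {a..b} r * u r) \<in> borel_measurable borel"
  and i: "integrable_pos (\<lambda>r. (u r)^2 * r)" and ab: "0 < a" "a <= b"
 shows "set_integrable lborel {a..b} (u :: real => real)"
 unfolding set_integrable_def
proof (rule Bochner_Integration.integrable_bound)
 have one: "set_integrable lborel {a..b} (\<lambda>r. 1::real)" by (rule borel_integrable_atLeastAtMost') auto
 show "integrable lborel (\<lambda>r. indicator {a..b} r *\<^sub>R (1::real) + (1/a) * (indicator {0<..} r *\<^sub>R ((u r)^2 * r)))"
  using i one by (intro Bochner_Integration.integrable_add integrable_mult_right) (simp_all only: set_integrable_def)
 show "(\<lambda>r. indicator {a..b} r *\<^sub>R u r) \<in> borel_measurable lborel" using m[OF ab(1)] by simp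
 show "AE r in lborel. norm (indicator {a..b} r *\<^sub>R u r) <=
   norm (indicator {a..b} r *\<^sub>R (1::real) + (1/a) * (indicator {0<..} r *\<^sub>R ((u r)^2 * r)))"
 proof (rule AE_I2)
  fix r :: real
  show "norm (indicator {a..b} r *\<^sub>R u r) <=
   norm (indicator {a..b} r *\<^sub>R (1::real) + (1/a) * (indicator {0<..} r *\<^sub>R ((u r)^2 * r)))"
  proof (cases "r \<in> {a..b}")
   case True
   have "\<bar>u r\<bar> <= 1 + (u r)^2"
    using sum_squares_bound[of 1 "\<bar>u r\<bar>"] by simp
   also have "(u r)^2 <= (1/a) * ((u r)^2 * r)"
    using True ab mult_left_mono[of 1 "r / a" "(u r)^2"] by (simp add: field_simps)
   finally show ?thesis using True ab by simp
  qed simp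
 qed
qed

lemma c1c_mult_C1:
 assumes c: "c1c \<phi> D a b" and w: "!!x. 0 < x ==> DERIV w x :> w' x"
  and cw: "continuous_on {0<..} w'"
 shows "c1c (\<lambda>x. w x * \<phi> x) (\<lambda>x. w' x * \<phi> x + w x * D x) a b"
 unfolding c1c_def
proof (intro conjI allI impI)
 have z: "\<phi> x = 0" "D x = 0" if "x \<notin> {a..b}" for x using c that by (auto simp: c1c_def)
 show a: "0 < a" "a <= b" using c by (auto simp: c1c_def)
 show "DERIV (\<lambda>x. w x * \<phi> x) x :> (w' x * \<phi> x + w x * D x)" for x
 proof (cases "0 < x")
  case True
  have "DERIV \<phi> x :> D x" using c by (simp add: c1c_def)
  from DERIV_mult[OF w[OF True] this] show ?thesis by (simp add: algebra_simps)
 next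
  case False
  have "DERIV (\<lambda>x. 0) x :> (w' x * \<phi> x + w x * D x)"
   using z[of x] False a by simp
  then show ?thesis
   by (rule has_field_derivative_transform_within_open[of _ _ _ "{..<a}"]) (use z a False in auto)
 qed
 have cw0: "continuous_on {0<..} w" using w by (auto intro!: continuous_at_imp_continuous_on DERIV_isCont)
 have "continuous_on ({..<a} \<union> {0<..}) (\<lambda>x. w' x * \<phi> x + w x * D x)"
 proof (rule continuous_on_open_Un)
  show "continuous_on {..<a} (\<lambda>x. w' x * \<phi> x + w x * D x)"
   using continuous_on_const[of "{..<a}" "0::real"] by (rule continuous_on_eq) (use z in auto)
  show "continuous_on {0<..} (\<lambda>x. w' x * \<phi> x + w x * D x)"
   using c1c_cont[OF c] by (intro continuous_intros cw cw0)
 qed auto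
 moreover have "{..<a} \<union> {0<..} = UNIV" using a by auto
 ultimately show "continuous_on UNIV (\<lambda>x. w' x * \<phi> x + w x * D x)" by simp
 show "w x * \<phi> x = 0" "w' x * \<phi> x + w x * D x = 0" if "x \<notin> {a..b}" for x using z[OF that] by simp_all
qed

text \<open>The radial derivative is the radial average of the radial component of the weak gradient,
 obtained as a Radon--Nikodym derivative; testing against \<open>\<eta>(|x|) x\<close> identifies it.\<close>

lemma H_rad_radH:
 assumes u: "u \<in> H_rad"
 obtains U v where "radH U v" "AE r in lborel. 0 < r --> u r = U r" "weak_gradient_on {0<..} u v"
proof -
 let ?W = "\<lambda>x::plane. u (norm x)"
 obtain G where Wm: "?W \<in> borel_measurable lborel" and Wi: "integrable lborel (\<lambda>x. (?W x)^2)"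
  and Gm: "G \<in> borel_measurable lborel" and Gi: "integrable lborel (\<lambda>x. (norm (G x))^2)"
  and WG: "weak_gradient_on UNIV ?W G"
  using u unfolding H_rad_def H1_def by auto
 have Wmb: "?W \<in> borel_measurable borel" using Wm by simp
 have ui2: "integrable_pos (\<lambda>r. (u r)^2 * r)"
  using radial_integral(1)[of "\<lambda>r. (u r)^2"] Wmb Wi by simp
 have um: "(\<lambda>r. indicator {a..b} r * u r) \<in> borel_measurable borel" if "0 < a" for a b
  using that by (intro radial_measurable_set[OF Wmb]) auto
 have uloc: "set_integrable lborel {a..b} u" if "0 < a" "a <= b" for a b
  using um ui2 that by (rule L2_loc_integrable)
 note [measurable] = Gm
 define gr where "gr x = G x \<bullet> sgn x" for x
 have grm[measurable]: "gr \<in> borel_measurable lborel" unfolding gr_def sgn_div_norm by measurable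
 have gr2: "integrable lborel (\<lambda>x. (gr x)^2)"
 proof (rule Bochner_Integration.integrable_bound[OF Gi])
  have "\<bar>gr x\<bar> <= norm (G x)" for x
  proof -
   have "\<bar>gr x\<bar> <= norm (G x) * norm (sgn x)" unfolding gr_def by (rule Cauchy_Schwarz_ineq2)
   also have "... <= norm (G x) * 1" by (intro mult_left_mono) (auto simp: norm_sgn)
   finally show ?thesis by simp
  qed
  then show "AE x in lborel. norm ((gr x)^2) <= norm ((norm (G x))^2)"
   by (intro AE_I2) (simp add: abs_le_square_iff[symmetric])
 qed measurable
 \<comment> \<open>\<open>gr\<close> is only square integrable, while the radial projection needs an
   integrable function. The square of this weight is integrable on the plane, and the weight is
   divided out again in \<open>v\<close>.\<close>
 define \<omega> where "\<omega> r = 1 / (1 + r^2)" for r :: real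
 have \<omega>m[measurable]: "\<omega> \<in> borel_measurable borel" unfolding \<omega>_def by measurable
 have \<omega>p: "0 < \<omega> r" for r by (simp add: \<omega>_def add_pos_nonneg)
 have \<omega>i: "integrable lborel (\<lambda>x::plane. (\<omega> (norm x))^2)"
 proof -
  have "integrable_pos (\<lambda>r. (\<omega> r)^2 * r)"
  proof (rule decay_integrable[where K=1])
   show "continuous_on {0<..} (\<lambda>r. (\<omega> r)^2 * r)"
    unfolding \<omega>_def by (intro continuous_intros) (auto simp: add_nonneg_eq_0_iff)
   fix r :: real assume r: "0 < r"
   have "r * \<omega> r <= 1"
    using zero_le_power2[of "r - 1"] add_pos_nonneg[of 1 "r^2"] by (simp add: \<omega>_def divide_le_eq power2_eq_square algebra_simps)
   then have "\<omega> r * (r * \<omega> r) <= \<omega> r * 1" using \<omega>p[of r] by (intro mult_left_mono) auto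
   moreover have "1 / (1 + r^2) = \<omega> r" by (simp add: \<omega>_def)
   ultimately show "\<bar>(\<omega> r)^2 * r\<bar> <= 1 / (1 + r^2)" using r \<omega>p[of r] by (simp add: power2_eq_square mult_ac)
  qed
  then show ?thesis by (subst radial_integral(1)) auto
 qed
 have "integrable lborel (\<lambda>x. gr x * \<omega> (norm x))"
  by (rule integrable_product_of_squares) (use gr2 \<omega>i in auto)
 then obtain D0 where D0m[measurable]: "D0 \<in> borel_measurable borel"
  and D0: "!!F B. F \<in> borel_measurable borel ==> (!!r. \<bar>F r\<bar> <= B) ==>
    integrable lborel (\<lambda>r. D0 r * F r) \<and> (LINT x|lborel. gr x * \<omega> (norm x) * F (norm x)) = (LINT r|lborel. D0 r * F r)"
  using radial_projection[of "\<lambda>x. gr x * \<omega> (norm x)"] by auto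
 \<comment> \<open>The factor 2 pi r is the polar density of
   \<open>distr_norm_plane\<close>.\<close>
 define v where "v r = D0 r / (2 * pi * r * \<omega> r)" for r
 have vm[measurable]: "v \<in> borel_measurable borel" unfolding v_def by measurable
 \<comment> \<open>Compact support inside the open half-line keeps F divided by the weight bounded,
   as \<open>D0\<close> requires.\<close>
 have key: "integrable_pos (\<lambda>r. v r * F r * r) \<and>
   (LINT x|lborel. gr x * F (norm x)) = 2 * pi * (LBINT r:{0<..}. v r * F r * r)"
  if Fm[measurable]: "F \<in> borel_measurable borel" and Fb: "!!r. \<bar>F r\<bar> <= B" and a: "0 < a" and F0: "!!r. r \<notin> {a..b} ==> F r = 0" for F B a b
 proof -
  have "\<bar>F r / \<omega> r\<bar> <= \<bar>B\<bar> * (1 + b^2)" for r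
  proof (cases "r \<in> {a..b}")
   case True
   then have "r^2 <= b^2" using a by (intro power_mono) auto
   moreover have "\<bar>F r\<bar> <= \<bar>B\<bar>" using Fb[of r] by linarith
   ultimately have "\<bar>F r\<bar> * (1 + r^2) <= \<bar>B\<bar> * (1 + b^2)" by (intro mult_mono) auto
   moreover have "\<bar>F r / \<omega> r\<bar> = \<bar>F r\<bar> * (1 + r^2)" by (simp add: \<omega>_def abs_mult)
   ultimately show ?thesis by simp
  qed (simp add: F0)
  then have D: "integrable lborel (\<lambda>r. D0 r * (F r / \<omega> r))"
   "(LINT x|lborel. gr x * \<omega> (norm x) * (F (norm x) / \<omega> (norm x))) = (LINT r|lborel. D0 r * (F r / \<omega> r))"
   using D0[of "\<lambda>r. F r / \<omega> r"] by auto
  have e: "D0 r * (F r / \<omega> r) = 2 * pi * (indicator {0<..} r *\<^sub>R (v r * F r * r))" for r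
   using F0[of r] a \<omega>p[of r] by (cases "r \<in> {a..b}") (auto simp: v_def)
  have e': "gr x * \<omega> (norm x) * (F (norm x) / \<omega> (norm x)) = gr x * F (norm x)" for x
   using \<omega>p[of "norm x"] by simp
  have "integrable lborel (\<lambda>r. 2 * pi * (indicator {0<..} r *\<^sub>R (v r * F r * r)))"
   using D(1) unfolding e .
  then have "integrable lborel (\<lambda>r. indicator {0<..} r *\<^sub>R (v r * F r * r))"
   by (subst (asm) integrable_mult_left_iff) auto
  then show ?thesis using D(2) unfolding e e' set_integrable_def set_lebesgue_integral_def by simp
 qed
 \<comment> \<open>Duality: v is tested against its own truncations \<open>Fn\<close>. The
   inequality 2ab <= a^2 + b^2 lets the left side absorb half of the right side, and monotone
   convergence removes the truncation.\<close>
 have v2: "integrable_pos (\<lambda>r. (v r)^2 * r)"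
 proof -
  define E where "E n = {1 / Suc n..real n} \<inter> {r. \<bar>v r\<bar> <= n}" for n :: nat
  have Em[measurable]: "E n \<in> sets borel" for n unfolding E_def by measurable
  define Fn where "Fn n r = indicator (E n) r * v r" for n r
  have Fnm[measurable]: "Fn n \<in> borel_measurable borel" for n unfolding Fn_def by measurable
  have Fb: "\<bar>Fn n r\<bar> <= n" for n r by (auto simp: Fn_def E_def indicator_def)
  have F0: "Fn n r = 0" if "r \<notin> {1 / Suc n..real n}" for n r using that by (auto simp: Fn_def E_def indicator_def)
  have p: "0 < 1 / real (Suc n)" for n by simp
  have Epos: "0 < r" if "r \<in> E n" for r n
  proof -
   have "1 / real (Suc n) <= r" using that by (auto simp: E_def)
   then show ?thesis using p[of n] by linarith
  qed
  note k = key[OF Fnm Fb p F0]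
  have sq: "v r * Fn n r * r = (Fn n r)^2 * r" for n r by (auto simp: Fn_def indicator_def power2_eq_square)
  have Fi: "integrable_pos (\<lambda>r. (Fn n r)^2 * r)" for n using k[of n] unfolding sq by simp
  then have Fi': "integrable lborel (\<lambda>x::plane. (Fn n (norm x))^2)" for n
   by (subst radial_integral(1)) auto
  define K where "K = (LINT x|lborel. (gr x)^2)"
  have bnd: "2 * pi * (LBINT r:{0<..}. (Fn n r)^2 * r) <= K" for n
  proof -
   have "2 * pi * (LBINT r:{0<..}. (Fn n r)^2 * r) = (LINT x|lborel. gr x * Fn n (norm x))"
    using k[of n] unfolding sq by simp
   also have "... <= (LINT x|lborel. (1/2) * (gr x)^2 + (1/2) * (Fn n (norm x))^2)"
   proof (rule integral_mono)
    show "integrable lborel (\<lambda>x. gr x * Fn n (norm x))"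
     by (rule integrable_product_of_squares) (use gr2 Fi' in auto)
    show "integrable lborel (\<lambda>x. (1/2) * (gr x)^2 + (1/2) * (Fn n (norm x))^2)"
     using gr2 Fi' by auto
    show "gr x * Fn n (norm x) <= (1/2) * (gr x)^2 + (1/2) * (Fn n (norm x))^2" for x
     using sum_squares_bound[of "gr x" "Fn n (norm x)"] by simp
   qed
   also have "... = K / 2 + (1/2) * (LINT x|lborel. (Fn n (norm (x::plane)))^2)"
    using gr2 Fi'[of n] by (simp add: K_def)
   also have "(LINT x|lborel. (Fn n (norm (x::plane)))^2) = 2 * pi * (LBINT r:{0<..}. (Fn n r)^2 * r)"
    by (rule radial_integral(2)) auto
   finally show ?thesis by simp
  qed
  have ind: "indicator {0<..} r * ((Fn n r)^2 * r) = indicator (E n) r * ((v r)^2 * r)" for n r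
   using Epos by (auto simp: Fn_def indicator_def)
  have "integrable lborel (\<lambda>r. indicator {0<..} r * ((v r)^2 * r))"
  proof (rule integrableI_bounded)
   have inc: "incseq (\<lambda>n. ennreal (indicator (E n) r * ((v r)^2 * r)))" for r
   proof (rule incseq_SucI)
    fix n
    have "1 / real (Suc (Suc n)) <= 1 / real (Suc n)" by (intro divide_left_mono) auto
    then have "E n \<subseteq> E (Suc n)" by (auto simp: E_def simp del: of_nat_Suc)
    then show "ennreal (indicator (E n) r * ((v r)^2 * r)) <= ennreal (indicator (E (Suc n)) r * ((v r)^2 * r))"
     using Epos by (auto simp: indicator_def)
   qed
   have lim: "(SUP n. ennreal (indicator (E n) r * ((v r)^2 * r))) = ennreal (indicator {0<..} r * ((v r)^2 * r))" for r
   proof (rule LIMSEQ_unique[OF LIMSEQ_SUP[OF inc]])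
    have "eventually (\<lambda>n. indicator (E n) r = (indicator {0<..} r :: real)) sequentially"
    proof (cases "0 < r")
     case True
     have "eventually (\<lambda>n::nat. 1/Suc n < r) sequentially"
      using LIMSEQ_inverse_real_of_nat True by (auto dest!: order_tendstoD(2) simp: inverse_eq_divide)
     moreover have "eventually (\<lambda>n::nat. r <= n) sequentially"
      using eventually_ge_at_top[of "nat \<lceil>r\<rceil>"] by eventually_elim linarith
     moreover have "eventually (\<lambda>n::nat. \<bar>v r\<bar> <= n) sequentially"
      using eventually_ge_at_top[of "nat \<lceil>\<bar>v r\<bar>\<rceil>"] by eventually_elim linarith
     ultimately show ?thesis by eventually_elim (use True in \<open>auto simp: E_def\<close>)
    next
     case False
     then show ?thesis using Epos by (intro always_eventually) (auto simp: indicator_def)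
    qed
    then show "(\<lambda>n. ennreal (indicator (E n) r * ((v r)^2 * r))) \<longlonglongrightarrow> ennreal (indicator {0<..} r * ((v r)^2 * r))"
     by (intro tendsto_eventually) (auto elim: eventually_mono)
   qed
   have "(\<integral>\<^sup>+r. ennreal (indicator {0<..} r * ((v r)^2 * r)) \<partial>lborel)
     = (\<integral>\<^sup>+r. (SUP n. ennreal (indicator (E n) r * ((v r)^2 * r))) \<partial>lborel)"
    by (simp add: lim)
   also have "... = (SUP n. (\<integral>\<^sup>+r. ennreal (indicator (E n) r * ((v r)^2 * r)) \<partial>lborel))"
    using inc by (intro nn_integral_monotone_convergence_SUP) (auto simp: incseq_def le_fun_def)
   also have "... <= ennreal (K / (2 * pi))"
   proof (rule SUP_least)
    fix n
    have "(\<integral>\<^sup>+r. ennreal (indicator (E n) r * ((v r)^2 * r)) \<partial>lborel)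
      = ennreal (LINT r|lborel. indicator {0<..} r * ((Fn n r)^2 * r))"
     unfolding ind[symmetric] using Fi[of n]
     by (intro nn_integral_eq_integral) (auto simp: set_integrable_def indicator_def)
    also have "... <= ennreal (K / (2 * pi))"
     using bnd[of n] by (intro ennreal_leI) (simp add: set_lebesgue_integral_def field_simps)
    finally show "(\<integral>\<^sup>+r. ennreal (indicator (E n) r * ((v r)^2 * r)) \<partial>lborel) <= ennreal (K / (2 * pi))" .
   qed
   also have "... < \<infinity>" by simp
   finally have fin: "(\<integral>\<^sup>+r. ennreal (indicator {0<..} r * ((v r)^2 * r)) \<partial>lborel) < \<infinity>" .
   have "norm (indicator {0<..} r * ((v r)^2 * r)) = indicator {0<..} r * ((v r)^2 * r)" for r
    by (auto simp: indicator_def)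
   then show "(\<integral>\<^sup>+r. ennreal (norm (indicator {0<..} r * ((v r)^2 * r))) \<partial>lborel) < \<infinity>"
    using fin by simp
  qed measurable
  then show ?thesis by (simp add: set_integrable_def)
 qed
 have vloc: "set_integrable lborel {a..b} v" if "0 < a" "a <= b" for a b
  by (rule L2_loc_integrable[OF _ v2 that]) measurable
 have wg: "weak_gradient_on {0<..} u v"
  unfolding weak_gradient_real_iff
 proof (intro conjI allI impI)
  fix a b :: real assume "0 < a" "a <= b"
  then show "set_integrable lborel {a..b} u" "set_integrable lborel {a..b} v" using uloc vloc by auto
 next
  fix \<phi> D a b assume c: "c1c \<phi> D a b"
  have ab: "0 < a" using c by (simp add: c1c_def)
  have z: "\<phi> r = 0" "D r = 0" if "r \<notin> {a..b}" for r using c that by (auto simp: c1c_def)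
  \<comment> \<open>With eta = phi/r^2 the divergence of eta(|x|) x is D/r, so the polar weight r
    leaves exactly D; on the other side eta r, times the weight r, is phi.\<close>
  define \<eta> where "\<eta> x = (1/x^2) * \<phi> x" for x
  define E where "E x = (-2/x^3) * \<phi> x + (1/x^2) * D x" for x
  have ce: "c1c \<eta> E a b" unfolding \<eta>_def E_def
   by (rule c1c_mult_C1[OF c]) (auto intro!: derivative_eq_intros continuous_intros simp: power2_eq_square power3_eq_cube field_simps)
  let ?f = "\<lambda>i x. \<eta> (norm x) * (x \<bullet> i)"
  let ?G = "\<lambda>i x::plane. (E (norm x) * (x \<bullet> i)) *\<^sub>R sgn x + \<eta> (norm x) *\<^sub>R i"
  have T: "(LINT x|lborel. ?W x * (?G i x \<bullet> i)) = - (LINT x|lborel. (G x \<bullet> i) * ?f i x)" if i: "i \<in> (Basis :: plane set)" for i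
  proof -
   have "(LBINT x:UNIV. ?W x * (?G i x \<bullet> i)) = - (LBINT x:UNIV. (G x \<bullet> i) * ?f i x)"
    using WG radial_vector_test_function[OF ce i] i
    unfolding weak_gradient_on_def by blast
   then show ?thesis by (simp add: set_lebesgue_integral_def)
  qed
  obtain M where M: "!!r. \<bar>\<eta> r\<bar> <= M" "!!r. \<bar>E r\<bar> <= M" "!!r. \<bar>E r * r\<bar> <= M" "!!r. \<bar>\<eta> r * r\<bar> <= M" "M >= 0"
  proof -
   have bd: "\<exists>M. \<forall>r. \<bar>h r\<bar> <= M" if h: "continuous_on UNIV h" "!!r. r \<notin> {a..b} ==> h r = 0" for h :: "real => real"
   proof -
    have "compact (h ` {a..b})" using h(1) by (intro compact_continuous_image) (auto intro: continuous_on_subset)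
    then obtain M where "\<forall>r\<in>{a..b}. \<bar>h r\<bar> <= M" using compact_imp_bounded bounded_real by (metis (no_types, lifting) image_eqI)
    then have "\<bar>h r\<bar> <= max M 0" for r using h(2)[of r] by (cases "r \<in> {a..b}") (auto simp: le_max_iff_disj)
    then show ?thesis by blast
   qed
   have e0: "\<eta> r = 0" "E r = 0" if "r \<notin> {a..b}" for r using ce that by (auto simp: c1c_def)
   obtain M1 where M1: "!!r. \<bar>\<eta> r\<bar> <= M1" using bd[of \<eta>] c1c_cont[OF ce] e0 by blast
   obtain M2 where M2: "!!r. \<bar>E r\<bar> <= M2" using bd[of E] c1c_cont[OF ce] e0 by blast
   have "continuous_on UNIV (\<lambda>r. E r * r)" "continuous_on UNIV (\<lambda>r. \<eta> r * r)"
    by (intro continuous_on_mult c1c_cont[OF ce] continuous_on_id)+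
   then have "\<exists>M. \<forall>r. \<bar>E r * r\<bar> <= M" "\<exists>M. \<forall>r. \<bar>\<eta> r * r\<bar> <= M"
    using e0 by (intro bd; simp)+
   then obtain M3 M4 where M3: "!!r. \<bar>E r * r\<bar> <= M3" and M4: "!!r. \<bar>\<eta> r * r\<bar> <= M4" by blast
   have "M1 >= 0" using M1[of 0] by linarith
   then show ?thesis
    by (intro that[of "max (max M1 M2) (max M3 M4)"]) (use M1 M2 M3 M4 in \<open>auto simp: le_max_iff_disj\<close>)
  qed
  have [measurable]: "\<eta> \<in> borel_measurable borel" "E \<in> borel_measurable borel"
   using c1c_cont[OF ce, of UNIV] by (auto intro: borel_measurable_continuous_onI)
  note [measurable] = Wmb
  have supp: "\<eta> (norm x) = 0" "E (norm x) = 0" if "x \<notin> cball (0::plane) b" for x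
   using ce that by (auto simp: c1c_def)
  have L1: "integrable lborel (\<lambda>x. indicator (cball (0::plane) b) x * h x)"
   if [measurable]: "h \<in> borel_measurable borel" and h: "integrable lborel (\<lambda>x. (h x)^2)" for h :: "plane => real"
  proof (rule integrable_product_of_squares[where f="indicator (cball (0::plane) b)" and g=h])
   have "integrable lborel (\<lambda>x. indicator (cball (0::plane) b) x :: real)"
    by (intro integrable_real_indicator) (use emeasure_bounded_finite[OF bounded_cball[of "0::plane" b]] in auto)
   moreover have "(\<lambda>x. (indicator (cball (0::plane) b) x :: real)^2) = (\<lambda>x. indicator (cball 0 b) x)"
    by (auto simp: indicator_def fun_eq_iff)
   ultimately show "integrable lborel (\<lambda>x. (indicator (cball (0::plane) b) x :: real)^2)"
    by (simp only:)
  qed (use h in \<open>auto intro!: borel_measurable_indicator\<close>)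
  have bprod: "integrable lborel (\<lambda>x. h x * k x)"
   if [measurable]: "h \<in> borel_measurable borel" "k \<in> borel_measurable borel"
    and h: "integrable lborel (\<lambda>x. (h x)^2)" and k: "!!x. \<bar>k x\<bar> <= C" "!!x. x \<notin> cball (0::plane) b ==> k x = 0"
   for h k :: "plane => real" and C
  proof (rule Bochner_Integration.integrable_bound)
   show "integrable lborel (\<lambda>x. C * (indicator (cball (0::plane) b) x * h x))" using L1[OF that(1) h] by simp
   show "(\<lambda>x. h x * k x) \<in> borel_measurable lborel" by measurable
   have "\<bar>h x * k x\<bar> <= \<bar>C * (indicator (cball 0 b) x * h x)\<bar>" for x
   proof (cases "x \<in> cball 0 b")
    case True
    have "\<bar>k x\<bar> * \<bar>h x\<bar> <= \<bar>C\<bar> * \<bar>h x\<bar>" using k(1)[of x] by (intro mult_right_mono) auto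
    then show ?thesis using True by (simp add: abs_mult mult.commute)
   qed (use k(2) in simp)
   then show "AE x in lborel. norm (h x * k x) <= norm (C * (indicator (cball 0 b) x * h x))" by simp
  qed
  have comp: "\<bar>x \<bullet> i\<bar> <= norm x" if "i \<in> Basis" for i x :: plane using that by (rule Basis_le_norm)
  have Gf: "integrable lborel (\<lambda>x. (G x \<bullet> i) * ?f i x)" if i: "i \<in> Basis" for i
  proof (rule bprod[of "\<lambda>x. G x \<bullet> i" "?f i" M])
   show "integrable lborel (\<lambda>x. (G x \<bullet> i)^2)"
    by (rule Bochner_Integration.integrable_bound[OF Gi])
     (use comp[OF i] in \<open>auto intro!: AE_I2 simp: abs_le_square_iff[symmetric]\<close>)
   fix x :: plane
   have "\<bar>?f i x\<bar> <= \<bar>\<eta> (norm x) * norm x\<bar>" using comp[OF i, of x] by (simp add: abs_mult mult_left_mono)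
   then show "\<bar>?f i x\<bar> <= M" using M(4)[of "norm x"] by linarith
  qed (use Gm supp in auto)
  have GW: "integrable lborel (\<lambda>x. ?W x * (?G i x \<bullet> i))" if i: "i \<in> Basis" for i
  proof (rule bprod[of ?W "\<lambda>x. ?G i x \<bullet> i" "2*M"])
   fix x :: plane
   have ii: "i \<bullet> i = 1" using i by simp
   have "\<bar>sgn x \<bullet> i\<bar> <= 1" using comp[OF i, of "sgn x"] by (simp add: norm_sgn split: if_splits)
   then have "\<bar>E (norm x) * (x \<bullet> i) * (sgn x \<bullet> i)\<bar> <= \<bar>E (norm x) * norm x\<bar> * 1"
    using comp[OF i, of x] unfolding abs_mult by (intro mult_mono) auto
   then show "\<bar>?G i x \<bullet> i\<bar> <= 2 * M" using M(3)[of "norm x"] M(1)[of "norm x"]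
    by (simp add: inner_add_left ii)
  qed (use Wi supp in \<open>auto simp: sgn_div_norm\<close>)
  have sumG: "(\<Sum>i\<in>Basis. ?G i x \<bullet> i) = E (norm x) * norm x + 2 * \<eta> (norm x)" for x :: plane
  proof -
   have "(\<Sum>i\<in>Basis. ?G i x \<bullet> i) = E (norm x) * (\<Sum>i\<in>Basis. (x \<bullet> i) * (sgn x \<bullet> i)) + (\<Sum>i\<in>(Basis::plane set). \<eta> (norm x))"
    by (simp add: inner_add_left sum.distrib sum_distrib_left mult.assoc)
   also have "(\<Sum>i\<in>Basis. (x \<bullet> i) * (sgn x \<bullet> i)) = x \<bullet> sgn x" by (rule euclidean_inner[symmetric])
   also have "x \<bullet> sgn x = norm x" by (cases "x = 0") (simp_all add: sgn_div_norm dot_square_norm power2_eq_square)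
   finally show ?thesis by simp
  qed
  have sumf: "(\<Sum>i\<in>Basis. (G x \<bullet> i) * ?f i x) = gr x * (\<eta> (norm x) * norm x)" for x
  proof -
   have "(\<Sum>i\<in>Basis. (G x \<bullet> i) * ?f i x) = \<eta> (norm x) * (G x \<bullet> x)"
    by (subst euclidean_inner) (simp add: sum_distrib_left mult.left_commute)
   also have "G x \<bullet> x = gr x * norm x" by (cases "x = 0") (simp_all add: gr_def sgn_div_norm)
   finally show ?thesis by simp
  qed
  have "(LINT x|lborel. ?W x * (E (norm x) * norm x + 2 * \<eta> (norm x))) = (\<Sum>i\<in>Basis. (LINT x|lborel. ?W x * (?G i x \<bullet> i)))"
   using GW by (subst Bochner_Integration.integral_sum[symmetric]) (auto simp: sum_distrib_left[symmetric] sumG)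
  also have "... = - (\<Sum>i\<in>Basis. (LINT x|lborel. (G x \<bullet> i) * ?f i x))" using T by (simp add: sum_negf)
  also have "... = - (LINT x|lborel. gr x * (\<eta> (norm x) * norm x))"
   using Gf by (subst Bochner_Integration.integral_sum[symmetric]) (auto simp: sumf)
  also have "(LINT x|lborel. gr x * (\<eta> (norm x) * norm x)) = 2 * pi * (LBINT r:{0<..}. v r * (\<eta> r * r) * r)"
   by (rule key[of "\<lambda>r. \<eta> r * r" M a b, THEN conjunct2]) (use M(4) ab ce in \<open>auto simp: c1c_def\<close>)
  also have "(LINT x|lborel. ?W x * (E (norm x) * norm x + 2 * \<eta> (norm x))) = 2 * pi * (LBINT r:{0<..}. u r * (E r * r + 2 * \<eta> r) * r)"
   by (rule radial_integral(2)[of "\<lambda>r. u r * (E r * r + 2 * \<eta> r)"]) measurable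
  finally have "2 * pi * (LBINT r:{0<..}. u r * (E r * r + 2 * \<eta> r) * r) = - (2 * pi * (LBINT r:{0<..}. v r * (\<eta> r * r) * r))" .
  then have "2 * pi * ((LBINT r:{0<..}. u r * (E r * r + 2 * \<eta> r) * r) + (LBINT r:{0<..}. v r * (\<eta> r * r) * r)) = 0"
   by (simp only: distrib_left)
  then have fin: "(LBINT r:{0<..}. u r * (E r * r + 2 * \<eta> r) * r) = - (LBINT r:{0<..}. v r * (\<eta> r * r) * r)"
   by (simp add: add_eq_0_iff2)
  have "(LBINT r:{0<..}. u r * D r) = (LBINT r:{0<..}. u r * (E r * r + 2 * \<eta> r) * r)"
   by (intro set_lebesgue_integral_cong) (auto simp: E_def \<eta>_def field_simps power2_eq_square power3_eq_cube)
  moreover have "(LBINT r:{0<..}. v r * \<phi> r) = (LBINT r:{0<..}. v r * (\<eta> r * r) * r)"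
   by (intro set_lebesgue_integral_cong) (auto simp: \<eta>_def field_simps power2_eq_square)
  ultimately show "(LBINT r:{0<..}. u r * D r) = - (LBINT r:{0<..}. v r * \<phi> r)" using fin by simp
 qed
 obtain U where U: "acd U v" "AE r in lborel. 0 < r --> u r = U r"
  using weak_gradient_acd_representative[OF wg] by blast
 have "integrable_pos (\<lambda>r. (U r)^2 * r)"
 proof -
  have "measurable_pos (\<lambda>r. (U r)^2 * r)"
   by (intro borel_measurable_continuous_on_indicator continuous_intros acd_continuous[OF U(1)]) auto
  then have "integrable lborel (\<lambda>r. indicator {0<..} r *\<^sub>R ((U r)^2 * r)) \<longleftrightarrow> integrable lborel (\<lambda>r. indicator {0<..} r *\<^sub>R ((u r)^2 * r))"
   using ui2 U(2) by (intro integrable_cong_AE) (auto simp: set_integrable_def indicator_def elim: eventually_mono)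
  then show ?thesis using ui2 by (simp add: set_integrable_def)
 qed
 then have "radH U v" using U(1) v2 by (simp add: radH_def)
 then show ?thesis using U(2) wg that by blast
qed

section \<open>Planar Sobolev functions from continuously differentiable profiles\<close>

lemma distr_plane_coordinates:
 assumes ij: "(Basis :: plane set) = {i, j}" "i ~= j"
 shows "distr (lborel :: (real \<times> real) measure) borel (\<lambda>p. fst p *\<^sub>R i + snd p *\<^sub>R j) = (lborel :: plane measure)"
proof (rule lborel_eqI[symmetric])
 let ?T = "\<lambda>p::real\<times>real. fst p *\<^sub>R i + snd p *\<^sub>R j :: plane"
 have iB: "i \<in> Basis" "j \<in> Basis" using ij(1) by blast+
 have d: "i \<bullet> i = 1" "j \<bullet> j = 1" "i \<bullet> j = 0" "j \<bullet> i = 0"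
  using iB ij(2) by (simp_all add: inner_Basis)
 have "continuous_on UNIV ?T" by (intro continuous_intros)
 then have m: "?T \<in> borel_measurable lborel" by (simp add: borel_measurable_continuous_onI)
 fix l u :: plane assume lu: "!!b. b \<in> Basis ==> l \<bullet> b <= u \<bullet> b"
 have "?T -` box l u \<inter> space lborel = {l \<bullet> i<..<u \<bullet> i} \<times> {l \<bullet> j<..<u \<bullet> j}"
  using d by (auto simp: box_def ij inner_add_left inner_add_right)
 then have "emeasure (distr lborel borel ?T) (box l u) = emeasure (lborel \<Otimes>\<^sub>M lborel) ({l \<bullet> i<..<u \<bullet> i} \<times> {l \<bullet> j<..<u \<bullet> j})"
  using m by (subst emeasure_distr) (auto simp: lborel_prod)
 also have "... = emeasure lborel {l \<bullet> i<..<u \<bullet> i} * emeasure lborel {l \<bullet> j<..<u \<bullet> j}"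
  by (rule lborel.emeasure_pair_measure_Times) auto
 also have "... = ennreal ((u - l) \<bullet> i) * ennreal ((u - l) \<bullet> j)"
  using lu[OF iB(1)] lu[OF iB(2)] by (simp add: inner_diff_left)
 also have "... = ennreal (\<Prod>b\<in>Basis. (u - l) \<bullet> b)"
  unfolding ij(1) using lu[OF iB(1)] lu[OF iB(2)] ij(2) by (simp add: ennreal_mult inner_diff_left)
 finally show "emeasure (distr lborel borel ?T) (box l u) = (\<Prod>b\<in>Basis. (u - l) \<bullet> b)" .
qed simp

text \<open>Fubini over the lines parallel to i. The line through the origin is negligible among
  them, so a singularity at the origin is never met.\<close>

lemma integral_plane_lines_zero:
 fixes F :: "plane => real"
 assumes ij: "(Basis :: plane set) = {i, j}" "i ~= j" and F: "integrable lborel F"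
  and z: "!!y. y ~= 0 ==> (LINT t|lborel. F (t *\<^sub>R i + y *\<^sub>R j)) = 0"
 shows "(LINT x|lborel. F x) = 0"
proof -
 let ?T = "\<lambda>p::real\<times>real. fst p *\<^sub>R i + snd p *\<^sub>R j :: plane"
 note [measurable] = borel_measurable_integrable[OF F]
 have "continuous_on UNIV ?T" by (intro continuous_intros)
 then have T[measurable]: "?T \<in> borel_measurable lborel" by (simp add: borel_measurable_continuous_onI)
 have eq: "(lborel :: plane measure) = distr lborel borel ?T" using distr_plane_coordinates[OF ij] by simp
 have Fb: "F \<in> borel_measurable borel" by simp
 have "integrable (distr lborel borel ?T) F" using F eq by simp
 then have i: "integrable (lborel \<Otimes>\<^sub>M lborel) (\<lambda>(t,y). F (t *\<^sub>R i + y *\<^sub>R j))"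
  using integrable_distr_eq[OF T Fb] by (simp add: lborel_prod case_prod_unfold)
 have "(LINT x|lborel. F x) = (LINT p|lborel. F (?T p))"
  unfolding eq by (rule integral_distr[OF T Fb])
 also have "... = (LINT p|(lborel \<Otimes>\<^sub>M lborel). (case p of (t,y) => F (t *\<^sub>R i + y *\<^sub>R j)))"
  by (simp add: lborel_prod case_prod_beta)
 also have "... = (LINT y|lborel. (LINT t|lborel. F (t *\<^sub>R i + y *\<^sub>R j)))"
  using lborel_pair.integral_snd[OF i] by simp
 also have "... = (LBINT y::real. 0)"
 proof (rule integral_cong_AE)
  show "AE y in lborel. (LINT t|lborel. F (t *\<^sub>R i + y *\<^sub>R j)) = 0"
   using AE_lborel_singleton[of 0] by eventually_elim (rule z)
  show "(\<lambda>y. LINT t|lborel. F (t *\<^sub>R i + y *\<^sub>R j)) \<in> borel_measurable lborel"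
   using lborel_pair.integrable_snd[OF i] by (rule borel_measurable_integrable)
 qed simp
 finally show ?thesis by simp
qed

lemma L2_compact_integrable:
 fixes h :: "plane => 'b::{banach, second_countable_topology}"
 assumes h[measurable]: "h \<in> borel_measurable borel" and i: "integrable lborel (\<lambda>x. (norm (h x))^2)" and K: "compact K"
 shows "set_integrable lborel K h"
 unfolding set_integrable_def
proof (rule Bochner_Integration.integrable_bound)
 have [measurable]: "K \<in> sets borel" using K by (rule borel_compact)
 have "integrable lborel (\<lambda>x. indicator K x :: real)"
  using emeasure_bounded_finite[of K] compact_imp_bounded[OF K] by (intro integrable_real_indicator) auto
 then show "integrable lborel (\<lambda>x. indicator K x + (norm (h x))^2 :: real)" using i by simp
 show "(\<lambda>x. indicator K x *\<^sub>R h x) \<in> borel_measurable lborel" by measurable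
 have "a <= 1 + a^2" if "0 <= a" for a :: real using sum_squares_bound[of 1 a] that by simp
 then show "AE x in lborel. norm (indicator K x *\<^sub>R h x) <= norm (indicator K x + (norm (h x))^2 :: real)"
  by (intro AE_I2) (auto simp: indicator_def)
qed

lemma plane_Basis_pair:
 assumes "i \<in> (Basis :: plane set)"
 obtains j where "(Basis :: plane set) = {i, j}" "i ~= j"
proof -
 have B: "(Basis :: plane set) = {axis 1 1, axis 2 1}"
  by (auto simp: Basis_vec_def UNIV_2)
 have n: "axis 1 1 ~= (axis 2 1 :: plane)" by (simp add: axis_eq_axis)
 from assms B consider "i = axis 1 1" | "i = axis 2 1" by auto
 then show ?thesis
 proof cases
  case 1 then show ?thesis using that[of "axis 2 1"] B n by simp
 next
  case 2 then show ?thesis using that[of "axis 1 1"] B n by (simp add: insert_commute)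
 qed
qed

text \<open>The profile may be singular at r = 0, so the planar function is C1 only off the origin.
  Integration by parts along coordinate lines that miss the origin avoids any cut-off there;
  integrability comes from the two finite integrals.\<close>

lemma radH_C1_H_rad:
 assumes d: "!!x. 0 < x ==> DERIV f x :> f' x" and c: "continuous_on {0<..} f'"
  and f2: "integrable_pos (\<lambda>r. (f r)^2 * r)" and f'2: "integrable_pos (\<lambda>r. (f' r)^2 * r)"
 shows "f \<in> H_rad"
proof -
 have cf: "continuous_on {0<..} f" using d by (auto intro!: continuous_at_imp_continuous_on DERIV_isCont)
 let ?W = "\<lambda>x::plane. f (norm x)"
 define G where "G x = f' (norm x) *\<^sub>R sgn x" for x :: plane
 have m1[measurable]: "measurable_pos f" "measurable_pos f'"
  using cf c by (intro borel_measurable_continuous_on_indicator; simp)+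
 \<comment> \<open>The value \<open>f 0\<close> is uncontrolled and is split off at a single point
   to obtain measurability.\<close>
 have We: "?W = (\<lambda>x. indicator {0<..} (norm x) *\<^sub>R f (norm x) + indicator {0} x * f 0)"
  by (auto simp: indicator_def fun_eq_iff)
 have "(\<lambda>x::plane. indicator {0<..} (norm x) *\<^sub>R f (norm x)) \<in> borel_measurable borel"
  using m1(1) by (rule measurable_compose[rotated]) simp
 then have Wm[measurable]: "?W \<in> borel_measurable borel" unfolding We by measurable
 have Ge: "G = (\<lambda>x. (indicator {0<..} (norm x) *\<^sub>R f' (norm x)) *\<^sub>R sgn x)"
  by (auto simp: indicator_def fun_eq_iff G_def)
 have m2: "(\<lambda>x::plane. indicator {0<..} (norm x) *\<^sub>R f' (norm x)) \<in> borel_measurable borel"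
  using m1(2) by (rule measurable_compose[rotated]) simp
 have Gm[measurable]: "G \<in> borel_measurable borel" unfolding Ge sgn_div_norm using m2 by measurable
 have Wi: "integrable lborel (\<lambda>x. (?W x)^2)" using f2 by (subst radial_integral(1)) auto
 have Gn: "(norm (G x))^2 = (indicator {0<..} (norm x) *\<^sub>R f' (norm x))^2" for x
  by (cases "x = 0") (auto simp: G_def norm_sgn)
 have Gi: "integrable lborel (\<lambda>x. (norm (G x))^2)"
  unfolding Gn
 proof (subst radial_integral(1))
  show "integrable_pos (\<lambda>r. (indicator {0<..} r *\<^sub>R f' r)^2 * r)"
   using f'2 by (subst set_integrable_cong[OF refl refl]) (auto simp: indicator_def)
 qed (use m2 in measurable)
 have Wd: "GDERIV ?W x :> G x" if "x ~= 0" for x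
  unfolding G_def by (rule GDERIV_DERIV_compose[OF GDERIV_norm[OF that]]) (use d that in auto)
 have cW: "continuous_on (- {0}) ?W" by (rule continuous_on_compose2[OF cf]) (auto intro: continuous_on_norm continuous_on_id)
 have cG: "continuous_on (- {0}) G" unfolding G_def
  by (intro continuous_on_scaleR continuous_on_compose2[OF c] continuous_on_sgn) (auto intro: continuous_on_norm continuous_on_id)
 have "weak_gradient_on UNIV ?W G"
  unfolding weak_gradient_on_def
 proof (intro conjI allI impI ballI)
  fix K :: "plane set" assume K: "compact K \<and> K \<subseteq> UNIV"
  show "set_integrable lborel K ?W" using K Wi by (intro L2_compact_integrable) auto
  show "set_integrable lborel K G" using K Gi by (intro L2_compact_integrable) auto
 next
  fix \<phi> and D :: "plane => plane" and i :: plane assume t: "test_function_on UNIV \<phi> D" and i: "i \<in> Basis"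
  obtain j where ij: "(Basis :: plane set) = {i, j}" "i ~= j" using plane_Basis_pair[OF i] by blast
  have iB: "i \<in> Basis" "j \<in> Basis" using ij(1) by blast+
  have dij: "i \<bullet> i = 1" "j \<bullet> j = 1" "i \<bullet> j = 0" "j \<bullet> i = 0"
   using iB ij(2) by (simp_all add: inner_Basis)
  define K where "K = closure {x. \<phi> x ~= 0}"
  have K: "compact K" and gd: "!!x. GDERIV \<phi> x :> D x" and cD: "continuous_on UNIV D"
   using t by (auto simp: test_function_on_def K_def)
  have [measurable]: "K \<in> sets borel" using K by (rule borel_compact)
  have c\<phi>: "continuous_on UNIV \<phi>" using gd unfolding gderiv_def
   by (auto intro!: continuous_at_imp_continuous_on has_derivative_continuous)
  have [measurable]: "\<phi> \<in> borel_measurable borel" "D \<in> borel_measurable borel"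
   using c\<phi> cD by (auto intro: borel_measurable_continuous_onI)
  have \<phi>0: "\<phi> x = 0" if "x \<notin> K" for x using that closure_subset[of "{x. \<phi> x ~= 0}"] by (auto simp: K_def)
  have D0: "D x = 0" if x: "x \<notin> K" for x
  proof -
   have "open (- K)" using K by (simp add: compact_imp_closed open_Compl)
   have "(\<phi> has_derivative (\<lambda>h. 0)) (at x)"
    by (rule has_derivative_transform_within_open[OF has_derivative_const[of 0] \<open>open (- K)\<close>]) (use x \<phi>0 in auto)
   then have "(\<lambda>h. inner h (D x)) = (\<lambda>h. 0)"
    using gd[of x] unfolding gderiv_def by (rule has_derivative_unique[symmetric])
   then have "inner (D x) (D x) = 0" by metis
   then show ?thesis by simp
  qed
  have "bounded (\<phi> ` K)" "bounded (D ` K)"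
   using K c\<phi> cD by (auto intro!: compact_imp_bounded compact_continuous_image intro: continuous_on_subset)
  then obtain A B where A: "!!x. x \<in> K ==> norm (\<phi> x) <= A" and B: "!!x. x \<in> K ==> norm (D x) <= B"
   unfolding bounded_iff by blast
  define A' where "A' = max A 0" define B' where "B' = max B 0"
  have A': "\<bar>\<phi> x\<bar> <= A'" for x using A[of x] \<phi>0[of x] by (cases "x \<in> K") (auto simp: A'_def)
  have B': "norm (D x) <= B'" for x using B[of x] D0[of x] by (cases "x \<in> K") (auto simp: B'_def)
  have comp: "\<bar>x \<bullet> i\<bar> <= norm x" for x :: plane using i by (rule Basis_le_norm)
  have I1: "integrable lborel (\<lambda>x. ?W x * (D x \<bullet> i))"
  proof (rule Bochner_Integration.integrable_bound)
   show "integrable lborel (\<lambda>x. B' * (indicator K x *\<^sub>R ?W x))"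
    using L2_compact_integrable[OF Wm _ K] Wi by (simp add: set_integrable_def)
   have "\<bar>?W x * (D x \<bullet> i)\<bar> <= \<bar>B' * (indicator K x *\<^sub>R ?W x)\<bar>" for x
   proof (cases "x \<in> K")
    case True
    have "\<bar>D x \<bullet> i\<bar> <= B'" using comp[of "D x"] B'[of x] by linarith
    then have "\<bar>D x \<bullet> i\<bar> * \<bar>?W x\<bar> <= \<bar>B'\<bar> * \<bar>?W x\<bar>" by (intro mult_right_mono) auto
    then show ?thesis using True by (simp add: abs_mult mult.commute)
   qed (simp add: D0)
   then show "AE x in lborel. norm (?W x * (D x \<bullet> i)) <= norm (B' * (indicator K x *\<^sub>R ?W x))" by simp
  qed measurable
  have I2: "integrable lborel (\<lambda>x. (G x \<bullet> i) * \<phi> x)"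
  proof (rule Bochner_Integration.integrable_bound)
   show "integrable lborel (\<lambda>x. A' *\<^sub>R (indicator K x *\<^sub>R G x))"
    by (rule integrable_scaleR_right) (use L2_compact_integrable[OF Gm Gi K] in \<open>simp add: set_integrable_def\<close>)
   have "\<bar>(G x \<bullet> i) * \<phi> x\<bar> <= norm (A' *\<^sub>R (indicator K x *\<^sub>R G x))" for x
   proof (cases "x \<in> K")
    case True
    have "\<bar>G x \<bullet> i\<bar> * \<bar>\<phi> x\<bar> <= norm (G x) * \<bar>A'\<bar>"
     using A'[of x] comp[of "G x"] by (intro mult_mono) auto
    then show ?thesis using True by (simp add: abs_mult mult.commute)
   qed (simp add: \<phi>0)
   then show "AE x in lborel. norm ((G x \<bullet> i) * \<phi> x) <= norm (A' *\<^sub>R (indicator K x *\<^sub>R G x))" by simp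
  qed measurable
  define F where "F x = ?W x * (D x \<bullet> i) + (G x \<bullet> i) * \<phi> x" for x
  have FI: "integrable lborel F" unfolding F_def using I1 I2 by simp
  obtain M where M: "!!x. x \<in> K ==> norm x < M" "M > 0"
   using compact_imp_bounded[OF K] bounded_pos_less by metis
  have "(LINT x|lborel. F x) = 0"
  proof (rule integral_plane_lines_zero[OF ij FI])
   fix y :: real assume y: "y ~= 0"
   define L where "L t = t *\<^sub>R i + y *\<^sub>R j" for t
   have L0: "L t ~= 0" for t
   proof
    assume "L t = 0"
    then have "L t \<bullet> j = 0" by simp
    then show False using y dij by (simp add: L_def inner_add_left)
   qed
   have Lt: "L t \<bullet> i = t" for t using dij by (simp add: L_def inner_add_left)
   have LK: "L t \<notin> K" if "M <= \<bar>t\<bar>" for t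
    using M(1)[of "L t"] comp[of "L t"] that by (auto simp: Lt)
   have dL: "(L has_derivative (\<lambda>h. h *\<^sub>R i)) (at t)" for t
    unfolding L_def by (auto intro!: derivative_eq_intros)
   have cL: "continuous_on UNIV L" unfolding L_def by (intro continuous_intros)
   have der: "DERIV (\<lambda>t. ?W (L t) * \<phi> (L t)) t :> F (L t)" for t
   proof -
    have "GDERIV (\<lambda>x. ?W x * \<phi> x) (L t) :> ?W (L t) *\<^sub>R D (L t) + \<phi> (L t) *\<^sub>R G (L t)"
     by (rule GDERIV_mult[OF Wd[OF L0] gd])
    then have "((\<lambda>x. ?W x * \<phi> x) has_derivative (\<lambda>h. h \<bullet> (?W (L t) *\<^sub>R D (L t) + \<phi> (L t) *\<^sub>R G (L t)))) (at (L t))"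
     by (simp add: gderiv_def)
    from has_derivative_compose[OF dL this] show ?thesis
     unfolding has_field_derivative_def F_def
     by (rule has_derivative_eq_rhs) (auto simp: fun_eq_iff inner_add_right inner_commute algebra_simps)
   qed
   have cF: "continuous_on (- {0}) F" unfolding F_def
    using cW cG c\<phi> cD by (intro continuous_intros) (auto intro: continuous_on_subset)
   have cFL: "continuous_on UNIV (\<lambda>t. F (L t))"
    by (rule continuous_on_compose2[OF cF cL]) (use L0 in auto)
   have "F (L t) = F (L t) * indicator {-M..M} t" for t
   proof (cases "t \<in> {-M..M}")
    case False
    then have "M <= \<bar>t\<bar>" by auto
    then show ?thesis using LK[of t] \<phi>0 D0 False by (simp add: F_def)
   qed simp
   then have "(LINT t|lborel. F (L t)) = (LINT t|lborel. F (L t) * indicator {-M..M} t)" by metis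
   also have "... = ?W (L M) * \<phi> (L M) - ?W (L (-M)) * \<phi> (L (-M))"
    by (rule integral_FTC_Icc_real) (use M der cFL in \<open>auto simp: continuous_on_eq_continuous_at\<close>)
   also have "... = 0" using LK[of M] LK[of "-M"] \<phi>0 by simp
   finally show "(LINT t|lborel. F (t *\<^sub>R i + y *\<^sub>R j)) = 0" by (simp add: L_def)
  qed
  then have "(LINT x|lborel. ?W x * (D x \<bullet> i)) + (LINT x|lborel. (G x \<bullet> i) * \<phi> x) = 0"
   unfolding F_def using I1 I2 by simp
  then show "(LBINT x:UNIV. ?W x * (D x \<bullet> i)) = - (LBINT x:UNIV. (G x \<bullet> i) * \<phi> x)"
   by (simp add: set_lebesgue_integral_def)
 qed
 then show ?thesis unfolding H_rad_def H1_def using Wi Gi by (auto intro!: exI[of _ G])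
qed

lemma loc_integrable_measurable:
 fixes v :: "real => real"
 assumes v: "!!a b. 0 < a ==> a <= b ==> set_integrable lborel {a..b} v"
 shows "measurable_pos v"
proof (rule borel_measurable_LIMSEQ_real)
 fix n :: nat
 have "1 / real (Suc n) <= real (Suc n)" by (rule order_trans[of _ 1]) auto
 then have "set_integrable lborel {1 / real (Suc n)..real (Suc n)} v" by (intro v) auto
 then show "(\<lambda>r. indicator {1 / real (Suc n)..real (Suc n)} r *\<^sub>R v r) \<in> borel_measurable borel"
  by (auto simp: set_integrable_def)
next
 fix r :: real
 show "(\<lambda>n. indicator {1 / real (Suc n)..real (Suc n)} r *\<^sub>R v r) \<longlonglongrightarrow> indicator {0<..} r *\<^sub>R v r"
 proof (cases "0 < r")
  case True
  have "eventually (\<lambda>n::nat. 1/Suc n < r) sequentially"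
   using LIMSEQ_inverse_real_of_nat True by (auto dest!: order_tendstoD(2) simp: inverse_eq_divide)
  moreover have "eventually (\<lambda>n::nat. r <= Suc n) sequentially"
   using eventually_ge_at_top[of "nat \<lceil>r\<rceil>"] by eventually_elim linarith
  ultimately have "eventually (\<lambda>n. indicator {1 / real (Suc n)..real (Suc n)} r *\<^sub>R v r = indicator {0<..} r *\<^sub>R v r) sequentially"
   by eventually_elim (use True in simp)
  then show ?thesis by (rule tendsto_eventually)
 next
  case False
  have nz: "indicator {1 / real (Suc n)..real (Suc n)} r *\<^sub>R v r = 0" for n
  proof -
   have "0 < 1 / real (Suc n)" by simp
   then have "r \<notin> {1 / real (Suc n)..real (Suc n)}" using False by (simp only: atLeastAtMost_iff) linarith
   then show ?thesis by simp
  qed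
  show ?thesis unfolding nz using False by simp
 qed
qed

lemma radH_quadratic_integrable:
 assumes r: "radH U v" and c: "measurable_pos c" and b: "!!r. 0 < r ==> \<bar>c r\<bar> <= B"
 shows "integrable_pos (\<lambda>r. ((v r)^2 + c r * (U r)^2) * r)" "integrable_pos (\<lambda>r. c r * (U r)^2 * r)"
proof -
 have U: "integrable_pos (\<lambda>r. (U r)^2 * r)" and v: "integrable_pos (\<lambda>r. (v r)^2 * r)"
  using r by (auto simp: radH_def)
 show c: "integrable_pos (\<lambda>r. c r * (U r)^2 * r)"
  unfolding set_integrable_def
 proof (rule Bochner_Integration.integrable_bound)
  show "integrable lborel (\<lambda>r. B * (indicator {0<..} r *\<^sub>R ((U r)^2 * r)))" using U by (simp add: set_integrable_def)
  have "(\<lambda>r. (indicator {0<..} r *\<^sub>R c r) * (indicator {0<..} r *\<^sub>R ((U r)^2 * r))) \<in> borel_measurable lborel"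
   using c U by (intro borel_measurable_times) (auto simp: set_integrable_def)
  moreover have "(\<lambda>r. (indicator {0<..} r *\<^sub>R c r) * (indicator {0<..} r *\<^sub>R ((U r)^2 * r))) = (\<lambda>r. indicator {0<..} r *\<^sub>R (c r * (U r)^2 * r))"
   by (auto simp: indicator_def fun_eq_iff)
  ultimately show "(\<lambda>r. indicator {0<..} r *\<^sub>R (c r * (U r)^2 * r)) \<in> borel_measurable lborel" by simp
  have "\<bar>c r * (U r)^2 * r\<bar> <= \<bar>B\<bar> * \<bar>(U r)^2 * r\<bar>" if "0 < r" for r
   using b[OF that] by (simp add: abs_mult mult.assoc) (intro mult_right_mono, auto)
  then show "AE r in lborel. norm (indicator {0<..} r *\<^sub>R (c r * (U r)^2 * r)) <= norm (B * (indicator {0<..} r *\<^sub>R ((U r)^2 * r)))"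
   by (intro AE_I2) (auto simp: indicator_def abs_mult)
 qed
 show "integrable_pos (\<lambda>r. ((v r)^2 + c r * (U r)^2) * r)"
  using set_integral_add(1)[OF v c] by (simp add: distrib_right)
qed

text \<open>Carries the integrals of \<open>g_star\<close>, written with the choice
  \<open>wderiv\<close>, to the absolutely continuous representative.\<close>

lemma g_star_integrals:
 assumes r: "radH U v" and u: "AE r in lborel. 0 < r --> u r = U r" and w: "weak_gradient_on {0<..} u v"
  and F: "continuous_on {0<..} F"
 shows "(LBINT r:{0<..}. ((wderiv u r)^2 - (1 - (F r)^2) * (u r)^2) * r) = (LBINT r:{0<..}. ((v r)^2 - (1 - (F r)^2) * (U r)^2) * r)"
  "(LBINT r:{0<..}. (u r)^2 * r) = (LBINT r:{0<..}. (U r)^2 * r)"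
proof -
 have ww: "weak_gradient_on {0<..} u (wderiv u)"
  unfolding wderiv_def by (rule someI_ex[of "weak_gradient_on {0<..} u"]) (use w in blast)
 have a: "acd U v" using r by (simp add: radH_def)
 have mu: "measurable_pos u"
  by (rule loc_integrable_measurable[OF weak_gradient_realD(1)[OF w]])
 have mU: "measurable_pos U"
  by (rule loc_integrable_measurable[OF weak_gradient_realD(1)[OF acd_weak_gradient[OF a]]])
 have mw: "(\<lambda>r. indicator {0<..} r *\<^sub>R wderiv u r) \<in> borel_measurable borel"
  by (rule loc_integrable_measurable[OF weak_gradient_realD(2)[OF ww]])
 have mv: "measurable_pos v"
  by (rule loc_integrable_measurable[OF weak_gradient_realD(2)[OF w]])
 have mF: "measurable_pos F"
  using F by (intro borel_measurable_continuous_on_indicator) auto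
 have q: "measurable_pos (\<lambda>r. ((p r)^2 - (1 - (F r)^2) * (y r)^2) * r)"
  if [measurable]: "measurable_pos p" "measurable_pos y"
  for p y :: "real => real"
 proof -
  note [measurable] = mF
  have "(\<lambda>r. indicator {0<..} r *\<^sub>R (((p r)^2 - (1 - (F r)^2) * (y r)^2) * r))
   = (\<lambda>r. ((indicator {0<..} r *\<^sub>R p r)^2 - (1 - (indicator {0<..} r *\<^sub>R F r)^2) * (indicator {0<..} r *\<^sub>R y r)^2) * r)"
   by (auto simp: indicator_def fun_eq_iff)
  also have "... \<in> borel_measurable borel" by measurable
  finally show ?thesis .
 qed
 have q2: "measurable_pos (\<lambda>r. (y r)^2 * r)"
  if [measurable]: "measurable_pos y" for y :: "real => real"
 proof -
  have "(\<lambda>r. indicator {0<..} r *\<^sub>R ((y r)^2 * r)) = (\<lambda>r. (indicator {0<..} r *\<^sub>R y r)^2 * r)"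
   by (auto simp: indicator_def fun_eq_iff)
  also have "... \<in> borel_measurable borel" by measurable
  finally show ?thesis .
 qed
 show "(LBINT r:{0<..}. ((wderiv u r)^2 - (1 - (F r)^2) * (u r)^2) * r) = (LBINT r:{0<..}. ((v r)^2 - (1 - (F r)^2) * (U r)^2) * r)"
  unfolding set_lebesgue_integral_def
 proof (rule integral_cong_AE)
  show "AE r in lborel. indicator {0<..} r *\<^sub>R (((wderiv u r)^2 - (1 - (F r)^2) * (u r)^2) * r) = indicator {0<..} r *\<^sub>R (((v r)^2 - (1 - (F r)^2) * (U r)^2) * r)"
   using wderiv_AE[OF w] u by eventually_elim (auto simp: indicator_def)
 qed (use q[OF mw mu] q[OF mv mU] in auto)
 show "(LBINT r:{0<..}. (u r)^2 * r) = (LBINT r:{0<..}. (U r)^2 * r)"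
  unfolding set_lebesgue_integral_def
 proof (rule integral_cong_AE)
  show "AE r in lborel. indicator {0<..} r *\<^sub>R ((u r)^2 * r) = indicator {0<..} r *\<^sub>R ((U r)^2 * r)"
   using u by eventually_elim (auto simp: indicator_def)
 qed (use q2[OF mu] q2[OF mU] in auto)
qed

section \<open>The Rayleigh quotient behind \<open>g_star\<close>\<close>

context
 fixes F :: "real => real"
 assumes F: "continuous_on {0<..} F" and F01: "!!r. 0 < r ==> 0 <= F r \<and> F r <= 1"
begin

lemma potential_bounds: "0 < r ==> 0 <= 1 - (F r)^2 \<and> 1 - (F r)^2 <= 1"
 using F01[of r] by (simp add: power_le_one)

lemma potential_measurable: "measurable_pos (\<lambda>r. k - (1 - (F r)^2))"
 by (intro borel_measurable_continuous_on_indicator continuous_intros F) auto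

lemma quotient_integrals:
 assumes r: "radH U v"
 shows "integrable_pos (\<lambda>r. ((v r)^2 - (1 - (F r)^2) * (U r)^2) * r)"
  "integrable_pos (\<lambda>r. ((v r)^2 + (g - (1 - (F r)^2)) * (U r)^2) * r)"
  "(LBINT r:{0<..}. ((v r)^2 + (g - (1 - (F r)^2)) * (U r)^2) * r) =
   (LBINT r:{0<..}. ((v r)^2 - (1 - (F r)^2) * (U r)^2) * r) + g * (LBINT r:{0<..}. (U r)^2 * r)"
  "- (LBINT r:{0<..}. (U r)^2 * r) <= (LBINT r:{0<..}. ((v r)^2 - (1 - (F r)^2) * (U r)^2) * r)"
proof -
 have b: "\<bar>k - (1 - (F r)^2)\<bar> <= \<bar>k\<bar> + 1" if "0 < r" for r k using potential_bounds[OF that] by linarith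
 have U: "integrable_pos (\<lambda>r. (U r)^2 * r)" using r by (auto simp: radH_def)
 show 1: "integrable_pos (\<lambda>r. ((v r)^2 - (1 - (F r)^2) * (U r)^2) * r)"
  using radH_quadratic_integrable(1)[OF r potential_measurable[of 0] b] by (simp add: algebra_simps)
 show "integrable_pos (\<lambda>r. ((v r)^2 + (g - (1 - (F r)^2)) * (U r)^2) * r)"
  by (rule radH_quadratic_integrable(1)[OF r potential_measurable b])
 have "(LBINT r:{0<..}. ((v r)^2 + (g - (1 - (F r)^2)) * (U r)^2) * r) =
   (LBINT r:{0<..}. ((v r)^2 - (1 - (F r)^2) * (U r)^2) * r + g * ((U r)^2 * r))"
  by (intro set_lebesgue_integral_cong) (auto simp: algebra_simps)
 also have "... = (LBINT r:{0<..}. ((v r)^2 - (1 - (F r)^2) * (U r)^2) * r) + (LBINT r:{0<..}. g * ((U r)^2 * r))"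
  using 1 U by (intro set_integral_add) auto
 finally show "(LBINT r:{0<..}. ((v r)^2 + (g - (1 - (F r)^2)) * (U r)^2) * r) =
   (LBINT r:{0<..}. ((v r)^2 - (1 - (F r)^2) * (U r)^2) * r) + g * (LBINT r:{0<..}. (U r)^2 * r)" by simp
 have "(LBINT r:{0<..}. - ((U r)^2 * r)) <= (LBINT r:{0<..}. ((v r)^2 - (1 - (F r)^2) * (U r)^2) * r)"
 proof (rule set_integral_mono[OF _ 1])
  show "integrable_pos (\<lambda>r. - ((U r)^2 * r))" using U by (simp add: set_integrable_def)
  fix r :: real assume "r \<in> {0<..}"
  then have "(1 - (F r)^2) * (U r)^2 <= 1 * (U r)^2" using potential_bounds[of r] by (intro mult_right_mono) auto
  then have "- ((U r)^2) <= (v r)^2 - (1 - (F r)^2) * (U r)^2" using zero_le_power2[of "v r"] by linarith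
  then have "- ((U r)^2) * r <= ((v r)^2 - (1 - (F r)^2) * (U r)^2) * r" using \<open>r \<in> {0<..}\<close> by (intro mult_right_mono) auto
  then show "- ((U r)^2 * r) <= ((v r)^2 - (1 - (F r)^2) * (U r)^2) * r" by simp
 qed
 then show "- (LBINT r:{0<..}. (U r)^2 * r) <= (LBINT r:{0<..}. ((v r)^2 - (1 - (F r)^2) * (U r)^2) * r)"
  using U by (simp add: set_integral_uminus)
qed

lemma radH_norm_pos:
 assumes r: "radH U v" and n: "\<not> (AE r in lborel. 0 < r --> U r = 0)"
 shows "0 < (LBINT r:{0<..}. (U r)^2 * r)"
proof -
 have U: "integrable lborel (\<lambda>r. indicator {0<..} r *\<^sub>R ((U r)^2 * r))" using r by (auto simp: radH_def set_integrable_def)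
 have p: "AE r in lborel. 0 <= indicator {0<..} r *\<^sub>R ((U r)^2 * r)" by (intro AE_I2) (auto simp: indicator_def)
 have "(LBINT r:{0<..}. (U r)^2 * r) ~= 0"
 proof
  assume "(LBINT r:{0<..}. (U r)^2 * r) = 0"
  then have "AE r in lborel. indicator {0<..} r *\<^sub>R ((U r)^2 * r) = 0"
   using integral_nonneg_eq_0_iff_AE[OF U p] by (simp add: set_lebesgue_integral_def)
  then have "AE r in lborel. 0 < r --> U r = 0" by eventually_elim auto
  then show False using n by simp
 qed
 moreover have "0 <= (LBINT r:{0<..}. (U r)^2 * r)"
  unfolding set_lebesgue_integral_def using p by (rule Bochner_Integration.integral_nonneg_AE)
 ultimately show ?thesis by simp
qed

definition "rayleigh w = (LBINT r:{0<..}. ((wderiv w r)^2 - (1 - (F r)^2) * (w r)^2) * r)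
    / (LBINT r:{0<..}. (w r)^2 * r)"

definition "nonzeroH = {w \<in> H_rad. \<not> (AE r in lborel. 0 < r --> w r = 0)}"

lemma g_star_rayleigh: "g_star F = - (INF w \<in> nonzeroH. rayleigh w)"
 by (simp add: g_star_def rayleigh_def nonzeroH_def)

lemma rayleigh_acd:
 assumes w: "w \<in> nonzeroH"
 obtains U v where "radH U v" "\<not> (AE r in lborel. 0 < r --> U r = 0)"
  "rayleigh w = (LBINT r:{0<..}. ((v r)^2 - (1 - (F r)^2) * (U r)^2) * r) / (LBINT r:{0<..}. (U r)^2 * r)"
proof -
 have "w \<in> H_rad" using w by (simp add: nonzeroH_def)
 then obtain U v where U: "radH U v" "AE r in lborel. 0 < r --> w r = U r" "weak_gradient_on {0<..} w v"
  by (rule H_rad_radH)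
 have "\<not> (AE r in lborel. 0 < r --> U r = 0)"
 proof
  assume "AE r in lborel. 0 < r --> U r = 0"
  then have "AE r in lborel. 0 < r --> w r = 0" using U(2) by eventually_elim auto
  then show False using w by (simp add: nonzeroH_def)
 qed
 then show ?thesis using that[OF U(1)] g_star_integrals[OF U F] by (simp add: rayleigh_def)
qed

text \<open>The potential 1 - F^2 is at most 1. The resulting lower bound makes the infimum a
  genuine one and later gives \<open>g_star F <= 1\<close>.\<close>

lemma rayleigh_ge: "w \<in> nonzeroH ==> -1 <= rayleigh w"
proof -
 assume "w \<in> nonzeroH"
 then obtain U v where U: "radH U v" "\<not> (AE r in lborel. 0 < r --> U r = 0)"
  "rayleigh w = (LBINT r:{0<..}. ((v r)^2 - (1 - (F r)^2) * (U r)^2) * r) / (LBINT r:{0<..}. (U r)^2 * r)"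
  by (rule rayleigh_acd)
 show ?thesis unfolding U(3) using radH_norm_pos[OF U(1,2)] quotient_integrals(4)[OF U(1)]
  by (simp add: le_divide_eq)
qed

lemma rayleigh_bdd: "bdd_below (rayleigh ` nonzeroH)"
 using rayleigh_ge by (intro bdd_belowI[of _ "-1"]) auto

lemma g_star_nonneg_form:
 assumes g: "g >= g_star F" and U: "U \<in> H_rad" "radH U v"
 shows "0 <= (LBINT r:{0<..}. ((v r)^2 + (g - (1 - (F r)^2)) * (U r)^2) * r)"
proof (cases "AE r in lborel. 0 < r --> U r = 0")
 case True
 show ?thesis
  unfolding set_lebesgue_integral_def
 proof (rule Bochner_Integration.integral_nonneg_AE)
  show "AE r in lborel. 0 <= indicator {0<..} r *\<^sub>R (((v r)^2 + (g - (1 - (F r)^2)) * (U r)^2) * r)"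
   using True by eventually_elim (auto simp: indicator_def)
 qed
next
 case False
 then have w: "U \<in> nonzeroH" using U by (simp add: nonzeroH_def)
 have "(INF w \<in> nonzeroH. rayleigh w) <= rayleigh U" using w by (rule cINF_lower[OF rayleigh_bdd])
 then have "- g <= rayleigh U" using g by (simp add: g_star_rayleigh)
 moreover have "rayleigh U = (LBINT r:{0<..}. ((v r)^2 - (1 - (F r)^2) * (U r)^2) * r) / (LBINT r:{0<..}. (U r)^2 * r)"
  unfolding rayleigh_def
  using g_star_integrals[OF U(2) _ acd_weak_gradient F, of U] U(2) by (simp add: radH_def)
 ultimately show ?thesis
  using radH_norm_pos[OF U(2) False] unfolding quotient_integrals(3)[OF U(2)]
  by (simp add: le_divide_eq)
qed

lemma g_star_negative_form:
 assumes g: "g < g_star F" and ne: "nonzeroH ~= {}"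
 obtains U v where "radH U v" "(LBINT r:{0<..}. ((v r)^2 + (g - (1 - (F r)^2)) * (U r)^2) * r) < 0"
proof -
 have "(INF w \<in> nonzeroH. rayleigh w) < - g" using g by (simp add: g_star_rayleigh)
 then obtain w where w: "w \<in> nonzeroH" "rayleigh w < - g"
  using cINF_less_iff[OF ne rayleigh_bdd] by auto
 obtain U v where U: "radH U v" "\<not> (AE r in lborel. 0 < r --> U r = 0)"
  "rayleigh w = (LBINT r:{0<..}. ((v r)^2 - (1 - (F r)^2) * (U r)^2) * r) / (LBINT r:{0<..}. (U r)^2 * r)"
  by (rule rayleigh_acd[OF w(1)])
 have "(LBINT r:{0<..}. ((v r)^2 + (g - (1 - (F r)^2)) * (U r)^2) * r) < 0"
  using w(2) radH_norm_pos[OF U(1,2)] unfolding quotient_integrals(3)[OF U(1)] U(3)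
  by (simp add: divide_less_eq)
 then show ?thesis using that U(1) by blast
qed

text \<open>The logarithmic cut-off \<open>(1 - ln(1 + r^2)/L)\<^sub>+^2\<close> has Dirichlet energy of order \<open>1/L\<close>.\<close>

lemma g_star_range:
 assumes F1: "!!r. 0 < r ==> F r < 1"
 shows "nonzeroH ~= {}" "0 < g_star F" "g_star F <= 1"
proof -
 have "compact {1/2..1::real}" by simp
 moreover have "continuous_on {1/2..1} (\<lambda>r. 1 - (F r)^2)"
  by (intro continuous_intros continuous_on_subset[OF F]) auto
 ultimately obtain r0 where r0: "r0 \<in> {1/2..1}" "!!r. r \<in> {1/2..1} ==> 1 - (F r0)^2 <= 1 - (F r)^2"
  using continuous_attains_inf[of "{1/2..1::real}" "\<lambda>r. 1 - (F r)^2"] by auto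
 \<comment> \<open>The smallest value of the potential on [1/2, 1]; it is positive because F <
   1.\<close>
 define \<kappa> where "\<kappa> = 1 - (F r0)^2"
 have \<kappa>: "\<kappa> > 0"
  using F01[of r0] F1[of r0] r0(1) by (simp add: \<kappa>_def power_less_one_iff)
 \<comment> \<open>L >= 2 keeps the cut-off above 1/4 on [1/2, 1]; L >= 1024/kappa puts the
   Dirichlet part 8/L strictly below the potential part kappa/64.\<close>
 define L where "L = max 2 (1024 / \<kappa>)"
 have L: "L >= 2" "8 / L < \<kappa> / 64" using \<kappa> by (auto simp: L_def field_simps max_def)
 define w where "w r = (max 0 (1 - ln (1 + r^2) / L))^2" for r
 define w' where "w' r = 2 * max 0 (1 - ln (1 + r^2) / L) * (- (2 * r / (1 + r^2)) / L)" for r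
 have p1: "1 + r^2 > 0" for r :: real by (simp add: add_pos_nonneg)
 have dw: "DERIV w r :> w' r" for r
 proof -
  have "DERIV (\<lambda>r. 1 - ln (1 + r^2) / L) r :> (- (2 * r / (1 + r^2)) / L)"
   using p1[of r] L by (auto intro!: derivative_eq_intros)
  from DERIV_chain2[OF DERIV_max0_square this] show ?thesis unfolding w_def w'_def .
 qed
 have nz: "1 + r^2 ~= 0" for r :: real using p1[of r] by simp
 have cw': "continuous_on UNIV w'" unfolding w'_def using L nz p1
  by (intro continuous_intros) auto
 have cw: "continuous_on UNIV w" using dw by (auto intro!: continuous_at_imp_continuous_on DERIV_isCont)
 \<comment> \<open>The radius with ln(1 + R^2) = L, beyond which the cut-off vanishes.\<close>
 define R where "R = sqrt (exp L - 1)"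
 have eL: "exp L > 1" using L by simp
 have R: "R > 0" "1 + R^2 = exp L" using eL by (auto simp: R_def)
 have z: "w r = 0" "w' r = 0" if "r > R" for r
 proof -
  have "R^2 < r^2" using that R by (intro power_strict_mono) auto
  then have "ln (exp L) <= ln (1 + r^2)" using R(2) p1[of r] by (subst ln_le_cancel_iff) auto
  then have "1 - ln (1 + r^2) / L <= 0" using L by (simp add: le_divide_eq)
  then show "w r = 0" "w' r = 0" by (simp_all add: w_def w'_def max_def)
 qed
 have i: "integrable_pos h" if h: "continuous_on UNIV h" "!!r. r > R ==> h r = 0" for h :: "real => real"
 proof -
  have 1: "set_integrable lborel {0..R} h" using h(1) by (intro borel_integrable_atLeastAtMost') (auto intro: continuous_on_subset)
  then have 2: "set_integrable lborel {0<..R} h" by (rule set_integrable_subset) auto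
  have "integrable_pos h \<longleftrightarrow> set_integrable lborel {0<..R} h"
   by (rule set_integral_support) (use h(2) in auto)
  then show ?thesis using 2 by simp
 qed
 have iw: "integrable_pos (\<lambda>r. (w r)^2 * r)" "integrable_pos (\<lambda>r. (w' r)^2 * r)"
  using cw cw' z by (auto intro!: i continuous_intros)
 have rw: "radH w w'" unfolding radH_def
  using iw dw cw' by (auto intro!: acd_C1 intro: continuous_on_subset)
 have wH: "w \<in> H_rad"
  by (rule radH_C1_H_rad[of w w']) (use dw cw' iw in \<open>auto intro: continuous_on_subset\<close>)
 have wlow: "1/4 <= w r" if "r \<in> {1/2..1}" for r
 proof -
  have r1: "r^2 <= 1" using that by (simp add: power_le_one)
  have "ln (1 + r^2) <= r^2" by (rule ln_add_one_self_le_self) simp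
  then have "ln (1 + r^2) <= 1" using r1 by linarith
  then have "ln (1 + r^2) / L <= 1 / 2" using L ln_ge_zero[of "1 + r^2"] by (simp add: divide_le_eq)
  then have "1/2 <= 1 - ln (1 + r^2) / L" by linarith
  then have "1/2 <= max 0 (1 - ln (1 + r^2) / L)" by (simp add: le_max_iff_disj)
  from power_mono[OF this, of 2] show ?thesis by (simp add: w_def power_divide)
 qed
 have nAE: "\<not> (AE r in lborel. 0 < r --> w r = 0)"
 proof
  assume "AE r in lborel. 0 < r --> w r = 0"
  then have "AE r in lborel. r \<notin> {1/2..1::real}"
  proof eventually_elim
   case (elim r)
   then show ?case using wlow[of r] by auto
  qed
  then have "emeasure lborel {1/2..1::real} = 0"
   using AE_iff_null_sets[of "{1/2..1::real}" lborel] by (auto simp: null_sets_def)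
  then show False by simp
 qed
 have wn: "w \<in> nonzeroH" using wH nAE by (simp add: nonzeroH_def)
 then show "nonzeroH ~= {}" by blast
 have "-1 <= (INF w \<in> nonzeroH. rayleigh w)" using wn rayleigh_ge by (intro cINF_greatest) auto
 then show "g_star F <= 1" by (simp add: g_star_rayleigh)
 have up: "(LBINT r:{0<..}. (w' r)^2 * r) <= 8 / L"
 proof -
  \<comment> \<open>The right side has the primitive (8/L^2) ln(1 + r^2), whose value at R is
    8/L.\<close>
  have bnd: "(w' r)^2 * r <= 16 / L^2 * (r / (1 + r^2))" if r: "0 < r" "r <= R" for r
  proof -
   have m: "0 <= max 0 (1 - ln (1 + r^2) / L)" "max 0 (1 - ln (1 + r^2) / L) <= 1"
    using L ln_ge_zero[of "1 + r^2"] by auto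
   have "(w' r)^2 = (max 0 (1 - ln (1 + r^2) / L))^2 * (16 / L^2 * (r^2 / (1 + r^2)^2))"
    by (simp add: w'_def power_mult_distrib power_divide mult_ac)
   also have "... <= 1 * (16 / L^2 * (r^2 / (1 + r^2)^2))"
    using m by (intro mult_right_mono power_le_one) auto
   finally have "(w' r)^2 <= 16 / L^2 * (r^2 / (1 + r^2)^2)" unfolding mult_1 .
   then have "(w' r)^2 * r <= (16 / L^2 * (r^2 / (1 + r^2)^2)) * r"
    by (rule mult_right_mono) (use r in simp)
   also have "... = 16 / L^2 * ((r / (1 + r^2)) * (r^2 / (1 + r^2)))"
    by (simp add: power2_eq_square)
   also have "... <= 16 / L^2 * ((r / (1 + r^2)) * 1)"
    using r p1[of r] by (intro mult_left_mono) (auto simp: divide_le_eq)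
   finally show ?thesis by simp
  qed
  have cr: "continuous_on UNIV (\<lambda>r::real. 16 / L^2 * (r / (1 + r^2)))" using nz L by (intro continuous_intros) auto
  have ir0: "set_integrable lborel {0..R} (\<lambda>r. 16 / L^2 * (r / (1 + r^2)))"
   by (rule borel_integrable_atLeastAtMost') (rule continuous_on_subset[OF cr], simp)
  have "(LBINT r:{0<..}. (w' r)^2 * r) = (LBINT r:{0<..R}. (w' r)^2 * r)"
   by (rule set_integral_support) (use z in auto)
  also have "... <= (LBINT r:{0<..R}. 16 / L^2 * (r / (1 + r^2)))"
  proof (rule set_integral_mono)
   show "set_integrable lborel {0<..R} (\<lambda>r. (w' r)^2 * r)" by (rule set_integrable_subset[OF iw(2)]) auto
   show "set_integrable lborel {0<..R} (\<lambda>r. 16 / L^2 * (r / (1 + r^2)))" by (rule set_integrable_subset[OF ir0]) auto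
   show "(w' r)^2 * r <= 16 / L^2 * (r / (1 + r^2))" if "r \<in> {0<..R}" for r using bnd that by simp
  qed
  also have "... <= (LBINT r:{0..R}. 16 / L^2 * (r / (1 + r^2)))"
   using p1 by (intro set_integral_mono_subset[OF ir0]) (auto intro!: mult_nonneg_nonneg divide_nonneg_pos)
  also have "... = 8 / L^2 * ln (1 + R^2) - 8 / L^2 * ln (1 + 0^2)"
   unfolding set_lebesgue_integral_def
  proof (rule integral_FTC_atLeastAtMost)
   fix r :: real
   have "((\<lambda>r. ln (1 + r^2)) has_real_derivative (2 * r / (1 + r^2))) (at r within {0..R})"
    using p1[of r] by (auto intro!: derivative_eq_intros)
   from DERIV_cmult[OF this, of "8 / L^2"]
   have "((\<lambda>r. 8 / L^2 * ln (1 + r^2)) has_real_derivative 16 / L^2 * (r / (1 + r^2))) (at r within {0..R})"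
    by simp
   then show "((\<lambda>r. 8 / L^2 * ln (1 + r^2)) has_vector_derivative 16 / L^2 * (r / (1 + r^2))) (at r within {0..R})"
    by (simp add: has_real_derivative_iff_has_vector_derivative)
  qed (use R cr in \<open>auto intro: continuous_on_subset\<close>)
  also have "... = 8 / L" using R(2) L by (simp add: power2_eq_square)
  finally show ?thesis .
 qed
 \<comment> \<open>kappa/64 collects kappa, the factor (1/4)^2 from the cut-off, 1/2 from the weight
   r and 1/2 from the length of the interval.\<close>
 have lo: "\<kappa> / 64 <= (LBINT r:{0<..}. (1 - (F r)^2) * (w r)^2 * r)"
 proof -
  have ci: "integrable_pos (\<lambda>r. (1 - (F r)^2) * (w r)^2 * r)"
   by (rule radH_quadratic_integrable(2)[OF rw, of _ 1])
    (use potential_bounds in \<open>auto intro!: borel_measurable_continuous_on_indicator continuous_intros F simp del: real_scaleR_def\<close>)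
  have "\<kappa> / 64 = (LBINT r:{1/2..1::real}. \<kappa> / 32)"
   by (simp add: set_lebesgue_integral_def)
  also have "... <= (LBINT r:{1/2..1}. (1 - (F r)^2) * (w r)^2 * r)"
  proof (rule set_integral_mono)
   show "set_integrable lborel {1/2..1::real} (\<lambda>r. \<kappa> / 32)" by (rule borel_integrable_atLeastAtMost') auto
   show "set_integrable lborel {1/2..1} (\<lambda>r. (1 - (F r)^2) * (w r)^2 * r)" by (rule set_integrable_subset[OF ci]) auto
   fix r :: real assume r: "r \<in> {1/2..1}"
   have "(1/4)^2 <= (w r)^2" using wlow[OF r] by (intro power_mono) auto
   then have "\<kappa> * (1/16) <= (1 - (F r)^2) * (w r)^2"
    using r0(2)[OF r] \<kappa> by (intro mult_mono) (auto simp: \<kappa>_def power_divide)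
   then have "\<kappa> * (1/16) * (1/2) <= (1 - (F r)^2) * (w r)^2 * r"
    using mult_mono[of "\<kappa> * (1/16)" "(1 - (F r)^2) * (w r)^2" "1/2" r] r \<kappa> by auto
   then show "\<kappa> / 32 <= (1 - (F r)^2) * (w r)^2 * r" by simp
  qed
  also have "... <= (LBINT r:{0<..}. (1 - (F r)^2) * (w r)^2 * r)"
   using potential_bounds by (intro set_integral_mono_subset[OF ci]) auto
  finally show ?thesis .
 qed
 have "(LBINT r:{0<..}. ((w' r)^2 - (1 - (F r)^2) * (w r)^2) * r)
   = (LBINT r:{0<..}. (w' r)^2 * r) - (LBINT r:{0<..}. (1 - (F r)^2) * (w r)^2 * r)"
 proof -
  have ci: "integrable_pos (\<lambda>r. (1 - (F r)^2) * (w r)^2 * r)"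
   by (rule radH_quadratic_integrable(2)[OF rw, of _ 1])
    (use potential_bounds in \<open>auto intro!: borel_measurable_continuous_on_indicator continuous_intros F simp del: real_scaleR_def\<close>)
  show ?thesis using set_integral_diff(2)[OF iw(2) ci] by (simp add: left_diff_distrib)
 qed
 then have neg: "(LBINT r:{0<..}. ((w' r)^2 - (1 - (F r)^2) * (w r)^2) * r) < 0"
  using up lo L(2) by linarith
 have "rayleigh w = (LBINT r:{0<..}. ((w' r)^2 - (1 - (F r)^2) * (w r)^2) * r) / (LBINT r:{0<..}. (w r)^2 * r)"
  unfolding rayleigh_def
  using g_star_integrals[OF rw _ acd_weak_gradient F, of w] rw by (simp add: radH_def)
 then have "rayleigh w < 0" using neg radH_norm_pos[OF rw nAE] by (simp add: divide_neg_pos)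
 moreover have "(INF w \<in> nonzeroH. rayleigh w) <= rayleigh w" by (rule cINF_lower[OF rayleigh_bdd wn])
 ultimately show "0 < g_star F" by (simp add: g_star_rayleigh)
qed

end


section \<open>Pointwise bounds for solutions\<close>

text \<open>At a positive interior maximum w' vanishes, and w'' > 0 would make w larger just to the
  right. The inequality is asked only at critical points with w > 0, so drift terms drop out where
  it is applied.\<close>

lemma max_principle_Icc:
 fixes w w' w'' :: "real => real"
 assumes d: "!!r. a <= r ==> r <= b ==> DERIV w r :> w' r"
  and d': "!!r. a <= r ==> r <= b ==> DERIV w' r :> w'' r"
  and bd: "w a <= 0" "w b <= 0"
  and pos: "!!r. a < r ==> r < b ==> w r > 0 ==> w' r = 0 ==> w'' r > 0"
  and r: "a <= r" "r <= b"
 shows "w r <= 0"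
proof (rule ccontr)
 assume n: "\<not> w r <= 0"
 have "continuous_on {a..b} w" using d by (auto intro!: continuous_at_imp_continuous_on DERIV_isCont)
 then obtain r0 where r0: "r0 \<in> {a..b}" "!!x. x \<in> {a..b} ==> w x <= w r0"
  using continuous_attains_sup[of "{a..b}" w] r by fastforce
 have w0: "w r0 > 0" using r0(2)[of r] r n by auto
 then have ab: "a < r0" "r0 < b" using r0(1) bd by (auto simp: less_le)
 have "w' r0 = 0"
 proof (rule DERIV_local_max[of w _ _ "min (r0 - a) (b - r0)"])
  show "DERIV w r0 :> w' r0" using d ab by simp
  show "\<forall>y. \<bar>r0 - y\<bar> < min (r0 - a) (b - r0) --> w y <= w r0"
  proof (intro allI impI)
   fix y assume "\<bar>r0 - y\<bar> < min (r0 - a) (b - r0)"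
   then have "y \<in> {a..b}" by (simp add: abs_less_iff)
   then show "w y <= w r0" by (rule r0(2))
  qed
 qed (use ab in auto)
 moreover from this have "w'' r0 > 0" using pos ab w0 by simp
 ultimately obtain e where e: "e > 0" "!!h. 0 < h ==> h < e ==> w' (r0 + h) > 0"
  using DERIV_pos_inc_right[OF d', of r0] ab by auto
 define h where "h = min (e/2) (b - r0)"
 have h: "0 < h" "h < e" "r0 + h <= b" using e ab by (auto simp: h_def)
 obtain z where z: "r0 < z" "z < r0 + h" "w (r0 + h) - w r0 = (r0 + h - r0) * w' z"
  using MVT2[of r0 "r0 + h" w w'] d h ab by (metis (no_types, opaque_lifting) add_less_cancel_left add.right_neutral less_eq_real_def order_trans)
 have "w' z > 0" using e(2)[of "z - r0"] z h by simp
 then have "0 < (r0 + h - r0) * w' z" using h by simp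
 then have "w (r0 + h) > w r0" using z(3) by linarith
 then show False using r0(2)[of "r0 + h"] h ab by auto
qed

lemma bounded_from_ends:
 fixes q :: "real => real"
 assumes q: "continuous_on {0<..} q" and 0: "eventually (\<lambda>r. q r <= C1) (at_right 0)"
  and i: "eventually (\<lambda>r. q r <= C2) at_top"
 shows "\<exists>C>0. \<forall>r>0. q r <= C"
proof -
 obtain a where a: "a > 0" "!!r. 0 < r ==> r < a ==> q r <= C1"
  using 0 unfolding eventually_at_right_field by auto
 obtain b where b: "!!r. r >= b ==> q r <= C2" using i unfolding eventually_at_top_linorder by auto
 have "compact (q ` {a..max a b})" using q a by (intro compact_continuous_image) (auto intro: continuous_on_subset)
 then have "bounded (q ` {a..max a b})" by (rule compact_imp_bounded)
 then obtain K where K: "!!r. r \<in> {a..max a b} ==> \<bar>q r\<bar> <= K" unfolding bounded_real by blast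
 have "q r <= max 1 (max K (max C1 C2))" if "0 < r" for r
 proof -
  consider "r < a" | "r \<in> {a..max a b}" | "r >= b" using that by fastforce
  then have "q r <= C1 \<or> q r <= K \<or> q r <= C2"
  proof cases
   case 1 then show ?thesis using a that by simp
  next
   case 2 then show ?thesis using K[of r] by (simp add: abs_le_iff)
  next
   case 3 then show ?thesis using b by simp
  qed
  then show ?thesis by (auto simp: le_max_iff_disj)
 qed
 then show ?thesis by (intro exI[of _ "max 1 (max K (max C1 C2))"]) auto
qed

text \<open>Comparison with M' exp(-alpha t) + eta exp(alpha t), where t = r - R0. The growing term
  wins at the far end of a bounded interval, where nothing but the bound on u is known; afterwards
  eta tends to 0.\<close>

lemma drift_decay:
 fixes u u' u'' b :: "real => real"
 assumes d: "!!r. R0 <= r ==> DERIV u r :> u' r"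
  and d': "!!r. R0 <= r ==> DERIV u' r :> u'' r"
  and M: "!!r. R0 <= r ==> u r <= M"
  and c: "0 < c" and b: "!!r. R0 <= r ==> \<bar>b r\<bar> <= D"
  and ineq: "!!r. R0 <= r ==> 0 < u r ==> u'' r + b r * u' r >= c * u r"
  and e: "\<epsilon> > 0"
 shows "eventually (\<lambda>r. u r <= \<epsilon>) at_top"
proof -
 define D' where "D' = max D 0 + c"
 \<comment> \<open>alpha (1 + D') <= c/2 and alpha <= 1 give alpha^2 + D' alpha < c, so the barrier
   is a strict supersolution.\<close>
 define \<alpha> where "\<alpha> = min 1 (c / (2 * (1 + D')))"
 have D': "D' > 0" using c by (simp add: D'_def)
 have a: "\<alpha> > 0" "\<alpha> <= 1" using c D' by (auto simp: \<alpha>_def)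
 have "\<alpha> * (1 + D') <= c / (2 * (1 + D')) * (1 + D')" using D' by (intro mult_right_mono) (auto simp: \<alpha>_def)
 moreover have "c / (2 * (1 + D')) * (1 + D') = c / 2" using D' by (simp add: field_simps)
 ultimately have ac: "\<alpha> * (1 + D') <= c / 2" by (rule ord_le_eq_trans)
 have "\<alpha> * \<alpha> <= \<alpha> * 1" using a by (intro mult_left_mono) auto
 then have ac2: "\<alpha> * \<alpha> + D' * \<alpha> < c" using ac c by (simp add: algebra_simps)
 define M' where "M' = max M 1"
 have M': "M' > 0" "M <= M'" by (auto simp: M'_def)
 have main: "u r <= M' * exp (- \<alpha> * (r - R0)) + \<eta> * exp (\<alpha> * (r - R0))" if r: "R0 <= r" and \<eta>: "\<eta> > 0" for r \<eta>
 proof -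
  define B where "B r = M' * exp (- \<alpha> * (r - R0)) + \<eta> * exp (\<alpha> * (r - R0))" for r
  define B' where "B' r = \<alpha> * (- M' * exp (- \<alpha> * (r - R0)) + \<eta> * exp (\<alpha> * (r - R0)))" for r
  have dB: "DERIV B r :> B' r" for r
   unfolding B_def B'_def by (auto intro!: derivative_eq_intros simp: algebra_simps)
  have dB': "DERIV B' r :> \<alpha> * \<alpha> * B r" for r
   unfolding B_def B'_def by (auto intro!: derivative_eq_intros simp: algebra_simps)
  have Bp: "B r > 0" for r unfolding B_def using M' \<eta> by (intro add_pos_pos mult_pos_pos) auto
  have B'b: "\<bar>B' r\<bar> <= \<alpha> * B r" for r
  proof -
   have "\<bar>- M' * exp (- \<alpha> * (r - R0)) + \<eta> * exp (\<alpha> * (r - R0))\<bar> <= B r"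
    unfolding B_def using M' \<eta> by (simp add: abs_le_iff)
   then have "\<alpha> * \<bar>- M' * exp (- \<alpha> * (r - R0)) + \<eta> * exp (\<alpha> * (r - R0))\<bar> <= \<alpha> * B r"
    using a by (intro mult_left_mono) auto
   then show ?thesis using a by (simp add: B'_def abs_mult)
  qed
  \<comment> \<open>Far enough out for the growing exponential alone to exceed M.\<close>
  define r2 where "r2 = max r (R0 + M' / \<eta> / \<alpha>)"
  have r2: "r2 >= r" "M <= \<eta> * exp (\<alpha> * (r2 - R0))"
  proof -
   show "r2 >= r" by (simp add: r2_def)
   have "M' / \<eta> / \<alpha> <= r2 - R0" by (simp add: r2_def)
   then have "\<alpha> * (M' / \<eta> / \<alpha>) <= \<alpha> * (r2 - R0)" using a by (intro mult_left_mono) auto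
   then have "M' / \<eta> <= \<alpha> * (r2 - R0)" using a by simp
   also have "... <= exp (\<alpha> * (r2 - R0))" using exp_ge_add_one_self[of "\<alpha> * (r2 - R0)"] by linarith
   finally have "M' <= \<eta> * exp (\<alpha> * (r2 - R0))" using \<eta> by (simp add: divide_le_eq mult.commute)
   then show "M <= \<eta> * exp (\<alpha> * (r2 - R0))" using M' by linarith
  qed
  have "u r - B r <= 0"
  proof (rule max_principle_Icc[where w="\<lambda>r. u r - B r" and r=r and a=R0 and b=r2 and w'="\<lambda>r. u' r - B' r" and w''="\<lambda>r. u'' r - \<alpha> * \<alpha> * B r"])
   show "u R0 - B R0 <= 0" using M[of R0] M' \<eta> by (simp add: B_def)
   have "0 < M' * exp (- \<alpha> * (r2 - R0))" using M' by simp
   then show "u r2 - B r2 <= 0" using M[of r2] r2 r unfolding B_def by linarith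
   fix x assume x: "R0 < x" "x < r2" and w: "u x - B x > 0" "u' x - B' x = 0"
   have up: "u x > 0" using w Bp[of x] by linarith
   have "\<bar>b x * B' x\<bar> <= D' * (\<alpha> * B x)"
    unfolding abs_mult using b[of x] B'b[of x] x D' c by (intro mult_mono) (auto simp: D'_def)
   then have "u'' x >= c * u x - D' * (\<alpha> * B x)" using ineq[of x] up x w by (simp add: abs_le_iff)
   moreover have "c * u x > c * B x" using w c by simp
   moreover have "(\<alpha> * \<alpha> + D' * \<alpha>) * B x < c * B x" using ac2 Bp[of x] by simp
   ultimately show "u'' x - \<alpha> * \<alpha> * B x > 0" by (simp add: algebra_simps)
  qed (use r r2 d d' dB dB' in \<open>auto intro!: DERIV_diff\<close>)
  then show ?thesis by (simp add: B_def)
 qed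
 have lim: "u r <= M' * exp (- \<alpha> * (r - R0))" if r: "R0 <= r" for r
 proof (rule field_le_epsilon)
  fix e :: real assume "e > 0"
  then show "u r <= M' * exp (- \<alpha> * (r - R0)) + e"
   using main[OF r, of "e / exp (\<alpha> * (r - R0))"] by simp
 qed
 show ?thesis
  using eventually_ge_at_top[of "R0 + M' / \<epsilon> / \<alpha>"]
 proof eventually_elim
  case (elim r)
  have q: "0 <= M' / \<epsilon> / \<alpha>" using M' e a by simp
  have "M' / \<epsilon> / \<alpha> <= r - R0" using elim by simp
  then have "\<alpha> * (M' / \<epsilon> / \<alpha>) <= \<alpha> * (r - R0)" using a by (intro mult_left_mono) auto
  then have "M' / \<epsilon> <= \<alpha> * (r - R0)" using a by simp
  also have "... <= exp (\<alpha> * (r - R0))" using exp_ge_add_one_self[of "\<alpha> * (r - R0)"] by linarith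
  finally have "M' <= \<epsilon> * exp (\<alpha> * (r - R0))" using e by (simp add: divide_le_eq mult.commute)
  then have "M' * exp (- \<alpha> * (r - R0)) <= \<epsilon> * exp (\<alpha> * (r - R0)) * exp (- \<alpha> * (r - R0))"
   by (rule mult_right_mono) simp
  also have "... = \<epsilon>" by (simp add: mult.assoc flip: exp_add)
  finally show ?case using lim[of r] elim q by simp
 qed
qed

text \<open>Integrating (r u')' gives the crude rate u' = O(r^(-1/2)), hence u'' = O(r^(-3/2)). In
  each [r, r+1] the mean value theorem finds a point with u' = O(r^(-2)), and the bound on u''
  carries the rate 3/2 back to r. With this rate r (u')^2 (1 + r^2) is bounded.\<close>

lemma derivative_decay:
 fixes u u' u'' :: "real => real"
 assumes R: "1 <= R" and d: "!!r. R <= r ==> DERIV u r :> u' r"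
  and d': "!!r. R <= r ==> DERIV u' r :> u'' r"
  and u: "!!r. R <= r ==> \<bar>u r\<bar> <= C / r^2" and L: "!!r. R <= r ==> \<bar>u'' r + u' r / r\<bar> <= C / r^2"
 obtains K where "K >= 0" "!!r. R <= r ==> \<bar>u' r\<bar> <= K / (r * sqrt r)"
proof -
 have "0 <= C / R^2" using u[of R] by linarith
 then have C: "C >= 0" using R by (simp add: zero_le_divide_iff)
 define P where "P r = r * u' r" for r
 have dP: "DERIV P r :> r * (u'' r + u' r / r)" if "R <= r" for r
  unfolding P_def using that R by (auto intro!: derivative_eq_intros d' simp: field_simps)
 have ds: "DERIV (\<lambda>r. 2 * C * sqrt r) r :> C / sqrt r" if "R <= r" for r
  using that R by (auto intro!: derivative_eq_intros simp: field_simps)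
 have sq: "r / r^2 <= 1 / sqrt r" if "R <= r" for r
 proof -
  have r: "1 <= r" using that R by simp
  have "1 * sqrt r <= sqrt r * sqrt r" using r by (intro mult_right_mono) auto
  then have "sqrt r <= r" using r by simp
  then have "1 / r <= 1 / sqrt r" using r by (intro divide_left_mono) auto
  then show ?thesis using r by (simp add: power2_eq_square)
 qed
 have P'b: "\<bar>r * (u'' r + u' r / r)\<bar> <= C / sqrt r" if "R <= r" for r
 proof -
  have "\<bar>r * (u'' r + u' r / r)\<bar> <= r * (C / r^2)" unfolding abs_mult using that R L[OF that] by (intro mult_mono) auto
  also have "... = C * (r / r^2)" by simp
  also have "... <= C * (1 / sqrt r)" using sq[OF that] C by (intro mult_left_mono)
  finally show ?thesis by simp
 qed
 have Pb: "\<bar>P r\<bar> <= \<bar>P R\<bar> + 2 * C * sqrt r" if r: "R <= r" for r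
 proof -
  have "P r - 2 * C * sqrt r <= P R - 2 * C * sqrt R"
  proof (rule DERIV_nonpos_imp_nonincreasing[OF r])
   fix x assume x: "R <= x" "x <= r"
   show "\<exists>y. DERIV (\<lambda>r. P r - 2 * C * sqrt r) x :> y \<and> y <= 0"
    using DERIV_diff[OF dP[OF x(1)] ds[OF x(1)]] P'b[OF x(1)] by (auto simp: abs_le_iff)
  qed
  moreover have "P R + 2 * C * sqrt R <= P r + 2 * C * sqrt r"
  proof (rule DERIV_nonneg_imp_nondecreasing[OF r])
   fix x assume x: "R <= x" "x <= r"
   show "\<exists>y. DERIV (\<lambda>r. P r + 2 * C * sqrt r) x :> y \<and> 0 <= y"
    using DERIV_add[OF dP[OF x(1)] ds[OF x(1)]] P'b[OF x(1)] by (intro exI conjI) (auto simp: abs_le_iff)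
  qed
  moreover have "0 <= 2 * C * sqrt R" using C R by simp
  ultimately show ?thesis by linarith
 qed
 define K0 where "K0 = \<bar>P R\<bar> + 2 * C"
 have K0: "K0 >= 0" using C by (simp add: K0_def)
 have u'b: "\<bar>u' r\<bar> <= K0 * sqrt r / r" if r: "R <= r" for r
 proof -
  have "1 <= sqrt r" using r R by simp
  then have "\<bar>P R\<bar> * 1 <= \<bar>P R\<bar> * sqrt r" by (intro mult_left_mono) auto
  then have "\<bar>P r\<bar> <= K0 * sqrt r" using Pb[OF r] by (simp add: K0_def algebra_simps)
  then show ?thesis using r R by (simp add: P_def abs_mult field_simps)
 qed
 define K1 where "K1 = C + K0"
 have r32: "1 / r^2 <= 1 / (r * sqrt r)" if "R <= r" for r
 proof -
  have "1 / r * (r / r^2) <= 1 / r * (1 / sqrt r)" using sq[OF that] that R by (intro mult_left_mono) auto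
  then show ?thesis using that R by (simp add: field_simps)
 qed
 have u''b: "\<bar>u'' r\<bar> <= K1 / (r * sqrt r)" if r: "R <= r" for r
 proof -
  have r0: "r > 0" using r R by simp
  have "\<bar>u' r / r\<bar> <= (K0 * sqrt r / r) / r" using divide_right_mono[OF u'b[OF r], of r] r0 by simp
  also have "... = K0 / (r * sqrt r)"
  proof -
   have "sqrt r / (r * r) = 1 / (r * sqrt r)" using r0 by (simp add: field_simps)
   from arg_cong[OF this, of "\<lambda>t. K0 * t"] show ?thesis by simp
  qed
  finally have 1: "\<bar>u' r / r\<bar> <= K0 / (r * sqrt r)" .
  have 2: "C / r^2 <= C / (r * sqrt r)" using mult_left_mono[OF r32[OF r] C] by simp
  have "\<bar>u'' r\<bar> <= \<bar>u'' r + u' r / r\<bar> + \<bar>u' r / r\<bar>" by linarith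
  also have "... <= C / (r * sqrt r) + K0 / (r * sqrt r)" using 1 2 L[OF r] by linarith
  finally show ?thesis by (simp add: K1_def add_divide_distrib)
 qed
 have K1: "K1 >= 0" using C K0 by (simp add: K1_def)
 show ?thesis
 proof (rule that[of "2 * C + K1"])
  show "0 <= 2 * C + K1" using C K1 by simp
  fix r assume r: "R <= r"
  then have r0: "r > 0" using R by simp
  obtain \<xi> where \<xi>: "r < \<xi>" "\<xi> < r + 1" "u (r + 1) - u r = (r + 1 - r) * u' \<xi>"
   using MVT2[of r "r + 1" u u'] d r by auto
  obtain \<eta> where \<eta>: "r < \<eta>" "\<eta> < \<xi>" "u' \<xi> - u' r = (\<xi> - r) * u'' \<eta>"
   using MVT2[of r \<xi> u' u''] d' r \<xi> by auto
  have "\<bar>u (r + 1)\<bar> <= C / (r + 1)^2" "\<bar>u r\<bar> <= C / r^2" using u r by auto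
  moreover have "C / (r + 1)^2 <= C / r^2" using r0 C by (intro divide_left_mono) (auto simp: power_mono)
  ultimately have 1: "\<bar>u' \<xi>\<bar> <= 2 * (C / r^2)" using \<xi>(3) by (simp add: abs_le_iff)
  have 2: "C / r^2 <= C / (r * sqrt r)" using mult_left_mono[OF r32[OF r] C] by simp
  have "\<bar>(\<xi> - r) * u'' \<eta>\<bar> <= 1 * (K1 / (\<eta> * sqrt \<eta>))"
   unfolding abs_mult using u''b[of \<eta>] \<xi> \<eta> r by (intro mult_mono) auto
  also have "... <= K1 / (r * sqrt r)"
   using \<eta> r0 K1 by (simp, intro divide_left_mono mult_mono) auto
  finally have 3: "\<bar>(\<xi> - r) * u'' \<eta>\<bar> <= K1 / (r * sqrt r)" .
  have "\<bar>u' r\<bar> <= \<bar>u' \<xi>\<bar> + \<bar>(\<xi> - r) * u'' \<eta>\<bar>" using \<eta>(3) by linarith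
  also have "... <= 2 * (C / (r * sqrt r)) + K1 / (r * sqrt r)" using 1 2 3 by linarith
  finally show "\<bar>u' r\<bar> <= (2 * C + K1) / (r * sqrt r)" by (simp add: add_divide_distrib)
 qed
qed

text \<open>If r f' >= delta on (0, r], then f loses at least delta ln(r/s) between r and s. This is
  the device that excludes singular solutions at the origin.\<close>

lemma no_logarithmic_growth:
 fixes f P :: "real => real"
 assumes r: "0 < r" and df: "!!x. 0 < x ==> x <= r ==> DERIV f x :> P x / x"
  and M: "!!x. 0 < x ==> x <= r ==> \<bar>f x\<bar> <= M" and P: "!!x. 0 < x ==> x <= r ==> \<delta> <= P x" and \<delta>: "0 < \<delta>"
 shows False
proof -
 have M0: "M >= 0" using M[of r] r by linarith
 \<comment> \<open>At s the logarithmic loss is 2M + 1, more than two values in [-M, M] can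
   differ.\<close>
 define s where "s = r * exp (- ((2 * M + 1) / \<delta>))"
 have "(2 * M + 1) / \<delta> > 0" using M0 \<delta> by simp
 then have s: "0 < s" "s < r" using r by (auto simp: s_def)
 have "f s - \<delta> * ln s <= f r - \<delta> * ln r"
 proof (rule DERIV_nonneg_imp_nondecreasing[where f="\<lambda>r. f r - \<delta> * ln r"])
  show "s <= r" using s by simp
  fix x assume x: "s <= x" "x <= r"
  have "DERIV (\<lambda>r. f r - \<delta> * ln r) x :> P x / x - \<delta> * (1 / x)"
   by (rule DERIV_diff[OF df DERIV_cmult]) (use x s r in \<open>auto intro!: derivative_eq_intros\<close>)
  moreover have "0 <= P x / x - \<delta> * (1 / x)"
   using P[of x] x s by (simp add: divide_right_mono flip: diff_divide_distrib)
  ultimately show "\<exists>y. DERIV (\<lambda>r. f r - \<delta> * ln r) x :> y \<and> 0 <= y" by blast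
 qed
 moreover have "ln s = ln r - (2 * M + 1) / \<delta>" using r by (simp add: s_def ln_mult)
 moreover have "\<delta> * ((2 * M + 1) / \<delta>) = 2 * M + 1" using \<delta> by simp
 ultimately have "f s <= f r - (2 * M + 1)" by (simp add: right_diff_distrib)
 then show False using M[of s] M[of r] s r by (simp add: abs_le_iff)
qed

text \<open>The flux r u' has derivative at most C r in absolute value. If it exceeded C r^2 at some
  radius, it would stay above a positive constant down to 0, and u would grow logarithmically.
  Boundedness of u thus replaces a condition at the origin.\<close>

lemma regular_derivative_upper:
 fixes u u' u'' :: "real => real"
 assumes d: "!!r. 0 < r ==> r <= r0 ==> DERIV u r :> u' r"
  and d': "!!r. 0 < r ==> r <= r0 ==> DERIV u' r :> u'' r"
  and M: "!!r. 0 < r ==> r <= r0 ==> \<bar>u r\<bar> <= M"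
  and L: "!!r. 0 < r ==> r <= r0 ==> \<bar>u'' r + u' r / r\<bar> <= C"
  and r: "0 < r" "r <= r0"
 shows "u' r <= C * r"
proof (rule ccontr)
 assume n: "\<not> u' r <= C * r"
 define P where "P r = r * u' r" for r
 have dP: "DERIV P r :> r * (u'' r + u' r / r)" if "0 < r" "r <= r0" for r
  unfolding P_def using that by (auto intro!: derivative_eq_intros d' simp: field_simps)
 have C: "C >= 0" using L[OF r] by linarith
 show False
 proof (rule no_logarithmic_growth[where f=u and P=P and M=M and \<delta>="P r - r * (r * C)", OF r(1)])
  have "r * (C * r) < r * u' r" using n r by (intro mult_strict_left_mono) auto
  then show "0 < P r - r * (r * C)" by (simp add: P_def mult_ac)
  fix x assume x: "0 < x" "x <= r"
  show "P r - r * (r * C) <= P x"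
  proof (cases "x = r")
   case False
   obtain z where z: "x < z" "z < r" "P r - P x = (r - x) * (z * (u'' z + u' z / z))"
    using MVT2[of x r P "\<lambda>r. r * (u'' r + u' r / r)"] dP x r False by auto
   have "\<bar>(r - x) * (z * (u'' z + u' z / z))\<bar> <= r * (r * C)"
    unfolding abs_mult using z x r L[of z] C by (intro mult_mono) auto
   then show ?thesis using z(3) by linarith
  qed (use r C in simp)
 qed (use d M r in \<open>auto simp: P_def\<close>)
qed

lemma regular_derivative_near_zero:
 fixes u u' u'' :: "real => real"
 assumes d: "!!r. 0 < r ==> r <= r0 ==> DERIV u r :> u' r"
  and d': "!!r. 0 < r ==> r <= r0 ==> DERIV u' r :> u'' r"
  and M: "!!r. 0 < r ==> r <= r0 ==> \<bar>u r\<bar> <= M"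
  and L: "!!r. 0 < r ==> r <= r0 ==> \<bar>u'' r + u' r / r\<bar> <= C"
  and r: "0 < r" "r <= r0"
 shows "\<bar>u' r\<bar> <= C * r"
proof -
 have "\<bar>- u'' r + - u' r / r\<bar> <= C" if "0 < r" "r <= r0" for r using L[OF that] by simp
 then have "- u' r <= C * r"
  using regular_derivative_upper[of r0 "\<lambda>r. - u r" "\<lambda>r. - u' r" "\<lambda>r. - u'' r" M C r] d d' M r by (auto intro: DERIV_minus)
 moreover have "u' r <= C * r" by (rule regular_derivative_upper[OF d d' M L r])
 ultimately show ?thesis by simp
qed

text \<open>With \<open>P = r f'\<close> the equation reads \<open>r P' = c f\<close>; the quantities \<open>P\<close>, \<open>4P^2 - f^2\<close>, \<open>f^2/r\<close> and
 \<open>Q f^2 - P^2\<close> are nondecreasing, and each sign follows because the wrong sign at one radius would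
 force logarithmic growth of \<open>f\<close> or \<open>P\<close> at the origin.\<close>

lemma singular_profile_near_zero:
 fixes f f' f'' c :: "real => real"
 assumes r0: "0 < r0" and d: "!!r. 0 < r ==> r <= r0 ==> DERIV f r :> f' r"
  and d': "!!r. 0 < r ==> r <= r0 ==> DERIV f' r :> f'' r"
  and f: "!!r. 0 < r ==> r <= r0 ==> 0 <= f r \<and> f r <= M"
  and c: "!!r. 0 < r ==> r <= r0 ==> 3/4 <= c r \<and> c r <= Q"
  and eq: "!!r. 0 < r ==> r <= r0 ==> f'' r + f' r / r = c r / r^2 * f r"
  and r: "0 < r" "r <= r0"
 shows "(f r)^2 <= M^2 / r0 * r" "(r * f' r)^2 <= Q * (f r)^2"
proof -
 define P where "P r = r * f' r" for r
 have df: "DERIV f r :> P r / r" if "0 < r" "r <= r0" for r using d[OF that] that by (simp add: P_def)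
 have dP: "DERIV P r :> c r * f r / r" if "0 < r" "r <= r0" for r
 proof -
  have "DERIV P r :> f' r + r * f'' r" unfolding P_def using that by (auto intro!: derivative_eq_intros d')
  moreover have "f' r + r * f'' r = r * (f'' r + f' r / r)" using that by (simp add: field_simps)
  moreover have "... = c r * f r / r" using eq[OF that] that by (simp add: power2_eq_square)
  ultimately show ?thesis by simp
 qed
 have mono: "h s <= h t" if "0 < s" "s <= t" "t <= r0"
  and h: "!!x. 0 < x ==> x <= r0 ==> DERIV h x :> h' x \<and> 0 <= h' x" for s t and h h' :: "real => real"
  by (rule DERIV_nonneg_imp_nondecreasing[OF that(2)]) (use h that in \<open>meson less_le_trans order_trans\<close>)
 have Pmono: "P s <= P t" if "0 < s" "s <= t" "t <= r0" for s t
  by (rule mono[OF that, of P "\<lambda>r. c r * f r / r"]) (use dP c f in \<open>force intro!: divide_nonneg_pos mult_nonneg_nonneg\<close>)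
 have bf: "\<bar>f x\<bar> <= M" if "0 < x" "x <= r0" for x using f[OF that] by simp
 have Ppos: "0 <= P r" if r: "0 < r" "r <= r0" for r
 proof (rule ccontr)
  assume n: "\<not> 0 <= P r"
  show False
  proof (rule no_logarithmic_growth[where f="\<lambda>x. - f x" and P="\<lambda>x. - P x" and M=M and \<delta>="- P r", OF r(1)])
   show "DERIV (\<lambda>x. - f x) x :> - P x / x" if "0 < x" "x <= r" for x
    using DERIV_minus[OF df[of x]] that r by simp
  qed (use n bf Pmono r in auto)
 qed
 have half: "f r <= 2 * P r" if r: "0 < r" "r <= r0" for r
 proof (rule ccontr)
  assume n: "\<not> f r <= 2 * P r"
  \<comment> \<open>E is nondecreasing because c >= 3/4 > 1/4. A negative value at r keeps f^2 >=
    -E(r) down to the origin, and then the flux P itself would grow logarithmically.\<close>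
  define E where "E x = 4 * (P x)^2 - (f x)^2" for x
  have Emono: "E s <= E t" if "0 < s" "s <= t" "t <= r0" for s t
  proof (rule mono[OF that, of E "\<lambda>x. 2 * (P x / x) * f x * (4 * c x - 1)"])
   fix x assume x: "0 < x" "x <= r0"
   have "DERIV E x :> 4 * (2 * P x * (c x * f x / x)) - 2 * f x * (P x / x)"
    unfolding E_def using DERIV_diff[OF DERIV_cmult[OF DERIV_power[OF dP[OF x], of 2], of 4] DERIV_power[OF df[OF x], of 2]]
    by (simp add: mult_ac)
   moreover have "4 * (2 * P x * (c x * f x / x)) - 2 * f x * (P x / x) = 2 * (P x / x) * f x * (4 * c x - 1)" by (simp add: algebra_simps diff_divide_distrib)
   ultimately show "DERIV E x :> 2 * (P x / x) * f x * (4 * c x - 1) \<and> 0 <= 2 * (P x / x) * f x * (4 * c x - 1)"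
    using Ppos[OF x] f[OF x] c[OF x] x by simp
  qed
  have "(2 * P r)^2 < (f r)^2" using n Ppos[OF r] by (intro power_strict_mono) auto
  then have e: "0 < - E r" by (simp add: E_def power_mult_distrib)
  show False
  proof (rule no_logarithmic_growth[where f=P and P="\<lambda>x. c x * f x" and M="P r" and \<delta>="3/4 * sqrt (- E r)", OF r(1)])
   fix x assume x: "0 < x" "x <= r"
   then have x0: "x <= r0" using r by simp
   show "DERIV P x :> c x * f x / x" by (rule dP[OF x(1) x0])
   show "\<bar>P x\<bar> <= P r" using Ppos[OF x(1) x0] Pmono[OF x r(2)] by simp
   have "- E r <= (f x)^2" using Emono[OF x r(2)] zero_le_power2[of "P x"] unfolding E_def by linarith
   then have "sqrt (- E r) <= f x" using f[OF x(1) x0] by (simp add: real_le_lsqrt)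
   then show "3/4 * sqrt (- E r) <= c x * f x" using c[OF x(1) x0] e by (intro mult_mono) auto
  qed (use e in simp)
 qed
 \<comment> \<open>The inequality f <= 2P is the sign of the derivative of f^2/r.\<close>
 have "(f r)^2 / r <= (f r0)^2 / r0"
 proof (rule mono[OF r order_refl, of "\<lambda>x. (f x)^2 / x" "\<lambda>x. f x * (2 * P x - f x) / x^2"])
  fix x assume x: "0 < x" "x <= r0"
  have "DERIV (\<lambda>x. (f x)^2 / x) x :> (2 * f x * (P x / x) * x - (f x)^2 * 1) / (x * x)"
   using DERIV_divide[OF DERIV_power[OF df[OF x], of 2] DERIV_ident, of] x by (simp add: mult_ac)
  moreover have "(2 * f x * (P x / x) * x - (f x)^2 * 1) / (x * x) = f x * (2 * P x - f x) / x^2"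
   using x by (simp add: power2_eq_square algebra_simps)
  ultimately show "DERIV (\<lambda>x. (f x)^2 / x) x :> f x * (2 * P x - f x) / x^2 \<and> 0 <= f x * (2 * P x - f x) / x^2"
   using half[OF x] f[OF x] by simp
 qed
 also have "... <= M^2 / r0" using f[OF r0 order_refl] r0 by (intro divide_right_mono power_mono) auto
 finally show "(f r)^2 <= M^2 / r0 * r" using r by (simp add: pos_divide_le_eq)
 show "(r * f' r)^2 <= Q * (f r)^2"
 proof (rule ccontr)
  define Y where "Y x = Q * (f x)^2 - (P x)^2" for x
  assume "\<not> (r * f' r)^2 <= Q * (f r)^2"
  then have e: "0 < - Y r" by (simp add: Y_def P_def)
  have Ymono: "Y s <= Y t" if "0 < s" "s <= t" "t <= r0" for s t
  proof (rule mono[OF that, of Y "\<lambda>x. 2 * (P x / x) * f x * (Q - c x)"])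
   fix x assume x: "0 < x" "x <= r0"
   have "DERIV Y x :> Q * (2 * f x * (P x / x)) - 2 * P x * (c x * f x / x)"
    unfolding Y_def using DERIV_diff[OF DERIV_cmult[OF DERIV_power[OF df[OF x], of 2], of Q] DERIV_power[OF dP[OF x], of 2]]
    by (simp add: mult_ac)
   moreover have "Q * (2 * f x * (P x / x)) - 2 * P x * (c x * f x / x) = 2 * (P x / x) * f x * (Q - c x)" by (simp add: algebra_simps diff_divide_distrib)
   ultimately show "DERIV Y x :> 2 * (P x / x) * f x * (Q - c x) \<and> 0 <= 2 * (P x / x) * f x * (Q - c x)"
    using Ppos[OF x] f[OF x] c[OF x] x by simp
  qed
  show False
  proof (rule no_logarithmic_growth[where f=f and P=P and M=M and \<delta>="sqrt (- Y r)", OF r(1)])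
   fix x assume x: "0 < x" "x <= r"
   then have x0: "x <= r0" using r by simp
   show "DERIV f x :> P x / x" "\<bar>f x\<bar> <= M" using df bf x x0 by auto
   have "0 <= Q * (f x)^2" using c[OF x(1) x0] by simp
   then have "- Y r <= (P x)^2" using Ymono[OF x r(2)] unfolding Y_def by linarith
   then show "sqrt (- Y r) <= P x" using Ppos[OF x(1) x0] by (simp add: real_le_lsqrt)
  qed (use e in simp)
 qed
qed

text \<open>Gronwall: f^2 + f'^2, damped by exp(-L r), cannot increase, and it starts at zero. In
  \<open>GLsol_nice\<close> this excludes zeros of f.\<close>

lemma linear_ode_zero:
 fixes f f' f'' c :: "real => real"
 assumes a: "0 < a" "a <= b" and d: "!!r. a <= r ==> r <= b ==> DERIV f r :> f' r"
  and d': "!!r. a <= r ==> r <= b ==> DERIV f' r :> f'' r"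
  and c: "continuous_on {a..b} c"
  and eq: "!!r. a <= r ==> r <= b ==> f'' r + f' r / r = c r * f r"
  and z: "f a = 0" "f' a = 0"
 shows "f b = 0"
proof -
 have "bounded (c ` {a..b})" using c by (intro compact_imp_bounded compact_continuous_image) auto
 then obtain K where K: "!!r. r \<in> {a..b} ==> \<bar>c r\<bar> <= K" unfolding bounded_real by blast
 define L where "L = 1 + K + 2 / a"
 define Y where "Y r = ((f r)^2 + (f' r)^2) * exp (- L * r)" for r
 have "Y b <= Y a"
 proof (rule DERIV_nonpos_imp_nonincreasing[where f=Y, OF a(2)])
  fix x assume x: "a <= x" "x <= b"
  have x0: "x > 0" using x a by simp
  have "DERIV Y x :> (2 * f x * f' x + 2 * f' x * f'' x) * exp (- L * x) + ((f x)^2 + (f' x)^2) * (exp (- L * x) * - L)"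
   unfolding Y_def by (auto intro!: derivative_eq_intros d[OF x] d'[OF x] simp: algebra_simps)
  moreover have "(2 * f x * f' x + 2 * f' x * f'' x) * exp (- L * x) + ((f x)^2 + (f' x)^2) * (exp (- L * x) * - L)
   = (2 * f x * f' x + 2 * f' x * f'' x - L * ((f x)^2 + (f' x)^2)) * exp (- L * x)" by (simp add: algebra_simps)
  moreover have "2 * f x * f' x + 2 * f' x * f'' x - L * ((f x)^2 + (f' x)^2) <= 0"
  proof -
   have f'': "f'' x = c x * f x - f' x / x" using eq[OF x] by simp
   have 1: "2 * f x * f' x <= (f x)^2 + (f' x)^2" using sum_squares_bound[of "f x" "f' x"] by simp
   have K0: "K >= 0" using K[of x] x by auto
   have "\<bar>c x * (2 * f x * f' x)\<bar> <= K * ((f x)^2 + (f' x)^2)"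
    unfolding abs_mult[of "c x"] using K[of x] x 1 sum_squares_bound[of "- f x" "f' x"] K0 by (intro mult_mono) (auto simp: abs_le_iff)
   then have 2: "c x * (2 * f x * f' x) <= K * ((f x)^2 + (f' x)^2)" by linarith
   have "(f' x)^2 / x >= 0" using x0 by simp
   moreover have "2 / a * ((f x)^2 + (f' x)^2) >= 0" using a by simp
   moreover have "2 * f' x * f'' x = c x * (2 * f x * f' x) - 2 * ((f' x)^2 / x)"
    by (simp add: f'' power2_eq_square algebra_simps)
   moreover have "L * ((f x)^2 + (f' x)^2) = ((f x)^2 + (f' x)^2) + K * ((f x)^2 + (f' x)^2) + 2 / a * ((f x)^2 + (f' x)^2)"
    by (simp only: L_def distrib_right mult_1)
   ultimately show ?thesis using 1 2 by linarith
  qed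
  ultimately show "\<exists>y. DERIV Y x :> y \<and> y <= 0" by (auto intro!: mult_nonpos_nonneg)
 qed
 then have "((f b)^2 + (f' b)^2) * exp (- L * b) <= 0" using z by (simp add: Y_def)
 then have "(f b)^2 + (f' b)^2 <= 0" by (simp add: mult_le_0_iff not_le[symmetric])
 then show ?thesis using sum_power2_le_zero_iff by blast
qed

text \<open>For C/r^2 the radial Laplacian is 4C/r^4, which for r^2 >= 8/c is at most half of c
  C/r^2. Thus C/r^2 plus a small constant is a supersolution even with a source of order
  r^(-2).\<close>

lemma inverse_square_decay:
 fixes z z' z'' :: "real => real"
 assumes R: "1 <= R" "8 / c <= R" and c: "0 < c" and A: "0 <= A"
  and d: "!!r. R <= r ==> DERIV z r :> z' r"
  and d': "!!r. R <= r ==> DERIV z' r :> z'' r"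
  and lim: "!!\<epsilon>. \<epsilon> > 0 ==> eventually (\<lambda>r. z r <= \<epsilon>) at_top"
  and ineq: "!!r. R <= r ==> z r > 0 ==> z'' r + z' r / r >= c * z r - A / r^2"
 obtains C where "C > 0" "!!r. R <= r ==> z r <= C / r^2"
proof -
 \<comment> \<open>C is positive, lets the source use at most a quarter of c C/r^2, and makes the
   barrier dominate z at R.\<close>
 define C where "C = max 1 (max (4 * A / c) (R^2 * z R))"
 have C: "C > 0" "4 * A / c <= C" "R^2 * z R <= C" by (auto simp: C_def)
 have main: "z r <= C / r^2 + \<epsilon>" if r: "R <= r" and e: "\<epsilon> > 0" for r \<epsilon>
 proof -
  obtain b where b: "b >= r" "z b <= \<epsilon>"
   using eventually_happens[OF eventually_conj[OF eventually_ge_at_top[of r] lim[OF e]]] by auto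
  have dB: "DERIV (\<lambda>x. C / x^2) x :> - (2 * C / x^3)" if "x > 0" for x
  proof -
   have "DERIV (\<lambda>x. C / x^2) x :> (0 * x^2 - C * (2 * x)) / (x^2 * x^2)"
    using that by (intro DERIV_divide) (auto intro!: derivative_eq_intros)
   moreover have "(0 * x^2 - C * (2 * x)) / (x^2 * x^2) = - (2 * C / x^3)"
    using that by (simp add: field_simps power2_eq_square power3_eq_cube)
   ultimately show ?thesis by simp
  qed
  have dB': "DERIV (\<lambda>x. - (2 * C / x^3)) x :> 6 * C / x^4" if "x > 0" for x
  proof -
   have "DERIV (\<lambda>x. - (2 * C / x^3)) x :> - ((0 * x^3 - (2 * C) * (3 * x^2)) / (x^3 * x^3))"
    using that by (intro DERIV_minus DERIV_divide) (auto intro!: derivative_eq_intros)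
   moreover have "- ((0 * x^3 - (2 * C) * (3 * x^2)) / (x^3 * x^3)) = 6 * C / x^4"
    using that by (simp add: field_simps power2_eq_square power3_eq_cube power4_eq_xxxx)
   ultimately show ?thesis by simp
  qed
  have "z r - C / r^2 - \<epsilon> <= 0"
  proof (rule max_principle_Icc[where w="\<lambda>r. z r - C / r^2 - \<epsilon>" and r=r and a=R and b=b and w'="\<lambda>x. z' x - - (2 * C / x^3) - 0" and w''="\<lambda>x. z'' x - 6 * C / x^4 - 0"])
   have "z R <= C / R^2" using C(3) R by (simp add: pos_le_divide_eq mult.commute)
   then show "z R - C / R^2 - \<epsilon> <= 0" using e by linarith
   have "0 <= C / b^2" using C by simp
   then show "z b - C / b^2 - \<epsilon> <= 0" using b by linarith
   fix x assume x: "R < x" "x < b" and w: "z x - C / x^2 - \<epsilon> > 0" "z' x - - (2 * C / x^3) - 0 = 0"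
   have x0: "x > 0" "1 <= x" using x R by auto
   have zx: "z x > C / x^2" using w e by simp
   have "0 < C / x^2" using C x0 by simp
   then have "z'' x >= c * z x - A / x^2 - z' x / x" using ineq[of x] zx x by simp
   moreover have "z' x / x = - (2 * C / x^4)" using w(2) x0 by (simp add: field_simps power3_eq_cube power4_eq_xxxx)
   moreover have "c * z x > c * (C / x^2)" using zx c by (rule mult_strict_left_mono)
   moreover have "A / x^2 <= (c * C / 4) / x^2" using C(2) c by (intro divide_right_mono) (auto simp: divide_le_eq mult.commute)
   moreover have "4 * C / x^4 <= (c * C / 2) / x^2"
   proof -
    have "8 / c <= x * x" using R x x0 mult_mono[of 1 x x x] by linarith
    then have "8 <= c * (x * x)" using c by (simp add: divide_le_eq mult.commute)
    then have "8 * C <= c * (x * x) * C" using C by (intro mult_right_mono) auto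
    then show ?thesis using x0 by (simp add: divide_simps power2_eq_square power4_eq_xxxx mult_ac)
   qed
   moreover have "(c * C / 4) / x^2 = (1/4) * (c * (C / x^2))" "(c * C / 2) / x^2 = (1/2) * (c * (C / x^2))" by simp_all
   moreover have "c * (C / x^2) > 0" using c C x0 by simp
   moreover have "6 * C / x^4 = 6 * (C / x^4)" "4 * C / x^4 = 4 * (C / x^4)" "2 * C / x^4 = 2 * (C / x^4)" by simp_all
   ultimately show "z'' x - 6 * C / x^4 - 0 > 0" by linarith
  next
   fix x assume "R <= x" "x <= b"
   then have x: "R <= x" "x > 0" using R by auto
   show "DERIV (\<lambda>r. z r - C / r^2 - \<epsilon>) x :> z' x - - (2 * C / x^3) - 0"
    by (rule DERIV_diff[OF DERIV_diff[OF d[OF x(1)] dB[OF x(2)]] DERIV_const])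
   have "DERIV (\<lambda>x. z' x - - (2 * C / x^3) - 0) x :> z'' x - 6 * C / x^4 - 0"
    by (rule DERIV_diff[OF DERIV_diff[OF d'[OF x(1)] dB'[OF x(2)]] DERIV_const])
   then show "DERIV (\<lambda>x. z' x - - (2 * C / x^3) - 0) x :> z'' x - 6 * C / x^4 - 0" .
  qed (use r b in auto)
  then show ?thesis by simp
 qed
 have "z r <= C / r^2" if "R <= r" for r by (rule field_le_epsilon, rule main[OF that])
 then show ?thesis by (rule that[OF C(1)])
qed

text \<open>D stands for d^2. The derivatives are explicit functions, so that limits of the
  iteration fit without \<open>deriv\<close>; only r > 0 is involved.\<close>

definition GLsol :: "real => real => (real => real) => (real => real) => (real => real) =>
  (real => real) => (real => real) => (real => real) => bool" where
 "GLsol D g f f' f'' m m' m'' \<longleftrightarrow> (\<forall>r>0. DERIV f r :> f' r \<and> DERIV f' r :> f'' r \<and>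
   DERIV m r :> m' r \<and> DERIV m' r :> m'' r \<and>
   f'' r + f' r / r = (D / r^2 - (1 - (f r)^2 - (m r)^2)) * f r \<and>
   m'' r + m' r / r = (g - (1 - (f r)^2 - (m r)^2)) * m r \<and> 0 <= f r \<and> 0 <= m r)"

lemma GLsolD:
 assumes "GLsol D g f f' f'' m m' m''" "0 < r"
 shows "DERIV f r :> f' r" "DERIV f' r :> f'' r"
  "DERIV m r :> m' r" "DERIV m' r :> m'' r"
  "f'' r + f' r / r = (D / r^2 - (1 - (f r)^2 - (m r)^2)) * f r"
  "m'' r + m' r / r = (g - (1 - (f r)^2 - (m r)^2)) * m r" "0 <= f r" "0 <= m r"
 using assms by (auto simp: GLsol_def)

lemma GLsol_cont:
 assumes "GLsol D g f f' f'' m m' m''"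
 shows "continuous_on {0<..} f" "continuous_on {0<..} f'" "continuous_on {0<..} m" "continuous_on {0<..} m'"
  "continuous_on {0<..} f''" "continuous_on {0<..} m''"
proof -
 note G = GLsolD[OF assms]
 show c: "continuous_on {0<..} f" "continuous_on {0<..} f'" "continuous_on {0<..} m" "continuous_on {0<..} m'"
  using G(1-4) by (auto intro!: continuous_at_imp_continuous_on DERIV_isCont)
 have "continuous_on {0<..} (\<lambda>r. (D / r^2 - (1 - (f r)^2 - (m r)^2)) * f r - f' r / r)"
  by (intro continuous_intros c) auto
 then show "continuous_on {0<..} f''" by (rule continuous_on_eq) (use G(5) in \<open>simp add: algebra_simps\<close>)
 have "continuous_on {0<..} (\<lambda>r. (g - (1 - (f r)^2 - (m r)^2)) * m r - m' r / r)"
  by (intro continuous_intros c) auto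
 then show "continuous_on {0<..} m''" by (rule continuous_on_eq) (use G(6) in \<open>simp add: algebra_simps\<close>)
qed

text \<open>The global bounds make energies and quadratic forms integrable. The eventual clauses
  control r f'/f and m' at the origin, and r f'/f and m at infinity, as the boundary terms of
  Picone's identity demand. One constant serves all clauses.\<close>

definition nice :: "real => real => (real => real) => (real => real) => (real => real) =>
  (real => real) => (real => real) => (real => real) => bool" where
 "nice D g f f' f'' m m' m'' \<longleftrightarrow> GLsol D g f f' f'' m m' m'' \<and> (\<forall>r>0. 0 < f r \<and> f r <= 1) \<and>
   (\<exists>C>0. (\<forall>r>0. (f r)^2 <= C * r \<and> (f' r)^2 * r <= C / (1 + r^2) \<and> (m r)^2 * r <= C / (1 + r^2) \<and>
    (m' r)^2 * r <= C / (1 + r^2) \<and> 1 - (f r)^2 <= C / (1 + r^2) \<and> (m r)^2 <= C) \<and>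
   (\<forall>\<^sub>F r in at_right 0. \<bar>r * f' r\<bar> <= C * f r \<and> \<bar>m' r\<bar> <= C * r) \<and>
   (\<forall>\<^sub>F r in at_top. \<bar>r * f' r\<bar> <= C * r * f r \<and> m r <= C / r^2))"

text \<open>Only boundedness near 0 and the limits at infinity are put in. Near 0, f obeys the
  estimates for the singular potential and m those for the regular one; at infinity barriers apply
  to m and 1 - f. \<open>bounded_from_ends\<close> fills the middle by compactness.\<close>

lemma GLsol_nice:
 assumes G: "GLsol D g f f' f'' m m' m''" and D: "1 <= D" and g: "0 < g"
  and r1: "0 < r1" and M: "!!r. 0 < r ==> r <= r1 ==> f r <= M \<and> m r <= M"
  and limf: "(f \<longlongrightarrow> 1) at_top" and limm: "(m \<longlongrightarrow> 0) at_top"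
 shows "nice D g f f' f'' m m' m''"
proof -
 note d = GLsolD[OF G] and c = GLsol_cont[OF G]
 \<comment> \<open>The bound 1/2 keeps r^2 <= 1/4, hence the coefficient \<open>cf\<close> at least
   3/4 as \<open>singular_profile_near_zero\<close> requires.\<close>
 define r0 where "r0 = min r1 (1/2)"
 have r0: "0 < r0" "r0 <= 1/2" "r0 <= r1" using r1 by (auto simp: r0_def)
 have M0: "0 <= M" using M[OF r1] d(7)[OF r1] by linarith
 define Q where "Q = D + M^2"
 define cf where "cf r = D - r^2 * (1 - (f r)^2 - (m r)^2)" for r
 have bnd: "(f r)^2 <= M^2" "(m r)^2 <= M^2" "0 <= f r" "f r <= M" if "0 < r" "r <= r0" for r
  using M[of r] d(7,8)[of r] that r0 by (auto intro!: power_mono)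
 have r4: "r^2 <= 1/4" if "0 < r" "r <= r0" for r :: real
  using power_mono[of r "1/2" 2] that r0 by (simp add: power_divide)
 have cfb: "3/4 <= cf r \<and> cf r <= Q" if r: "0 < r" "r <= r0" for r
 proof -
  have "(f r)^2 + (m r)^2 <= M^2 + M^2" using bnd(1,2)[OF r] by (rule add_mono)
  then have "r^2 * ((f r)^2 + (m r)^2) <= (1/4) * (M^2 + M^2)"
   using r4[OF r] by (intro mult_mono) auto
  moreover have "(1/4) * (M^2 + M^2) <= M^2" by simp
  moreover have "0 <= r^2 * ((f r)^2 + (m r)^2)" by simp
  moreover have "cf r = D - r^2 + r^2 * ((f r)^2 + (m r)^2)" by (simp add: cf_def algebra_simps)
  ultimately show ?thesis unfolding Q_def using r4[OF r] D zero_le_power2[of r] by (intro conjI; linarith)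
 qed
 have Qp: "Q > 0" using D by (simp add: Q_def add_pos_nonneg)
 have cfe: "f'' r + f' r / r = cf r / r^2 * f r" if "0 < r" for r
  using d(5)[OF that] that by (simp add: cf_def field_simps)
 have fz: "(f r)^2 <= M^2 / r0 * r" "(r * f' r)^2 <= Q * (f r)^2" if r: "0 < r" "r <= r0" for r
  by (rule singular_profile_near_zero[where f=f and f'=f' and f''=f'' and c=cf and M=M and Q=Q and ?r0.0=r0];
    use r0 d bnd cfb cfe r in auto)+
 define Cm where "Cm = (g + 1 + 2 * M^2) * M"
 have Cm0: "0 <= Cm" using g M0 by (simp add: Cm_def)
 have mz: "\<bar>m' r\<bar> <= Cm * r" if r: "0 < r" "r <= r0" for r
 proof (rule regular_derivative_near_zero[where u=m and u'=m' and u''=m'' and ?r0.0=r0 and M=M])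
  show "\<bar>m'' x + m' x / x\<bar> <= Cm" if "0 < x" "x <= r0" for x
  proof -
   have "\<bar>g - (1 - (f x)^2 - (m x)^2)\<bar> <= g + 1 + 2 * M^2"
    using bnd[OF that] g zero_le_power2[of "f x"] zero_le_power2[of "m x"] by linarith
   then show ?thesis unfolding d(6)[OF that(1)] Cm_def abs_mult
    using M[of x] d(8)[of x] that r0 by (intro mult_mono) auto
  qed
 qed (use d M r r0 in \<open>auto simp: abs_le_iff intro: order_trans[of _ 0]\<close>)
 have f1: "f r <= 1" if r: "0 < r" for r
 proof (rule field_le_epsilon)
  fix e :: real assume e: "e > 0"
  have "eventually (\<lambda>r. f r < 1 + e) at_top" using order_tendstoD(2)[OF limf] e by simp
  then obtain b where b: "b >= r" "f b < 1 + e"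
   using eventually_happens[OF eventually_conj[OF eventually_ge_at_top[of r]]] by force
  \<comment> \<open>So small that f(a)^2 <= M^2 a/r0 <= 1, which is the left boundary value for the
    maximum principle.\<close>
  define a where "a = min r (min r0 (r0 / (M^2 + 1)))"
  have pos: "0 < r0 / (M^2 + 1)" using r0 by (intro divide_pos_pos) (auto simp: add_nonneg_pos)
  have a: "0 < a" "a <= r" "a <= r0" using r r0 pos by (auto simp: a_def)
  have m2: "0 < M^2 + 1" by (simp add: add_nonneg_pos)
  have "a <= r0 / (M^2 + 1)" by (simp add: a_def)
  then have "a * (M^2 + 1) <= r0" using m2 by (simp add: le_divide_eq)
  then have "M^2 * a <= r0" using a by (simp add: algebra_simps)
  then have "M^2 / r0 * a <= 1" using r0 by (simp add: divide_le_eq)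
  then have "(f a)^2 <= 1" using fz(1)[OF a(1,3)] by linarith
  then have fa: "f a <= 1" using power2_le_imp_le[of "f a" 1] by simp
  have "f r - (1 + e) <= 0"
  proof (rule max_principle_Icc[where w="\<lambda>r. f r - (1 + e)" and r=r and a=a and b=b and w'="\<lambda>r. f' r - 0" and w''="\<lambda>r. f'' r - 0"])
   fix x assume x: "a < x" "x < b" and w: "0 < f x - (1 + e)" "f' x - 0 = 0"
   have x0: "x > 0" using x a by simp
   have "1 < f x" using w e by simp
   then have "1 < (f x)^2" by (simp add: one_less_power)
   moreover have "0 <= (m x)^2" "0 < D / x^2" using D x0 by auto
   ultimately have "0 < D / x^2 - (1 - (f x)^2 - (m x)^2)" by linarith
   then have "0 < (D / x^2 - (1 - (f x)^2 - (m x)^2)) * f x" using \<open>1 < f x\<close> by (intro mult_pos_pos) auto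
   then show "0 < f'' x - 0" using d(5)[OF x0] w by simp
  next
   fix x assume "a <= x" then have x: "x > 0" using a by simp
   show "DERIV (\<lambda>r. f r - (1 + e)) x :> f' x - 0" "DERIV (\<lambda>r. f' r - 0) x :> f'' x - 0"
    by (rule DERIV_diff[OF d(1)[OF x] DERIV_const] DERIV_diff[OF d(2)[OF x] DERIV_const])+
  qed (use fa b e a in auto)
  then show "f r <= 1 + e" by simp
 qed
 \<comment> \<open>A zero would be a minimum, so f' vanishes there too; then f is zero from that
   radius on, against the limit 1.\<close>
 have fpos: "0 < f r" if r: "0 < r" for r
 proof (rule ccontr)
  assume "\<not> 0 < f r"
  then have z: "f r = 0" using d(7)[OF r] by simp
  have "f' r = 0"
   by (rule DERIV_local_min[OF d(1)[OF r], of r]) (use r d(7) z in \<open>auto simp: abs_less_iff\<close>)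
  have "f b = 0" if "r <= b" for b
   by (rule linear_ode_zero[where a=r and f=f and f'=f' and f''=f'' and c="\<lambda>r. D / r^2 - (1 - (f r)^2 - (m r)^2)"])
    (use r that d z \<open>f' r = 0\<close> in \<open>auto intro!: continuous_intros continuous_on_subset[OF c(1)] continuous_on_subset[OF c(3)]\<close>)
  then have "eventually (\<lambda>b. f b = 0) at_top" by (rule eventually_mono[OF eventually_ge_at_top[of r]])
  then have "(f \<longlongrightarrow> 0) at_top" by (rule tendsto_eventually)
  then show False using limf tendsto_unique[of at_top f 0 1] by simp
 qed
 \<comment> \<open>The bound f > 1 - g/8 leaves at least g/2 in the equation for m, and f > 9/10
   gives (1 + f) f >= 1 in the equation for 1 - f.\<close>
 have "eventually (\<lambda>r. f r > max (9/10) (1 - g/8) \<and> m r < 1) at_top"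
  using order_tendstoD(1)[OF limf, of "max (9/10) (1 - g/8)"] order_tendstoD(2)[OF limm, of 1] g by (intro eventually_conj) auto
 then obtain Ra where Ra: "!!r. Ra <= r ==> f r > 9/10 \<and> f r > 1 - g/8 \<and> m r < 1"
  unfolding eventually_at_top_linorder by auto
 define R where "R = max (max 1 Ra) (max (8 / (g/2)) (8 / 1))"
 have R: "1 <= R" "8 / (g/2) <= R" "8 / 1 <= R" "Ra <= R" by (auto simp: R_def)
 have Rp: "0 < r" "1 <= r" if "R <= r" for r using R(1) that by auto
 have s1: "g / 2 <= g - (1 - (f r)^2 - (m r)^2)" if r: "R <= r" for r
 proof -
  have "1 - (f r)^2 = (1 - f r) * (1 + f r)" by (simp add: power2_eq_square algebra_simps)
  also have "... <= (g/8) * 2" using Ra[of r] R r f1[OF Rp(1)[OF r]] g by (intro mult_mono) auto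
  finally show ?thesis using zero_le_power2[of "m r"] g by linarith
 qed
 obtain C1 where C1: "C1 > 0" "!!r. R <= r ==> m r <= C1 / r^2"
 proof (rule inverse_square_decay[where z=m and z'=m' and z''=m'' and c="g/2" and A=0 and R=R])
  show "eventually (\<lambda>r. m r <= \<epsilon>) at_top" if "\<epsilon> > 0" for \<epsilon>
   using order_tendstoD(2)[OF limm that] by (rule eventually_mono) simp
  show "g / 2 * m r - 0 / r^2 <= m'' r + m' r / r" if "R <= r" "0 < m r" for r
   unfolding d(6)[OF Rp(1)[OF that(1)]] using s1[OF that(1)] that by (simp add: mult_right_mono)
 qed (use R g d Rp that in auto)
 have m2: "(m r)^2 <= C1 / r^2" if "R <= r" for r
 proof -
  have "(m r)^2 <= m r * 1" unfolding power2_eq_square using Ra[of r] R that d(8)[OF Rp(1)[OF that]] by (intro mult_left_mono) auto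
  then show ?thesis using C1(2)[OF that] by linarith
 qed
 \<comment> \<open>The equation for 1 - f: a linear term with coefficient (1 + f) f, and sources of
   order r^(-2) once m^2 is known to decay.\<close>
 have zeq: "- f'' r + - f' r / r = (1 - f r) * ((1 + f r) * f r) - (m r)^2 * f r - D / r^2 * f r" if "0 < r" for r
  using d(5)[OF that] by (simp add: power2_eq_square algebra_simps)
 obtain C2 where C2: "C2 > 0" "!!r. R <= r ==> 1 - f r <= C2 / r^2"
 proof (rule inverse_square_decay[where z="\<lambda>r. 1 - f r" and z'="\<lambda>r. - f' r" and z''="\<lambda>r. - f'' r" and c=1 and A="C1 + D" and R=R])
  show "eventually (\<lambda>r. 1 - f r <= \<epsilon>) at_top" if "\<epsilon> > 0" for \<epsilon>
  proof -
   have "eventually (\<lambda>r. 1 - \<epsilon> < f r) at_top" using order_tendstoD(1)[OF limf] that by simp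
   then show ?thesis by (rule eventually_mono) simp
  qed
  show "1 * (1 - f r) - (C1 + D) / r^2 <= - f'' r + - f' r / r" if r: "R <= r" "0 < 1 - f r" for r
  proof -
   have fr: "9/10 < f r" "f r <= 1" using Ra[of r] R r f1[OF Rp(1)[OF r(1)]] by auto
   have "1 <= (19/10) * (9/10::real)" by simp
   also have "... <= (1 + f r) * f r" using fr by (intro mult_mono) auto
   finally have "(1 - f r) * 1 <= (1 - f r) * ((1 + f r) * f r)" using r by (intro mult_left_mono) auto
   moreover have "(m r)^2 * f r <= C1 / r^2 * 1" using m2[OF r(1)] fr C1(1) by (intro mult_mono) auto
   moreover have "D / r^2 * f r <= D / r^2 * 1" using fr D by (intro mult_left_mono) auto
   ultimately show ?thesis unfolding zeq[OF Rp(1)[OF r(1)]] by (simp add: add_divide_distrib)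
  qed
  show "DERIV (\<lambda>r. 1 - f r) r :> - f' r" "DERIV (\<lambda>r. - f' r) r :> - f'' r" if "R <= r" for r
   using DERIV_diff[OF DERIV_const[of 1] d(1)[OF Rp(1)[OF that]]] DERIV_minus[OF d(2)[OF Rp(1)[OF that]]] by simp_all
 qed (use R C1 D that in auto)
 define E1 where "E1 = (g + 2) * C1"
 have E1: "C1 <= E1" unfolding E1_def using C1 g mult_right_mono[of 1 "g + 2" C1] by simp
 have md: "\<bar>m r\<bar> <= E1 / r^2" "\<bar>m'' r + m' r / r\<bar> <= E1 / r^2" if r: "R <= r" for r
 proof -
  have m0: "0 <= m r" "m r < 1" "f r <= 1" "0 <= f r" using d(7,8)[OF Rp(1)[OF r]] Ra[of r] R r f1[OF Rp(1)[OF r]] by auto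
  have "C1 / r^2 <= E1 / r^2" using E1 by (intro divide_right_mono) auto
  then show "\<bar>m r\<bar> <= E1 / r^2" using C1(2)[OF r] m0 by linarith
  have "(f r)^2 <= 1" "(m r)^2 <= 1" using m0 by (auto intro!: power_le_one)
  then have "\<bar>g - (1 - (f r)^2 - (m r)^2)\<bar> <= g + 2"
   using g zero_le_power2[of "f r"] zero_le_power2[of "m r"] by linarith
  then have "\<bar>(g - (1 - (f r)^2 - (m r)^2)) * m r\<bar> <= (g + 2) * (C1 / r^2)"
   unfolding abs_mult using C1(2)[OF r] m0 g by (intro mult_mono) auto
  then show "\<bar>m'' r + m' r / r\<bar> <= E1 / r^2" unfolding d(6)[OF Rp(1)[OF r]] E1_def by simp
 qed
 obtain K1 where K1: "K1 >= 0" "!!r. R <= r ==> \<bar>m' r\<bar> <= K1 / (r * sqrt r)"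
  by (rule derivative_decay[where u=m and u'=m' and u''=m'' and R=R and C=E1]) (use R d Rp md in auto)
 define E2 where "E2 = 2 * C2 + C1 + D"
 have abs_bound: "\<bar>a - b - c\<bar> <= e" if "a <= x * 2" "0 <= a" "b <= y * 1" "c <= z * 1" "0 <= b" "0 <= c"
  "e = x * 2 + y * 1 + z * 1" "0 < x" "0 < y" "0 < z" for a b c x y z e :: real
  using that by linarith
 have fd: "\<bar>1 - f r\<bar> <= E2 / r^2" "\<bar>- f'' r + - f' r / r\<bar> <= E2 / r^2" if r: "R <= r" for r
 proof -
  have f0: "f r <= 1" "0 <= f r" using d(7)[OF Rp(1)[OF r]] f1[OF Rp(1)[OF r]] by auto
  have "C2 / r^2 <= E2 / r^2" using C1 C2 D by (intro divide_right_mono) (auto simp: E2_def)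
  then show "\<bar>1 - f r\<bar> <= E2 / r^2" using C2(2)[OF r] f0 by linarith
  have "(1 + f r) * f r <= 2 * 1" using f0 by (intro mult_mono) auto
  then have "(1 - f r) * ((1 + f r) * f r) <= C2 / r^2 * 2" using f0 C2(2)[OF r] C2(1) by (intro mult_mono) auto
  moreover have "0 <= (1 - f r) * ((1 + f r) * f r)" using f0 by simp
  moreover have "(m r)^2 * f r <= C1 / r^2 * 1" using m2[OF r] f0 C1 by (intro mult_mono) auto
  moreover have "D / r^2 * f r <= D / r^2 * 1" using f0 D by (intro mult_left_mono) auto
  moreover have "0 <= (m r)^2 * f r" "0 <= D / r^2 * f r" using f0 D by auto
  moreover have "E2 / r^2 = C2 / r^2 * 2 + C1 / r^2 * 1 + D / r^2 * 1" by (simp add: E2_def add_divide_distrib)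
  moreover have "0 < C2 / r^2" "0 < C1 / r^2" "0 < D / r^2" using C1 C2 D Rp[OF r] by auto
  ultimately show "\<bar>- f'' r + - f' r / r\<bar> <= E2 / r^2" unfolding zeq[OF Rp(1)[OF r]] by (rule abs_bound)
 qed
 obtain K2 where K2: "K2 >= 0" "!!r. R <= r ==> \<bar>- f' r\<bar> <= K2 / (r * sqrt r)"
 proof (rule derivative_decay[where u="\<lambda>r. 1 - f r" and u'="\<lambda>r. - f' r" and u''="\<lambda>r. - f'' r" and R=R and C=E2])
  show "DERIV (\<lambda>r. 1 - f r) r :> - f' r" "DERIV (\<lambda>r. - f' r) r :> - f'' r" if "R <= r" for r
   using DERIV_diff[OF DERIV_const[of 1] d(1)[OF Rp(1)[OF that]]] DERIV_minus[OF d(2)[OF Rp(1)[OF that]]] by simp_all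
 qed (use R fd that in auto)
 have ev0: "eventually (\<lambda>r. 0 < r \<and> r <= r0) (at_right 0)"
  using r0 unfolding eventually_at_right_field by (auto intro!: exI[of _ r0])
 have evi: "eventually (\<lambda>r. R <= r) at_top" by (rule eventually_ge_at_top)
 have r2a: "1 + r^2 <= 2" if "0 < r" "r <= r0" for r using r4[OF that] by simp
 have r2b: "1 + r^2 <= 2 * r^2" if "R <= r" for r using Rp[OF that] by (simp add: one_le_power)
 have dsq: "(u' r)^2 * r * (1 + r^2) <= 2 * K^2" if r: "R <= r" and u: "\<bar>u' r\<bar> <= K / (r * sqrt r)" for u' r K
 proof -
  have p: "0 < r * sqrt r" using Rp[OF r] by simp
  have "\<bar>u' r\<bar> * (r * sqrt r) <= K" using u p by (simp add: le_divide_eq)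
  then have "(\<bar>u' r\<bar> * (r * sqrt r))^2 <= K^2" using p by (intro power_mono) auto
  then have "(u' r)^2 * (r * r^2) <= K^2" using Rp[OF r] by (simp add: power_mult_distrib mult.commute)
  moreover have "(u' r)^2 * r * (1 + r^2) <= (u' r)^2 * r * (2 * r^2)" using r2b[OF r] Rp[OF r] by (intro mult_left_mono) auto
  ultimately show ?thesis by (simp add: mult_ac)
 qed
 have A1: "\<exists>C>0. \<forall>r>0. (f r)^2 / r <= C"
 proof (rule bounded_from_ends)
  show "continuous_on {0<..} (\<lambda>r. (f r)^2 / r)" by (intro continuous_intros c) auto
  show "eventually (\<lambda>r. (f r)^2 / r <= M^2 / r0) (at_right 0)"
   using ev0 by eventually_elim (use fz in \<open>simp add: divide_le_eq\<close>)
  show "eventually (\<lambda>r. (f r)^2 / r <= 1) at_top"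
   using evi
  proof eventually_elim
   case (elim r)
   have "(f r)^2 <= 1" using f1[OF Rp(1)[OF elim]] d(7)[OF Rp(1)[OF elim]] by (auto intro!: power_le_one)
   then show ?case using Rp[OF elim] by (simp add: divide_le_eq)
  qed
 qed
 have A2: "\<exists>C>0. \<forall>r>0. (f' r)^2 * r * (1 + r^2) <= C"
 proof (rule bounded_from_ends)
  show "continuous_on {0<..} (\<lambda>r. (f' r)^2 * r * (1 + r^2))" by (intro continuous_intros c)
  show "eventually (\<lambda>r. (f' r)^2 * r * (1 + r^2) <= Q * (M^2 / r0) * 2) (at_right 0)"
   using ev0
  proof eventually_elim
   case (elim r)
   have "(r * f' r)^2 <= Q * (M^2 / r0 * r)" using fz[of r] elim Qp by (meson mult_left_mono order_trans less_imp_le)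
   then have "r * ((f' r)^2 * r) <= r * (Q * (M^2 / r0))" by (simp add: power_mult_distrib power2_eq_square mult_ac)
   then have "(f' r)^2 * r <= Q * (M^2 / r0)" by (rule mult_left_le_imp_le) (use elim in simp)
   then show ?case using mult_mono[of "(f' r)^2 * r" "Q * (M^2 / r0)" "1 + r^2" 2] elim r2a[of r] Qp r0 by auto
  qed
  show "eventually (\<lambda>r. (f' r)^2 * r * (1 + r^2) <= 2 * K2^2) at_top"
   using evi by eventually_elim (rule dsq, use K2 in auto)
 qed
 have A3: "\<exists>C>0. \<forall>r>0. (m r)^2 * r * (1 + r^2) <= C"
 proof (rule bounded_from_ends)
  show "continuous_on {0<..} (\<lambda>r. (m r)^2 * r * (1 + r^2))" by (intro continuous_intros c)
  show "eventually (\<lambda>r. (m r)^2 * r * (1 + r^2) <= M^2 * 1 * 2) (at_right 0)"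
   using ev0
  proof eventually_elim
   case (elim r) then show ?case using bnd(2)[of r] r2a[of r] r0 by (intro mult_mono) auto
  qed
  show "eventually (\<lambda>r. (m r)^2 * r * (1 + r^2) <= 2 * C1^2) at_top"
   using evi
  proof eventually_elim
   case (elim r)
   note r = Rp[OF elim]
   have "m r * r^2 <= C1" using C1(2)[OF elim] r by (simp add: le_divide_eq)
   then have "(m r * r^2)^2 <= C1^2" using d(8)[OF r(1)] by (intro power_mono) auto
   have "(m r)^2 * r * (1 + r^2) <= (m r)^2 * r^2 * (2 * r^2)"
    using r2b[OF elim] r by (intro mult_mono mult_left_mono) (auto simp: power2_eq_square)
   also have "... = 2 * (m r * r^2)^2" by (simp add: power_mult_distrib power2_eq_square)
   finally show ?case using \<open>(m r * r^2)^2 <= C1^2\<close> by linarith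
  qed
 qed
 have A4: "\<exists>C>0. \<forall>r>0. (m' r)^2 * r * (1 + r^2) <= C"
 proof (rule bounded_from_ends)
  show "continuous_on {0<..} (\<lambda>r. (m' r)^2 * r * (1 + r^2))" by (intro continuous_intros c)
  show "eventually (\<lambda>r. (m' r)^2 * r * (1 + r^2) <= Cm^2 * 1 * 2) (at_right 0)"
   using ev0
  proof eventually_elim
   case (elim r)
   have "Cm * r <= Cm * 1" using elim r0 Cm0 by (intro mult_left_mono) auto
   then have "\<bar>m' r\<bar> <= Cm" using mz[of r] elim by simp
   then have "(m' r)^2 <= Cm^2" using power_mono[of "\<bar>m' r\<bar>" Cm 2] by simp
   then show ?case using r2a[of r] r0 elim by (intro mult_mono) auto
  qed
  show "eventually (\<lambda>r. (m' r)^2 * r * (1 + r^2) <= 2 * K1^2) at_top"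
   using evi by eventually_elim (rule dsq, use K1 in auto)
 qed
 have A5: "\<exists>C>0. \<forall>r>0. (1 - (f r)^2) * (1 + r^2) <= C"
 proof (rule bounded_from_ends)
  show "continuous_on {0<..} (\<lambda>r. (1 - (f r)^2) * (1 + r^2))" by (intro continuous_intros c)
  show "eventually (\<lambda>r. (1 - (f r)^2) * (1 + r^2) <= 1 * 2) (at_right 0)"
   using ev0
  proof eventually_elim
   case (elim r) then show ?case using r2a[of r] by (intro mult_mono) auto
  qed
  show "eventually (\<lambda>r. (1 - (f r)^2) * (1 + r^2) <= 4 * C2) at_top"
   using evi
  proof eventually_elim
   case (elim r)
   note r = Rp[OF elim]
   have f0: "f r <= 1" "0 <= f r" using d(7)[OF r(1)] f1[OF r(1)] by auto
   have "1 - (f r)^2 = (1 - f r) * (1 + f r)" by (simp add: power2_eq_square algebra_simps)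
   also have "... <= C2 / r^2 * 2" using f0 C2(2)[OF elim] C2(1) by (intro mult_mono) auto
   finally have "(1 - (f r)^2) * (1 + r^2) <= (C2 / r^2 * 2) * (2 * r^2)"
    using r2b[OF elim] C2(1) by (intro mult_mono) auto
   then show ?case using r by simp
  qed
 qed
 have A6: "\<exists>C>0. \<forall>r>0. (m r)^2 <= C"
 proof (rule bounded_from_ends)
  show "continuous_on {0<..} (\<lambda>r. (m r)^2)" by (intro continuous_intros c)
  show "eventually (\<lambda>r. (m r)^2 <= M^2) (at_right 0)" using ev0 by eventually_elim (use bnd in auto)
  show "eventually (\<lambda>r. (m r)^2 <= 1) at_top"
   using evi
  proof eventually_elim
   case (elim r)
   then show ?case using d(8)[OF Rp(1)[OF elim]] Ra[of r] R by (auto intro!: power_le_one)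
  qed
 qed
 from A1 obtain B1 where B1: "B1 > 0" "!!r. r > 0 ==> (f r)^2 / r <= B1" by blast
 from A2 obtain B2 where B2: "B2 > 0" "!!r. r > 0 ==> (f' r)^2 * r * (1 + r^2) <= B2" by blast
 from A3 obtain B3 where B3: "B3 > 0" "!!r. r > 0 ==> (m r)^2 * r * (1 + r^2) <= B3" by blast
 from A4 obtain B4 where B4: "B4 > 0" "!!r. r > 0 ==> (m' r)^2 * r * (1 + r^2) <= B4" by blast
 from A5 obtain B5 where B5: "B5 > 0" "!!r. r > 0 ==> (1 - (f r)^2) * (1 + r^2) <= B5" by blast
 from A6 obtain B6 where B6: "B6 > 0" "!!r. r > 0 ==> (m r)^2 <= B6" by blast
 note B = B1(1) B2(1) B3(1) B4(1) B5(1) B6(1) B1(2) B2(2) B3(2) B4(2) B5(2) B6(2)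
 define C where "C = B1 + B2 + B3 + B4 + B5 + B6 + (Q + 1) + Cm + 2 * K2 + C1"
 have Cge: "C > 0" "B1 <= C" "B2 <= C" "B3 <= C" "B4 <= C" "B5 <= C" "B6 <= C" "Q + 1 <= C" "Cm <= C" "2 * K2 <= C" "C1 <= C"
  unfolding C_def using B(1-6) Qp Cm0 K2(1) C1(1) by linarith+
 have p1: "1 + r^2 > 0" for r :: real by (simp add: add_pos_nonneg)
 have all: "(f r)^2 <= C * r \<and> (f' r)^2 * r <= C / (1 + r^2) \<and> (m r)^2 * r <= C / (1 + r^2) \<and>
    (m' r)^2 * r <= C / (1 + r^2) \<and> 1 - (f r)^2 <= C / (1 + r^2) \<and> (m r)^2 <= C" if r: "0 < r" for r
 proof -
  have "(f r)^2 / r <= C" using B(7)[OF r] Cge by linarith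
  then have "(f r)^2 <= C * r" using r by (simp add: divide_le_eq)
  moreover have "(f' r)^2 * r * (1 + r^2) <= C" "(m r)^2 * r * (1 + r^2) <= C" "(m' r)^2 * r * (1 + r^2) <= C"
   "(1 - (f r)^2) * (1 + r^2) <= C" "(m r)^2 <= C"
   using B(8-12)[OF r] Cge by linarith+
  ultimately show ?thesis using p1[of r] by (simp add: le_divide_eq)
 qed
 have e0: "\<forall>\<^sub>F r in at_right 0. \<bar>r * f' r\<bar> <= C * f r \<and> \<bar>m' r\<bar> <= C * r"
  using ev0
 proof eventually_elim
  case (elim r)
  have "(r * f' r)^2 <= Q * (f r)^2" using fz(2) elim by simp
  \<comment> \<open>Q <= (Q + 1)^2 avoids the square root of Q.\<close>
  also have "... <= (Q + 1)^2 * (f r)^2" using Qp by (intro mult_right_mono) (auto simp: power2_eq_square algebra_simps)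
  also have "... = ((Q + 1) * f r)^2" by (simp add: power_mult_distrib)
  finally have "\<bar>r * f' r\<bar> <= (Q + 1) * f r" using Qp fpos[of r] elim by (simp add: abs_le_square_iff[symmetric])
  also have "... <= C * f r" using Cge fpos[of r] elim by (intro mult_right_mono) auto
  finally have "\<bar>r * f' r\<bar> <= C * f r" .
  moreover have "Cm * r <= C * r" using Cge elim by (intro mult_right_mono) auto
  ultimately show ?case using mz[of r] elim by linarith
 qed
 have ei: "\<forall>\<^sub>F r in at_top. \<bar>r * f' r\<bar> <= C * r * f r \<and> m r <= C / r^2"
  using evi
 proof eventually_elim
  case (elim r)
  note r = Rp[OF elim]
  have "1 <= r * sqrt r" using r mult_mono[of 1 r 1 "sqrt r"] by simp
  then have "K2 / (r * sqrt r) <= K2" using K2(1) by (simp add: divide_le_eq mult_le_cancel_left1 split: if_splits) 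
  then have "\<bar>f' r\<bar> <= K2" using K2(2)[OF elim] by simp
  also have "K2 <= 2 * K2 * f r" using Ra[of r] R elim K2(1) mult_left_mono[of "1/2" "f r" "2 * K2"] by simp
  also have "... <= C * f r" using Cge fpos[OF r(1)] by (intro mult_right_mono) auto
  finally have "r * \<bar>f' r\<bar> <= r * (C * f r)" using r by (intro mult_left_mono) auto
  moreover have "C1 / r^2 <= C / r^2" using Cge by (intro divide_right_mono) auto
  ultimately show ?case using C1(2)[OF elim] r by (simp add: abs_mult mult_ac)
 qed
 show ?thesis unfolding nice_def using G fpos f1 Cge(1) all e0 ei by (intro conjI exI[of _ C]) auto
qed


section \<open>Green operators\<close>

lemma acd_DERIV:
 assumes U: "acd U u" and u: "continuous_on {0<..} u" and r: "0 < r"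
 shows "DERIV U r :> u r"
proof -
 let ?a = "r/2" and ?b = "r + 1"
 have ab: "0 < ?a" "?a <= r" "r <= ?b" using r by auto
 have c: "continuous_on {?a..?b} u" using u ab by (auto elim!: continuous_on_subset)
 have "((\<lambda>x. integral {?a..x} u) has_real_derivative u r) (at r within {?a..?b})"
  by (rule integral_has_real_derivative[OF c]) (use ab in auto)
 then have 1: "((\<lambda>x. U ?a + integral {?a..x} u) has_real_derivative u r) (at r within {?a..?b})"
  by (auto intro!: derivative_eq_intros)
 have 2: "U x = U ?a + integral {?a..x} u" if "x \<in> {?a..?b}" for x
  using acdD[OF U ab(1), of x] that set_borel_integral_eq_integral(2)[of "{?a..x}" u] by auto
 have "(U has_real_derivative u r) (at r within {?a..?b})"
 proof (rule has_field_derivative_transform_within[OF 1 zero_less_one])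
  show "r \<in> {?a..?b}" using ab by simp
  show "U ?a + integral {?a..x'} u = U x'" if "x' \<in> {?a..?b}" for x' by (rule 2[OF that, symmetric])
 qed
 then show ?thesis using at_within_Icc_at[of ?a r ?b] r by simp
qed

lemma tail_acd:
 assumes g: "!!a. 0 < a ==> set_integrable lborel {a<..} (g :: real => real)"
 shows "acd (\<lambda>r. LBINT s:{r<..}. g s) (\<lambda>r. - g r)"
 unfolding acd_def
proof (intro allI impI conjI)
 fix a b :: real assume ab: "0 < a" "a <= b"
 have i: "set_integrable lborel {a..b} g"
  by (rule set_integrable_subset[OF g[of "a/2"]]) (use ab in auto)
 then show "set_integrable lborel {a..b} (\<lambda>r. - g r)" by (simp add: set_integrable_def)
 have i2: "set_integrable lborel {a<..b} g" by (rule set_integrable_subset[OF i]) auto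
 have "(LBINT s:{a<..b} \<union> {b<..}. g s) = (LBINT s:{a<..b}. g s) + (LBINT s:{b<..}. g s)"
  by (rule set_integral_Un) (use i2 g[of b] ab in auto)
 moreover have "{a<..b} \<union> {b<..} = {a<..}" using ab by auto
 moreover have "(LBINT s:{a<..b}. g s) = (LBINT s:{a..b}. g s)"
 proof (rule set_integral_cong_set)
  show "set_borel_measurable lborel {a..b} g" "set_borel_measurable lborel {a<..b} g"
   using i i2 by (auto simp: set_borel_measurable_def set_integrable_def)
  show "AE x in lborel. (x \<in> {a..b}) = (x \<in> {a<..b})"
   using AE_lborel_singleton[of a] by eventually_elim auto
 qed
 ultimately show "(LBINT r:{a..b}. - g r) = (LBINT s:{b<..}. g s) - (LBINT s:{a<..}. g s)"
  using i by (simp add: set_integral_uminus)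
qed

lemma head_acd:
 assumes g: "!!r. 0 < r ==> set_integrable lborel {0<..<r} (g :: real => real)"
 shows "acd (\<lambda>r. LBINT s:{0<..<r}. g s) g"
 unfolding acd_def
proof (intro allI impI conjI)
 fix a b :: real assume ab: "0 < a" "a <= b"
 show i: "set_integrable lborel {a..b} g"
  by (rule set_integrable_subset[OF g[of "b + 1"]]) (use ab in auto)
 have i2: "set_integrable lborel {a..<b} g" by (rule set_integrable_subset[OF i]) auto
 have "(LBINT s:{0<..<a} \<union> {a..<b}. g s) = (LBINT s:{0<..<a}. g s) + (LBINT s:{a..<b}. g s)"
  by (rule set_integral_Un) (use i2 g[of a] ab in auto)
 moreover have "{0<..<a} \<union> {a..<b} = {0<..<b}" using ab by auto
 moreover have "(LBINT s:{a..<b}. g s) = (LBINT s:{a..b}. g s)"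
 proof (rule set_integral_cong_set)
  show "set_borel_measurable lborel {a..b} g" "set_borel_measurable lborel {a..<b} g"
   using i i2 by (auto simp: set_borel_measurable_def set_integrable_def)
  show "AE x in lborel. (x \<in> {a..b}) = (x \<in> {a..<b})"
   using AE_lborel_singleton[of b] by eventually_elim auto
 qed
 ultimately show "(LBINT r:{a..b}. g r) = (LBINT s:{0<..<b}. g s) - (LBINT s:{0<..<a}. g s)"
  by simp
qed

lemma FTC_head:
 fixes F f :: "real => real"
 assumes b: "0 < b" and F: "!!x. 0 < x ==> x < b ==> DERIV F x :> f x" and c: "!!x. 0 < x ==> x < b ==> isCont f x"
  and p: "!!x. 0 < x ==> x < b ==> 0 <= f x" and A: "(F \<longlongrightarrow> A) (at_right 0)" and B: "(F \<longlongrightarrow> B) (at_left b)"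
 shows "set_integrable lborel {0<..<b} f" "(LBINT x:{0<..<b}. f x) = B - A"
proof -
 have A': "((F \<circ> real_of_ereal) \<longlongrightarrow> A) (at_right (ereal 0))" using A by (simp only: ereal_tendsto_simps)
 have B': "((F \<circ> real_of_ereal) \<longlongrightarrow> B) (at_left (ereal b))" using B by (simp only: ereal_tendsto_simps)
 have n: "AE x in lborel. ereal 0 < ereal x --> ereal x < ereal b --> 0 <= f x" using p by (intro AE_I2) auto
 note T = interval_integral_FTC_nonneg[of "ereal 0" "ereal b" F f A B, OF _ _ _ n A' B']
 show "set_integrable lborel {0<..<b} f" using T(1) F c b by auto
 have "(LBINT x=ereal 0..ereal b. f x) = B - A" using T(2) F c b by auto
 then show "(LBINT x:{0<..<b}. f x) = B - A" using b by (simp add: interval_integral_eq_integral' interval_lebesgue_integral_def set_lebesgue_integral_def)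
qed

text \<open>\<open>phi n r = r^n exp(r^2)\<close> and the decaying \<open>psi n\<close> solve \<open>u'' + u'/r = kk n r u\<close>; the potential \<open>kk\<close> is
chosen for this explicit solution and exceeds \<open>n^2/r^2 + 4\<close>, which makes the nonlinearities monotone.\<close>

definition phi :: "nat => real => real" where "phi n r = r ^ n * exp (r^2)"
definition phi1 :: "nat => real => real" where "phi1 n r = (real n / r + 2 * r) * phi n r"
definition kk :: "nat => real => real" where "kk n r = (real n)^2 / r^2 + 4 * (real n + 1) + 4 * r^2"
text \<open>Reduction of order: phi times this tail integral is a second, decaying solution,
  normalised so that its Wronskian with phi is 1/r.\<close>

definition JJ :: "nat => real => real" where "JJ n r = (LBINT s:{r<..}. 1 / (s * (phi n s)^2))"
definition psi :: "nat => real => real" where "psi n r = phi n r * JJ n r"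
definition psi1 :: "nat => real => real" where "psi1 n r = phi1 n r * JJ n r - 1 / (r * phi n r)"
text \<open>Variation of constants: \<open>phi\<close> belongs to the origin, \<open>psi\<close> to
  infinity, and the result inverts -u'' - u'/r + kk u. The weight s in the integrals is the
  reciprocal of the Wronskian.\<close>

definition green :: "nat => (real => real) => real => real" where
 "green n h r = psi n r * (LBINT s:{0<..<r}. phi n s * h s * s) + phi n r * (LBINT s:{r<..}. psi n s * h s * s)"

lemma phi_pos: "0 < r ==> 0 < phi n r" by (simp add: phi_def)

lemma kk_ge: "0 < r ==> 4 <= kk n r" "0 < r ==> (real n)^2 / r^2 + 4 <= kk n r"
 by (simp_all add: kk_def add_nonneg_nonneg add_increasing)

lemma phi_DERIV:
 assumes r: "0 < r"
 shows "DERIV (phi n) r :> phi1 n r" "DERIV (phi1 n) r :> kk n r * phi n r - phi1 n r / r"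
proof -
 show 1: "DERIV (phi n) r :> phi1 n r"
 proof -
  have p: "real n * r ^ (n - Suc 0) = real n / r * r ^ n" using r by (cases n) auto
  have "DERIV (\<lambda>r. exp (r^2)) r :> exp (r^2) * (2 * r)" by (auto intro!: derivative_eq_intros)
  from DERIV_mult[OF DERIV_pow[of n r UNIV] this]
  have "DERIV (phi n) r :> real n * r ^ (n - Suc 0) * exp (r^2) + exp (r^2) * (2 * r) * r ^ n"
   unfolding phi_def[abs_def] .
  then show ?thesis unfolding p phi1_def phi_def by (simp add: algebra_simps)
 qed
 have "DERIV (\<lambda>r. real n / r + 2 * r) r :> - (real n / r^2) + 2"
  using r by (auto intro!: derivative_eq_intros simp: power2_eq_square)
 from DERIV_mult[OF this 1]
 have "DERIV (phi1 n) r :> (- (real n / r^2) + 2) * phi n r + phi1 n r * (real n / r + 2 * r)"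
  unfolding phi1_def[abs_def] by (simp add: phi1_def)
 moreover have "(- (real n / r^2) + 2) * phi n r + phi1 n r * (real n / r + 2 * r) = kk n r * phi n r - phi1 n r / r"
 proof -
  have "- (real n / r^2) + 2 + (real n / r + 2 * r) * (real n / r + 2 * r) = kk n r - (real n / r + 2 * r) / r"
   using r by (simp add: kk_def field_simps power2_eq_square)
  then have e: "- (real n / r^2) + 2 = kk n r - (real n / r + 2 * r) / r - (real n / r + 2 * r) * (real n / r + 2 * r)" by linarith
  define q where "q = real n / r + 2 * r"
  show ?thesis unfolding e phi1_def q_def[symmetric] by (simp add: algebra_simps)
 qed
 ultimately show "DERIV (phi1 n) r :> kk n r * phi n r - phi1 n r / r" by simp
qed

text \<open>The integrand is s E_p with E_p = exp(-2 s^2)/s^p and p = 2n + 2, while -E_p' = 4 s E_p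
  + p E_p/s. Hence it lies below -E_p'/4 and, for n = 0 and s >= 1, above -E_p'/8; both bounds
  integrate exactly.\<close>

lemma JJ_kernel:
 shows JJ_integrable: "0 < a ==> set_integrable lborel {a<..} (\<lambda>s. 1 / (s * (phi n s)^2))"
  and JJ_le: "0 < r ==> JJ n r <= exp (- 2 * r^2) / (4 * r ^ (2 * n + 2))"
  and JJ_ge: "1 <= r ==> exp (- 2 * r^2) / (8 * r^2) <= JJ 0 r"
proof -
 define E where "E p r = exp (- 2 * r^2) / r ^ p" for p :: nat and r :: real
 have dE: "DERIV (E p) r :> - (4 * r * E p r + p * E p r / r)" if "0 < r" for p r
 proof -
  have "DERIV (\<lambda>r. exp (- 2 * r^2)) r :> exp (- 2 * r^2) * (- 4 * r)"
   by (auto intro!: derivative_eq_intros)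
  from DERIV_divide[OF this DERIV_pow[of p r UNIV]] that
  have "DERIV (E p) r :> (exp (- 2 * r^2) * (- 4 * r) * r ^ p - exp (- 2 * r^2) * (real p * r ^ (p - Suc 0))) / (r ^ p * r ^ p)"
   unfolding E_def[abs_def] by simp
  moreover have "(exp (- 2 * r^2) * (- 4 * r) * r ^ p - exp (- 2 * r^2) * (real p * r ^ (p - Suc 0))) / (r ^ p * r ^ p) = - (4 * r * E p r + p * E p r / r)"
   using that by (cases p) (simp_all add: E_def field_simps)
  ultimately show ?thesis by simp
 qed
 have Elim: "(E p \<longlongrightarrow> 0) at_top" for p
 proof (rule Lim_null_comparison)
  show "\<forall>\<^sub>F r in at_top. norm (E p r) <= inverse r"
   using eventually_ge_at_top[of 1]
  proof eventually_elim
   case (elim r)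
   have "r <= r^2" using elim by (simp add: power2_eq_square)
   also have "r^2 <= 2 * r^2" by simp
   also have "... <= exp (2 * r^2)" using exp_ge_add_one_self[of "2 * r^2"] by linarith
   also have "... <= exp (2 * r^2) * r ^ p" using elim by (simp add: one_le_power)
   finally have "inverse (exp (2 * r^2) * r ^ p) <= inverse r" using elim by (intro le_imp_inverse_le) auto
   moreover have "norm (E p r) = inverse (exp (2 * r^2) * r ^ p)" using elim by (simp add: E_def exp_minus field_simps)
   ultimately show ?case by simp
  qed
  show "(inverse \<longlongrightarrow> (0::real)) at_top" by (rule tendsto_inverse_0_at_top[OF filterlim_ident])
 qed
 have Ec: "isCont (\<lambda>r. c * (4 * r * E p r + p * E p r / r)) r" if "0 < r" for p r c
  using that by (intro continuous_intros DERIV_isCont[OF dE]) auto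
 have Ei: "set_integrable lborel {a<..} (\<lambda>r. c * (4 * r * E p r + p * E p r / r))"
  "(LBINT r:{a<..}. c * (4 * r * E p r + p * E p r / r)) = c * E p a" if a: "0 < a" and c: "0 <= c" for a p c
 proof -
  have F: "DERIV (\<lambda>r. - c * E p r) x :> c * (4 * x * E p x + p * E p x / x)" if "a < x" for x
   using DERIV_cmult[OF dE[of x p], of "-c"] that a by (simp add: algebra_simps)
  have pos: "0 <= c * (4 * x * E p x + p * E p x / x)" if "a < x" for x
   using that a c by (simp add: E_def)
  have "isCont (E p) a" using DERIV_isCont[OF dE[OF a]] .
  then have A: "((\<lambda>r. - c * E p r) \<longlongrightarrow> - c * E p a) (at_right a)"
   by (intro tendsto_mult tendsto_const) (simp add: isCont_def filterlim_at_split)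
  have B: "((\<lambda>r. - c * E p r) \<longlongrightarrow> - c * 0) at_top" by (intro tendsto_mult tendsto_const Elim)
  note T = FTC_tail[OF F Ec pos A B]
  show "set_integrable lborel {a<..} (\<lambda>r. c * (4 * r * E p r + p * E p r / r))"
   using T(1) a by simp
  show "(LBINT r:{a<..}. c * (4 * r * E p r + p * E p r / r)) = c * E p a" using T(2) a by simp
 qed
 have ker: "1 / (s * (phi n s)^2) = s * E (2 * n + 2) s" if "0 < s" for s n
 proof -
  have "(phi n s)^2 = s ^ (2 * n) * exp (2 * s^2)"
   by (simp add: phi_def power_mult_distrib power_mult[symmetric] mult.commute exp_double[symmetric] flip: exp_of_nat_mult)
  then show ?thesis using that by (simp add: E_def exp_minus field_simps power2_eq_square)
 qed
 show I: "set_integrable lborel {a<..} (\<lambda>s. 1 / (s * (phi n s)^2))" if a: "0 < a" for a n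
 proof (rule set_integrable_bound[OF Ei(1)[OF a, of "1/4" "2 * n + 2"]])
  have "continuous_on {a<..} (\<lambda>s. 1 / (s * (phi n s)^2))"
   using a phi_pos[of _ n] by (intro continuous_intros continuous_at_imp_continuous_on ballI DERIV_isCont[OF phi_DERIV(1)]) (auto simp: less_imp_neq[symmetric])
  then show "set_borel_measurable lborel {a<..} (\<lambda>s. 1 / (s * (phi n s)^2))"
   unfolding set_borel_measurable_def by (simp add: borel_measurable_continuous_on_indicator del: real_scaleR_def)
  show "AE x in lborel. x \<in> {a<..} --> norm (1 / (x * (phi n x)^2)) <= norm (1/4 * (4 * x * E (2*n+2) x + real (2*n+2) * E (2*n+2) x / x))"
  proof (intro AE_I2 impI)
   fix x assume "x \<in> {a<..}"
   then have x: "0 < x" using a by simp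
   have "0 <= real (2*n+2) * E (2*n+2) x / x" "0 <= x * E (2*n+2) x" using x by (auto simp: E_def)
   then show "norm (1 / (x * (phi n x)^2)) <= norm (1/4 * (4 * x * E (2*n+2) x + real (2*n+2) * E (2*n+2) x / x))"
    unfolding ker[OF x] by simp
  qed
 qed simp
 show "JJ n r <= exp (- 2 * r^2) / (4 * r ^ (2 * n + 2))" if r: "0 < r" for r
 proof -
  have "JJ n r <= (LBINT s:{r<..}. 1/4 * (4 * s * E (2*n+2) s + real (2*n+2) * E (2*n+2) s / s))"
   unfolding JJ_def
  proof (rule set_integral_mono[OF I[OF r] Ei(1)[OF r]])
   fix x assume "x \<in> {r<..}"
   then have x: "0 < x" using r by simp
   have "0 <= real (2*n+2) * E (2*n+2) x / x" using x by (auto simp: E_def)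
   then show "1 / (x * (phi n x)^2) <= 1/4 * (4 * x * E (2*n+2) x + real (2*n+2) * E (2*n+2) x / x)"
    unfolding ker[OF x] by simp
  qed simp
  also have "... = 1/4 * E (2*n+2) r" by (rule Ei(2)[OF r]) simp
  finally show ?thesis by (simp add: E_def)
 qed
 show "exp (- 2 * r^2) / (8 * r^2) <= JJ 0 r" if r: "1 <= r" for r
 proof -
  have r0: "0 < r" using r by simp
  have "1/8 * E 2 r = (LBINT s:{r<..}. 1/8 * (4 * s * E 2 s + real 2 * E 2 s / s))"
   by (rule Ei(2)[OF r0, symmetric]) simp
  also have "... <= JJ 0 r" unfolding JJ_def
  proof (rule set_integral_mono[OF Ei(1)[OF r0] I[OF r0]])
   fix x assume "x \<in> {r<..}"
   then have x: "0 < x" "1 <= x" using r by auto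
   have "E 2 x / x <= x * E 2 x"
   proof -
    have "1 * E 2 x <= (x * x) * E 2 x" using x mult_mono[of 1 x 1 x] by (intro mult_right_mono) (auto simp: E_def)
    then show ?thesis using x by (simp add: pos_divide_le_eq mult_ac)
   qed
   moreover have "0 <= x * E 2 x" using x by (simp add: E_def)
   ultimately show "1/8 * (4 * x * E 2 x + real 2 * E 2 x / x) <= 1 / (x * (phi 0 x)^2)"
    unfolding ker[OF x(1), of 0] mult_0_right add_0 by simp
  qed simp
  finally show ?thesis by (simp add: E_def)
 qed
qed

lemma JJ_DERIV: "0 < r ==> DERIV (JJ n) r :> - (1 / (r * (phi n r)^2))"
proof -
 assume r: "0 < r"
 have "acd (JJ n) (\<lambda>r. - (1 / (r * (phi n r)^2)))" unfolding JJ_def[abs_def]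
  by (rule tail_acd[OF JJ_integrable])
 moreover have "continuous_on {0<..} (\<lambda>r. - (1 / (r * (phi n r)^2)))"
  using phi_pos[of _ n] by (intro continuous_intros continuous_at_imp_continuous_on ballI DERIV_isCont[OF phi_DERIV(1)]) (auto simp: less_imp_neq[symmetric])
 ultimately show ?thesis using r by (rule acd_DERIV)
qed

lemma set_integral_pos:
 fixes h :: "real => real"
 assumes h: "set_integrable lborel S h" and S: "open S" and c: "continuous_on S h" and p: "!!x. x \<in> S ==> 0 <= h x"
  and x: "x0 \<in> S" "0 < h x0"
 shows "0 < (LBINT x:S. h x)"
proof -
 have nn: "AE x in lborel. 0 <= indicator S x *\<^sub>R h x" using p by (intro AE_I2) (auto simp: indicator_def)
 have "0 <= (LBINT x:S. h x)" unfolding set_lebesgue_integral_def using nn by (rule Bochner_Integration.integral_nonneg_AE)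
 moreover have "(LBINT x:S. h x) ~= 0"
 proof
  assume "(LBINT x:S. h x) = 0"
  then have 0: "AE x in lborel. indicator S x *\<^sub>R h x = 0"
   using integral_nonneg_eq_0_iff_AE[OF _ nn] h by (simp add: set_integrable_def set_lebesgue_integral_def)
  have o: "open (h -` {0<..} \<inter> S)" using continuous_open_preimage[OF c S, of "{0<..}"] by (simp add: Int_commute)
  have "AE x in lborel. x \<notin> h -` {0<..} \<inter> S"
   using 0
  proof eventually_elim
   case (elim x)
   then show ?case by (auto simp: indicator_def)
  qed
  then have "h -` {0<..} \<inter> S \<in> null_sets lborel" using o by (subst AE_iff_null_sets) auto
  then have "h -` {0<..} \<inter> S = {}" using o by (meson open_not_negligible negligible_iff_null_sets null_sets_completionI)
  then show False using x by auto
 qed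
 ultimately show ?thesis by simp
qed

lemma JJ_pos: "0 < r ==> 0 < JJ n r"
 unfolding JJ_def
proof (rule set_integral_pos[OF JJ_integrable, where ?x0.0="r + 1"])
 assume r: "0 < r"
 show "continuous_on {r<..} (\<lambda>s. 1 / (s * (phi n s)^2))"
  using r phi_pos[of _ n] by (intro continuous_intros continuous_at_imp_continuous_on ballI DERIV_isCont[OF phi_DERIV(1)]) (auto simp: less_imp_neq[symmetric])
 show "0 < 1 / ((r + 1) * (phi n (r + 1))^2)" using r phi_pos[of "r + 1" n] by simp
 show "0 <= 1 / (s * (phi n s)^2)" if "s \<in> {r<..}" for s using r that by simp
qed auto

lemma psi_pos: "0 < r ==> 0 < psi n r" by (simp add: psi_def phi_pos JJ_pos)

lemma psi_DERIV:
 assumes r: "0 < r"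
 shows "DERIV (psi n) r :> psi1 n r" "DERIV (psi1 n) r :> kk n r * psi n r - psi1 n r / r"
proof -
 note p = phi_pos[OF r, of n]
 have "DERIV (psi n) r :> phi1 n r * JJ n r + - (1 / (r * (phi n r)^2)) * phi n r"
  unfolding psi_def[abs_def] by (rule DERIV_mult[OF phi_DERIV(1)[OF r] JJ_DERIV[OF r]])
 moreover have "phi1 n r * JJ n r + - (1 / (r * (phi n r)^2)) * phi n r = psi1 n r"
  using p r by (simp add: psi1_def power2_eq_square)
 ultimately show "DERIV (psi n) r :> psi1 n r" by simp
 have "DERIV (\<lambda>r. r * phi n r) r :> 1 * phi n r + phi1 n r * r"
  by (rule DERIV_mult[OF DERIV_ident phi_DERIV(1)[OF r]])
 from DERIV_divide[OF DERIV_const[of 1] this] p r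
 have "DERIV (\<lambda>r. 1 / (r * phi n r)) r :> (0 * (r * phi n r) - 1 * (1 * phi n r + phi1 n r * r)) / (r * phi n r * (r * phi n r))" by simp
 from DERIV_diff[OF DERIV_mult[OF phi_DERIV(2)[OF r] JJ_DERIV[OF r]] this]
 have "DERIV (psi1 n) r :> (kk n r * phi n r - phi1 n r / r) * JJ n r + - (1 / (r * (phi n r)^2)) * phi1 n r
   - (0 * (r * phi n r) - 1 * (1 * phi n r + phi1 n r * r)) / (r * phi n r * (r * phi n r))"
  unfolding psi1_def[abs_def] .
 moreover have "(kk n r * phi n r - phi1 n r / r) * JJ n r + - (1 / (r * (phi n r)^2)) * phi1 n r
   - (0 * (r * phi n r) - 1 * (1 * phi n r + phi1 n r * r)) / (r * phi n r * (r * phi n r)) = kk n r * psi n r - psi1 n r / r"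
 proof -
  have "(1 * phi n r + phi1 n r * r) / (r * phi n r * (r * phi n r)) = 1 / (r * phi n r) / r + 1 / (r * (phi n r)^2) * phi1 n r"
   using p r by (simp add: field_simps power2_eq_square)
  then show ?thesis by (simp add: psi_def psi1_def algebra_simps diff_divide_distrib power2_eq_square)
 qed
 ultimately show "DERIV (psi1 n) r :> kk n r * psi n r - psi1 n r / r" by simp
qed

lemma wronskian: "0 < r ==> r * (psi n r * phi1 n r - phi n r * psi1 n r) = 1"
 using phi_pos[of r n] by (simp add: psi_def psi1_def field_simps)

lemma phi_limits_zero:
 shows "((\<lambda>r. r * phi1 n r) \<longlongrightarrow> 0) (at_right 0)" "\<exists>C. \<forall>\<^sub>F r in at_right 0. \<bar>phi n r\<bar> <= C"
proof -
 have e: "\<forall>\<^sub>F r in at_right (0::real). 0 < r" by (auto simp: eventually_at_right_field intro!: exI[of _ 1])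
 have T: "((\<lambda>r. (real n + 2 * r^2) * (r ^ n * exp (r^2))) \<longlongrightarrow> (real n + 2 * 0^2) * (0 ^ n * exp (0^2))) (at_right (0::real))"
  by (intro tendsto_intros)
 have z0: "(real n + 2 * 0^2) * (0 ^ n * exp (0^2)) = (0::real)" by (cases n) auto
 from T have "((\<lambda>r. (real n + 2 * r^2) * (r ^ n * exp (r^2))) \<longlongrightarrow> 0) (at_right (0::real))" unfolding z0 .
 moreover have "\<forall>\<^sub>F r in at_right 0. (real n + 2 * r^2) * (r ^ n * exp (r^2)) = r * phi1 n r"
  using e by eventually_elim (simp add: phi1_def phi_def field_simps power2_eq_square)
 ultimately show "((\<lambda>r. r * phi1 n r) \<longlongrightarrow> 0) (at_right 0)" by (rule Lim_transform_eventually)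
 have "\<forall>\<^sub>F r in at_right (0::real). 0 < r \<and> r < 1" by (auto simp: eventually_at_right_field intro!: exI[of _ 1])
 then have "\<forall>\<^sub>F r in at_right 0. \<bar>phi n r\<bar> <= 1 * exp 1"
 proof eventually_elim
  case (elim r)
  then have "r ^ n <= 1" "r^2 <= 1" by (auto intro: power_le_one)
  then show ?case unfolding phi_def abs_mult using elim by (intro mult_mono) auto
 qed
 then show "\<exists>C. \<forall>\<^sub>F r in at_right 0. \<bar>phi n r\<bar> <= C" by blast
qed

lemma psi_limits_top:
 shows "((\<lambda>r. r^2 * psi n r) \<longlongrightarrow> 0) at_top" "((\<lambda>r. r * psi1 n r) \<longlongrightarrow> 0) at_top"
proof -
 have b: "\<forall>\<^sub>F r in at_top. \<bar>r^2 * psi n r\<bar> <= inverse r \<and> \<bar>1 / phi n r\<bar> <= inverse r \<and> 1 <= r"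
  using eventually_ge_at_top[of 1]
 proof eventually_elim
  case (elim r)
  have r: "0 < r" using elim by simp
  have "r <= r^2" using elim by (simp add: power2_eq_square)
  also have "... <= exp (r^2)" using exp_ge_add_one_self[of "r^2"] by linarith
  finally have e1: "r <= exp (r^2)" .
  then have e: "exp (- (r^2)) <= inverse r" using r by (simp add: exp_minus le_imp_inverse_le)
  have pn: "1 <= r ^ n" using elim by (rule one_le_power)
  have "r <= phi n r" unfolding phi_def using e1 pn mult_mono[of 1 "r^n" r "exp (r^2)"] r by simp
  then have 2: "\<bar>1 / phi n r\<bar> <= inverse r" using r phi_pos[OF r, of n] by (simp add: inverse_eq_divide frac_le)
  have "psi n r <= phi n r * (exp (- 2 * r^2) / (4 * r ^ (2 * n + 2)))"
   unfolding psi_def using JJ_le[OF r, of n] phi_pos[OF r, of n] by (intro mult_left_mono) auto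
  also have "... = exp (- (r^2)) / (4 * r ^ n * r^2)"
  proof -
   have "exp (r^2) * exp (- 2 * r^2) = exp (- (r^2))" by (simp flip: exp_add)
   moreover have "r ^ (2 * n + 2) = r ^ n * r ^ n * r^2" by (simp add: power_add mult_2 power2_eq_square)
   ultimately show ?thesis using r by (simp add: phi_def field_simps)
  qed
  finally have "r^2 * psi n r <= r^2 * (exp (- (r^2)) / (4 * r ^ n * r^2))" by (rule mult_left_mono) simp
  also have "... = exp (- (r^2)) / (4 * r ^ n)" using r by simp
  also have "... <= exp (- (r^2)) / 1" using pn by (intro divide_left_mono) auto
  finally have "r^2 * psi n r <= inverse r" using e by simp
  moreover have "0 <= r^2 * psi n r" using psi_pos[OF r, of n] by simp
  ultimately show ?case using 2 elim by simp
 qed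
 have lim: "((\<lambda>r. C * inverse r) \<longlongrightarrow> 0) at_top" for C :: real
  using tendsto_mult[OF tendsto_const[of C] tendsto_inverse_0_at_top[OF filterlim_ident]] by simp
 show "((\<lambda>r. r^2 * psi n r) \<longlongrightarrow> 0) at_top"
  by (rule Lim_null_comparison[OF _ lim[of 1]]) (use b in \<open>auto elim: eventually_mono\<close>)
 show "((\<lambda>r. r * psi1 n r) \<longlongrightarrow> 0) at_top"
 proof (rule Lim_null_comparison[OF _ lim[of "real n + 3"]])
  show "\<forall>\<^sub>F r in at_top. norm (r * psi1 n r) <= (real n + 3) * inverse r"
   using b
  proof eventually_elim
   case (elim r)
   have r: "0 < r" "1 <= r^2" using elim by (auto simp: one_le_power)
   have e: "r * psi1 n r = (real n + 2 * r^2) * psi n r - 1 / phi n r"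
    using r phi_pos[OF r(1), of n] by (simp add: psi1_def psi_def phi1_def field_simps power2_eq_square)
   have "real n * 1 + 2 * r^2 <= real n * r^2 + 2 * r^2" using r by (intro add_right_mono mult_left_mono) auto
   then have "(real n + 2 * r^2) * psi n r <= (real n * r^2 + 2 * r^2) * psi n r"
    using psi_pos[OF r(1), of n] by (intro mult_right_mono) auto
   also have "... = (real n + 2) * (r^2 * psi n r)" by (simp add: algebra_simps)
   also have "... <= (real n + 2) * inverse r" using elim by (intro mult_left_mono) auto
   finally have 1: "(real n + 2 * r^2) * psi n r <= (real n + 2) * inverse r" .
   have 0: "0 <= (real n + 2 * r^2) * psi n r" using psi_pos[OF r(1), of n] by simp
   have "(real n + 3) * inverse r = (real n + 2) * inverse r + inverse r" by (simp add: algebra_simps)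
   then show ?case unfolding e using 0 1 elim by (simp only: real_norm_def) linarith
  qed
 qed
qed

text \<open>Lagrange's identity: r (phi u' - phi' u) and its analogue with psi are primitives of
  -phi h r and -psi h r. The conditions on u remove their limits at 0 and at infinity respectively,
  and h >= 0 turns convergence into integrability.\<close>

lemma green_identity:
 fixes u u' u'' h :: "real => real"
 assumes d: "!!r. 0 < r ==> DERIV u r :> u' r" and d': "!!r. 0 < r ==> DERIV u' r :> u'' r"
  and h: "!!r. 0 < r ==> h r = kk n r * u r - (u'' r + u' r / r)" "!!r. 0 < r ==> 0 <= h r" "continuous_on {0<..} h"
  and z: "((\<lambda>r. r * u' r) \<longlongrightarrow> 0) (at_right 0)" and b: "!!r. 0 < r ==> \<bar>u r\<bar> <= C"
  and t: "\<forall>\<^sub>F r in at_top. \<bar>r * u' r\<bar> <= C * r^2" and r: "0 < r"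
 shows "set_integrable lborel {0<..<r} (\<lambda>s. phi n s * h s * s)" "set_integrable lborel {r<..} (\<lambda>s. psi n s * h s * s)"
  "(LBINT s:{0<..<r}. phi n s * h s * s) = - (r * (phi n r * u' r - phi1 n r * u r))"
  "green n h r = u r"
proof -
 have C0: "0 <= C" using b[OF r] by linarith
 define F where "F r = - (r * (phi n r * u' r - phi1 n r * u r))" for r
 define G where "G r = - (r * (psi n r * u' r - psi1 n r * u r))" for r
 have dF: "DERIV F x :> phi n x * h x * x" if x: "0 < x" for x
 proof -
  have "DERIV F x :> - (1 * (phi n x * u' x - phi1 n x * u x) + ((phi1 n x * u' x + u'' x * phi n x) - ((kk n x * phi n x - phi1 n x / x) * u x + u' x * phi1 n x)) * x)"
   unfolding F_def by (intro DERIV_minus DERIV_mult DERIV_diff DERIV_ident phi_DERIV[OF x] d[OF x] d'[OF x])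
  moreover have "- (1 * (phi n x * u' x - phi1 n x * u x) + ((phi1 n x * u' x + u'' x * phi n x) - ((kk n x * phi n x - phi1 n x / x) * u x + u' x * phi1 n x)) * x) = phi n x * h x * x"
   unfolding h(1)[OF x] using x by (simp add: field_simps)
  ultimately show ?thesis by simp
 qed
 have dG: "DERIV G x :> psi n x * h x * x" if x: "0 < x" for x
 proof -
  have "DERIV G x :> - (1 * (psi n x * u' x - psi1 n x * u x) + ((psi1 n x * u' x + u'' x * psi n x) - ((kk n x * psi n x - psi1 n x / x) * u x + u' x * psi1 n x)) * x)"
   unfolding G_def by (intro DERIV_minus DERIV_mult DERIV_diff DERIV_ident psi_DERIV[OF x] d[OF x] d'[OF x])
  moreover have "- (1 * (psi n x * u' x - psi1 n x * u x) + ((psi1 n x * u' x + u'' x * psi n x) - ((kk n x * psi n x - psi1 n x / x) * u x + u' x * psi1 n x)) * x) = psi n x * h x * x"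
   unfolding h(1)[OF x] using x by (simp add: field_simps)
  ultimately show ?thesis by simp
 qed
 have hc: "isCont h x" if "0 < x" for x using h(3) that continuous_on_eq_continuous_at[of "{0<..}" h] by auto
 have cF: "isCont (\<lambda>x. phi n x * h x * x) x" if "0 < x" for x
  by (intro continuous_intros DERIV_isCont[OF phi_DERIV(1)[OF that]] hc[OF that])
 have cG: "isCont (\<lambda>x. psi n x * h x * x) x" if "0 < x" for x
  by (intro continuous_intros DERIV_isCont[OF psi_DERIV(1)[OF that]] hc[OF that])
 have e0: "\<forall>\<^sub>F r in at_right (0::real). 0 < r" by (auto simp: eventually_at_right_field intro!: exI[of _ 1])
 have F0: "(F \<longlongrightarrow> 0) (at_right 0)"
 proof -
  obtain C1 where C1: "\<forall>\<^sub>F r in at_right 0. \<bar>phi n r\<bar> <= C1" using phi_limits_zero(2)[of n] by blast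
  have 1: "((\<lambda>r. phi n r * (r * u' r)) \<longlongrightarrow> 0) (at_right 0)"
  proof (rule Lim_null_comparison)
   show "\<forall>\<^sub>F r in at_right 0. norm (phi n r * (r * u' r)) <= C1 * \<bar>r * u' r\<bar>"
    using C1 by eventually_elim (simp only: real_norm_def abs_mult[of "phi n _"], intro mult_right_mono, auto)
   show "((\<lambda>r. C1 * \<bar>r * u' r\<bar>) \<longlongrightarrow> 0) (at_right 0)"
    using tendsto_mult[OF tendsto_const[of C1] tendsto_rabs_zero[OF z]] by simp
  qed
  have 2: "((\<lambda>r. (r * phi1 n r) * u r) \<longlongrightarrow> 0) (at_right 0)"
  proof (rule Lim_null_comparison)
   show "\<forall>\<^sub>F r in at_right 0. norm ((r * phi1 n r) * u r) <= \<bar>r * phi1 n r\<bar> * C"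
    using e0 by eventually_elim (simp only: real_norm_def abs_mult[of "_ * phi1 n _"], intro mult_left_mono b, auto)
   show "((\<lambda>r. \<bar>r * phi1 n r\<bar> * C) \<longlongrightarrow> 0) (at_right 0)"
    using tendsto_mult[OF tendsto_rabs_zero[OF phi_limits_zero(1)[of n]] tendsto_const[of C]] by simp
  qed
  have "((\<lambda>r. - (phi n r * (r * u' r) - (r * phi1 n r) * u r)) \<longlongrightarrow> - (0 - 0)) (at_right 0)"
   by (intro tendsto_minus tendsto_diff 1 2)
  then show ?thesis by (simp add: F_def[abs_def] algebra_simps)
 qed
 have Gi: "(G \<longlongrightarrow> 0) at_top"
 proof (rule Lim_null_comparison)
  show "\<forall>\<^sub>F r in at_top. norm (G r) <= C * \<bar>r^2 * psi n r\<bar> + C * \<bar>r * psi1 n r\<bar>"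
   using t eventually_gt_at_top[of 0]
  proof eventually_elim
   case (elim r)
   have "\<bar>psi n r * (r * u' r)\<bar> <= psi n r * (C * r^2)"
    unfolding abs_mult[of "psi n r"] using elim psi_pos[of r n] by (intro mult_mono) auto
   also have "... = C * \<bar>r^2 * psi n r\<bar>" using elim psi_pos[of r n] by (simp add: abs_mult mult_ac)
   finally have 1: "\<bar>psi n r * (r * u' r)\<bar> <= C * \<bar>r^2 * psi n r\<bar>" .
   have 2: "\<bar>(r * psi1 n r) * u r\<bar> <= C * \<bar>r * psi1 n r\<bar>"
    unfolding abs_mult[of "r * psi1 n r"] using b[of r] elim by (subst mult.commute) (intro mult_right_mono, auto)
   have "G r = (r * psi1 n r) * u r - psi n r * (r * u' r)" by (simp add: G_def algebra_simps)
   then show ?case using 1 2 unfolding real_norm_def by linarith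
  qed
  show "((\<lambda>r. C * \<bar>r^2 * psi n r\<bar> + C * \<bar>r * psi1 n r\<bar>) \<longlongrightarrow> 0) at_top"
   using tendsto_add[OF tendsto_mult[OF tendsto_const[of C] tendsto_rabs_zero[OF psi_limits_top(1)[of n]]]
     tendsto_mult[OF tendsto_const[of C] tendsto_rabs_zero[OF psi_limits_top(2)[of n]]]] by simp
 qed
 have Fr: "(F \<longlongrightarrow> F r) (at_left r)" using DERIV_isCont[OF dF[OF r]] by (simp add: isCont_def filterlim_at_split)
 have Gr: "(G \<longlongrightarrow> G r) (at_right r)" using DERIV_isCont[OF dG[OF r]] by (simp add: isCont_def filterlim_at_split)
 have pF: "0 <= phi n x * h x * x" "0 <= psi n x * h x * x" if "0 < x" for x
  using phi_pos[OF that, of n] psi_pos[OF that, of n] h(2)[OF that] that by auto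
 note I1 = FTC_head[OF r dF cF pF(1) F0 Fr]
 note I2 = FTC_tail[OF dG cG pF(2) Gr Gi]
 show "set_integrable lborel {0<..<r} (\<lambda>s. phi n s * h s * s)" using I1(1) by simp
 show "set_integrable lborel {r<..} (\<lambda>s. psi n s * h s * s)" using I2(1) r by simp
 have 1: "(LBINT s:{0<..<r}. phi n s * h s * s) = F r" using I1(2) by simp
 then show "(LBINT s:{0<..<r}. phi n s * h s * s) = - (r * (phi n r * u' r - phi1 n r * u r))" by (simp add: F_def)
 have 2: "(LBINT s:{r<..}. psi n s * h s * s) = - G r" using I2(2) r by simp
 have "green n h r = psi n r * F r - phi n r * G r" unfolding green_def 1 2 by simp
 also have "... = (r * (psi n r * phi1 n r - phi n r * psi1 n r)) * u r" by (simp add: F_def G_def algebra_simps)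
 finally show "green n h r = u r" using wronskian[OF r, of n] by simp
qed

text \<open>The constant 1 solves the equation with source \<open>kk\<close>, so \<open>kk\<close>
  is an explicitly integrated majorant for all sources used later.\<close>

lemma green_kk:
 assumes r: "0 < r"
 shows "set_integrable lborel {0<..<r} (\<lambda>s. phi n s * kk n s * s)" "set_integrable lborel {r<..} (\<lambda>s. psi n s * kk n s * s)"
  "(LBINT s:{0<..<r}. phi n s * kk n s * s) = r * phi1 n r" "green n (kk n) r = 1"
proof -
 have c: "continuous_on {0<..} (kk n)" unfolding kk_def by (intro continuous_intros) auto
 have k0: "0 <= kk n r" if "0 < r" for r using kk_ge(1)[OF that, of n] by simp
 have z: "\<forall>\<^sub>F r::real in at_top. \<bar>r * 0\<bar> <= 1 * r^2" by simp
 note G = green_identity[where u="\<lambda>r. 1" and u'="\<lambda>r. 0" and u''="\<lambda>r. 0" and C=1 and h="kk n" and n=n, OF _ _ _ k0 c _ _ z r]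
 show "set_integrable lborel {0<..<r} (\<lambda>s. phi n s * kk n s * s)" "set_integrable lborel {r<..} (\<lambda>s. psi n s * kk n s * s)"
  "(LBINT s:{0<..<r}. phi n s * kk n s * s) = r * phi1 n r" "green n (kk n) r = 1"
  using G by simp_all
qed

section \<open>The Green operator on sources dominated by \<open>kk\<close>\<close>

definition green1 :: "nat => (real => real) => real => real" where
 "green1 n h r = psi1 n r * (LBINT s:{0<..<r}. phi n s * h s * s) + phi1 n r * (LBINT s:{r<..}. psi n s * h s * s)"

text \<open>The sign serves monotonicity, the majorant C kk integrability; by
  \<open>green_cmult_kk\<close> the same C bounds the result.\<close>

definition green_adm :: "nat => real => (real => real) => bool" where
 "green_adm n C h \<longleftrightarrow> measurable_pos h \<and> (\<forall>r>0. 0 <= h r \<and> h r <= C * kk n r)"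

lemma green_integrable:
 assumes h: "green_adm n C h" and r: "0 < r"
 shows "set_integrable lborel {0<..<r} (\<lambda>s. phi n s * h s * s)" "set_integrable lborel {r<..} (\<lambda>s. psi n s * h s * s)"
proof -
 have hm[measurable]: "measurable_pos h" using h by (simp add: green_adm_def)
 have C0: "0 <= C" using h r kk_ge(1)[OF r, of n] unfolding green_adm_def by (smt (verit) mult_nonneg_nonneg mult_neg_pos)
 have I: "set_integrable lborel S (\<lambda>s. w s * h s * s)"
  if S: "S \<subseteq> {0<..}" "S \<in> sets borel" and w: "continuous_on {0<..} w" "!!s. 0 < s ==> 0 < w s" and k: "set_integrable lborel S (\<lambda>s. w s * kk n s * s)" for S w
 proof (rule set_integrable_bound[where f="\<lambda>s. C * (w s * kk n s * s)"])
  show "set_integrable lborel S (\<lambda>s. C * (w s * kk n s * s))" using k by simp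
  have [measurable]: "measurable_pos w" "S \<in> sets borel"
   using w(1) S by (auto intro!: borel_measurable_continuous_on_indicator simp del: real_scaleR_def)
  have "(\<lambda>s. indicator S s *\<^sub>R (w s * h s * s)) = (\<lambda>s. indicator S s *\<^sub>R ((indicator {0<..} s *\<^sub>R w s) * (indicator {0<..} s *\<^sub>R h s) * s))"
   using S by (auto simp: indicator_def fun_eq_iff)
  also have "... \<in> borel_measurable borel" by measurable
  finally show "set_borel_measurable lborel S (\<lambda>s. w s * h s * s)" by (simp add: set_borel_measurable_def)
  show "AE x in lborel. x \<in> S --> norm (w x * h x * x) <= norm (C * (w x * kk n x * x))"
  proof (intro AE_I2 impI)
   fix x assume "x \<in> S"
   then have x: "0 < x" using S by auto
   have hx: "0 <= h x" "h x <= C * kk n x" using h x by (auto simp: green_adm_def)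
   have "w x * h x * x <= w x * (C * kk n x) * x" using hx w(2)[OF x] x by (intro mult_right_mono mult_left_mono) auto
   moreover have "0 <= w x * h x * x" using hx w(2)[OF x] x by simp
   ultimately show "norm (w x * h x * x) <= norm (C * (w x * kk n x * x))"
    using C0 w(2)[OF x] kk_ge(1)[OF x, of n] x by (simp add: mult_ac)
  qed
 qed
 have cp: "continuous_on {0<..} (phi n)" "continuous_on {0<..} (psi n)"
  using phi_DERIV(1)[of _ n] psi_DERIV(1)[of _ n] by (auto intro!: continuous_at_imp_continuous_on DERIV_isCont)
 show "set_integrable lborel {0<..<r} (\<lambda>s. phi n s * h s * s)"
  by (rule I) (use cp phi_pos green_kk(1)[OF r, of n] in auto)
 show "set_integrable lborel {r<..} (\<lambda>s. psi n s * h s * s)"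
  by (rule I) (use r cp psi_pos green_kk(2)[OF r, of n] in auto)
qed

lemma green_acd:
 assumes h: "green_adm n C h"
 shows "acd (\<lambda>r. LBINT s:{0<..<r}. phi n s * h s * s) (\<lambda>s. phi n s * h s * s)"
  "acd (\<lambda>r. LBINT s:{r<..}. psi n s * h s * s) (\<lambda>s. - (psi n s * h s * s))"
 using head_acd[of "\<lambda>s. phi n s * h s * s"] tail_acd[of "\<lambda>s. psi n s * h s * s"] green_integrable[OF h] by simp_all

lemma green_mono:
 assumes h: "green_adm n C h" and h': "green_adm n C' h'" and le: "!!s. 0 < s ==> h s <= h' s" and r: "0 < r"
 shows "green n h r <= green n h' r"
 unfolding green_def
proof (intro add_mono mult_left_mono)
 show "(LBINT s:{0<..<r}. phi n s * h s * s) <= (LBINT s:{0<..<r}. phi n s * h' s * s)"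
  using phi_pos[of _ n] le by (intro set_integral_mono green_integrable[OF h r] green_integrable[OF h' r]) (auto intro!: mult_right_mono mult_left_mono simp: less_imp_le)
 show "(LBINT s:{r<..}. psi n s * h s * s) <= (LBINT s:{r<..}. psi n s * h' s * s)"
  using psi_pos[of _ n] le r by (intro set_integral_mono green_integrable[OF h r] green_integrable[OF h' r]) (auto intro!: mult_right_mono mult_left_mono simp: less_imp_le)
qed (use phi_pos[OF r, of n] psi_pos[OF r, of n] in auto)

lemma green_adm_kk: "0 <= c ==> green_adm n c (\<lambda>r. c * kk n r)"
proof -
 assume c: "0 <= c"
 have "continuous_on {0<..} (\<lambda>r. c * kk n r)" unfolding kk_def by (intro continuous_intros) auto
 moreover have "0 <= c * kk n r" if "0 < r" for r using c kk_ge(1)[OF that, of n] by simp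
 ultimately show ?thesis by (auto simp: green_adm_def intro!: borel_measurable_continuous_on_indicator simp del: real_scaleR_def)
qed

lemma green_cmult_kk: "0 < r ==> green n (\<lambda>r. c * kk n r) r = c"
proof -
 assume r: "0 < r"
 have "green n (\<lambda>r. c * kk n r) r = c * green n (kk n) r"
  unfolding green_def by (simp add: mult.left_commute[of _ c] mult.assoc distrib_left)
 then show ?thesis using green_kk(4)[OF r] by simp
qed

lemma green_le:
 assumes h: "green_adm n C h" and le: "!!s. 0 < s ==> h s <= c * kk n s" and c: "0 <= c" and r: "0 < r"
 shows "green n h r <= c"
 using green_mono[OF h green_adm_kk[OF c] le r] green_cmult_kk[OF r, of n c] by simp

lemma green_nonneg:
 assumes h: "green_adm n C h" and r: "0 < r"
 shows "0 <= green n h r"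
 using green_mono[OF green_adm_kk[of 0] h, of r] h r green_cmult_kk[OF r, of n 0] by (auto simp: green_adm_def)

lemma green_continuous:
 assumes h: "green_adm n C h"
 shows "continuous_on {0<..} (green n h)"
proof -
 have cp: "continuous_on {0<..} (phi n)" "continuous_on {0<..} (psi n)"
  using phi_DERIV(1)[of _ n] psi_DERIV(1)[of _ n] by (auto intro!: continuous_at_imp_continuous_on DERIV_isCont)
 show ?thesis unfolding green_def[abs_def]
  by (intro continuous_on_add continuous_on_mult cp acd_continuous[OF green_acd(1)[OF h]] acd_continuous[OF green_acd(2)[OF h]])
qed

text \<open>In the first derivative the contributions of the moving limits cancel; in the second
  they combine through the Wronskian to -h.\<close>

lemma green_DERIV:
 assumes h: "green_adm n C h" and c: "continuous_on {0<..} h" and r: "0 < r"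
 shows "DERIV (green n h) r :> green1 n h r"
  "DERIV (green1 n h) r :> kk n r * green n h r - green1 n h r / r - h r"
proof -
 let ?a = "\<lambda>r. LBINT s:{0<..<r}. phi n s * h s * s" and ?b = "\<lambda>r. LBINT s:{r<..}. psi n s * h s * s"
 have cp: "continuous_on {0<..} (phi n)" "continuous_on {0<..} (psi n)"
  using phi_DERIV(1)[of _ n] psi_DERIV(1)[of _ n] by (auto intro!: continuous_at_imp_continuous_on DERIV_isCont)
 have a: "DERIV ?a r :> phi n r * h r * r"
  by (rule acd_DERIV[OF green_acd(1)[OF h] _ r]) (intro continuous_intros cp c)
 have b: "DERIV ?b r :> - (psi n r * h r * r)"
  by (rule acd_DERIV[OF green_acd(2)[OF h] _ r]) (intro continuous_intros cp c)
 have "DERIV (green n h) r :> (psi1 n r * ?a r + phi n r * h r * r * psi n r) + (phi1 n r * ?b r + - (psi n r * h r * r) * phi n r)"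
  unfolding green_def[abs_def] by (intro DERIV_add DERIV_mult a b phi_DERIV[OF r] psi_DERIV[OF r])
 then show "DERIV (green n h) r :> green1 n h r" by (simp add: green1_def mult_ac)
 have "DERIV (green1 n h) r :> ((kk n r * psi n r - psi1 n r / r) * ?a r + phi n r * h r * r * psi1 n r) + ((kk n r * phi n r - phi1 n r / r) * ?b r + - (psi n r * h r * r) * phi1 n r)"
  unfolding green1_def[abs_def] by (intro DERIV_add DERIV_mult a b phi_DERIV[OF r] psi_DERIV[OF r])
 moreover have "((kk n r * psi n r - psi1 n r / r) * ?a r + phi n r * h r * r * psi1 n r) + ((kk n r * phi n r - phi1 n r / r) * ?b r + - (psi n r * h r * r) * phi1 n r)
  = kk n r * green n h r - green1 n h r / r - h r * (r * (psi n r * phi1 n r - phi n r * psi1 n r))"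
  by (simp add: green_def green1_def algebra_simps add_divide_distrib)
 ultimately show "DERIV (green1 n h) r :> kk n r * green n h r - green1 n h r / r - h r"
  using wronskian[OF r, of n] by simp
qed

lemma green_pos:
 assumes h: "green_adm n C h" and c: "continuous_on {0<..} h" and r1: "0 < r1" "0 < h r1" and r: "0 < r"
 shows "0 < green n h r"
proof -
 have cp: "continuous_on {0<..} (phi n)" "continuous_on {0<..} (psi n)"
  using phi_DERIV(1)[of _ n] psi_DERIV(1)[of _ n] by (auto intro!: continuous_at_imp_continuous_on DERIV_isCont)
 have h0: "0 <= h s" if "0 < s" for s using h that by (auto simp: green_adm_def)
 \<comment> \<open>A point of positivity different from the splitting radius r, so that it lies in
   one of the two open intervals of integration.\<close>
 obtain r2 where r2: "0 < r2" "0 < h r2" "r2 ~= r"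
 proof (cases "r1 = r")
  case False then show ?thesis using that r1 by blast
 next
  case True
  have "isCont h r1" using c r1 by (simp add: continuous_on_eq_continuous_at)
  then have "\<forall>\<^sub>F x in at r1. 0 < h x" using r1(2) by (auto simp: isCont_def dest: order_tendstoD(1))
  then have "\<forall>\<^sub>F x in at_right r1. 0 < h x" by (simp add: filterlim_at_split eventually_at_split)
  then obtain b where "b > r1" "!!y. r1 < y ==> y < b ==> 0 < h y" unfolding eventually_at_right_field by blast
  then show ?thesis using that[of "(r1 + b) / 2"] r1 True by auto
 qed
 have a0: "0 <= (LBINT s:{0<..<r}. phi n s * h s * s)"
  unfolding set_lebesgue_integral_def using h0 phi_pos[of _ n] by (intro Bochner_Integration.integral_nonneg_AE AE_I2) (auto simp: indicator_def less_imp_le)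
 have b0: "0 <= (LBINT s:{r<..}. psi n s * h s * s)"
  unfolding set_lebesgue_integral_def using h0 psi_pos[of _ n] r by (intro Bochner_Integration.integral_nonneg_AE AE_I2) (auto simp: indicator_def less_imp_le)
 show ?thesis
 proof (cases "r2 < r")
  case True
  have "0 < (LBINT s:{0<..<r}. phi n s * h s * s)"
  proof (rule set_integral_pos[where ?x0.0=r2, OF green_integrable(1)[OF h r]])
   show "continuous_on {0<..<r} (\<lambda>s. phi n s * h s * s)"
    by (intro continuous_intros continuous_on_subset[OF cp(1)] continuous_on_subset[OF c]) auto
   show "0 <= phi n s * h s * s" if "s \<in> {0<..<r}" for s using that h0[of s] phi_pos[of s n] by auto
   show "0 < phi n r2 * h r2 * r2" using r2 phi_pos[of r2 n] by simp
  qed (use True r2 in auto)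
  then have "0 < psi n r * (LBINT s:{0<..<r}. phi n s * h s * s)" using psi_pos[OF r, of n] by simp
  then show ?thesis unfolding green_def using b0 phi_pos[OF r, of n] by (intro add_pos_nonneg) auto
 next
  case False
  have "0 < (LBINT s:{r<..}. psi n s * h s * s)"
  proof (rule set_integral_pos[where ?x0.0=r2, OF green_integrable(2)[OF h r]])
   show "continuous_on {r<..} (\<lambda>s. psi n s * h s * s)"
    using r by (intro continuous_intros continuous_on_subset[OF cp(2)] continuous_on_subset[OF c]) auto
   show "0 <= psi n s * h s * s" if "s \<in> {r<..}" for s using that h0[of s] psi_pos[of s n] r by auto
   show "0 < psi n r2 * h r2 * r2" using r2 psi_pos[of r2 n] by simp
  qed (use False r2 in auto)
  then have "0 < phi n r * (LBINT s:{r<..}. psi n s * h s * s)" using phi_pos[OF r, of n] by simp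
  then show ?thesis unfolding green_def using a0 psi_pos[OF r, of n] by (intro add_nonneg_pos) auto
 qed
qed

text \<open>C kk is integrable against both kernels, which makes dominated convergence available;
  the two-sided bounds pass to the limit source.\<close>

lemma green_dominated:
 assumes h: "!!j. green_adm n C (h j)" and lim: "!!s. 0 < s ==> (\<lambda>j. h j s) \<longlonglongrightarrow> hl s" and r: "0 < r"
 shows "green_adm n C hl" "(\<lambda>j. green n (h j) r) \<longlonglongrightarrow> green n hl r"
proof -
 show adm: "green_adm n C hl"
  unfolding green_adm_def
 proof (intro conjI allI impI)
  show "measurable_pos hl"
  proof (rule borel_measurable_LIMSEQ_real)
   show "(\<lambda>r. indicator {0<..} r *\<^sub>R h j r) \<in> borel_measurable borel" for j using h[of j] by (simp add: green_adm_def)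
   show "(\<lambda>j. indicator {0<..} r *\<^sub>R h j r) \<longlonglongrightarrow> indicator {0<..} r *\<^sub>R hl r" for r
    using lim[of r] by (cases "0 < r") auto
  qed
  fix s :: real assume s: "0 < s"
  show "0 <= hl s" by (rule LIMSEQ_le_const[OF lim[OF s]]) (use h s in \<open>auto simp: green_adm_def\<close>)
  show "hl s <= C * kk n s" by (rule LIMSEQ_le_const2[OF lim[OF s]]) (use h s in \<open>auto simp: green_adm_def\<close>)
 qed
 have D: "(\<lambda>j. LBINT s:S. w s * h j s * s) \<longlonglongrightarrow> (LBINT s:S. w s * hl s * s)"
  if S: "S \<subseteq> {0<..}" and w: "!!s. 0 < s ==> 0 < w s"
   and I: "!!h. green_adm n C h ==> set_integrable lborel S (\<lambda>s. w s * h s * s)" and k: "set_integrable lborel S (\<lambda>s. w s * kk n s * s)" for S w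
  unfolding set_lebesgue_integral_def
 proof (rule integral_dominated_convergence)
  show "integrable lborel (\<lambda>s. C * (indicator S s *\<^sub>R (w s * kk n s * s)))" using k by (simp add: set_integrable_def)
  show "(\<lambda>s. indicator S s *\<^sub>R (w s * hl s * s)) \<in> borel_measurable lborel" using I[OF adm] unfolding set_integrable_def by (rule borel_measurable_integrable)
  show "(\<lambda>s. indicator S s *\<^sub>R (w s * h j s * s)) \<in> borel_measurable lborel" for j using I[OF h] unfolding set_integrable_def by (rule borel_measurable_integrable)
  show "AE s in lborel. (\<lambda>j. indicator S s *\<^sub>R (w s * h j s * s)) \<longlonglongrightarrow> indicator S s *\<^sub>R (w s * hl s * s)"
  proof (rule AE_I2)
   fix s :: real
   show "(\<lambda>j. indicator S s *\<^sub>R (w s * h j s * s)) \<longlonglongrightarrow> indicator S s *\<^sub>R (w s * hl s * s)"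
   proof (cases "s \<in> S")
    case True
    then show ?thesis using S by (auto intro!: tendsto_intros lim)
   qed simp
  qed
  show "AE s in lborel. norm (indicator S s *\<^sub>R (w s * h j s * s)) <= C * (indicator S s *\<^sub>R (w s * kk n s * s))" for j
  proof (rule AE_I2)
   fix s :: real
   show "norm (indicator S s *\<^sub>R (w s * h j s * s)) <= C * (indicator S s *\<^sub>R (w s * kk n s * s))"
   proof (cases "s \<in> S")
    case True
    then have s: "0 < s" using S by auto
    have hx: "0 <= h j s" "h j s <= C * kk n s" using h[of j] s by (auto simp: green_adm_def)
    have "w s * h j s * s <= w s * (C * kk n s) * s" using hx w[OF s] s by (intro mult_right_mono mult_left_mono) auto
    moreover have "0 <= w s * h j s * s" using hx w[OF s] s by simp
    ultimately show ?thesis using True by (simp add: mult_ac)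
   qed simp
  qed
 qed
 have "(\<lambda>j. LBINT s:{0<..<r}. phi n s * h j s * s) \<longlonglongrightarrow> (LBINT s:{0<..<r}. phi n s * hl s * s)"
  by (rule D) (use phi_pos green_integrable(1)[OF _ r] green_kk(1)[OF r, of n] in auto)
 moreover have "(\<lambda>j. LBINT s:{r<..}. psi n s * h j s * s) \<longlonglongrightarrow> (LBINT s:{r<..}. psi n s * hl s * s)"
  by (rule D) (use psi_pos green_integrable(2)[OF _ r] green_kk(2)[OF r, of n] r in auto)
 ultimately show "(\<lambda>j. green n (h j) r) \<longlonglongrightarrow> green n hl r"
  unfolding green_def by (intro tendsto_intros)
qed

text \<open>The last bound is the boundary estimate for Picone's identity with an iterate: r u'/u
  grows at most like r^2. Up to r = 1 the inner integral is of order r^2 while \<open>green\<close>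
  is bounded below; from r = 1 on, the lower bound for \<open>JJ 0\<close> controls the inner
  integral by its own term in \<open>green\<close>.\<close>

lemma green0_bounds:
 assumes h: "green_adm 0 C h" and c: "continuous_on {0<..} h" and p: "!!r. 0 < r ==> 0 < h r"
 obtains b K where "0 < b" "!!r. 0 < r ==> r <= 1 ==> b <= green 0 h r"
  "!!r. 0 < r ==> \<bar>r * green1 0 h r\<bar> <= K * r^2 * green 0 h r"
proof -
 let ?a = "\<lambda>r. LBINT s:{0<..<r}. phi 0 s * h s * s" and ?b = "\<lambda>r. LBINT s:{r<..}. psi 0 s * h s * s"
 have cp: "continuous_on {0<..} (psi 0)"
  using psi_DERIV(1)[of _ 0] by (auto intro!: continuous_at_imp_continuous_on DERIV_isCont)
 have p0: "0 <= h s" if "0 < s" for s using p[OF that] by simp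
 have C0: "0 < C" using h p[of 1] kk_ge(1)[of 1 0] unfolding green_adm_def by (smt (verit) mult_nonneg_nonneg mult_nonpos_nonneg)
 have b: "0 < ?b 1"
  by (rule set_integral_pos[where ?x0.0=2, OF green_integrable(2)[OF h]])
   (use p p0 psi_pos in \<open>auto intro!: continuous_intros continuous_on_subset[OF cp] continuous_on_subset[OF c] simp: less_imp_le\<close>)
 have a0: "0 <= ?a r" if "0 < r" for r
  unfolding set_lebesgue_integral_def using p0 phi_pos[of _ 0] by (intro Bochner_Integration.integral_nonneg_AE AE_I2) (auto simp: indicator_def less_imp_le)
 have b0: "0 <= ?b r" if "0 < r" for r
  unfolding set_lebesgue_integral_def using p0 psi_pos[of _ 0] that by (intro Bochner_Integration.integral_nonneg_AE AE_I2) (auto simp: indicator_def less_imp_le)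
 have low: "?b 1 <= green 0 h r" if r: "0 < r" "r <= 1" for r
 proof -
  have "?b 1 <= ?b r"
   by (rule set_integral_mono_subset[OF green_integrable(2)[OF h r(1)]]) (use r p0 psi_pos[of _ 0] in \<open>auto simp: less_imp_le\<close>)
  also have "1 * ?b r <= phi 0 r * ?b r" using b0[OF r(1)] by (intro mult_right_mono) (auto simp: phi_def)
  finally show ?thesis unfolding green_def using a0[OF r(1)] psi_pos[OF r(1), of 0] by (simp add: add_increasing)
 qed
 have up: "\<bar>r * green1 0 h r\<bar> <= 2 * r^2 * green 0 h r + ?a r / phi 0 r" if r: "0 < r" for r
 proof -
  have "r * green1 0 h r = 2 * r^2 * green 0 h r - ?a r / phi 0 r"
   using r phi_pos[OF r, of 0] by (simp add: green1_def green_def psi1_def psi_def phi1_def algebra_simps power2_eq_square)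
  moreover have "0 <= 2 * r^2 * green 0 h r" using green_nonneg[OF h r] by simp
  moreover have "0 <= ?a r / phi 0 r" using a0[OF r] phi_pos[OF r, of 0] by simp
  ultimately show ?thesis by linarith
 qed
 define K where "K = 2 + max 8 (2 * C / ?b 1)"
 have "?a r / phi 0 r <= max 8 (2 * C / ?b 1) * r^2 * green 0 h r" if r: "0 < r" for r
 proof (cases "r <= 1")
  case True
  have "?a r <= (LBINT s:{0<..<r}. C * (phi 0 s * kk 0 s * s))"
  proof (rule set_integral_mono[OF green_integrable(1)[OF h r]])
   show "set_integrable lborel {0<..<r} (\<lambda>s. C * (phi 0 s * kk 0 s * s))" using green_kk(1)[OF r, of 0] by simp
   fix s assume "s \<in> {0<..<r}"
   then have s: "0 < s" by simp
   have "phi 0 s * h s * s <= phi 0 s * (C * kk 0 s) * s"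
    using h s phi_pos[OF s, of 0] by (intro mult_right_mono mult_left_mono) (auto simp: green_adm_def)
   then show "phi 0 s * h s * s <= C * (phi 0 s * kk 0 s * s)" by (simp add: mult_ac)
  qed
  also have "... = C * (r * phi1 0 r)" using green_kk(3)[OF r, of 0] by simp
  also have "... = (2 * C * r^2) * phi 0 r" by (simp add: phi1_def power2_eq_square)
  finally have "?a r / phi 0 r <= 2 * C * r^2" using phi_pos[OF r, of 0] by (simp add: pos_divide_le_eq)
  also have "... = (2 * C / ?b 1) * r^2 * ?b 1" using b by simp
  also have "... <= max 8 (2 * C / ?b 1) * r^2 * green 0 h r"
   using low[OF r True] b by (intro mult_mono mult_right_mono) auto
  finally show ?thesis .
 next
  case False
  then have r1: "1 <= r" by simp
  have "exp (- 2 * r^2) / (8 * r^2) <= JJ 0 r" by (rule JJ_ge[OF r1])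
  then have "(phi 0 r)^2 * (exp (- 2 * r^2) / (8 * r^2)) <= (phi 0 r)^2 * JJ 0 r" by (intro mult_left_mono) auto
  moreover have "(phi 0 r)^2 * exp (- 2 * r^2) = 1"
   by (simp add: phi_def power2_eq_square flip: exp_add)
  ultimately have "1 / (8 * r^2) <= (phi 0 r)^2 * JJ 0 r" by simp
  then have "1 <= (8 * r^2) * ((phi 0 r)^2 * JJ 0 r)" using r by (simp add: pos_divide_le_eq mult_ac)
  then have "?a r * 1 <= ?a r * ((8 * r^2) * ((phi 0 r)^2 * JJ 0 r))" using a0[OF r] by (intro mult_left_mono)
  then have "?a r * 1 <= ((8 * r^2) * (psi 0 r * ?a r)) * phi 0 r" by (simp add: psi_def power2_eq_square mult_ac)
  then have "?a r / phi 0 r <= (8 * r^2) * (psi 0 r * ?a r)" using phi_pos[OF r, of 0] by (simp add: pos_divide_le_eq)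
  also have "... <= (8 * r^2) * green 0 h r" unfolding green_def using b0[OF r] phi_pos[OF r, of 0] by (intro mult_left_mono) auto
  also have "... <= (max 8 (2 * C / ?b 1) * r^2) * green 0 h r" using green_nonneg[OF h r] by (intro mult_right_mono) auto
  finally show ?thesis .
 qed
 then have "\<bar>r * green1 0 h r\<bar> <= K * r^2 * green 0 h r" if "0 < r" for r
  using up[OF that] that by (simp add: K_def algebra_simps) (smt (verit))
 then show ?thesis using that[OF b low] by blast
qed


section \<open>Monotone iteration\<close>

text \<open>Right-hand side after adding \<open>kk\<close> times the unknown to the equation. For
  values in [0,1] the added potential makes it increasing in its own unknown, and competition makes
  it decreasing in the other; the same holds for \<open>HM\<close> when g <= 1.\<close>

definition HF :: "nat => real => real => real => real" where
 "HF n r x y = (kk n r - (real n)^2 / r^2 + (1 - x^2 - y^2)) * x"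
definition HM :: "real => real => real => real => real" where
 "HM g r x y = (kk 0 r - g + (1 - x^2 - y^2)) * y"

text \<open>The difference quotient of t (K - t^2 - p) is K - p - (a^2 + a b + b^2), at least 4 - 1
  - 3 = 0. This is the origin of the margin 4 in \<open>kk_ge\<close>.\<close>

lemma cubic_mono:
 fixes a b p q K :: real
 assumes "0 <= a" "a <= b" "b <= 1" "q <= p" "p <= 1" "4 <= K"
 shows "(K - a^2 - p) * a <= (K - b^2 - q) * b"
proof -
 have "a * a <= 1 * 1" "a * b <= 1 * 1" "b * b <= 1 * 1" using assms by (intro mult_mono; simp)+
 then have "0 <= (b - a) * (K - p - (a * a + a * b + b * b))" using assms by (intro mult_nonneg_nonneg) auto
 moreover have "0 <= (p - q) * b" using assms by simp
 moreover have "(K - b^2 - q) * b - (K - a^2 - p) * a = (b - a) * (K - p - (a * a + a * b + b * b)) + (p - q) * b"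
  by (simp add: power2_eq_square algebra_simps)
 ultimately show ?thesis by linarith
qed

lemma HF_mono:
 assumes "0 < r" "0 <= x" "x <= x'" "x' <= 1" "0 <= y'" "y' <= y" "y <= 1"
 shows "HF n r x y <= HF n r x' y'"
proof -
 have "(kk n r - (real n)^2 / r^2 + 1 - x^2 - y^2) * x <= (kk n r - (real n)^2 / r^2 + 1 - x'^2 - y'^2) * x'"
  using assms kk_ge(2)[of r n] by (intro cubic_mono) (auto intro: power_mono power_le_one)
 then show ?thesis by (simp add: HF_def algebra_simps)
qed

lemma HM_mono:
 assumes "0 < r" "g <= 1" "0 <= y" "y <= y'" "y' <= 1" "0 <= x'" "x' <= x" "x <= 1"
 shows "HM g r x y <= HM g r x' y'"
proof -
 have "(kk 0 r - g + 1 - y^2 - x^2) * y <= (kk 0 r - g + 1 - y'^2 - x'^2) * y'"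
  using assms kk_ge(1)[of r 0] by (intro cubic_mono) (auto intro: power_mono power_le_one)
 then show ?thesis by (simp add: HM_def algebra_simps)
qed

lemma HF_bounds:
 assumes "0 < r" "0 <= x" "x <= 1" "0 <= y" "y <= 1"
 shows "0 <= HF n r x y" "HF n r x y <= kk n r"
proof -
 show "0 <= HF n r x y" using HF_mono[of r 0 x y y n] assms by (simp add: HF_def)
 have "HF n r x y <= HF n r 1 0" using assms by (intro HF_mono) auto
 also have "... <= kk n r" by (simp add: HF_def)
 finally show "HF n r x y <= kk n r" .
qed

lemma HM_bounds:
 assumes "0 < r" "0 <= g" "g <= 1" "0 <= x" "x <= 1" "0 <= y" "y <= 1"
 shows "0 <= HM g r x y" "HM g r x y <= kk 0 r" "0 < y ==> 0 < HM g r x y"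
proof -
 show "0 <= HM g r x y" using HM_mono[of r g 0 y x x] assms by (simp add: HM_def)
 have "HM g r x y <= HM g r 0 1" using assms by (intro HM_mono) auto
 also have "... <= kk 0 r" using assms by (simp add: HM_def)
 finally show "HM g r x y <= kk 0 r" .
 assume y: "0 < y"
 have "x^2 <= 1" "y^2 <= 1" using assms by (auto intro: power_le_one)
 then have "0 < kk 0 r - g + (1 - x^2 - y^2)" using kk_ge(1)[of r 0] assms by linarith
 then show "0 < HM g r x y" using y by (simp add: HM_def)
qed

lemma HF_adm:
 assumes c: "continuous_on {0<..} f" "continuous_on {0<..} m"
  and b: "!!r. 0 < r ==> 0 <= f r \<and> f r <= 1 \<and> 0 <= m r \<and> m r <= 1"
 shows "green_adm n 1 (\<lambda>r. HF n r (f r) (m r))" "continuous_on {0<..} (\<lambda>r. HF n r (f r) (m r))"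
proof -
 show c: "continuous_on {0<..} (\<lambda>r. HF n r (f r) (m r))"
  unfolding HF_def kk_def using c by (intro continuous_intros) auto
 show "green_adm n 1 (\<lambda>r. HF n r (f r) (m r))"
  unfolding green_adm_def
 proof (intro conjI allI impI)
  show "measurable_pos (\<lambda>r. HF n r (f r) (m r))"
   using c by (intro borel_measurable_continuous_on_indicator) auto
  fix r :: real assume r: "0 < r"
  show "0 <= HF n r (f r) (m r)" "HF n r (f r) (m r) <= 1 * kk n r"
   using HF_bounds[of r "f r" "m r" n] b[OF r] r by auto
 qed
qed

lemma HM_adm:
 assumes g: "0 <= g" "g <= 1" and c: "continuous_on {0<..} f" "continuous_on {0<..} m"
  and b: "!!r. 0 < r ==> 0 <= f r \<and> f r <= 1 \<and> 0 <= m r \<and> m r <= 1"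
 shows "green_adm 0 1 (\<lambda>r. HM g r (f r) (m r))" "continuous_on {0<..} (\<lambda>r. HM g r (f r) (m r))"
proof -
 show c: "continuous_on {0<..} (\<lambda>r. HM g r (f r) (m r))"
  unfolding HM_def kk_def using c by (intro continuous_intros) auto
 show "green_adm 0 1 (\<lambda>r. HM g r (f r) (m r))"
  unfolding green_adm_def
 proof (intro conjI allI impI)
  show "measurable_pos (\<lambda>r. HM g r (f r) (m r))"
   using c by (intro borel_measurable_continuous_on_indicator) auto
  fix r :: real assume r: "0 < r"
  show "0 <= HM g r (f r) (m r)" "HM g r (f r) (m r) <= 1 * kk 0 r"
   using HM_bounds[of r g "f r" "m r"] b[OF r] r g by auto
 qed
qed

text \<open>\<open>\<surd>g F(\<surd>g r)\<close> solves the first equation with the constant \<open>m = \<surd>(1 - g)\<close>, which in turn is a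
 supersolution of the second one. Starting from this pair, the competitive system is iterated
 with \<open>f\<close> increasing and \<open>m\<close> decreasing.\<close>

context
 fixes n :: nat and g :: real and F F' F'' :: "real => real"
 assumes n: "1 <= n" and g: "0 < g" "g < 1"
  and F: "nice ((real n)^2) 1 F F' F'' (\<lambda>r. 0) (\<lambda>r. 0) (\<lambda>r. 0)" and Flim: "(F \<longlongrightarrow> 1) at_top"
begin

definition "f0 r = sqrt g * F (sqrt g * r)"
definition "\<mu> = sqrt (1 - g)"

lemma mu: "0 < \<mu>" "\<mu> <= 1" "\<mu>^2 = 1 - g"
 using g by (auto simp: \<mu>_def real_sqrt_le_1_iff)

lemma sg: "0 < sqrt g" "sqrt g < 1" "sqrt g * sqrt g = g" using g by auto

lemma f0_bounds: "0 < r ==> 0 < f0 r \<and> f0 r <= 1"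
proof -
 assume r: "0 < r"
 have "0 < F (sqrt g * r)" "F (sqrt g * r) <= 1" using F sg r by (auto simp: nice_def)
 then show ?thesis using sg mult_mono[of "sqrt g" 1 "F (sqrt g * r)" 1] by (simp add: f0_def)
qed

lemma f0_continuous: "continuous_on {0<..} f0"
proof -
 have "continuous_on {0<..} F" using F GLsol_cont(1) by (auto simp: nice_def)
 then have "continuous_on {0<..} (\<lambda>r. F (sqrt g * r))"
  by (rule continuous_on_compose2[OF _ continuous_on_mult[OF continuous_on_const continuous_on_id]]) (use sg in auto)
 then show ?thesis unfolding f0_def[abs_def] by (rule continuous_on_mult[OF continuous_on_const])
qed

text \<open>Rescaling turns 1 - F^2 into g - f0^2 = 1 - mu^2 - f0^2, so f0 is a fixed point of the
  Green map of the f equation when m is the constant mu. The bounds in \<open>nice\<close> give the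
  end conditions of \<open>green_identity\<close>.\<close>

lemma f0_green: 
 assumes r: "0 < r"
 shows "green n (\<lambda>r. HF n r (f0 r) \<mu>) r = f0 r"
proof -
 have GS: "GLsol ((real n)^2) 1 F F' F'' (\<lambda>r. 0) (\<lambda>r. 0) (\<lambda>r. 0)" using F by (simp add: nice_def)
 obtain C where C: "C > 0" "!!r. 0 < r ==> (F' r)^2 * r <= C / (1 + r^2)"
 proof -
  from F obtain C where "C > 0" and "\<forall>r>0. (F r)^2 <= C * r \<and> (F' r)^2 * r <= C / (1 + r^2) \<and> (0::real)^2 * r <= C / (1 + r^2) \<and> (0::real)^2 * r <= C / (1 + r^2) \<and> 1 - (F r)^2 <= C / (1 + r^2) \<and> (0::real)^2 <= C"
   unfolding nice_def by force
  then show ?thesis by (intro that[of C]) auto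
 qed
 define u' where "u' r = sqrt g * (F' (sqrt g * r) * sqrt g)" for r
 define u'' where "u'' r = sqrt g * (F'' (sqrt g * r) * sqrt g * sqrt g)" for r
 have lin: "DERIV (\<lambda>r. sqrt g * r) r :> sqrt g" for r by (auto intro!: derivative_eq_intros)
 have sp: "0 < sqrt g * r" if "0 < r" for r using sg that by simp
 have d: "DERIV f0 r :> u' r" if "0 < r" for r
  unfolding f0_def u'_def by (intro DERIV_cmult DERIV_chain2[OF _ lin] GLsolD(1)[OF GS sp[OF that]])
 have d': "DERIV u' r :> u'' r" if "0 < r" for r
  unfolding u'_def u''_def by (intro DERIV_cmult DERIV_cmult_right DERIV_chain2[OF _ lin] GLsolD(2)[OF GS sp[OF that]])
 have h: "HF n r (f0 r) \<mu> = kk n r * f0 r - (u'' r + u' r / r)" if r: "0 < r" for r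
 proof -
  define x where "x = sqrt g * r"
  have x: "0 < x" using sp[OF r] by (simp add: x_def)
  have "u'' r + u' r / r = sqrt g * (g * (F'' x + F' x / x))"
  proof -
   have sg3: "sqrt g * (y * sqrt g) = g * y" "sqrt g * (sqrt g * y) = g * y" for y using sg(3) by (metis mult.assoc mult.commute)+
   have "sqrt g * (F' x * sqrt g) / r = sqrt g * (g * (F' x / x))"
    using r sg g by (simp add: x_def field_simps)
   then show ?thesis unfolding u''_def u'_def x_def[symmetric] using g by (simp add: distrib_left mult_ac sg3)
  qed
  also have "F'' x + F' x / x = ((real n)^2 / x^2 - (1 - (F x)^2)) * F x" using GLsolD(5)[OF GS x] by simp
  also have "sqrt g * (g * (((real n)^2 / x^2 - (1 - (F x)^2)) * F x)) = ((real n)^2 / r^2 - (g - (f0 r)^2)) * f0 r"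
  proof -
   have "g * ((real n)^2 / x^2) = (real n)^2 / r^2" using g by (simp add: x_def power_mult_distrib)
   moreover have "(f0 r)^2 = g * (F x)^2" using g by (simp add: f0_def x_def power_mult_distrib)
   ultimately have "g * ((real n)^2 / x^2 - (1 - (F x)^2)) = (real n)^2 / r^2 - (g - (f0 r)^2)"
    by (simp add: right_diff_distrib)
   then show ?thesis by (simp add: f0_def x_def mult_ac)
  qed
  finally have "u'' r + u' r / r = ((real n)^2 / r^2 - (g - (f0 r)^2)) * f0 r" .
  then show ?thesis by (simp add: HF_def mu(3) algebra_simps)
 qed
 have sq: "(r * u' r)^2 <= C * (sqrt g * r) / (1 + (sqrt g * r)^2)" if r: "0 < r" for r
 proof -
  define x where "x = sqrt g * r"
  have x: "0 < x" using sp[OF r] by (simp add: x_def)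
  have "r * u' r = sqrt g * (x * F' x)" by (simp add: u'_def x_def mult_ac)
  then have "(r * u' r)^2 = g * (x * ((F' x)^2 * x))" using g by (simp add: power_mult_distrib) (simp add: power2_eq_square)
  also have "... <= 1 * (x * (C / (1 + x^2)))" using C(2)[OF x] g x by (intro mult_mono mult_left_mono) auto
  finally show ?thesis by (simp add: x_def mult_ac)
 qed
 have p1: "1 <= 1 + (sqrt g * r)^2" for r by simp
 have sq0: "(r * u' r)^2 <= C * (sqrt g * r)" if r: "0 < r" for r
 proof -
  have "C * (sqrt g * r) / (1 + (sqrt g * r)^2) <= C * (sqrt g * r) / 1"
   using p1[of r] C(1) sp[OF r] by (intro divide_left_mono) (auto intro: add_pos_nonneg)
  then show ?thesis using sq[OF r] by simp
 qed
 have z: "((\<lambda>r. r * u' r) \<longlongrightarrow> 0) (at_right 0)"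
 proof (rule Lim_null_comparison)
  have "\<forall>\<^sub>F r in at_right (0::real). 0 < r" by (auto simp: eventually_at_right_field intro!: exI[of _ 1])
  then show "\<forall>\<^sub>F r in at_right 0. norm (r * u' r) <= sqrt (C * (sqrt g * r))"
   by eventually_elim (use sq0 in \<open>simp add: real_le_rsqrt\<close>)
  have "((\<lambda>r. sqrt (C * (sqrt g * r))) \<longlongrightarrow> sqrt (C * (sqrt g * 0))) (at_right 0)" by (intro tendsto_intros)
  then show "((\<lambda>r. sqrt (C * (sqrt g * r))) \<longlongrightarrow> 0) (at_right 0)" by simp
 qed
 have t: "\<forall>\<^sub>F r in at_top. \<bar>r * u' r\<bar> <= (C + 1) * r^2"
  using eventually_ge_at_top[of 1]
 proof eventually_elim
  case (elim r)
  have r: "0 < r" using elim by simp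
  have "(r * u' r)^2 <= C * (sqrt g * r)" by (rule sq0[OF r])
  also have "C * (sqrt g * r) <= (C + 1) * (1 * r)" using C(1) sg r by (intro mult_mono) auto
  also have "... <= ((C + 1) * (C + 1)) * (r^2 * r^2)"
  proof (rule mult_mono)
   show "C + 1 <= (C + 1) * (C + 1)" using C(1) by (simp add: algebra_simps)
   have "r <= r^2" using elim by (simp add: power2_eq_square)
   moreover have "1 <= r^2" using elim by (simp add: one_le_power)
   ultimately show "1 * r <= r^2 * r^2" using r by (intro mult_mono) auto
  qed (use C(1) r in auto)
  also have "... = ((C + 1) * r^2)^2" by (simp add: power2_eq_square)
  finally have "\<bar>r * u' r\<bar> <= \<bar>(C + 1) * r^2\<bar>" by (simp only: abs_le_square_iff)
  then show ?case using C(1) by (simp add: abs_mult)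
 qed
 have b: "\<bar>f0 r\<bar> <= C + 1" if "0 < r" for r using f0_bounds[OF that] C(1) by simp
 have b2: "0 <= f0 r \<and> f0 r <= 1 \<and> 0 <= \<mu> \<and> \<mu> <= 1" if "0 < r" for r using f0_bounds[OF that] mu by simp
 have hc: "continuous_on {0<..} (\<lambda>r. HF n r (f0 r) \<mu>)" by (rule HF_adm(2)[OF f0_continuous continuous_on_const b2])
 have h0: "0 <= HF n r (f0 r) \<mu>" if "0 < r" for r using HF_bounds(1)[OF that] b2[OF that] by simp
 show ?thesis by (rule green_identity(4)[OF d d' h h0 hc z b t r])
qed

fun it :: "nat => (real => real) \<times> (real => real)" where
 "it 0 = (f0, \<lambda>r. \<mu>)"
| "it (Suc j) = (green n (\<lambda>r. HF n r (fst (it j) r) (snd (it j) r)), green 0 (\<lambda>r. HM g r (fst (it j) r) (snd (it j) r)))"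

abbreviation "fs j \<equiv> fst (it j)"
abbreviation "ms j \<equiv> snd (it j)"
abbreviation "hfs j \<equiv> (\<lambda>r. HF n r (fs j r) (ms j r))"
abbreviation "hms j \<equiv> (\<lambda>r. HM g r (fs j r) (ms j r))"

lemma it_invariant:
 "continuous_on {0<..} (fs j) \<and> continuous_on {0<..} (ms j) \<and> (\<forall>r>0. 0 <= fs j r \<and> fs j r <= 1 \<and> 0 < ms j r \<and> ms j r <= 1)"
proof (induction j)
 case 0
 show ?case using f0_continuous f0_bounds mu by (auto simp: less_imp_le)
next
 case (Suc j)
 have c: "continuous_on {0<..} (fs j)" "continuous_on {0<..} (ms j)" using Suc by auto
 have b: "0 <= fs j r \<and> fs j r <= 1 \<and> 0 <= ms j r \<and> ms j r <= 1" if "0 < r" for r using Suc that by (auto simp: less_imp_le)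
 note af = HF_adm[OF c b, of n] and am = HM_adm[OF _ _ c b, of g]
 have am: "green_adm 0 1 (hms j)" "continuous_on {0<..} (hms j)" using am g by auto
 show ?case
 proof (intro conjI allI impI)
  show "continuous_on {0<..} (fs (Suc j))" using green_continuous[OF af(1)] by simp
  show "continuous_on {0<..} (ms (Suc j))" using green_continuous[OF am(1)] by simp
  fix r :: real assume r: "0 < r"
  show "0 <= fs (Suc j) r" using green_nonneg[OF af(1) r] by simp
  show "fs (Suc j) r <= 1" using green_le[OF af(1) _ _ r, of 1] af(1) by (auto simp: green_adm_def)
  show "ms (Suc j) r <= 1" using green_le[OF am(1) _ _ r, of 1] am(1) by (auto simp: green_adm_def)
  have "0 < hms j 1" using Suc HM_bounds(3)[of 1 g "fs j 1" "ms j 1"] g b[of 1] by auto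
  then show "0 < ms (Suc j) r" using green_pos[OF am _ _ r, of 1] by simp
 qed
qed

lemma it_bounds: "0 < r ==> 0 <= fs j r \<and> fs j r <= 1 \<and> 0 <= ms j r \<and> ms j r <= 1" "0 < r ==> 0 < ms j r"
 using it_invariant[of j] by (auto simp: less_imp_le)

lemma it_adm: "green_adm n 1 (hfs j)" "continuous_on {0<..} (hfs j)" "green_adm 0 1 (hms j)" "continuous_on {0<..} (hms j)"
 using HF_adm[of "fs j" "ms j" n] HM_adm[of g "fs j" "ms j"] it_invariant[of j] it_bounds(1)[of _ j] g by auto

text \<open>The initial step leaves f unchanged by \<open>f0_green\<close> and lowers m; the
  monotonicity of \<open>HF\<close> and \<open>HM\<close> propagates both inequalities.\<close>

lemma it_mono: "0 < r ==> fs j r <= fs (Suc j) r \<and> ms (Suc j) r <= ms j r"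
proof (induction j arbitrary: r)
 case 0
 have "ms (Suc 0) r <= \<mu>"
 proof -
  have "green 0 (hms 0) r <= \<mu>"
  proof (rule green_le[OF it_adm(3) _ _ 0])
   fix s :: real assume s: "0 < s"
   \<comment> \<open>mu^2 = 1 - g cancels g, so only the favourable term -f0^2 remains and the
     constant mu is a supersolution.\<close>
   have "hms 0 s = (kk 0 s - (f0 s)^2) * \<mu>" by (simp add: HM_def mu(3))
   also have "... <= kk 0 s * \<mu>" using mu by (intro mult_right_mono) auto
   finally show "hms 0 s <= \<mu> * kk 0 s" by (simp add: mult.commute)
  qed (use mu in auto)
  then show ?thesis by simp
 qed
 then show ?case using f0_green[OF 0] by simp
next
 case (Suc j)
 have "green n (hfs j) r <= green n (hfs (Suc j)) r"
  by (rule green_mono[OF it_adm(1) it_adm(1) _ Suc.prems]) (rule HF_mono; use Suc.IH it_bounds in blast)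
 moreover have "green 0 (hms (Suc j)) r <= green 0 (hms j) r"
  by (rule green_mono[OF it_adm(3) it_adm(3) _ Suc.prems]) (rule HM_mono; use g Suc.IH it_bounds in \<open>auto simp del: it.simps\<close>)
 ultimately show ?case by simp
qed

section \<open>The limit of the iteration\<close>

definition "fl r = lim (\<lambda>j. fs j r)"
definition "ml r = lim (\<lambda>j. ms j r)"

lemma it_lim: 
 assumes r: "0 < r"
 shows "(\<lambda>j. fs j r) \<longlonglongrightarrow> fl r" "(\<lambda>j. ms j r) \<longlonglongrightarrow> ml r"
proof -
 have "incseq (\<lambda>j. fs j r)" using it_mono[OF r] by (intro incseq_SucI) blast
 then have "convergent (\<lambda>j. fs j r)"
  using it_bounds(1)[OF r] by (intro Bseq_monoseq_convergent BseqI'[of _ 1]) (auto simp: monoseq_iff)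
 then show "(\<lambda>j. fs j r) \<longlonglongrightarrow> fl r" unfolding fl_def by (simp add: convergent_LIMSEQ_iff)
 have "decseq (\<lambda>j. ms j r)" using it_mono[OF r] by (intro decseq_SucI) blast
 then have "convergent (\<lambda>j. ms j r)"
  using it_bounds(1)[OF r] by (intro Bseq_monoseq_convergent BseqI'[of _ 1]) (auto simp: monoseq_iff)
 then show "(\<lambda>j. ms j r) \<longlonglongrightarrow> ml r" unfolding ml_def by (simp add: convergent_LIMSEQ_iff)
qed

lemma lim_bounds: 
 assumes r: "0 < r"
 shows "0 <= fl r" "fl r <= 1" "0 <= ml r" "ml r <= 1" "f0 r <= fl r" 
proof -
 show "0 <= fl r" by (rule LIMSEQ_le_const[OF it_lim(1)[OF r]]) (use it_bounds(1)[OF r] in auto)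
 show "fl r <= 1" by (rule LIMSEQ_le_const2[OF it_lim(1)[OF r]]) (use it_bounds(1)[OF r] in auto)
 show "0 <= ml r" by (rule LIMSEQ_le_const[OF it_lim(2)[OF r]]) (use it_bounds(1)[OF r] in auto)
 show "ml r <= 1" by (rule LIMSEQ_le_const2[OF it_lim(2)[OF r]]) (use it_bounds(1)[OF r] in auto)
 have "incseq (\<lambda>j. fs j r)" using it_mono[OF r] by (intro incseq_SucI) blast
 from incseq_le[OF this it_lim(1)[OF r], of 0] show "f0 r <= fl r" by simp
qed

definition "hfl r = HF n r (fl r) (ml r)"
definition "hml r = HM g r (fl r) (ml r)"

lemma h_lim:
 assumes r: "0 < r"
 shows "(\<lambda>j. hfs j r) \<longlonglongrightarrow> hfl r" "(\<lambda>j. hms j r) \<longlonglongrightarrow> hml r"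
 unfolding hfl_def hml_def HF_def HM_def by (intro tendsto_intros it_lim[OF r])+

lemma lim_green:
 assumes r: "0 < r"
 shows "green_adm n 1 hfl" "green_adm 0 1 hml" "fl r = green n hfl r" "ml r = green 0 hml r"
proof -
 note Df = green_dominated[of n 1 hfs hfl, OF it_adm(1) h_lim(1) r]
 note Dm = green_dominated[of 0 1 hms hml, OF it_adm(3) h_lim(2) r]
 show "green_adm n 1 hfl" "green_adm 0 1 hml" using Df(1) Dm(1) by auto
 have "(\<lambda>j. fs (Suc j) r) \<longlonglongrightarrow> fl r" using it_lim(1)[OF r] by (rule LIMSEQ_Suc)
 then have "(\<lambda>j. green n (hfs j) r) \<longlonglongrightarrow> fl r" by simp
 then show "fl r = green n hfl r" using Df(2) by (rule LIMSEQ_unique)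
 have "(\<lambda>j. ms (Suc j) r) \<longlonglongrightarrow> ml r" using it_lim(2)[OF r] by (rule LIMSEQ_Suc)
 then have "(\<lambda>j. green 0 (hms j) r) \<longlonglongrightarrow> ml r" by simp
 then show "ml r = green 0 hml r" using Dm(2) by (rule LIMSEQ_unique)
qed

lemma lim_continuous: "continuous_on {0<..} fl" "continuous_on {0<..} ml" "continuous_on {0<..} hfl" "continuous_on {0<..} hml"
proof -
 have a: "green_adm n 1 hfl" "green_adm 0 1 hml" using lim_green[of 1] by auto
 show 1: "continuous_on {0<..} fl" using green_continuous[OF a(1)] by (rule continuous_on_eq) (use lim_green(3) in auto)
 show 2: "continuous_on {0<..} ml" using green_continuous[OF a(2)] by (rule continuous_on_eq) (use lim_green(4) in auto)
 have b: "0 <= fl r \<and> fl r <= 1 \<and> 0 <= ml r \<and> ml r <= 1" if "0 < r" for r using lim_bounds[OF that] by simp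
 show "continuous_on {0<..} hfl" using HF_adm(2)[OF 1 2 b, of n] by (simp add: hfl_def[abs_def])
 show "continuous_on {0<..} hml" using HM_adm(2)[OF _ _ 1 2 b, of g] g by (simp add: hml_def[abs_def])
qed

definition "fl' = green1 n hfl"
definition "fl'' r = kk n r * green n hfl r - green1 n hfl r / r - hfl r"
definition "ml' = green1 0 hml"
definition "ml'' r = kk 0 r * green 0 hml r - green1 0 hml r / r - hml r"

lemma lim_GLsol: "GLsol ((real n)^2) g fl fl' fl'' ml ml' ml''"
 unfolding GLsol_def
proof (intro allI impI)
 fix r :: real assume r: "0 < r"
 have a: "green_adm n 1 hfl" "green_adm 0 1 hml" using lim_green[of 1] by auto
 note df = green_DERIV[OF a(1) lim_continuous(3) r] and dm = green_DERIV[OF a(2) lim_continuous(4) r]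
 have ev: "\<forall>\<^sub>F x in nhds r. 0 < x" using eventually_nhds_in_open[of "{0<..}" r] r by simp
 have 1: "DERIV fl r :> fl' r"
 proof -
  have "\<forall>\<^sub>F x in nhds r. fl x = green n hfl x" using ev by eventually_elim (rule lim_green(3))
  then have "DERIV fl r :> fl' r \<longleftrightarrow> DERIV (green n hfl) r :> fl' r" by (intro DERIV_cong_ev) auto
  then show ?thesis using df(1) by (simp add: fl'_def)
 qed
 have 2: "DERIV ml r :> ml' r"
 proof -
  have "\<forall>\<^sub>F x in nhds r. ml x = green 0 hml x" using ev by eventually_elim (rule lim_green(4))
  then have "DERIV ml r :> ml' r \<longleftrightarrow> DERIV (green 0 hml) r :> ml' r" by (intro DERIV_cong_ev) auto
  then show ?thesis using dm(1) by (simp add: ml'_def)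
 qed
 have 3: "DERIV fl' r :> fl'' r" using df(2) by (simp add: fl'_def fl''_def)
 have 4: "DERIV ml' r :> ml'' r" using dm(2) by (simp add: ml'_def ml''_def)
 have 5: "fl'' r + fl' r / r = ((real n)^2 / r^2 - (1 - (fl r)^2 - (ml r)^2)) * fl r"
  using lim_green(3)[OF r, symmetric] by (simp add: fl''_def fl'_def hfl_def HF_def algebra_simps)
 have 6: "ml'' r + ml' r / r = (g - (1 - (fl r)^2 - (ml r)^2)) * ml r"
  using lim_green(4)[OF r, symmetric] by (simp add: ml''_def ml'_def hml_def HM_def algebra_simps)
 show "DERIV fl r :> fl' r \<and> DERIV fl' r :> fl'' r \<and>
   DERIV ml r :> ml' r \<and> DERIV ml' r :> ml'' r \<and>
   fl'' r + fl' r / r = ((real n)^2 / r^2 - (1 - (fl r)^2 - (ml r)^2)) * fl r \<and>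
   ml'' r + ml' r / r = (g - (1 - (fl r)^2 - (ml r)^2)) * ml r \<and> 0 <= fl r \<and> 0 <= ml r"
  using 1 2 3 4 5 6 lim_bounds[OF r] by simp
qed

text \<open>The Green kernel is strictly positive: one positive value of ml makes the source
  positive somewhere, hence ml positive everywhere, and \<open>green0_bounds\<close> keeps it away
  from zero near the origin. Complete collapse is the only alternative.\<close>

lemma lim_dichotomy: "(\<forall>r>0. ml r = 0) \<or> (\<exists>b>0. (\<forall>r>0. 0 < ml r) \<and> (\<forall>r>0. r <= 1 --> b <= ml r))"
proof (cases "\<exists>r1>0. ml r1 ~= 0")
 case True
 then obtain r1 where r1: "0 < r1" "0 < ml r1" using lim_bounds(3) by (metis less_le)
 have a: "green_adm 0 1 hml" using lim_green[of 1] by auto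
 have hp: "0 < hml r" if "0 < r" "0 < ml r" for r
  using HM_bounds(3)[of r g "fl r" "ml r"] lim_bounds[OF that(1)] that g by (simp add: hml_def)
 have p: "0 < ml r" if r: "0 < r" for r
  using green_pos[OF a lim_continuous(4) r1(1) hp[OF r1] r] lim_green(4)[OF r] by simp
 have hp': "0 < hml r" if "0 < r" for r by (rule hp[OF that p[OF that]])
 obtain b K where b: "0 < b" "!!r. 0 < r ==> r <= 1 ==> b <= green 0 hml r"
  by (rule green0_bounds[OF a lim_continuous(4) hp']) blast+
 have "b <= ml r" if "0 < r" "r <= 1" for r using b(2)[OF that] lim_green(4)[OF that(1)] by simp
 then show ?thesis using p b(1) by (intro disjI2 exI[of _ b]) auto
qed auto

text \<open>The iterate m_(j+1) is positive and, as m_(j+1) <= m_j, a supersolution of the linear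
  equation with the coefficients of step j. Picone's identity gives the sign at each step, and
  dominated convergence passes it to the limit, where ml itself may vanish and cannot serve as
  comparison function.\<close>

lemma lim_quadratic_form:
 assumes U: "radH U v"
 shows "0 <= second_variation g fl ml U v"
proof -
 define cj where "cj j r = g - (1 - (fs j r)^2 - (ms j r)^2)" for j r
 define c where "c r = g - (1 - (fl r)^2 - (ml r)^2)" for r
 have aU: "acd U v" and U2: "integrable_pos (\<lambda>r. (U r)^2 * r)" and v2: "integrable_pos (\<lambda>r. (v r)^2 * r)"
  using U by (auto simp: radH_def)
 have cb: "\<bar>cj j r\<bar> <= 3" if r: "0 < r" for j r
 proof -
  have "(fs j r)^2 <= 1" "(ms j r)^2 <= 1" using it_bounds(1)[OF r, of j] by (auto intro: power_le_one)
  then show ?thesis using g zero_le_power2[of "fs j r"] zero_le_power2[of "ms j r"] unfolding cj_def by linarith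
 qed
 have cc: "continuous_on {0<..} (cj j)" for j unfolding cj_def[abs_def] using it_invariant[of j] by (intro continuous_intros) auto
 have cl: "continuous_on {0<..} c" unfolding c_def[abs_def] by (intro continuous_intros lim_continuous)
 have cbl: "\<bar>c r\<bar> <= 3" if r: "0 < r" for r
 proof -
  have "(fl r)^2 <= 1" "(ml r)^2 <= 1" using lim_bounds[OF r] by (auto intro: power_le_one)
  then show ?thesis using g zero_le_power2[of "fl r"] zero_le_power2[of "ml r"] unfolding c_def by linarith
 qed
 have I: "integrable_pos (\<lambda>r. ((v r)^2 + e r * (U r)^2) * r)" if "continuous_on {0<..} e" "!!r. 0 < r ==> \<bar>e r\<bar> <= 3" for e
  by (rule radH_quadratic_integrable(1)[OF U _ that(2)]) (use that(1) in \<open>auto intro!: borel_measurable_continuous_on_indicator simp del: real_scaleR_def\<close>)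
 have nn: "0 <= (LBINT r:{0<..}. ((v r)^2 + cj j r * (U r)^2) * r)" for j
 proof -
  define u where "u = green 0 (hms j)"
  define u' where "u' = green1 0 (hms j)"
  define u'' where "u'' r = kk 0 r * u r - u' r / r - hms j r" for r
  have ue: "u = ms (Suc j)" by (simp add: u_def)
  have up: "0 < u r" if "0 < r" for r using it_bounds(2)[OF that, of "Suc j"] by (simp only: ue)
  have hp: "0 < hms j r" if "0 < r" for r
   using HM_bounds(3)[of r g "fs j r" "ms j r"] it_bounds[OF that, of j] that g by simp
  obtain b K where K: "!!r. 0 < r ==> \<bar>r * u' r\<bar> <= K * r^2 * u r"
   unfolding u_def u'_def by (rule green0_bounds[OF it_adm(3) it_adm(4) hp]) blast+
  have d: "DERIV u r :> u' r" "DERIV u' r :> u'' r" if "0 < r" for r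
   using green_DERIV[OF it_adm(3) it_adm(4) that] unfolding u_def u'_def u''_def by auto
  have cu: "continuous_on {0<..} u" "continuous_on {0<..} u'"
   using d by (auto intro!: continuous_at_imp_continuous_on DERIV_isCont)
  have ck: "continuous_on {0<..} (kk 0)" unfolding kk_def by (intro continuous_intros) auto
  have cu'': "continuous_on {0<..} u''" unfolding u''_def[abs_def] by (intro continuous_intros cu ck it_adm(4)) auto
  have sup: "u'' r + u' r / r <= cj j r * u r" if r: "0 < r" for r
  proof -
   have le: "u r <= ms j r" using it_mono[OF r, of j] by (simp only: ue)
   have "(fs j r)^2 <= 1" "(ms j r)^2 <= 1" using it_bounds(1)[OF r, of j] by (auto intro: power_le_one)
   then have "0 <= kk 0 r - g + (1 - (fs j r)^2 - (ms j r)^2)" using kk_ge(1)[OF r, of 0] g by linarith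
   then have "(kk 0 r - g + (1 - (fs j r)^2 - (ms j r)^2)) * u r <= hms j r"
    unfolding HM_def using le by (rule mult_left_mono[rotated])
   then show ?thesis by (simp add: u''_def cj_def algebra_simps)
  qed
  have bb: "\<bar>(U r)^2 * (r * u' r / u r)\<bar> <= K * (r * ((U r)^2 * r))" if r: "0 < r" for r
  proof -
   have "\<bar>r * u' r / u r\<bar> <= K * r^2" using K[OF r] up[OF r] by (simp add: pos_divide_le_eq)
   then have "(U r)^2 * \<bar>r * u' r / u r\<bar> <= (U r)^2 * (K * r^2)" by (intro mult_left_mono) auto
   then show ?thesis by (simp add: abs_mult power2_eq_square mult_ac)
  qed
  have e0: "\<forall>\<^sub>F r in at_right (0::real). 0 < r" by (auto simp: eventually_at_right_field intro!: exI[of _ 1])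
  show ?thesis
  proof (rule picone[OF aU up d cu'' sup I[OF cc cb] U2])
   show "\<forall>\<^sub>F r in at_right 0. \<bar>(U r)^2 * (r * u' r / u r)\<bar> <= K * (r * ((U r)^2 * r))"
    using e0 by eventually_elim (rule bb)
   show "\<forall>\<^sub>F r in at_top. \<bar>(U r)^2 * (r * u' r / u r)\<bar> <= K * (r * ((U r)^2 * r))"
    using eventually_gt_at_top[of 0] by eventually_elim (rule bb)
  qed auto
 qed
 have "(\<lambda>j. LINT r|lborel. indicator {0<..} r *\<^sub>R (((v r)^2 + cj j r * (U r)^2) * r)) \<longlonglongrightarrow> (LINT r|lborel. indicator {0<..} r *\<^sub>R (((v r)^2 + c r * (U r)^2) * r))"
 proof (rule integral_dominated_convergence)
  show "integrable lborel (\<lambda>r. indicator {0<..} r *\<^sub>R (((v r)^2 + 3 * (U r)^2) * r))"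
   using I[of "\<lambda>r. 3"] by (simp add: set_integrable_def)
  show "(\<lambda>r. indicator {0<..} r *\<^sub>R (((v r)^2 + c r * (U r)^2) * r)) \<in> borel_measurable lborel"
   using I[OF cl cbl] unfolding set_integrable_def by (rule borel_measurable_integrable)
  show "(\<lambda>r. indicator {0<..} r *\<^sub>R (((v r)^2 + cj j r * (U r)^2) * r)) \<in> borel_measurable lborel" for j
   using I[OF cc cb] unfolding set_integrable_def by (rule borel_measurable_integrable)
  show "AE r in lborel. (\<lambda>j. indicator {0<..} r *\<^sub>R (((v r)^2 + cj j r * (U r)^2) * r)) \<longlonglongrightarrow> indicator {0<..} r *\<^sub>R (((v r)^2 + c r * (U r)^2) * r)"
  proof (rule AE_I2)
   fix r :: real
   show "(\<lambda>j. indicator {0<..} r *\<^sub>R (((v r)^2 + cj j r * (U r)^2) * r)) \<longlonglongrightarrow> indicator {0<..} r *\<^sub>R (((v r)^2 + c r * (U r)^2) * r)"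
   proof (cases "0 < r")
    case True
    then show ?thesis unfolding cj_def c_def by (intro tendsto_intros it_lim)
   qed simp
  qed
  show "AE r in lborel. norm (indicator {0<..} r *\<^sub>R (((v r)^2 + cj j r * (U r)^2) * r)) <= indicator {0<..} r *\<^sub>R (((v r)^2 + 3 * (U r)^2) * r)" for j
  proof (rule AE_I2)
   fix r :: real
   show "norm (indicator {0<..} r *\<^sub>R (((v r)^2 + cj j r * (U r)^2) * r)) <= indicator {0<..} r *\<^sub>R (((v r)^2 + 3 * (U r)^2) * r)"
   proof (cases "0 < r")
    case True
    have "\<bar>cj j r * (U r)^2\<bar> <= 3 * (U r)^2" unfolding abs_mult using cb[OF True, of j] by (intro mult_mono) auto
    then have "\<bar>(v r)^2 + cj j r * (U r)^2\<bar> <= (v r)^2 + 3 * (U r)^2" using zero_le_power2[of "v r"] by linarith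
    then have "\<bar>(v r)^2 + cj j r * (U r)^2\<bar> * r <= ((v r)^2 + 3 * (U r)^2) * r" using True by (intro mult_right_mono) auto
    then show ?thesis using True by (simp add: abs_mult)
   qed simp
  qed
 qed
 then have "0 <= (LINT r|lborel. indicator {0<..} r *\<^sub>R (((v r)^2 + c r * (U r)^2) * r))"
  by (rule LIMSEQ_le_const) (use nn in \<open>auto simp: set_lebesgue_integral_def\<close>)
 then show ?thesis by (simp add: set_lebesgue_integral_def c_def)
qed

text \<open>The quotient \<open>z = m/f\<close> satisfies \<open>z'' + (1/r + 2f'/f) z' = (g - D/r^2) z\<close>, so it decays.\<close>

lemma lim_at_infinity: "(fl \<longlongrightarrow> 1) at_top" "(ml \<longlongrightarrow> 0) at_top"
proof -
 note d = GLsolD[OF lim_GLsol] and b = lim_bounds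
 define D where "D = (real n)^2"
 have D: "1 <= D" using n by (simp add: D_def one_le_power)
 \<comment> \<open>The iteration increases f, so fl >= f0 = sqrt g F(sqrt g r), which exceeds half
   of sqrt g once F > 1/2.\<close>
 define c0 where "c0 = sqrt g / 2"
 have c0: "0 < c0" "c0 < 1" using sg(1,2) unfolding c0_def by linarith+
 have "\<forall>\<^sub>F r in at_top. 1/2 < F r" by (rule order_tendstoD(1)[OF Flim]) simp
 then obtain R0 where R0: "!!r. R0 <= r ==> 1/2 < F r" unfolding eventually_at_top_linorder by auto
 \<comment> \<open>Beyond R the factor F(sqrt g r) exceeds 1/2 and D/r^2 <= g/2.\<close>
 define R where "R = max (max 1 (R0 / sqrt g)) (2 * D / g)"
 have R: "1 <= R" "R0 / sqrt g <= R" "2 * D / g <= R" by (auto simp: R_def)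
 have Rp: "0 < r" "1 <= r" if "R <= r" for r using that R by auto
 have fc: "c0 <= fl r" if r: "R <= r" for r
 proof -
  have "R0 / sqrt g <= r" using r R by simp
  then have "R0 <= sqrt g * r" using sg by (simp add: pos_divide_le_eq mult.commute)
  then have "sqrt g * (1/2) <= f0 r" unfolding f0_def using R0 sg by (intro mult_left_mono) (auto intro: less_imp_le)
  then show ?thesis using b(5)[OF Rp(1)[OF r]] by (simp add: c0_def)
 qed
 have bd: "(fl r)^2 <= 1" "(ml r)^2 <= 1" if "0 < r" for r using b[OF that] by (auto intro: power_le_one)
 have rhs: "\<bar>fl'' r + fl' r / r\<bar> <= D + 1" if r: "R <= r" for r
 proof -
  have "D / r^2 <= D / 1" using D Rp[OF r] by (intro divide_left_mono) (auto simp: one_le_power)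
  moreover have "0 <= D / r^2" using D by simp
  ultimately have "\<bar>D / r^2 - (1 - (fl r)^2 - (ml r)^2)\<bar> <= D + 1"
   using bd[OF Rp(1)[OF r]] D zero_le_power2[of "fl r"] zero_le_power2[of "ml r"] by linarith
  then have "\<bar>(D / r^2 - (1 - (fl r)^2 - (ml r)^2)) * fl r\<bar> <= (D + 1) * 1"
   unfolding abs_mult using b[OF Rp(1)[OF r]] D by (intro mult_mono) auto
  then show ?thesis unfolding d(5)[OF Rp(1)[OF r]] D_def by simp
 qed
 \<comment> \<open>The drift 2f'/f of the quotient must be bounded. A mean value point with |f'| <=
   1 exists in each unit interval, and the equation for r f' transports this bound to r.\<close>
 have f'b: "\<bar>fl' r\<bar> <= 2 + 2 * (D + 1)" if r: "R <= r" for r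
 proof -
  note r0 = Rp[OF r]
  define P where "P r = r * fl' r" for r
  have dP: "DERIV P x :> x * (fl'' x + fl' x / x)" if "0 < x" for x
   unfolding P_def using that by (auto intro!: derivative_eq_intros d(2) simp: field_simps)
  obtain \<xi> where \<xi>: "r < \<xi>" "\<xi> < r + 1" "fl (r + 1) - fl r = (r + 1 - r) * fl' \<xi>"
   using MVT2[of r "r + 1" fl fl'] d(1) r0 by auto
  obtain \<eta> where \<eta>: "r < \<eta>" "\<eta> < \<xi>" "P \<xi> - P r = (\<xi> - r) * (\<eta> * (fl'' \<eta> + fl' \<eta> / \<eta>))"
   using MVT2[of r \<xi> P "\<lambda>x. x * (fl'' x + fl' x / x)"] dP r0 \<xi> by auto
  have "\<bar>fl' \<xi>\<bar> <= 1" using \<xi>(3) b(1,2)[of r] b(1,2)[of "r + 1"] r0 by simp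
  then have "\<bar>P \<xi>\<bar> <= (r + 1) * 1" unfolding P_def abs_mult using \<xi> r0 by (intro mult_mono) auto
  moreover have "\<bar>P \<xi> - P r\<bar> <= 1 * ((r + 1) * (D + 1))"
   unfolding \<eta>(3) abs_mult using \<xi> \<eta> r r0 rhs[of \<eta>] D by (intro mult_mono) auto
  ultimately have "\<bar>P r\<bar> <= (r + 1) + (r + 1) * (D + 1)" unfolding mult_1_left mult_1_right by linarith
  also have "... <= (2 * r) + (2 * r) * (D + 1)" using r0 D by (intro add_mono mult_right_mono) auto
  finally have "r * \<bar>fl' r\<bar> <= r * (2 + 2 * (D + 1))" using r0 by (simp add: P_def abs_mult algebra_simps)
  then show ?thesis using r0 by simp
 qed
 define K where "K = 2 + 2 * (D + 1)"
 define z where "z r = ml r / fl r" for r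
 define z' where "z' r = (ml' r * fl r - ml r * fl' r) / (fl r * fl r)" for r
 define z'' where "z'' r = (ml'' r * fl r - ml r * fl'' r) / (fl r * fl r) - 2 * fl' r / fl r * z' r" for r
 have fp: "0 < fl r" if "R <= r" for r using fc[OF that] c0 by linarith
 have dz: "DERIV z r :> z' r" if r: "R <= r" for r
  unfolding z_def z'_def by (rule DERIV_divide[OF d(3)[OF Rp(1)[OF r]] d(1)[OF Rp(1)[OF r]]]) (use fp[OF r] in simp)
 have dz': "DERIV z' r :> z'' r" if r: "R <= r" for r
 proof -
  note r0 = Rp(1)[OF r]
  have N: "DERIV (\<lambda>r. ml' r * fl r - ml r * fl' r) r :> (ml'' r * fl r + fl' r * ml' r) - (ml' r * fl' r + fl'' r * ml r)"
   by (intro DERIV_diff DERIV_mult d[OF r0])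
  have Q: "DERIV (\<lambda>r. fl r * fl r) r :> fl' r * fl r + fl' r * fl r" by (intro DERIV_mult d[OF r0])
  have "DERIV z' r :> (((ml'' r * fl r + fl' r * ml' r) - (ml' r * fl' r + fl'' r * ml r)) * (fl r * fl r) - (ml' r * fl r - ml r * fl' r) * (fl' r * fl r + fl' r * fl r)) / (fl r * fl r * (fl r * fl r))"
   unfolding z'_def by (rule DERIV_divide[OF N Q]) (use fp[OF r] in simp)
  moreover have "(((ml'' r * fl r + fl' r * ml' r) - (ml' r * fl' r + fl'' r * ml r)) * (fl r * fl r) - (ml' r * fl r - ml r * fl' r) * (fl' r * fl r + fl' r * fl r)) / (fl r * fl r * (fl r * fl r)) = z'' r"
   unfolding z''_def z'_def using fp[OF r] by (simp add: field_simps)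
  ultimately show ?thesis by simp
 qed
 have zeq: "z'' r + (1 / r + 2 * fl' r / fl r) * z' r = (g - D / r^2) * z r" if r: "R <= r" for r
 proof -
  note r0 = Rp(1)[OF r]
  have "ml'' r = (g - (1 - (fl r)^2 - (ml r)^2)) * ml r - ml' r / r" "fl'' r = (D / r^2 - (1 - (fl r)^2 - (ml r)^2)) * fl r - fl' r / r"
   using d(5,6)[OF r0] by (simp_all add: D_def)
  then have "ml'' r * fl r - ml r * fl'' r = (g - D / r^2) * (ml r * fl r) - (ml' r * fl r - ml r * fl' r) / r"
   by (simp only:) (simp add: algebra_simps diff_divide_distrib)
  then have "(ml'' r * fl r - ml r * fl'' r) / (fl r * fl r) = (g - D / r^2) * z r - z' r / r"
   using fp[OF r] by (simp add: z_def z'_def diff_divide_distrib mult_ac)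
  then show ?thesis by (simp add: z''_def algebra_simps)
 qed
 have zlim: "\<forall>\<^sub>F r in at_top. z r <= \<epsilon>" if e: "\<epsilon> > 0" for \<epsilon>
 proof (rule drift_decay[where u=z and u'=z' and u''=z'' and ?R0.0=R and c="g/2" and b="\<lambda>r. 1 / r + 2 * fl' r / fl r" and D="1 + 2 * K / c0" and M="1 / c0"])
  fix r assume r: "R <= r"
  note r0 = Rp[OF r]
  show "z r <= 1 / c0" unfolding z_def using b[OF r0(1)] fc[OF r] c0 by (intro frac_le) auto
  have "\<bar>2 * fl' r / fl r\<bar> <= 2 * K / c0"
   unfolding abs_divide abs_mult using f'b[OF r] fc[OF r] c0 D fp[OF r] by (intro frac_le) (auto simp: K_def)
  moreover have "\<bar>1 / r\<bar> <= 1" using r0 by simp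
  ultimately show "\<bar>1 / r + 2 * fl' r / fl r\<bar> <= 1 + 2 * K / c0" by linarith
  show "z'' r + (1 / r + 2 * fl' r / fl r) * z' r >= g / 2 * z r" if "0 < z r"
  proof -
   have "2 * D / g <= r * r" using R(3) r r0 mult_mono[of 1 r r r] by linarith
   then have "D / r^2 <= g / 2" using g r0 by (simp add: pos_divide_le_eq power2_eq_square mult_ac)
   then have "g / 2 * z r <= (g - D / r^2) * z r" using that by (intro mult_right_mono) auto
   then show ?thesis using zeq[OF r] by simp
  qed
 qed (use dz dz' g e in auto)
 have ml_le: "\<forall>\<^sub>F r in at_top. ml r <= \<epsilon>" if e: "\<epsilon> > 0" for \<epsilon>
  using zlim[OF e] eventually_ge_at_top[of R]
 proof eventually_elim
  case (elim r)
  have "ml r = z r * fl r" using fp[OF elim(2)] by (simp add: z_def)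
  also have "... <= \<epsilon> * 1" using elim b[OF Rp(1)[OF elim(2)]] e by (intro mult_mono) auto
  finally show ?case by simp
 qed
 show "(ml \<longlongrightarrow> 0) at_top"
 proof (rule order_tendstoI)
  fix a :: real assume "a < 0"
  then show "\<forall>\<^sub>F r in at_top. a < ml r" by (intro eventually_mono[OF eventually_gt_at_top[of 0]] less_le_trans[OF _ b(3)])
 next
  fix a :: real assume "0 < a"
  then show "\<forall>\<^sub>F r in at_top. ml r < a" using ml_le[of "a/2"] by (auto elim!: eventually_mono)
 qed
 \<comment> \<open>Subtracting epsilon absorbs the sources: where 1 - f > epsilon, the terms m^2 f
   and D f/r^2 together are at most c0 epsilon, and the differential inequality becomes
   homogeneous.\<close>
 have w: "\<forall>\<^sub>F r in at_top. 1 - fl r - \<epsilon> <= \<epsilon>" if e: "\<epsilon> > 0" for \<epsilon>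
 proof -
  define \<delta> where "\<delta> = min 1 (c0 * \<epsilon> / 2)"
  have \<delta>: "0 < \<delta>" "\<delta> <= 1" "\<delta> <= c0 * \<epsilon> / 2" using c0 e by (auto simp: \<delta>_def)
  obtain R2 where R2: "!!r. R2 <= r ==> ml r <= \<delta>" using ml_le[OF \<delta>(1)] unfolding eventually_at_top_linorder by auto
  define R1 where "R1 = max (max R R2) (D / (c0 * \<epsilon> / 2))"
  have R1: "R <= r" "R2 <= r" "D / (c0 * \<epsilon> / 2) <= r" if "R1 <= r" for r using that by (auto simp: R1_def)
  show ?thesis
  proof (rule drift_decay[where u="\<lambda>r. 1 - fl r - \<epsilon>" and u'="\<lambda>r. - fl' r" and u''="\<lambda>r. - fl'' r" and ?R0.0=R1 and c=c0 and b="\<lambda>r. 1 / r" and D=1 and M=1])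
   fix r assume r: "R1 <= r"
   note r0 = Rp[OF R1(1)[OF r]]
   show "DERIV (\<lambda>r. 1 - fl r - \<epsilon>) r :> - fl' r"
    using DERIV_diff[OF DERIV_diff[OF DERIV_const[of 1] d(1)[OF r0(1)]] DERIV_const[of \<epsilon>]] by simp
   show "DERIV (\<lambda>r. - fl' r) r :> - fl'' r" by (rule DERIV_minus[OF d(2)[OF r0(1)]])
   show "1 - fl r - \<epsilon> <= 1" using b[OF r0(1)] e by linarith
   show "\<bar>1 / r\<bar> <= 1" using r0 by simp
   show "- fl'' r + 1 / r * - fl' r >= c0 * (1 - fl r - \<epsilon>)" if w: "0 < 1 - fl r - \<epsilon>"
   proof -
    have f1: "c0 <= fl r" "fl r <= 1" "0 <= fl r" using fc[OF R1(1)[OF r]] b[OF r0(1)] by auto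
    have "(1 - fl r) * c0 <= (1 - fl r) * ((1 + fl r) * fl r)"
     using f1 c0 mult_mono[of 1 "1 + fl r" c0 "fl r"] by (intro mult_left_mono) auto
    moreover have "(ml r)^2 * fl r <= (\<delta> * 1) * 1"
     using R2[OF R1(2)[OF r]] b[OF r0(1)] \<delta> f1 by (intro mult_mono) (auto simp: power2_eq_square intro!: order_trans[OF mult_mono[of "ml r" \<delta> "ml r" 1]])
    moreover have "D / r^2 * fl r <= (c0 * \<epsilon> / 2) * 1"
    proof (intro mult_mono)
     have "D / (c0 * \<epsilon> / 2) <= r * r" using R1(3)[OF r] r0 mult_mono[of 1 r r r] by linarith
     then show "D / r^2 <= c0 * \<epsilon> / 2" using c0 e r0 by (simp add: pos_divide_le_eq power2_eq_square mult_ac)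
    qed (use f1 c0 e in auto)
    moreover have "- fl'' r + 1 / r * - fl' r = (1 - fl r) * ((1 + fl r) * fl r) - (ml r)^2 * fl r - D / r^2 * fl r"
     using d(5)[OF r0(1)] by (simp add: D_def power2_eq_square algebra_simps)
    moreover have "c0 * (1 - fl r - \<epsilon>) = (1 - fl r) * c0 - c0 * \<epsilon>" by (simp add: algebra_simps)
    ultimately show ?thesis using \<delta>(3) by linarith
   qed
  qed (use c0 e in auto)
 qed
 show "(fl \<longlongrightarrow> 1) at_top"
 proof (rule order_tendstoI)
  fix a :: real assume "a < 1"
  then show "\<forall>\<^sub>F r in at_top. a < fl r" using w[of "(1 - a) / 4"] by (auto elim!: eventually_mono simp: field_simps)
 next
  fix a :: real assume "1 < a"
  then show "\<forall>\<^sub>F r in at_top. fl r < a" by (intro eventually_mono[OF eventually_gt_at_top[of 0]] le_less_trans[OF b(2)])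
 qed
qed

lemma lim_nice: "nice ((real n)^2) g fl fl' fl'' ml ml' ml''"
proof (rule GLsol_nice[OF lim_GLsol _ g(1), where ?r1.0=1 and M=1])
 show "1 <= (real n)^2" using n by (simp add: one_le_power)
 show "fl r <= 1 \<and> ml r <= 1" if "0 < r" for r using lim_bounds[OF that] by simp
qed (use lim_at_infinity in auto)

lemma coexistence_solution:
 obtains f f' f'' m m' m'' where "nice ((real n)^2) g f f' f'' m m' m''" "(f \<longlongrightarrow> 1) at_top"
  "!!U v. radH U v ==> 0 <= second_variation g f m U v"
  "(\<forall>r>0. m r = 0) \<or> (\<exists>b>0. (\<forall>r>0. 0 < m r) \<and> (\<forall>r>0. r <= 1 --> b <= m r))"
 using that lim_nice lim_at_infinity(1) lim_quadratic_form lim_dichotomy by blast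

end


section \<open>Energy comparison and uniqueness\<close>

lemma nice_elim:
 assumes "nice D g f f' f'' m m' m''"
 obtains C where "GLsol D g f f' f'' m m' m''" "C > 0" "!!r. 0 < r ==> 0 < f r" "!!r. 0 < r ==> f r <= 1"
  "!!r. 0 < r ==> (f r)^2 <= C * r" "!!r. 0 < r ==> (f' r)^2 * r <= C / (1 + r^2)"
  "!!r. 0 < r ==> (m r)^2 * r <= C / (1 + r^2)" "!!r. 0 < r ==> (m' r)^2 * r <= C / (1 + r^2)"
  "!!r. 0 < r ==> 1 - (f r)^2 <= C / (1 + r^2)" "!!r. 0 < r ==> (m r)^2 <= C"
  "\<forall>\<^sub>F r in at_right 0. \<bar>r * f' r\<bar> <= C * f r" "\<forall>\<^sub>F r in at_right 0. \<bar>m' r\<bar> <= C * r"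
  "\<forall>\<^sub>F r in at_top. \<bar>r * f' r\<bar> <= C * r * f r" "\<forall>\<^sub>F r in at_top. m r <= C / r^2"
proof -
 from assms obtain C where "C > 0" and
  *: "\<forall>r>0. (f r)^2 <= C * r \<and> (f' r)^2 * r <= C / (1 + r^2) \<and> (m r)^2 * r <= C / (1 + r^2) \<and>
    (m' r)^2 * r <= C / (1 + r^2) \<and> 1 - (f r)^2 <= C / (1 + r^2) \<and> (m r)^2 <= C"
  and **: "\<forall>\<^sub>F r in at_right 0. \<bar>r * f' r\<bar> <= C * f r \<and> \<bar>m' r\<bar> <= C * r"
   "\<forall>\<^sub>F r in at_top. \<bar>r * f' r\<bar> <= C * r * f r \<and> m r <= C / r^2"
  unfolding nice_def by auto
 have "GLsol D g f f' f'' m m' m''" "!!r. 0 < r ==> 0 < f r" "!!r. 0 < r ==> f r <= 1"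
  using assms by (simp_all add: nice_def)
 then show ?thesis
  using \<open>C > 0\<close> * **[unfolded eventually_conj_iff] by (intro that[of C]) auto
qed

lemma abs_mult_le_half: 
 fixes x a b :: real
 assumes "x^2 <= a * b" "0 <= a" "0 <= b"
 shows "\<bar>x\<bar> <= (a + b) / 2"
proof -
 have "4 * (a * b) <= (a + b)^2" using zero_le_power2[of "a - b"] by (simp add: power2_eq_square algebra_simps)
 then have "\<bar>x\<bar>^2 <= ((a + b) / 2)^2" using assms(1) by (simp add: power_divide)
 then show ?thesis using assms by (intro power2_le_imp_le[of "\<bar>x\<bar>"]) auto
qed

lemma abs_product_le: "\<bar>x * y\<bar> <= (x^2 + y^2) / (2::real)"
 by (rule abs_mult_le_half) (auto simp: power_mult_distrib)

lemma half_sum_le: "0 <= a ==> 0 <= b ==> (a + b) / 2 <= a + (b::real)" "a <= c ==> b <= c ==> (a + b) / 2 <= (c::real)"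
 by auto

lemma square_add_le: "(x + y)^2 <= 2 * x^2 + 2 * (y::real)^2"
 using zero_le_power2[of "x - y"] by (simp add: power2_eq_square algebra_simps)

lemma eventually_at_right_pos: "\<forall>\<^sub>F r in at_right (0::real). 0 < r \<and> r < 1"
 by (auto simp: eventually_at_right_field intro!: exI[of _ 1])

definition energy_density :: "real => real => (real => real) => (real => real) => (real => real) =>
  (real => real) => (real => real) => real => real" where
 "energy_density D g F f f' m m' r = ((f' r)^2 + (m' r)^2 + g * (m r)^2 + D / r^2 * ((f r)^2 - (F r)^2)
   + 1 / 2 * (1 - (f r)^2 - (m r)^2)^2) * r"

text \<open>The potential expands exactly as (1 - S)^2 = (1 - s)^2 - 2 (1 - s)(S - s) + (S - s)^2,
  and S - s equals 2 f V + V^2 + Q^2 - m^2. Everything except the last square is therefore linear or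
  quadratic with the potential frozen at s.\<close>

lemma energy_density_expansion:
 fixes s S c cm v V q Q :: real
 assumes "s = f^2 + m^2" "S = (f + V)^2 + Q^2"
 shows "((f' + v)^2 + q^2 + g * Q^2 + c * ((f + V)^2 - F) + 1 / 2 * (1 - (f + V)^2 - Q^2)^2) * r =
  (f'^2 + m'^2 + g * m^2 + c * (f^2 - F) + 1 / 2 * (1 - f^2 - m^2)^2) * r
  + (2 * ((f' * v + (c - (1 - s)) * f * V) * r) + (v^2 + (c - (1 - s)) * V^2) * r + (q^2 + (g - (1 - s)) * Q^2) * r
    - (m'^2 + (g - (1 - s)) * m^2) * r) + 1 / 2 * (S - s)^2 * r"
 unfolding assms by (simp add: power2_eq_square algebra_simps)

section \<open>Integral identities for solutions with the bounds in \<open>nice\<close>\<close>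

context
 fixes D g :: real and f f' f'' m m' m'' :: "real => real"
 assumes N: "nice D g f f' f'' m m' m''" and D: "0 <= D"
begin

lemma nice_continuous: "continuous_on {0<..} f" "continuous_on {0<..} f'" "continuous_on {0<..} m" "continuous_on {0<..} m'"
  "continuous_on {0<..} f''" "continuous_on {0<..} m''"
 using N GLsol_cont[of D g f f' f'' m m' m''] by (simp_all add: nice_def)

lemma nice_acd: "acd f f'" "acd m m'"
proof -
 have G: "GLsol D g f f' f'' m m' m''" using N by (simp add: nice_def)
 show "acd f f'" by (rule acd_C1[OF GLsolD(1)[OF G] nice_continuous(2)])
 show "acd m m'" by (rule acd_C1[OF GLsolD(3)[OF G] nice_continuous(4)])
qed

lemma nice_m_radH: "radH m m'" "m \<in> H_rad"
proof -
 obtain C where G: "GLsol D g f f' f'' m m' m''" and C: "C > 0" and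
  b: "!!r. 0 < r ==> (m r)^2 * r <= C / (1 + r^2)" "!!r. 0 < r ==> (m' r)^2 * r <= C / (1 + r^2)"
  by (rule nice_elim[OF N]) blast
 have 1: "integrable_pos (\<lambda>r. (m r)^2 * r)" "integrable_pos (\<lambda>r. (m' r)^2 * r)"
  using b by (auto intro!: decay_integrable[where K=C] continuous_intros nice_continuous simp: abs_mult)
 then show "radH m m'" using nice_acd by (simp add: radH_def)
 show "m \<in> H_rad" by (rule radH_C1_H_rad[OF GLsolD(3)[OF G] nice_continuous(4) 1])
qed

text \<open>The weight r^3 is the one needed for the first variation, where 1 - s multiplies f V and
  V is measured by V^2/r.\<close>

lemma nice_potential_bound:
 obtains B where "0 < B" "!!r. 0 < r ==> \<bar>1 - (f r)^2 - (m r)^2\<bar> <= B"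
  "!!r. 0 < r ==> (1 - (f r)^2 - (m r)^2)^2 * r <= B / (1 + r^2)"
  "!!r. 0 < r ==> (1 - (f r)^2 - (m r)^2)^2 * r ^ 3 <= B"
proof -
 obtain C where C: "C > 0" and f: "!!r. 0 < r ==> 0 < f r" "!!r. 0 < r ==> f r <= 1" and
  b: "!!r. 0 < r ==> (m r)^2 * r <= C / (1 + r^2)" "!!r. 0 < r ==> 1 - (f r)^2 <= C / (1 + r^2)" "!!r. 0 < r ==> (m r)^2 <= C"
  by (rule nice_elim[OF N]) blast
 let ?X = "\<lambda>r. 1 - (f r)^2 - (m r)^2"
 have f2: "0 <= 1 - (f r)^2" if "0 < r" for r using f[OF that] by (simp add: power_le_one)
 have B1: "\<bar>?X r\<bar> <= 1 + C" if "0 < r" for r using f2[OF that] b(3)[OF that] zero_le_power2[of "f r"] zero_le_power2[of "m r"] C by linarith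
 have key: "(?X r)^2 * r <= 4 * C^2 / (1 + r^2)" "(?X r)^2 * r ^ 3 <= 4 * C^2" if r: "0 < r" for r
 proof -
  have p: "0 < 1 + r^2" by (simp add: add_pos_nonneg)
  have rl: "r / (1 + r^2) <= 1" "r^2 / (1 + r^2) <= 1" using p zero_le_power2[of "r - 1"]
   by (auto simp: pos_divide_le_eq power2_eq_square algebra_simps)
  have X: "(?X r)^2 <= 2 * (1 - (f r)^2)^2 + 2 * ((m r)^2)^2"
   using square_add_le[of "1 - (f r)^2" "- ((m r)^2)"] by simp
  have "(1 - (f r)^2) * (1 - (f r)^2) <= C / (1 + r^2) * (C / (1 + r^2))" using b(2)[OF r] f2[OF r] C p by (intro mult_mono) auto
  then have "(1 - (f r)^2)^2 * r <= C / (1 + r^2) * (C / (1 + r^2)) * r"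
   unfolding power2_eq_square[of "1 - (f r)^2"] by (rule mult_right_mono) (use r in simp)
  also have "... = C^2 / (1 + r^2) * (r / (1 + r^2))" by (simp add: power2_eq_square)
  also have "... <= C^2 / (1 + r^2) * 1" using rl p by (intro mult_left_mono) auto
  finally have u: "(1 - (f r)^2)^2 * r <= C^2 / (1 + r^2)" by simp
  have "(m r)^2 * ((m r)^2 * r) <= C * (C / (1 + r^2))" using b[OF r] C r by (intro mult_mono) auto
  then have w: "((m r)^2)^2 * r <= C^2 / (1 + r^2)" by (simp add: power2_eq_square mult_ac)
  have "(?X r)^2 * r <= (2 * (1 - (f r)^2)^2 + 2 * ((m r)^2)^2) * r" using X r by (intro mult_right_mono) auto
  also have "... = 2 * ((1 - (f r)^2)^2 * r) + 2 * (((m r)^2)^2 * r)" by (simp add: algebra_simps)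
  also have "... <= 2 * (C^2 / (1 + r^2)) + 2 * (C^2 / (1 + r^2))" using u w by linarith
  finally show k: "(?X r)^2 * r <= 4 * C^2 / (1 + r^2)" by simp
  have "(?X r)^2 * r ^ 3 = ((?X r)^2 * r) * r^2" by (simp add: power2_eq_square power3_eq_cube)
  also have "... <= 4 * C^2 / (1 + r^2) * r^2" using k by (intro mult_right_mono) auto
  also have "... = 4 * C^2 * (r^2 / (1 + r^2))" by simp
  also have "... <= 4 * C^2 * 1" using rl by (intro mult_left_mono) auto
  finally show "(?X r)^2 * r ^ 3 <= 4 * C^2" by simp
 qed
 show ?thesis
 proof (rule that[of "1 + C + 4 * C^2"])
  show "0 < 1 + C + 4 * C^2" using C by (simp add: add_pos_nonneg)
  fix r :: real assume r: "0 < r"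
  show "\<bar>?X r\<bar> <= 1 + C + 4 * C^2" using B1[OF r] by (simp add: add_increasing2)
  have "4 * C^2 / (1 + r^2) <= (1 + C + 4 * C^2) / (1 + r^2)" using C by (intro divide_right_mono) auto
  then show "(?X r)^2 * r <= (1 + C + 4 * C^2) / (1 + r^2)" using key(1)[OF r] by linarith
  show "(?X r)^2 * r ^ 3 <= 1 + C + 4 * C^2" using key(2)[OF r] C by linarith
 qed
qed

lemma nice_form_integrable:
 assumes U: "radH U v"
 shows "integrable_pos (\<lambda>r. ((v r)^2 + (g - (1 - (f r)^2 - (m r)^2)) * (U r)^2) * r)"
proof -
 obtain B where B: "0 < B" "!!r. 0 < r ==> \<bar>1 - (f r)^2 - (m r)^2\<bar> <= B" by (rule nice_potential_bound) blast
 show ?thesis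
 proof (rule radH_quadratic_integrable(1)[OF U])
  show "measurable_pos (\<lambda>r. g - (1 - (f r)^2 - (m r)^2))"
   by (intro borel_measurable_continuous_on_indicator continuous_intros nice_continuous) auto
  show "\<bar>g - (1 - (f r)^2 - (m r)^2)\<bar> <= \<bar>g\<bar> + B" if "0 < r" for r using B(2)[OF that] by linarith
 qed
qed

text \<open>The second equation is tested with m itself. The boundary term r m' m is of order r^2 at
  the origin and is controlled at infinity by the bounds on m^2 r and m'^2 r.\<close>

lemma nice_m_form_zero: "second_variation g f m m m' = 0"
proof -
 obtain C where G: "GLsol D g f f' f'' m m' m''" and C: "C > 0" and
  b: "!!r. 0 < r ==> (m r)^2 * r <= C / (1 + r^2)" "!!r. 0 < r ==> (m' r)^2 * r <= C / (1 + r^2)" "!!r. 0 < r ==> (m r)^2 <= C"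
  and m0: "\<forall>\<^sub>F r in at_right 0. \<bar>m' r\<bar> <= C * r"
  by (rule nice_elim[OF N]) blast
 note d = GLsolD[OF G]
 let ?c = "\<lambda>r. g - (1 - (f r)^2 - (m r)^2)"
 have P: "acd (\<lambda>r. r * m' r) (\<lambda>r. r * (?c r * m r))"
 proof (rule acd_C1)
  fix r :: real assume r: "0 < r"
  have "DERIV (\<lambda>r. r * m' r) r :> 1 * m' r + m'' r * r" by (rule DERIV_mult[OF DERIV_ident d(4)[OF r]])
  moreover have "1 * m' r + m'' r * r = r * (?c r * m r)" using d(6)[OF r, symmetric] r by (simp add: field_simps)
  ultimately show "DERIV (\<lambda>r. r * m' r) r :> r * (?c r * m r)" by simp
 qed (intro continuous_intros nice_continuous)
 note A = acd_mult[OF P nice_acd(2)]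
 have bp: "r / (1 + r^2) >= 0" if "0 < r" for r :: real using that by simp
 show ?thesis
 \<comment> \<open>In the constant, the summand C serves infinity and 2 C (1 + C) the
   origin.\<close>
 proof (rule integral_zero_of_boundary[OF nice_form_integrable[OF nice_m_radH(1)], where B = "\<lambda>r. (r * m' r) * m r" and H = "\<lambda>r. 1 / (1 + r^2)" and C = "C + 2 * C * (1 + C)"])
  fix a b :: real assume ab: "0 < a" "a <= b"
  have "(\<lambda>r. ((m' r)^2 + ?c r * (m r)^2) * r) = (\<lambda>r. r * (?c r * m r) * m r + r * m' r * m' r)"
   by (simp add: fun_eq_iff power2_eq_square algebra_simps)
  then show "(LBINT r:{a..b}. ((m' r)^2 + ?c r * (m r)^2) * r) = b * m' b * m b - a * m' a * m a"
   using acdD(2)[OF A ab] by simp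
 next
  show "integrable_pos (\<lambda>r::real. 1 / (1 + r^2))"
   by (rule decay_integrable[where K=1]) (auto intro!: continuous_intros simp: add_nonneg_eq_0_iff)
  show "\<forall>\<^sub>F r in at_right 0. \<bar>r * m' r * m r\<bar> <= (C + 2 * C * (1 + C)) * (r * (1 / (1 + r^2)))"
   using m0 eventually_at_right_pos
  proof eventually_elim
   case (elim r)
   have mb: "\<bar>m r\<bar> <= 1 + C" using b(3)[of r] elim abs_product_le[of "m r" 1] C by simp
   have "\<bar>r * m' r * m r\<bar> <= r * (C * r) * (1 + C)" unfolding abs_mult using elim mb C by (intro mult_mono) auto
   also have "... <= r * (C * 1) * (1 + C)" using elim C by (intro mult_mono mult_left_mono) auto
   also have "... = 2 * C * (1 + C) * (r * (1 / 2))" by simp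
   also have "... <= (C + 2 * C * (1 + C)) * (r * (1 / (1 + r^2)))"
    using elim C by (intro mult_mono mult_left_mono divide_left_mono) (auto simp: power_le_one add_pos_nonneg)
   finally show ?case .
  qed
  show "\<forall>\<^sub>F r in at_top. \<bar>r * m' r * m r\<bar> <= (C + 2 * C * (1 + C)) * (r * (1 / (1 + r^2)))"
   using eventually_ge_at_top[of 1]
  proof eventually_elim
   case (elim r)
   have "r * \<bar>m' r * m r\<bar> <= r * (((m' r)^2 + (m r)^2) / 2)" using abs_product_le elim by (intro mult_left_mono) auto
   also have "... <= C / (1 + r^2)" 
   proof -
    have "r * (((m' r)^2 + (m r)^2) / 2) = ((m r)^2 * r + (m' r)^2 * r) / 2" by (simp add: algebra_simps)
    then show ?thesis using half_sum_le(2)[OF b(1,2)[of r]] elim by simp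
   qed
   also have "... <= C * (r * (1 / (1 + r^2)))" using elim C by (simp add: divide_right_mono)
   also have "... <= (C + 2 * C * (1 + C)) * (r * (1 / (1 + r^2)))" using elim C by (intro mult_right_mono) auto
   finally show ?case using elim by (simp add: abs_mult mult_ac)
  qed
 qed auto
qed

text \<open>The first variation in \<open>f\<close> vanishes, and its second variation is nonnegative by Picone's
 identity because \<open>f > 0\<close>; the cross term of the quartic is the square \<open>(S - s)^2\<close>.\<close>

lemma energy_comparison:
 assumes p: "acd p p'" and V2: "integrable_pos (\<lambda>r. (p r - f r)^2 * r)"
  and V0: "integrable_pos (\<lambda>r. (p r - f r)^2 / r)" and v2: "integrable_pos (\<lambda>r. (p' r - f' r)^2 * r)"
  and q: "radH q q'" and hq: "0 <= second_variation g f m q q'"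
 obtains L where "integrable_pos L" "0 <= (LBINT r:{0<..}. L r)"
  "!!F r. 0 < r ==> energy_density D g F p p' q q' r = energy_density D g F f f' m m' r + L r
    + 1 / 2 * ((p r)^2 + (q r)^2 - ((f r)^2 + (m r)^2))^2 * r"
proof -
 define V where "V r = p r - f r" for r
 define v where "v r = p' r - f' r" for r
 define c where "c r = D / r^2 - (1 - (f r)^2 - (m r)^2)" for r
 \<comment> \<open>V^2/r pays for r f'/f = O(1) at the origin, V^2 r for r f'/f = O(r) at
   infinity.\<close>
 define H where "H r = (V r)^2 / r + (V r)^2 * r" for r
 obtain C where G: "GLsol D g f f' f'' m m' m''" and C: "C > 0" and f: "!!r. 0 < r ==> 0 < f r" "!!r. 0 < r ==> f r <= 1" and
  b: "!!r. 0 < r ==> (f r)^2 <= C * r" "!!r. 0 < r ==> (f' r)^2 * r <= C / (1 + r^2)"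
  and e: "\<forall>\<^sub>F r in at_right 0. \<bar>r * f' r\<bar> <= C * f r" "\<forall>\<^sub>F r in at_top. \<bar>r * f' r\<bar> <= C * r * f r"
  by (rule nice_elim[OF N]) blast
 obtain B where B: "0 < B" "!!r. 0 < r ==> \<bar>1 - (f r)^2 - (m r)^2\<bar> <= B" "!!r. 0 < r ==> (1 - (f r)^2 - (m r)^2)^2 * r ^ 3 <= B"
  by (rule nice_potential_bound) blast
 note d = GLsolD[OF G]
 have aV: "acd V v" unfolding V_def[abs_def] v_def[abs_def] by (rule acd_diff[OF p nice_acd(1)])
 have cV: "continuous_on {0<..} V" by (rule acd_continuous[OF aV])
 have cc: "continuous_on {0<..} c" unfolding c_def[abs_def] by (intro continuous_intros nice_continuous) auto
 have mv: "measurable_pos v" by (rule loc_integrable_measurable[OF acdD(1)[OF aV]])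
 have iV2: "integrable_pos (\<lambda>r. (V r)^2 * r)" and iV0: "integrable_pos (\<lambda>r. (V r)^2 / r)"
  and iv: "integrable_pos (\<lambda>r. (v r)^2 * r)"
  using V2 V0 v2 by (simp_all add: V_def v_def)
 have iH: "integrable_pos H" unfolding H_def[abs_def] by (rule set_integral_add(1)[OF iV0 iV2])
 have H0: "0 <= H r" if "0 < r" for r using that by (simp add: H_def)
 have rH: "r * H r = (V r)^2 + (V r)^2 * r^2" if "0 < r" for r using that by (simp add: H_def field_simps power2_eq_square)
 have if': "integrable_pos (\<lambda>r. (f' r)^2 * r)"
  using b(2) by (intro decay_integrable[where K=C] continuous_intros nice_continuous) auto

 define hV where "hV r = ((v r)^2 + c r * (V r)^2) * r" for r
 have ihV: "integrable_pos hV"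
 proof -
  have 1: "integrable_pos (\<lambda>r. c r * (V r)^2 * r)"
  proof (rule set_integrable_bounded_by[OF set_integrable_mult_right[OF iH]])
   show "measurable_pos (\<lambda>r. c r * (V r)^2 * r)"
    by (intro borel_measurable_continuous_on_indicator continuous_intros cV cc) auto
   fix r :: real assume r: "0 < r"
   have "\<bar>c r * (V r)^2 * r\<bar> = \<bar>c r\<bar> * ((V r)^2 * r)" using r by (simp add: abs_mult)
   also have "... <= (D / r^2 + B) * ((V r)^2 * r)"
    using B(2)[OF r] D r by (intro mult_right_mono) (auto simp: c_def intro!: order_trans[OF abs_triangle_ineq4] add_mono)
   also have "... = D * ((V r)^2 / r) + B * ((V r)^2 * r)" using r by (simp add: field_simps power2_eq_square)
   also have "... <= (D + B) * ((V r)^2 / r) + (D + B) * ((V r)^2 * r)"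
    using D B(1) r by (intro add_mono mult_right_mono) auto
   finally show "\<bar>c r * (V r)^2 * r\<bar> <= (D + B) * H r" by (simp add: H_def distrib_left)
  qed
  show ?thesis using set_integral_add(1)[OF iv 1] unfolding hV_def[abs_def] by (simp add: algebra_simps)
 qed
 have hV0: "0 <= (LBINT r:{0<..}. hV r)"
  unfolding hV_def
 proof (rule picone[OF aV f(1) d(1,2) nice_continuous(5) _ ihV[unfolded hV_def[abs_def]] iH H0, where C = C])
  show "f'' r + f' r / r <= c r * f r" if "0 < r" for r using d(5)[OF that] by (simp add: c_def)
  show "\<forall>\<^sub>F r in at_right 0. \<bar>(V r)^2 * (r * f' r / f r)\<bar> <= C * (r * H r)"
   using e(1) eventually_at_right_pos
  proof eventually_elim
   case (elim r)
   then have "\<bar>r * f' r / f r\<bar> <= C" using f(1)[of r] by (simp add: pos_divide_le_eq)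
   then have "(V r)^2 * \<bar>r * f' r / f r\<bar> <= (V r)^2 * C" by (intro mult_left_mono) auto
   also have "... <= C * (r * H r)" using rH[of r] elim C by (simp add: distrib_left)
   finally show ?case by (simp add: abs_mult)
  qed
  show "\<forall>\<^sub>F r in at_top. \<bar>(V r)^2 * (r * f' r / f r)\<bar> <= C * (r * H r)"
   using e(2) eventually_gt_at_top[of 0]
  proof eventually_elim
   case (elim r)
   then have "\<bar>r * f' r / f r\<bar> <= C * r" using f(1)[of r] by (simp add: pos_divide_le_eq)
   then have "(V r)^2 * \<bar>r * f' r / f r\<bar> <= (V r)^2 * (C * r)" by (intro mult_left_mono) auto
   also have "... = C * ((V r)^2 * r)" by simp
   also have "r <= 1 + r^2" using zero_le_power2[of "r - 1"] elim by (simp add: power2_eq_square algebra_simps)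
   then have "C * ((V r)^2 * r) <= C * ((V r)^2 * (1 + r^2))" using C by (intro mult_left_mono) auto
   also have "... = C * (r * H r)" using rH[of r] elim by (simp add: distrib_left)
   finally show ?case by (simp add: abs_mult)
  qed
 qed

 \<comment> \<open>Half of the linear term of the expansion; it is the derivative of r f' V by the
   equation for f.\<close>
 define hc where "hc r = (f' r * v r + c r * f r * V r) * r" for r
 \<comment> \<open>From (a - b)^2 <= 2 a^2 + 2 b^2 applied to the coefficient c, with f^2 <= C r for
   the part D/r^2 and f <= 1 with the r^3 bound of \<open>nice_potential_bound\<close> for the
   rest.\<close>
 define K where "K = 2 * D^2 * C + 2 * B"
 have K: "0 <= K" using C B by (simp add: K_def)
 have ihc: "integrable_pos hc"
 proof -
  have 1: "integrable_pos (\<lambda>r. f' r * v r * r)"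
  proof (rule set_integrable_bounded_by[OF set_integral_add(1)[OF if' iv]])
   have "(\<lambda>r. (indicator {0<..} r *\<^sub>R (f' r * r)) * (indicator {0<..} r *\<^sub>R v r)) \<in> borel_measurable borel"
    by (intro borel_measurable_times mv borel_measurable_continuous_on_indicator continuous_intros nice_continuous) auto
   moreover have "(\<lambda>r. (indicator {0<..} r *\<^sub>R (f' r * r)) * (indicator {0<..} r *\<^sub>R v r)) = (\<lambda>r. indicator {0<..} r *\<^sub>R (f' r * v r * r))"
    by (auto simp: fun_eq_iff indicator_def)
   ultimately show "measurable_pos (\<lambda>r. f' r * v r * r)" by simp
   fix r :: real assume r: "0 < r"
   have "\<bar>f' r * v r\<bar> * r <= ((f' r)^2 + (v r)^2) / 2 * r" using abs_product_le r by (intro mult_right_mono) auto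
   also have "... <= (f' r)^2 * r + (v r)^2 * r" using r by (simp add: algebra_simps)
   finally show "\<bar>f' r * v r * r\<bar> <= (f' r)^2 * r + (v r)^2 * r" using r by (simp add: abs_mult)
  qed
  have i1: "integrable_pos (\<lambda>r::real. K / (1 + r^2))"
   using K by (intro decay_integrable[where K=K]) (auto intro!: continuous_intros simp: add_nonneg_eq_0_iff)
  have 2: "integrable_pos (\<lambda>r. c r * f r * V r * r)"
  proof (rule set_integrable_bounded_by[OF set_integral_add(1)[OF i1 iH]])
   show "measurable_pos (\<lambda>r. c r * f r * V r * r)"
    by (intro borel_measurable_continuous_on_indicator continuous_intros nice_continuous cV cc) auto
   fix r :: real assume r: "0 < r"
   define X where "X = 1 - (f r)^2 - (m r)^2"
   have "(c r)^2 * (f r)^2 * r ^ 3 <= (2 * (D / r^2)^2 + 2 * X^2) * (f r)^2 * r ^ 3"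
    using square_add_le[of "D / r^2" "- X"] r by (intro mult_right_mono) (auto simp: c_def X_def[symmetric])
   also have "... = 2 * D^2 * ((f r)^2 / r) + 2 * (X^2 * r ^ 3) * (f r)^2"
    using r by (simp add: field_simps power2_eq_square power3_eq_cube)
   also have "... <= 2 * D^2 * C + 2 * B * 1"
   proof (intro add_mono mult_left_mono mult_mono)
    show "(f r)^2 / r <= C" using b(1)[OF r] r by (simp add: pos_divide_le_eq)
    show "(f r)^2 <= 1" using f[OF r] by (simp add: power_le_one)
    show "X^2 * r ^ 3 <= B" using B(3)[OF r] by (simp add: X_def)
   qed (use B(1) r in auto)
   finally have k: "(c r)^2 * (f r)^2 * r ^ 3 <= K" by (simp add: K_def)
   have "(c r * f r * V r * r)^2 = ((c r)^2 * (f r)^2 * r ^ 3) * ((V r)^2 / r)"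
    using r by (simp add: field_simps power2_eq_square power3_eq_cube)
   also have "... <= K * ((V r)^2 / r)" using k r by (intro mult_right_mono) auto
   also have "... = (K / (1 + r^2)) * ((V r)^2 / r * (1 + r^2))"
    using add_pos_nonneg[of 1 "r^2"] by simp
   also have "(V r)^2 / r * (1 + r^2) = H r" using r by (simp add: H_def field_simps power2_eq_square)
   finally have "\<bar>c r * f r * V r * r\<bar> <= (K / (1 + r^2) + H r) / 2"
    by (rule abs_mult_le_half) (use K H0[OF r] in auto)
   also have "... <= K / (1 + r^2) + H r"
   proof -
    have "0 <= K / (1 + r^2)" using K by simp
    then show ?thesis using H0[OF r] by (rule half_sum_le(1))
   qed
   finally show "\<bar>c r * f r * V r * r\<bar> <= K / (1 + r^2) + H r" .
  qed
  show ?thesis using set_integral_add(1)[OF 1 2] unfolding hc_def[abs_def] by (simp add: algebra_simps)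
 qed
 have hc0: "(LBINT r:{0<..}. hc r) = 0"
 proof -
  have P: "acd (\<lambda>r. r * f' r) (\<lambda>r. r * (c r * f r))"
  proof (rule acd_C1)
   fix r :: real assume r: "0 < r"
   have "DERIV (\<lambda>r. r * f' r) r :> 1 * f' r + f'' r * r" by (rule DERIV_mult[OF DERIV_ident d(2)[OF r]])
   moreover have "1 * f' r + f'' r * r = r * (f'' r + f' r / r)" using r by (simp add: field_simps)
   ultimately show "DERIV (\<lambda>r. r * f' r) r :> r * (c r * f r)" unfolding c_def d(5)[OF r, symmetric] by simp
  qed (intro continuous_intros nice_continuous cc)
  note A = acd_mult[OF P aV]
  have B: "\<bar>r * f' r * V r\<bar> <= 1 * (r * ((f' r)^2 * r + H r))" if r: "0 < r" for r
  proof -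
   have "\<bar>r * f' r * V r\<bar> <= ((r * f' r)^2 + (V r)^2) / 2" by (rule abs_product_le)
   also have "... <= (r * f' r)^2 + ((V r)^2 + (V r)^2 * r^2)" by (simp add: field_simps)
   also have "... = 1 * (r * ((f' r)^2 * r + H r))" using rH[OF r] by (simp add: power2_eq_square algebra_simps)
   finally show ?thesis .
  qed
  show ?thesis
  proof (rule integral_zero_of_boundary[OF ihc, where B = "\<lambda>r. (r * f' r) * V r" and H = "\<lambda>r. (f' r)^2 * r + H r" and C = 1])
   fix a b :: real assume ab: "0 < a" "a <= b"
   have "hc = (\<lambda>r. r * (c r * f r) * V r + r * f' r * v r)" by (simp add: fun_eq_iff hc_def algebra_simps)
   then show "(LBINT r:{a..b}. hc r) = b * f' b * V b - a * f' a * V a" using acdD(2)[OF A ab] by simp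
  next
   show "integrable_pos (\<lambda>r. (f' r)^2 * r + H r)" by (rule set_integral_add(1)[OF if' iH])
   show "0 <= (f' r)^2 * r + H r" if "0 < r" for r using H0[OF that] that by simp
   show "\<forall>\<^sub>F r in at_right 0. \<bar>r * f' r * V r\<bar> <= 1 * (r * ((f' r)^2 * r + H r))"
    by (rule eventually_mono[OF eventually_at_right_pos]) (use B in blast)
   show "\<forall>\<^sub>F r in at_top. \<bar>r * f' r * V r\<bar> <= 1 * (r * ((f' r)^2 * r + H r))"
    by (rule eventually_mono[OF eventually_gt_at_top[of 0]]) (use B in blast)
  qed
 qed

 define hQ where "hQ r = ((q' r)^2 + (g - (1 - (f r)^2 - (m r)^2)) * (q r)^2) * r" for r
 define hm where "hm r = ((m' r)^2 + (g - (1 - (f r)^2 - (m r)^2)) * (m r)^2) * r" for r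
 have iQ: "integrable_pos hQ" unfolding hQ_def[abs_def] by (rule nice_form_integrable[OF q])
 have im: "integrable_pos hm" unfolding hm_def[abs_def] by (rule nice_form_integrable[OF nice_m_radH(1)])
 have i2: "integrable_pos (\<lambda>r. 2 * hc r)" using ihc by simp
 note s1 = set_integral_add[OF i2 ihV]
 note s2 = set_integral_add[OF s1(1) iQ]
 note s3 = set_integral_diff[OF s2(1) im]
 \<comment> \<open>The form in m enters with a minus sign but integrates to zero by
   \<open>nice_m_form_zero\<close>.\<close>
 define L where "L r = 2 * hc r + hV r + hQ r - hm r" for r
 show ?thesis
 proof (rule that[of L])
  show "integrable_pos L" unfolding L_def[abs_def] by (rule s3(1))
  have "(LBINT r:{0<..}. L r) = 2 * 0 + (LBINT r:{0<..}. hV r) + (LBINT r:{0<..}. hQ r) - 0"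
   unfolding L_def s3(2) s2(2) s1(2) using hc0 nice_m_form_zero[folded hm_def] by simp
  then show "0 <= (LBINT r:{0<..}. L r)" using hV0 hq by (simp add: hQ_def)
  fix F r assume r: "0 < (r::real)"
  have "p r = f r + V r" "p' r = f' r + v r" by (simp_all add: V_def v_def)
  then show "energy_density D g F p p' q q' r = energy_density D g F f f' m m' r + L r
    + 1 / 2 * ((p r)^2 + (q r)^2 - ((f r)^2 + (m r)^2))^2 * r"
   unfolding energy_density_def L_def hc_def hV_def hQ_def hm_def c_def
   using energy_density_expansion[of "(f r)^2 + (m r)^2" "f r" "m r" "(f r + V r)^2 + (q r)^2" "V r" "q r" "f' r" "v r" "q' r" g "D / r^2" "(F r)^2" r "m' r"]
   by (simp only: diff_diff_eq)
 qed
qed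

text \<open>Picone's identity with m; the work is the bound on r m'/m. Near 0 it follows from m >=
  b. At infinity the potential is nonnegative, so r m' is nondecreasing, and it must stay
  nonpositive because m decays. Then m decreases, and a mean value argument bounds -r m' by a
  multiple of r^2 m.\<close>

lemma nice_positive_form:
 assumes mp: "!!r. 0 < r ==> 0 < m r" and b: "0 < b" "0 < \<rho>" "!!r. 0 < r ==> r <= \<rho> ==> b <= m r" and g: "0 < g" and U: "radH U v"
 shows "0 <= second_variation g f m U v"
proof -
 obtain C where G: "GLsol D g f f' f'' m m' m''" and C: "C > 0" and f: "!!r. 0 < r ==> f r <= 1" and
  fb: "!!r. 0 < r ==> 1 - (f r)^2 <= C / (1 + r^2)"
  and m0: "\<forall>\<^sub>F r in at_right 0. \<bar>m' r\<bar> <= C * r" and m1: "\<forall>\<^sub>F r in at_top. m r <= C / r^2"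
  by (rule nice_elim[OF N]) blast
 obtain B where B: "0 < B" "!!r. 0 < r ==> \<bar>1 - (f r)^2 - (m r)^2\<bar> <= B" by (rule nice_potential_bound) blast
 note d = GLsolD[OF G]
 define \<kappa> where "\<kappa> r = g - (1 - (f r)^2 - (m r)^2)" for r
 \<comment> \<open>For r >= 1 + C/g the chain C/(1 + r^2) <= C/r <= g makes the potential
   nonnegative.\<close>
 define R where "R = 1 + C / g"
 have R1: "1 <= R" using C g by (simp add: R_def)
 have \<kappa>0: "0 <= \<kappa> r" if r: "R <= r" for r
 proof -
  have r0: "0 < r" "1 <= r" using r R1 by auto
  have "C / (1 + r^2) <= C / r" using C r0 by (intro divide_left_mono) (auto simp: power2_eq_square intro!: mult_pos_pos add_pos_nonneg add_increasing)
  also have "... <= g"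
  proof -
   have "C + g <= g * r" using r C g by (simp add: R_def field_simps)
   then show ?thesis using g r0 by (simp add: pos_divide_le_eq)
  qed
  finally show ?thesis using fb[OF r0(1)] zero_le_power2[of "m r"] unfolding \<kappa>_def by linarith
 qed
 have \<kappa>B: "\<kappa> r <= g + B" if "0 < r" for r using B(2)[OF that] by (simp add: \<kappa>_def)
 define P where "P r = r * m' r" for r
 have dP: "DERIV P r :> r * (\<kappa> r * m r)" if r: "0 < r" for r
 proof -
  have "DERIV P r :> 1 * m' r + m'' r * r" unfolding P_def by (rule DERIV_mult[OF DERIV_ident d(4)[OF r]])
  moreover have "1 * m' r + m'' r * r = r * (m'' r + m' r / r)" using r by (simp add: field_simps)
  ultimately show ?thesis unfolding \<kappa>_def d(6)[OF r, symmetric] by simp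
 qed
 have Pmono: "P r <= P s" if "R <= r" "r <= s" for r s
 proof (rule DERIV_nonneg_imp_nondecreasing[OF that(2)])
  fix x assume x: "r <= x" "x <= s"
  then have "0 < x" "R <= x" using that R1 by auto
  then show "\<exists>y. DERIV P x :> y \<and> 0 <= y"
   using dP[of x] \<kappa>0[of x] mp[of x] by (intro exI[of _ "x * (\<kappa> x * m x)"]) auto
 qed
 have Pneg: "P r <= 0" if r: "R <= r" for r
 proof (rule ccontr)
  assume n: "\<not> P r <= 0"
  have r0: "0 < r" using r R1 by simp
  have inc: "m r <= m s" if s: "r <= s" for s
  proof (rule DERIV_nonneg_imp_nondecreasing[OF s])
   fix x assume x: "r <= x" "x <= s"
   have "0 < P x" using Pmono[OF r x(1)] n by linarith
   then have "0 <= m' x" using x r0 by (simp add: P_def zero_less_mult_iff)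
   then show "\<exists>y. DERIV m x :> y \<and> 0 <= y" using d(3)[of x] x r0 by (intro exI[of _ "m' x"]) auto
  qed
  obtain s0 where s0: "!!s. s0 <= s ==> m s <= C / s^2" using m1 unfolding eventually_at_top_linorder by auto
  \<comment> \<open>Chosen so that C/s^2 falls below m(r), although m does not decrease from r to
    s.\<close>
  define s where "s = max (max s0 r) (max 1 (2 * C / m r))"
  have s: "s0 <= s" "r <= s" "1 <= s" "2 * C / m r <= s" by (auto simp: s_def)
  have "m r <= C / s^2" using inc[OF s(2)] s0[OF s(1)] by linarith
  then have "m r * s^2 <= C" using s(3) by (simp add: pos_le_divide_eq)
  moreover have "m r * s <= m r * s^2" using s(3) mp[OF r0] by (simp add: power2_eq_square)
  moreover have "2 * C <= m r * s" using s(4) mp[OF r0] by (simp add: pos_divide_le_eq mult.commute)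
  ultimately show False using C by linarith
 qed
 have dec: "m s <= m r" if "R <= r" "r <= s" for r s
 proof (rule DERIV_nonpos_imp_nonincreasing[OF that(2)])
  fix x assume x: "r <= x" "x <= s"
  then have x0: "0 < x" "R <= x" using that R1 by auto
  have "m' x <= 0" using Pneg[OF x0(2)] x0 by (simp add: P_def mult_le_0_iff)
  then show "\<exists>y. DERIV m x :> y \<and> y <= 0" using d(3)[OF x0(1)] by (intro exI[of _ "m' x"]) auto
 qed
 have Pb: "\<bar>r * m' r\<bar> <= (2 * (1 + g + B)) * r^2 * m r" if r: "R <= r" for r
 proof -
  have r0: "0 < r" "1 <= r" using r R1 by auto
  obtain \<xi> where \<xi>: "r < \<xi>" "\<xi> < r + 1" "m (r + 1) - m r = (r + 1 - r) * m' \<xi>"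
   using MVT2[of r "r + 1" m m'] d(3) r0 by auto
  obtain \<eta> where \<eta>: "r < \<eta>" "\<eta> < \<xi>" "P \<xi> - P r = (\<xi> - r) * (\<eta> * (\<kappa> \<eta> * m \<eta>))"
   using MVT2[of r \<xi> P "\<lambda>x. x * (\<kappa> x * m x)"] dP r0 \<xi> by auto
  have "- m r <= m' \<xi>" using \<xi>(3) mp[of "r + 1"] r0 by simp
  then have "\<xi> * - m r <= P \<xi>" unfolding P_def using \<xi> r0 by (intro mult_left_mono) auto
  moreover have "\<xi> * m r <= (r + 1) * m r" using \<xi> mp[OF r0(1)] by (intro mult_right_mono) auto
  moreover have "(\<xi> - r) * (\<eta> * (\<kappa> \<eta> * m \<eta>)) <= 1 * ((r + 1) * ((g + B) * m r))"
   using \<xi> \<eta> r r0 \<kappa>0[of \<eta>] \<kappa>B[of \<eta>] dec[of r \<eta>] mp[of \<eta>] mp[of r] B(1) g by (intro mult_mono) auto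
  ultimately have "- P r <= (r + 1) * m r + (r + 1) * ((g + B) * m r)" using \<eta>(3) unfolding mult_1_left mult_minus_right by linarith
  also have "... = (r + 1) * ((1 + g + B) * m r)" by (simp add: algebra_simps)
  also have "... <= (2 * r^2) * ((1 + g + B) * m r)"
  proof (intro mult_right_mono)
   have "r <= r^2" using r0 by (simp add: power2_eq_square)
   then show "r + 1 <= 2 * r^2" using r0 by linarith
  qed (use mp[OF r0(1)] g B(1) in auto)
  finally have "- P r <= (2 * (1 + g + B)) * r^2 * m r" by (simp only: mult_ac)
  then show ?thesis using Pneg[OF r] by (simp add: P_def)
 qed
 have mc: "(U r)^2 * \<bar>r * m' r / m r\<bar> <= (U r)^2 * (K * r^2)" if "0 < r" "\<bar>r * m' r\<bar> <= K * r^2 * m r" for r K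
  using that mp[OF that(1)] by (intro mult_left_mono) (auto simp: pos_divide_le_eq)
 define K where "K = C / b + 2 * (1 + g + B)"
 have K: "C / b <= K" "2 * (1 + g + B) <= K" "0 <= K" using C b(1) g B(1) by (auto simp: K_def add_nonneg_nonneg)
 have aU: "acd U v" and U2: "integrable_pos (\<lambda>r. (U r)^2 * r)" using U by (auto simp: radH_def)
 show ?thesis
 proof (rule picone[OF aU mp d(3,4) nice_continuous(6) _ nice_form_integrable[OF U] U2, where C = K])
  show "m'' r + m' r / r <= (g - (1 - (f r)^2 - (m r)^2)) * m r" if "0 < r" for r using d(6)[OF that] by simp
  have e: "\<forall>\<^sub>F r in at_right 0. 0 < r \<and> r < \<rho>" using b(2) by (auto simp: eventually_at_right_field intro!: exI[of _ \<rho>])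
  show "\<forall>\<^sub>F r in at_right 0. \<bar>(U r)^2 * (r * m' r / m r)\<bar> <= K * (r * ((U r)^2 * r))"
   using m0 e
  proof eventually_elim
   case (elim r)
   then have r: "0 < r" "r <= \<rho>" by auto
   have "\<bar>r * m' r\<bar> <= r * (C * r)" unfolding abs_mult using elim by (intro mult_mono) auto
   also have "... = C / b * r^2 * b" using b(1) by (simp add: power2_eq_square)
   also have "... <= K * r^2 * m r" using K(1,3) b(1) b(3)[OF r] C by (intro mult_mono mult_right_mono) auto
   finally have "(U r)^2 * \<bar>r * m' r / m r\<bar> <= (U r)^2 * (K * r^2)" by (rule mc[OF r(1)])
   then show ?case by (simp add: abs_mult) (simp add: power2_eq_square mult_ac)
  qed
  show "\<forall>\<^sub>F r in at_top. \<bar>(U r)^2 * (r * m' r / m r)\<bar> <= K * (r * ((U r)^2 * r))"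
   using eventually_ge_at_top[of R]
  proof eventually_elim
   case (elim r)
   have r: "0 < r" using elim R1 by simp
   note Pb[OF elim]
   also have "2 * (1 + g + B) * r^2 * m r <= K * r^2 * m r" using K(2) mp[OF r] by (intro mult_right_mono) auto
   finally have "(U r)^2 * \<bar>r * m' r / m r\<bar> <= (U r)^2 * (K * r^2)" by (rule mc[OF r])
   then show ?case by (simp add: abs_mult) (simp add: power2_eq_square mult_ac)
  qed
 qed (use U2 in auto)
qed

end


text \<open>Both profiles are at most of order sqrt r at the origin and approach 1 at rate r^(-2),
  whatever their second components and couplings are. Hence the difference has all the norms
  required of a variation V in \<open>energy_comparison\<close>.\<close>

lemma nice_difference:
 assumes N1: "nice D g f1 f1' f1'' m1 m1' m1''" and N2: "nice D h f2 f2' f2'' m2 m2' m2''" and D: "0 <= D"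
 shows "integrable_pos (\<lambda>r. (f1 r - f2 r)^2 * r)" "integrable_pos (\<lambda>r. (f1 r - f2 r)^2 / r)"
  "integrable_pos (\<lambda>r. (f1' r - f2' r)^2 * r)"
  "integrable_pos (\<lambda>r. D / r^2 * ((f1 r)^2 - (f2 r)^2) * r)"
proof -
 obtain A where A: "A > 0" and f1: "!!r. 0 < r ==> 0 < f1 r" "!!r. 0 < r ==> f1 r <= 1" and
  a: "!!r. 0 < r ==> (f1 r)^2 <= A * r" "!!r. 0 < r ==> (f1' r)^2 * r <= A / (1 + r^2)" "!!r. 0 < r ==> 1 - (f1 r)^2 <= A / (1 + r^2)"
  by (rule nice_elim[OF N1]) blast
 obtain B where B: "B > 0" and f2: "!!r. 0 < r ==> 0 < f2 r" "!!r. 0 < r ==> f2 r <= 1" and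
  b: "!!r. 0 < r ==> (f2 r)^2 <= B * r" "!!r. 0 < r ==> (f2' r)^2 * r <= B / (1 + r^2)" "!!r. 0 < r ==> 1 - (f2 r)^2 <= B / (1 + r^2)"
  by (rule nice_elim[OF N2]) blast
 note c = nice_continuous[OF N1 D] nice_continuous[OF N2 D]
 define C where "C = A + B"
 have C: "0 < C" "A <= C" "B <= C" using A B by (auto simp: C_def)
 have p: "0 < 1 + r^2" for r :: real by (simp add: add_pos_nonneg)
 have rl: "r / (1 + r^2) <= 1" for r :: real using p[of r] zero_le_power2[of "r - 1"]
   by (auto simp: pos_divide_le_eq power2_eq_square algebra_simps)
 have sq: "\<bar>(f1 r)^2 - (f2 r)^2\<bar> <= C / (1 + r^2)" if r: "0 < r" for r
 proof -
  have "A / (1 + r^2) <= C / (1 + r^2)" "B / (1 + r^2) <= C / (1 + r^2)" using C p[of r] by (auto intro!: divide_right_mono)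
  moreover have "(f1 r)^2 <= 1" "(f2 r)^2 <= 1" using f1[OF r] f2[OF r] by (auto simp: power_le_one)
  ultimately show ?thesis using a(3)[OF r] b(3)[OF r] by linarith
 qed
 have V: "\<bar>f1 r - f2 r\<bar> <= C / (1 + r^2)" if r: "0 < r" for r
 proof -
  have "A / (1 + r^2) <= C / (1 + r^2)" "B / (1 + r^2) <= C / (1 + r^2)" using C p[of r] by (auto intro!: divide_right_mono)
  moreover have "(f1 r)^2 <= f1 r" "(f2 r)^2 <= f2 r" using f1[OF r] f2[OF r] mult_left_mono[of "f1 r" 1 "f1 r"] mult_left_mono[of "f2 r" 1 "f2 r"] by (auto simp: power2_eq_square)
  ultimately show ?thesis using a(3)[OF r] b(3)[OF r] f1(2)[OF r] f2(2)[OF r] by linarith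
 qed
 have V2: "(f1 r - f2 r)^2 * r <= C^2 / (1 + r^2)" if r: "0 < r" for r
 proof -
  have "\<bar>f1 r - f2 r\<bar> * \<bar>f1 r - f2 r\<bar> <= C / (1 + r^2) * (C / (1 + r^2))" using V[OF r] C p[of r] by (intro mult_mono) auto
  then have "(f1 r - f2 r)^2 * r <= C / (1 + r^2) * (C / (1 + r^2)) * r" using r by (intro mult_right_mono) (auto simp: power2_eq_square abs_mult_self_eq)
  also have "... = C^2 / (1 + r^2) * (r / (1 + r^2))" by (simp add: power2_eq_square)
  also have "... <= C^2 / (1 + r^2) * 1" using rl p by (intro mult_left_mono) auto
  finally show ?thesis by simp
 qed
 \<comment> \<open>On (0, 1] the factor 1 + r^2 is at most 2, so a constant bound there costs only
   the factor 2.\<close>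
 have split: "y <= K / (1 + r^2)" if "0 < r" "r <= 1 ==> y <= K / 2" "1 <= r ==> y <= K / (1 + r^2)" "0 <= K" for r y K :: real
 proof (cases "r <= 1")
  case True
  have "K / 2 <= K / (1 + r^2)" using that(1,4) True p[of r] by (intro divide_left_mono) (auto simp: power_le_one)
  then show ?thesis using that(2)[OF True] by linarith
 qed (use that in auto)
 show "integrable_pos (\<lambda>r. (f1 r - f2 r)^2 * r)"
  using V2 by (intro decay_integrable[where K="C^2"] continuous_intros c) auto
 show "integrable_pos (\<lambda>r. (f1 r - f2 r)^2 / r)"
 proof (rule decay_integrable[where K="C^2 + 4 * C"])
  show "continuous_on {0<..} (\<lambda>r. (f1 r - f2 r)^2 / r)" by (intro continuous_intros c) auto
  fix r :: real assume r: "0 < r"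
  have "(f1 r - f2 r)^2 / r <= (C^2 + 4 * C) / (1 + r^2)"
  proof (rule split[OF r])
   have "(f1 r - f2 r)^2 <= 2 * (f1 r)^2 + 2 * (f2 r)^2" using square_add_le[of "f1 r" "- f2 r"] by simp
   also have "... <= 2 * C * r" using a(1)[OF r] b(1)[OF r] by (simp add: C_def algebra_simps)
   finally have "(f1 r - f2 r)^2 / r <= 2 * C" using r by (simp add: pos_divide_le_eq)
   also have "2 * C <= (C^2 + 4 * C) / 2" by simp
   finally show "(f1 r - f2 r)^2 / r <= (C^2 + 4 * C) / 2" .
   assume "1 <= r"
   then have "1 <= r * r" using mult_mono[of 1 r 1 r] by simp
   then have "(f1 r - f2 r)^2 * 1 <= (f1 r - f2 r)^2 * (r * r)" by (intro mult_left_mono) auto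
   then have "(f1 r - f2 r)^2 / r <= (f1 r - f2 r)^2 * r" using r by (simp add: pos_divide_le_eq mult_ac)
   also note V2[OF r]
   also have "C^2 / (1 + r^2) <= (C^2 + 4 * C) / (1 + r^2)" using C by (intro divide_right_mono) auto
   finally show "(f1 r - f2 r)^2 / r <= (C^2 + 4 * C) / (1 + r^2)" .
  qed (use C in auto)
  then show "\<bar>(f1 r - f2 r)^2 / r\<bar> <= (C^2 + 4 * C) / (1 + r^2)" using r by simp
 qed
 show "integrable_pos (\<lambda>r. (f1' r - f2' r)^2 * r)"
 proof (rule decay_integrable[where K="2 * C"])
  show "continuous_on {0<..} (\<lambda>r. (f1' r - f2' r)^2 * r)" by (intro continuous_intros c)
  fix r :: real assume r: "0 < r"
  have "(f1' r - f2' r)^2 * r <= (2 * (f1' r)^2 + 2 * (f2' r)^2) * r" using square_add_le[of "f1' r" "- f2' r"] r by (intro mult_right_mono) auto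
  also have "... = 2 * ((f1' r)^2 * r) + 2 * ((f2' r)^2 * r)" by (simp add: algebra_simps)
  also have "... <= 2 * (A / (1 + r^2)) + 2 * (B / (1 + r^2))" using a(2)[OF r] b(2)[OF r] by (intro add_mono mult_left_mono) auto
  also have "... = 2 * C / (1 + r^2)" by (simp add: C_def add_divide_distrib)
  finally show "\<bar>(f1' r - f2' r)^2 * r\<bar> <= 2 * C / (1 + r^2)" using r by simp
 qed
 show "integrable_pos (\<lambda>r. D / r^2 * ((f1 r)^2 - (f2 r)^2) * r)"
 proof (rule decay_integrable[where K="2 * C * D"])
  show "continuous_on {0<..} (\<lambda>r. D / r^2 * ((f1 r)^2 - (f2 r)^2) * r)" by (intro continuous_intros c) auto
  fix r :: real assume r: "0 < r"
  have "\<bar>(f1 r)^2 - (f2 r)^2\<bar> / r <= 2 * C / (1 + r^2)"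
  proof (rule split[OF r])
   have "\<bar>(f1 r)^2 - (f2 r)^2\<bar> <= C * r" using a(1)[OF r] b(1)[OF r] zero_le_power2[of "f1 r"] zero_le_power2[of "f2 r"]
    unfolding C_def distrib_right by linarith
   then show "\<bar>(f1 r)^2 - (f2 r)^2\<bar> / r <= 2 * C / 2" using r by (simp add: pos_divide_le_eq)
   assume r1: "1 <= r"
   have "\<bar>(f1 r)^2 - (f2 r)^2\<bar> / r <= \<bar>(f1 r)^2 - (f2 r)^2\<bar> / 1" using r1 by (intro divide_left_mono) auto
   also have "... <= C / (1 + r^2)" using sq[OF r] by simp
   also have "... <= 2 * C / (1 + r^2)" using C by (intro divide_right_mono) auto
   finally show "\<bar>(f1 r)^2 - (f2 r)^2\<bar> / r <= 2 * C / (1 + r^2)" .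
  qed (use C in auto)
  then have "D * (\<bar>(f1 r)^2 - (f2 r)^2\<bar> / r) <= D * (2 * C / (1 + r^2))" using D by (intro mult_left_mono) auto
  moreover have "\<bar>D / r^2 * ((f1 r)^2 - (f2 r)^2) * r\<bar> = D * (\<bar>(f1 r)^2 - (f2 r)^2\<bar> / r)"
   using r D by (simp add: abs_mult power2_eq_square)
  ultimately show "\<bar>D / r^2 * ((f1 r)^2 - (f2 r)^2) * r\<bar> <= 2 * C * D / (1 + r^2)" by (simp add: mult_ac)
 qed
qed

lemma nice_energy_integrable:
 assumes N: "nice D g f f' f'' m m' m''" and N0: "nice D h F F' F'' M M' M''" and D: "0 <= D"
 shows "integrable_pos (energy_density D g F f f' m m')"
proof -
 obtain C where C: "C > 0" and b: "!!r. 0 < r ==> (f' r)^2 * r <= C / (1 + r^2)"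
  by (rule nice_elim[OF N]) blast
 obtain B where B: "0 < B" "!!r. 0 < r ==> (1 - (f r)^2 - (m r)^2)^2 * r <= B / (1 + r^2)" by (rule nice_potential_bound[OF N D]) blast
 note c = nice_continuous[OF N D]
 have 1: "integrable_pos (\<lambda>r. (f' r)^2 * r)" using b by (intro decay_integrable[where K=C] continuous_intros c) auto
 have 2: "integrable_pos (\<lambda>r. (1 - (f r)^2 - (m r)^2)^2 * r)" using B(2) by (intro decay_integrable[where K=B] continuous_intros c) auto
 have 3: "integrable_pos (\<lambda>r. (m r)^2 * r)" "integrable_pos (\<lambda>r. (m' r)^2 * r)"
  using nice_m_radH(1)[OF N D] by (auto simp: radH_def)
 have "integrable_pos (\<lambda>r. (f' r)^2 * r + ((m' r)^2 * r + (g * ((m r)^2 * r)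
   + (D / r^2 * ((f r)^2 - (F r)^2) * r + 1 / 2 * ((1 - (f r)^2 - (m r)^2)^2 * r)))))"
  by (intro set_integral_add(1) 1 3 nice_difference(4)[OF N N0 D] set_integrable_mult_right 2)
 then show ?thesis unfolding energy_density_def[abs_def] by (simp add: algebra_simps)
qed

text \<open>The two comparison identities are added pointwise, so the energies cancel before any
  integration. The Wronskian W is constant and bounded by A f1 + B f2 near the origin, where both
  profiles vanish; the ratio f1/f2 is then constant, and its limit at infinity is 1.\<close>

lemma nice_unique:
 assumes N1: "nice D g f1 f1' f1'' m1 m1' m1''" and N2: "nice D g f2 f2' f2'' m2 m2' m2''" and D: "0 <= D"
  and h12: "0 <= second_variation g f1 m1 m2 m2'"
  and h21: "0 <= second_variation g f2 m2 m1 m1'"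
  and r: "0 < r"
 shows "f1 r = f2 r" "m1 r = m2 r"
proof -
 obtain L1 where L1: "integrable_pos L1" "0 <= (LBINT r:{0<..}. L1 r)"
  "!!F r. 0 < r ==> energy_density D g F f2 f2' m2 m2' r = energy_density D g F f1 f1' m1 m1' r + L1 r
    + 1 / 2 * ((f2 r)^2 + (m2 r)^2 - ((f1 r)^2 + (m1 r)^2))^2 * r"
  by (rule energy_comparison[OF N1 D nice_acd(1)[OF N2 D] nice_difference(1-3)[OF N2 N1 D] nice_m_radH(1)[OF N2 D] h12]) blast
 obtain L2 where L2: "integrable_pos L2" "0 <= (LBINT r:{0<..}. L2 r)"
  "!!F r. 0 < r ==> energy_density D g F f1 f1' m1 m1' r = energy_density D g F f2 f2' m2 m2' r + L2 r
    + 1 / 2 * ((f1 r)^2 + (m1 r)^2 - ((f2 r)^2 + (m2 r)^2))^2 * r"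
  by (rule energy_comparison[OF N2 D nice_acd(1)[OF N1 D] nice_difference(1-3)[OF N1 N2 D] nice_m_radH(1)[OF N1 D] h21]) blast
 define z where "z r = ((f1 r)^2 + (m1 r)^2 - ((f2 r)^2 + (m2 r)^2))^2 * r" for r
 note c = nice_continuous[OF N1 D] nice_continuous[OF N2 D]
 have zz: "z r = - (L1 r + L2 r)" if r: "0 < r" for r
 proof -
  have "1 / 2 * ((f2 r)^2 + (m2 r)^2 - ((f1 r)^2 + (m1 r)^2))^2 * r = 1 / 2 * z r" "1 / 2 * ((f1 r)^2 + (m1 r)^2 - ((f2 r)^2 + (m2 r)^2))^2 * r = 1 / 2 * z r"
   unfolding z_def by (simp_all add: power2_commute)
  \<comment> \<open>The reference profile in the density cancels; the zero function is an arbitrary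
    choice.\<close>
  then show ?thesis using L1(3)[OF r, of "\<lambda>_. 0"] L2(3)[OF r, of "\<lambda>_. 0"] by linarith
 qed
 note LL = set_integral_add[OF L1(1) L2(1)]
 have iz: "integrable_pos z"
 proof -
  have "integrable_pos (\<lambda>r. (- 1) * (L1 r + L2 r))" by (rule set_integrable_mult_right[OF LL(1)])
  moreover have "integrable_pos z = integrable_pos (\<lambda>r. (- 1) * (L1 r + L2 r))"
   by (rule set_integrable_cong) (use zz in auto)
  ultimately show ?thesis by simp
 qed
 have "(LBINT r:{0<..}. z r) = (LBINT r:{0<..}. (- 1) * (L1 r + L2 r))"
  by (rule set_lebesgue_integral_cong) (use zz in auto)
 then have z0: "(LBINT r:{0<..}. z r) <= 0" 
  unfolding set_integral_mult_right using L1(2) L2(2) LL(2) by simp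
 have seq: "(f1 r)^2 + (m1 r)^2 = (f2 r)^2 + (m2 r)^2" if r: "0 < r" for r
 proof (rule ccontr)
  assume n: "(f1 r)^2 + (m1 r)^2 ~= (f2 r)^2 + (m2 r)^2"
  have "0 < (LBINT r:{0<..}. z r)"
  proof (rule set_integral_pos[OF iz, where ?x0.0=r])
   show "continuous_on {0<..} z" unfolding z_def[abs_def] by (intro continuous_intros c)
   show "0 < z r" using n r by (simp add: z_def)
  qed (use r in \<open>auto simp: z_def\<close>)
  then show False using z0 by simp
 qed
 obtain A where G1: "GLsol D g f1 f1' f1'' m1 m1' m1''" and A: "A > 0" and f1: "!!r. 0 < r ==> 0 < f1 r" "!!r. 0 < r ==> f1 r <= 1" and
  a: "!!r. 0 < r ==> (f1 r)^2 <= A * r" "!!r. 0 < r ==> 1 - (f1 r)^2 <= A / (1 + r^2)" "\<forall>\<^sub>F r in at_right 0. \<bar>r * f1' r\<bar> <= A * f1 r"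
  by (rule nice_elim[OF N1]) blast
 obtain B where G2: "GLsol D g f2 f2' f2'' m2 m2' m2''" and B: "B > 0" and f2: "!!r. 0 < r ==> 0 < f2 r" "!!r. 0 < r ==> f2 r <= 1" and
  b: "!!r. 0 < r ==> (f2 r)^2 <= B * r" "!!r. 0 < r ==> 1 - (f2 r)^2 <= B / (1 + r^2)" "\<forall>\<^sub>F r in at_right 0. \<bar>r * f2' r\<bar> <= B * f2 r"
  by (rule nice_elim[OF N2]) blast
 note d1 = GLsolD[OF G1] and d2 = GLsolD[OF G2]
 define W where "W r = r * (f1' r * f2 r - f2' r * f1 r)" for r
 have dW: "DERIV W r :> 0" if r: "0 < r" for r
 proof -
  have "DERIV W r :> 1 * (f1' r * f2 r - f2' r * f1 r) + ((f1'' r * f2 r + f2' r * f1' r) - (f2'' r * f1 r + f1' r * f2' r)) * r"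
   unfolding W_def by (intro DERIV_mult DERIV_diff DERIV_ident d1[OF r] d2[OF r])
  moreover have "1 * (f1' r * f2 r - f2' r * f1 r) + ((f1'' r * f2 r + f2' r * f1' r) - (f2'' r * f1 r + f1' r * f2' r)) * r
    = r * ((f1'' r + f1' r / r) * f2 r - (f2'' r + f2' r / r) * f1 r)" using r by (simp add: field_simps)
  moreover have "(f1'' r + f1' r / r) * f2 r - (f2'' r + f2' r / r) * f1 r = 0"
   unfolding d1(5)[OF r] d2(5)[OF r] using seq[OF r] by (simp add: algebra_simps)
  ultimately show ?thesis by simp
 qed
 have Wc: "W r = W 1" if r: "0 < r" for r
  by (rule DERIV_isconst3[of 0 "max r 1 + 1" r 1 W]) (use r dW in auto)
 have sqz: "((\<lambda>r. sqrt (K * r)) \<longlongrightarrow> 0) (at_right 0)" for K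
 proof -
  have "((\<lambda>r. sqrt (K * r)) \<longlongrightarrow> sqrt (K * 0)) (at_right 0)" by (intro tendsto_intros)
  then show ?thesis by simp
 qed
 have "((\<lambda>r. A * sqrt (A * r) + B * sqrt (B * r)) \<longlongrightarrow> A * 0 + B * 0) (at_right 0)" by (intro tendsto_intros sqz)
 then have lim0: "((\<lambda>r. A * sqrt (A * r) + B * sqrt (B * r)) \<longlongrightarrow> 0) (at_right 0)" by simp
 have "\<forall>\<^sub>F r in at_right 0. norm (W 1) <= A * sqrt (A * r) + B * sqrt (B * r)"
  using a(3) b(3) eventually_at_right_pos
 proof eventually_elim
  case (elim r)
  then have r: "0 < r" by simp
  have "\<bar>r * f1' r\<bar> * f2 r <= (A * f1 r) * 1" "\<bar>r * f2' r\<bar> * f1 r <= (B * f2 r) * 1"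
   using elim f1[OF r] f2[OF r] A B by (intro mult_mono; simp)+
  moreover have "W r = (r * f1' r) * f2 r - (r * f2' r) * f1 r" by (simp add: W_def algebra_simps)
  moreover have "\<bar>(r * f1' r) * f2 r\<bar> = \<bar>r * f1' r\<bar> * f2 r" "\<bar>(r * f2' r) * f1 r\<bar> = \<bar>r * f2' r\<bar> * f1 r"
   using f1[OF r] f2[OF r] by (simp_all add: abs_mult)
  ultimately have "\<bar>W r\<bar> <= A * f1 r + B * f2 r" by linarith
  also have "... <= A * sqrt (A * r) + B * sqrt (B * r)"
   using a(1)[OF r] b(1)[OF r] A B by (intro add_mono mult_left_mono real_le_rsqrt) auto
  finally show ?case using Wc[OF r] by simp
 qed
 then have "((\<lambda>r::real. W 1) \<longlongrightarrow> 0) (at_right 0)" using lim0 by (rule Lim_null_comparison)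
 then have W1: "W 1 = 0" by (simp add: tendsto_const_iff)
 define k where "k r = f1 r / f2 r" for r
 have dk: "DERIV k r :> 0" if r: "0 < r" for r
 proof -
  have "DERIV k r :> (f1' r * f2 r - f1 r * f2' r) / (f2 r * f2 r)"
   unfolding k_def by (rule DERIV_divide[OF d1(1)[OF r] d2(1)[OF r]]) (use f2(1)[OF r] in simp)
  moreover have "f1' r * f2 r - f1 r * f2' r = 0" using Wc[OF r] W1 r by (simp add: W_def mult_ac)
  ultimately show ?thesis by simp
 qed
 have kc: "k s = k r" if s: "0 < s" for s
  by (rule DERIV_isconst3[of 0 "max s r + 1" s r k]) (use s r dk in auto)
 have lim1: "(f \<longlongrightarrow> 1) at_top" if f: "!!r. 0 < r ==> 0 < f r" "!!r. 0 < r ==> f r <= 1" "!!r. 0 < r ==> 1 - (f r)^2 <= K / (1 + r^2)" for f :: "real => real" and K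
 proof -
  have "((\<lambda>r. K / (1 + r^2)) \<longlongrightarrow> 0) at_top"
   by (intro real_tendsto_divide_at_top[OF tendsto_const] filterlim_tendsto_add_at_top[OF tendsto_const] filterlim_pow_at_top filterlim_ident) auto
  moreover have "\<forall>\<^sub>F r in at_top. norm (f r - 1) <= K / (1 + r^2)"
   using eventually_gt_at_top[of 0]
  proof eventually_elim
   case (elim r)
   have "(f r)^2 <= f r * 1" unfolding power2_eq_square using f(1,2)[OF elim] by (intro mult_left_mono) auto
   then show ?case using f(2,3)[OF elim] by simp
  qed
  ultimately have "((\<lambda>r. f r - 1) \<longlongrightarrow> 0) at_top" by (rule Lim_null_comparison[rotated])
  then show ?thesis by (rule LIM_zero_cancel)
 qed
 have "(k \<longlongrightarrow> 1 / 1) at_top" unfolding k_def by (intro tendsto_divide lim1[OF f1 a(2)] lim1[OF f2 b(2)]) auto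
 moreover have "\<forall>\<^sub>F s in at_top. k s = k r" using eventually_gt_at_top[of 0] by eventually_elim (rule kc)
 ultimately have "((\<lambda>s::real. k r) \<longlongrightarrow> 1) at_top" by (simp add: tendsto_cong)
 then have "k r = 1" by (simp add: tendsto_const_iff)
 then show f: "f1 r = f2 r" using f2(1)[OF r] by (simp add: k_def)
 have "(m1 r)^2 = (m2 r)^2" using seq[OF r] f by simp
 then show "m1 r = m2 r" using d1(8)[OF r] d2(8)[OF r] by simp
qed


section \<open>Admissible solutions\<close>

lemma set_nn_integral_eq: "(\<integral>\<^sup>+r\<in>A. ennreal (h r) \<partial>lborel) = (\<integral>\<^sup>+r. ennreal (indicator A r *\<^sub>R h r) \<partial>lborel)"
 by (intro nn_integral_cong) (auto simp: indicator_def)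

lemma ext_integral_cong_AE:
 assumes "AE r in lborel. 0 < r --> h r = k r"
 shows "ext_integral {0<..} h = ext_integral {0<..} k"
proof -
 have "(\<integral>\<^sup>+r\<in>{0<..}. ennreal (h r) \<partial>lborel) = (\<integral>\<^sup>+r\<in>{0<..}. ennreal (k r) \<partial>lborel)"
  using assms by (intro nn_integral_cong_AE) (auto elim!: eventually_mono simp: indicator_def)
 moreover have "(\<integral>\<^sup>+r\<in>{0<..}. ennreal (- h r) \<partial>lborel) = (\<integral>\<^sup>+r\<in>{0<..}. ennreal (- k r) \<partial>lborel)"
  using assms by (intro nn_integral_cong_AE) (auto elim!: eventually_mono simp: indicator_def)
 ultimately show ?thesis by (simp add: ext_integral_def)
qed

lemma ext_integral_mono_AE:
 assumes "AE r in lborel. 0 < r --> h r <= k r"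
 shows "ext_integral {0<..} h <= ext_integral {0<..} k"
 unfolding ext_integral_def
proof (intro ereal_minus_mono)
 have "(\<integral>\<^sup>+r\<in>{0<..}. ennreal (h r) \<partial>lborel) <= (\<integral>\<^sup>+r\<in>{0<..}. ennreal (k r) \<partial>lborel)"
  using assms by (intro nn_integral_mono_AE) (auto elim!: eventually_mono simp: indicator_def ennreal_leI)
 then show "enn2ereal (\<integral>\<^sup>+r\<in>{0<..}. ennreal (h r) \<partial>lborel) <= enn2ereal (\<integral>\<^sup>+r\<in>{0<..}. ennreal (k r) \<partial>lborel)"
  by (simp add: less_eq_ennreal.rep_eq)
 have "(\<integral>\<^sup>+r\<in>{0<..}. ennreal (- k r) \<partial>lborel) <= (\<integral>\<^sup>+r\<in>{0<..}. ennreal (- h r) \<partial>lborel)"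
  using assms by (intro nn_integral_mono_AE) (auto elim!: eventually_mono simp: indicator_def ennreal_leI)
 then show "enn2ereal (\<integral>\<^sup>+r\<in>{0<..}. ennreal (- k r) \<partial>lborel) <= enn2ereal (\<integral>\<^sup>+r\<in>{0<..}. ennreal (- h r) \<partial>lborel)"
  by (simp add: less_eq_ennreal.rep_eq)
qed

lemma ext_integral_eq:
 assumes "integrable_pos h"
 shows "ext_integral {0<..} h = ereal (LBINT r:{0<..}. h r)"
proof -
 let ?J = "\<lambda>r. indicator {0<..} r *\<^sub>R h r"
 have i: "integrable lborel ?J" using assms by (simp add: set_integrable_def)
 have fin: "enn2ereal x = ereal (enn2real x)" if "x ~= \<infinity>" for x
 proof -
  have "ennreal (enn2real x) = x" using that by (intro ennreal_enn2real) (simp add: less_top)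
  then have "enn2ereal x = enn2ereal (ennreal (enn2real x))" by simp
  then show ?thesis by (simp add: enn2ereal_ennreal)
 qed
 have "(\<integral>\<^sup>+r. ennreal (?J r) \<partial>lborel) ~= \<infinity>" "(\<integral>\<^sup>+r. ennreal (- ?J r) \<partial>lborel) ~= \<infinity>" using i by (simp_all add: real_integrable_def)
 moreover have "(\<integral>\<^sup>+r\<in>{0<..}. ennreal (- h r) \<partial>lborel) = (\<integral>\<^sup>+r. ennreal (- ?J r) \<partial>lborel)"
  unfolding set_nn_integral_eq by simp
 ultimately show ?thesis
  unfolding ext_integral_def set_lebesgue_integral_def real_lebesgue_integral_def[OF i] set_nn_integral_eq[of h]
  using fin by simp
qed

text \<open>The negative part is dominated by k, so a value below infinity forces the positive part
  to be finite.\<close>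

lemma ext_integral_integrable:
 assumes h: "measurable_pos h" and k: "integrable_pos k"
  and le: "!!r. 0 < r ==> - k r <= h r" and fin: "ext_integral {0<..} h < \<infinity>"
 shows "integrable_pos h"
proof -
 let ?J = "\<lambda>r. indicator {0<..} r *\<^sub>R h r"
 have "(\<integral>\<^sup>+r. ennreal (- ?J r) \<partial>lborel) <= (\<integral>\<^sup>+r. ennreal (indicator {0<..} r *\<^sub>R k r) \<partial>lborel)"
 proof (intro nn_integral_mono ennreal_leI)
  fix r :: real show "- ?J r <= indicator {0<..} r *\<^sub>R k r" using le[of r] by (cases "0 < r") auto
 qed
 also have "... < \<infinity>" using k by (simp add: set_integrable_def real_integrable_def less_top)
 finally have n: "(\<integral>\<^sup>+r. ennreal (- ?J r) \<partial>lborel) < \<infinity>" .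
 have n': "(\<integral>\<^sup>+r\<in>{0<..}. ennreal (- h r) \<partial>lborel) = (\<integral>\<^sup>+r. ennreal (- ?J r) \<partial>lborel)"
  unfolding set_nn_integral_eq by simp
 have "(\<integral>\<^sup>+r. ennreal (?J r) \<partial>lborel) ~= \<infinity>"
 proof
  assume p: "(\<integral>\<^sup>+r. ennreal (?J r) \<partial>lborel) = \<infinity>"
  obtain x where x: "(\<integral>\<^sup>+r. ennreal (- ?J r) \<partial>lborel) = ennreal x" "0 <= x" using n by (cases "(\<integral>\<^sup>+r. ennreal (- ?J r) \<partial>lborel)") auto
  have "ext_integral {0<..} h = \<infinity>" unfolding ext_integral_def n' set_nn_integral_eq[of h] p x(1) using x(2) by (simp add: enn2ereal_ennreal)
  then show False using fin by simp
 qed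
 then show ?thesis using h n unfolding set_integrable_def real_integrable_def by simp
qed

lemma GL_energy_eq:
 assumes p: "AE r in lborel. 0 < r --> p r = P r" "weak_gradient_on {0<..} p p'"
  and q: "AE r in lborel. 0 < r --> q r = Q r" "weak_gradient_on {0<..} q q'"
 shows "GL_energy d F g p q = ereal (1 / 2) * ext_integral {0<..} (energy_density ((of_int d)^2) g F P p' Q q')"
proof -
 have "AE r in lborel. 0 < r --> ((wderiv p r)^2 + (wderiv q r)^2 + g * (q r)^2 + (of_int d)^2 / r^2 * ((p r)^2 - (F r)^2)
   + 1 / 2 * (1 - (p r)^2 - (q r)^2)^2) * r = energy_density ((of_int d)^2) g F P p' Q q' r"
  using p(1) q(1) wderiv_AE[OF p(2)] wderiv_AE[OF q(2)] by eventually_elim (simp add: energy_density_def)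
 then show ?thesis unfolding GL_energy_def by (simp only: ext_integral_cong_AE)
qed

lemma GL_energy_acd:
 assumes "acd p p'" "acd q q'"
 shows "GL_energy d F g p q = ereal (1 / 2) * ext_integral {0<..} (energy_density ((of_int d)^2) g F p p' q q')"
 using assms by (intro GL_energy_eq acd_weak_gradient) auto

lemma C0_twice_diff_DERIV:
 assumes "C0_twice_diff f" "0 < r"
 shows "DERIV f r :> deriv f r" "DERIV (deriv f) r :> deriv (deriv f) r"
 using assms by (auto simp: C0_twice_diff_def DERIV_deriv_iff_real_differentiable)

lemma C0_twice_diffI:
 assumes c: "continuous_on {0..} f" and d: "!!r. 0 < r ==> DERIV f r :> f' r"
  and d': "!!r. 0 < r ==> DERIV f' r :> f'' r"
 shows "C0_twice_diff f" "0 < r ==> deriv f r = f' r" "0 < r ==> deriv (deriv f) r = f'' r"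
proof -
 have 1: "deriv f r = f' r" if "0 < r" for r by (rule DERIV_imp_deriv[OF d[OF that]])
 have 2: "DERIV (deriv f) r :> f'' r" if r: "0 < r" for r
 proof -
  have "\<forall>\<^sub>F x in nhds r. 0 < x" using eventually_nhds_in_open[of "{0<..}" r] r by simp
  then have "\<forall>\<^sub>F x in nhds r. deriv f x = f' x" by eventually_elim (rule 1)
  then have "DERIV (deriv f) r :> f'' r \<longleftrightarrow> DERIV f' r :> f'' r" by (intro DERIV_cong_ev) auto
  then show ?thesis using d'[OF r] by simp
 qed
 show "C0_twice_diff f" unfolding C0_twice_diff_def real_differentiable_def
  using c d 2 by (intro conjI allI impI) (assumption | rule exI)+
 show "0 < r ==> deriv f r = f' r" by (rule 1)
 show "0 < r ==> deriv (deriv f) r = f'' r" by (rule DERIV_imp_deriv[OF 2])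
qed

lemma C0_twice_diff_bounded:
 assumes "C0_twice_diff f"
 obtains M where "!!r. 0 < r ==> r <= 1 ==> f r <= M"
proof -
 have "continuous_on {0..1} f" by (rule continuous_on_subset[of "{0..}"]) (use assms in \<open>auto simp: C0_twice_diff_def\<close>)
 then obtain x where "\<forall>y\<in>{0..1}. f y <= f x" using continuous_attains_sup[of "{0..1::real}" f] by auto
 then show ?thesis by (intro that[of "f x"]) auto
qed

lemma eq_at_zero:
 assumes "C0_twice_diff f" "C0_twice_diff h" and e: "!!r. 0 < r ==> f r = h r"
 shows "f 0 = (h 0 :: real)"
proof -
 have cl: "closure {0<..} = {0::real..}" by (rule closure_greaterThan)
 have "continuous_on {0..} f" "continuous_on {0..} h" using assms by (simp_all add: C0_twice_diff_def)
 then have c: "continuous_on (closure {0<..}) (\<lambda>r. f r - h r)" unfolding cl by (rule continuous_on_diff)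
 have "f 0 - h 0 = 0" by (rule continuous_constant_on_closure[OF c]) (use e in \<open>simp_all add: cl\<close>)
 then show ?thesis by simp
qed

lemma GL_system_GLsol:
 assumes f: "C0_twice_diff f" and m: "C0_twice_diff m" and s: "GL_system d g f m" and p: "\<forall>r\<ge>0. f r >= 0 \<and> m r >= 0"
 shows "GLsol ((of_int d)^2) g f (deriv f) (deriv (deriv f)) m (deriv m) (deriv (deriv m))"
 unfolding GLsol_def
proof (intro allI impI conjI C0_twice_diff_DERIV[OF f] C0_twice_diff_DERIV[OF m])
 fix r :: real assume r: "0 < r"
 have "- deriv (deriv f) r - 1 / r * deriv f r + (of_int d)^2 / r^2 * f r = (1 - (f r)^2 - (m r)^2) * f r"
  "- deriv (deriv m) r - 1 / r * deriv m r + g * m r = (1 - (f r)^2 - (m r)^2) * m r"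
  using s r by (auto simp: GL_system_def)
 then show "deriv (deriv f) r + deriv f r / r = ((of_int d)^2 / r^2 - (1 - (f r)^2 - (m r)^2)) * f r"
  "deriv (deriv m) r + deriv m r / r = (g - (1 - (f r)^2 - (m r)^2)) * m r"
  by (simp_all add: algebra_simps)
 show "0 <= f r" "0 <= m r" using p r by auto
qed

text \<open>F plus the tail integral T of G is nonincreasing beyond R. T converges, and F <= G is
  small at some point by \<open>integrable_frequently_small\<close>; from that point on F can grow
  only by the oscillation of T.\<close>

lemma integrable_tail_decay:
 fixes F F' G :: "real => real"
 assumes R: "1 <= R" and d: "!!r. R < r ==> DERIV F r :> F' r"
  and cG: "continuous_on {0<..} G" and G0: "!!r. 0 < r ==> 0 <= G r" and iG: "set_integrable lborel {R<..} G"
  and F': "!!r. R < r ==> \<bar>F' r\<bar> <= G r" and F: "!!r. R < r ==> 0 <= F r" "!!r. R < r ==> F r <= G r"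
 shows "(F \<longlongrightarrow> 0) at_top"
proof -
 have Ga: "set_integrable lborel {a<..} G" if a: "0 < a" for a
 proof -
  have "set_integrable lborel {a..R} G" by (intro borel_integrable_atLeastAtMost' continuous_on_subset[OF cG]) (use a in auto)
  then have "set_integrable lborel ({a..R} \<union> {R<..}) G" by (intro set_integrable_Un iG) auto
  then show ?thesis by (rule set_integrable_subset) auto
 qed
 define T where "T r = (LBINT s:{r<..}. G s)" for r
 have aT: "acd T (\<lambda>r. - G r)" unfolding T_def[abs_def] by (rule tail_acd[OF Ga])
 have dT: "DERIV T r :> - G r" if "0 < r" for r
  by (rule acd_DERIV[OF aT _ that]) (intro continuous_intros cG)
 have "((\<lambda>b. LBINT x:{R..b}. G x) \<longlongrightarrow> (LBINT x:{R..}. G x)) at_top"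
  by (rule tendsto_set_lebesgue_integral_at_top) (use R in \<open>auto intro!: set_integrable_subset[OF Ga[of "R/2"]]\<close>)
 then have l: "((\<lambda>b. T R - (LBINT x:{R..b}. G x)) \<longlongrightarrow> T R - (LBINT x:{R..}. G x)) at_top"
  by (intro tendsto_intros)
 define l where "l = T R - (LBINT x:{R..}. G x)"
 have "(T \<longlongrightarrow> l) at_top"
 proof (rule Lim_transform_eventually[OF l[folded l_def]])
  show "\<forall>\<^sub>F b in at_top. T R - (LBINT x:{R..b}. G x) = T b"
   using eventually_ge_at_top[of R]
  proof eventually_elim
   case (elim b)
   have "(LBINT x:{R..b}. - G x) = T b - T R" by (rule acdD(2)[OF aT]) (use R elim in auto)
   then show ?case by (simp add: set_lebesgue_integral_def)
  qed
 qed
 have ih: "integrable_pos (\<lambda>r. indicator {R<..} r * G r)"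
 proof -
  have "(\<lambda>r. indicator {0<..} r *\<^sub>R (indicator {R<..} r * G r)) = (\<lambda>r. indicator {R<..} r *\<^sub>R G r)"
   using R by (auto simp: fun_eq_iff indicator_def)
  then show ?thesis using iG by (simp add: set_integrable_def)
 qed
 \<comment> \<open>The factor 3 counts F at the starting point and two distances of T to its
   limit.\<close>
 have small: "\<forall>\<^sub>F r in at_top. F r <= 3 * e" if e: "0 < e" for e
 proof -
  have "\<forall>\<^sub>F r in at_top. dist (T r) l < e" by (rule tendstoD[OF \<open>(T \<longlongrightarrow> l) at_top\<close> e])
  then obtain R2 where R2: "!!r. R2 <= r ==> \<bar>T r - l\<bar> < e" unfolding eventually_at_top_linorder by (auto simp: dist_real_def)
  define R3 where "R3 = max R R2"
  have "\<exists>r>R3. r * (indicator {R<..} r * G r) < e"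
   by (rule integrable_frequently_small(1)[OF ih _ e]) (use G0 R in \<open>auto simp: R3_def\<close>)
  then obtain r0 where r0: "R3 < r0" "r0 * (indicator {R<..} r0 * G r0) < e" by auto
  have r0': "R < r0" "R2 <= r0" "1 <= r0" using r0 R by (auto simp: R3_def)
  have "1 * G r0 <= r0 * G r0" using r0' G0[of r0] by (intro mult_right_mono) auto
  then have Fr0: "F r0 < e" using r0 r0' F(2)[OF r0'(1)] by simp
  show ?thesis using eventually_ge_at_top[of r0]
  proof eventually_elim
   case (elim r)
   have "F r + T r <= F r0 + T r0"
   proof (rule DERIV_nonpos_imp_nonincreasing[OF elim])
    fix x assume "r0 <= x" "x <= r"
    then have x: "R < x" "0 < x" using r0' by auto
    have "DERIV (\<lambda>x. F x + T x) x :> F' x + - G x" by (rule DERIV_add[OF d[OF x(1)] dT[OF x(2)]])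
    then show "\<exists>y. DERIV (\<lambda>x. F x + T x) x :> y \<and> y <= 0" using F'[OF x(1)] by (intro exI[of _ "F' x + - G x"]) auto
   qed
   moreover have "\<bar>T r - l\<bar> < e" "\<bar>T r0 - l\<bar> < e" using R2 r0' elim by auto
   ultimately show ?case using Fr0 by linarith
  qed
 qed
 show ?thesis
 proof (rule order_tendstoI)
  fix a :: real assume "a < 0"
  then show "\<forall>\<^sub>F r in at_top. a < F r" by (intro eventually_mono[OF eventually_gt_at_top[of R]] less_le_trans[OF _ F(1)])
 next
  fix a :: real assume "0 < a"
  then show "\<forall>\<^sub>F r in at_top. F r < a" using small[of "a / 4"] by (auto elim!: eventually_mono)
 qed
qed

text \<open>The zero second component solves its equation for every g, so the core profile can be
  compared with solutions at whichever positive g is at hand.\<close>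

lemma profile_nice:
 assumes F: "normal_core_profile d F" and d: "d ~= 0" and g: "0 < g"
 shows "nice ((of_int d)^2) g F (deriv F) (deriv (deriv F)) (\<lambda>r. 0) (\<lambda>r. 0) (\<lambda>r. 0)"
proof -
 have c: "C0_twice_diff F" using F by (simp add: normal_core_profile_def)
 have G: "GLsol ((of_int d)^2) g F (deriv F) (deriv (deriv F)) (\<lambda>r. 0) (\<lambda>r. 0) (\<lambda>r. 0)"
  unfolding GLsol_def
 proof (intro allI impI conjI C0_twice_diff_DERIV[OF c])
  fix r :: real assume r: "0 < r"
  have "F r > 0" "- deriv (deriv F) r - 1 / r * deriv F r + (of_int d)^2 / r^2 * F r = (1 - (F r)^2) * F r"
   using F r by (auto simp: normal_core_profile_def)
  then show "deriv (deriv F) r + deriv F r / r = ((of_int d)^2 / r^2 - (1 - (F r)^2 - 0^2)) * F r" "0 <= F r"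
   by (simp_all add: algebra_simps)
 qed auto
 obtain M where M: "!!r. 0 < r ==> r <= 1 ==> F r <= M" by (rule C0_twice_diff_bounded[OF c]) blast
 have D: "1 <= (real_of_int d)^2" using d by (metis of_int_1_le_iff of_int_power zero_less_power2 int_one_le_iff_zero_less)
 show ?thesis
 proof (rule GLsol_nice[OF G D g, where ?r1.0 = 1 and M = "max M 0"])
  show "(F \<longlongrightarrow> 1) at_top" using F by (simp add: normal_core_profile_def)
  show "F r <= max M 0 \<and> 0 <= max M 0" if "0 < r" "r <= 1" for r using M[OF that] by simp
 qed auto
qed

text \<open>Where F touches 1 it has a maximum, so F' = 0, while the equation gives F'' = d^2/r^2 >
  0. The strict inequality makes the potential in \<open>g_star_range\<close> positive.\<close>

lemma profile_less_1:
 assumes F: "normal_core_profile d F" and d: "d ~= 0" and r: "0 < r"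
 shows "F r < 1"
proof (rule ccontr)
 assume n: "\<not> F r < 1"
 have N: "nice ((of_int d)^2) 1 F (deriv F) (deriv (deriv F)) (\<lambda>r. 0) (\<lambda>r. 0) (\<lambda>r. 0)" by (rule profile_nice[OF F d]) simp
 have G: "GLsol ((of_int d)^2) 1 F (deriv F) (deriv (deriv F)) (\<lambda>r. 0) (\<lambda>r. 0) (\<lambda>r. 0)" and le: "!!r. 0 < r ==> F r <= 1"
  using N by (auto simp: nice_def)
 note D = GLsolD[OF G]
 have F1: "F r = 1" using n le[OF r] by simp
 have z: "deriv F r = 0"
  by (rule DERIV_local_max[OF D(1)[OF r] r]) (use le F1 in auto)
 have "deriv (deriv F) r = (of_int d)^2 / r^2" using D(5)[OF r] z F1 by simp
 then have "0 < deriv (deriv F) r" using d r by simp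
 from DERIV_pos_inc_right[OF D(2)[OF r] this] obtain e where e: "0 < e" "!!h. 0 < h ==> h < e ==> deriv F r < deriv F (r + h)" by auto
 obtain \<xi> where \<xi>: "r < \<xi>" "\<xi> < r + e/2" "F (r + e/2) - F r = (r + e/2 - r) * deriv F \<xi>"
  using MVT2[of r "r + e/2" F "deriv F"] D(1) r e(1) by auto
 have "0 < deriv F \<xi>" using e(2)[of "\<xi> - r"] \<xi> z by simp
 then have "0 < (r + e/2 - r) * deriv F \<xi>" using e(1) by (intro mult_pos_pos) auto
 then have "F (r + e/2) > F r" using \<xi>(3) by linarith
 then show False using le[of "r + e/2"] F1 r e(1) by simp
qed

text \<open>Admissibility asks for finite energy and not for membership in Z. The term with D/r^2
  has no sign; beyond R it is absorbed by the square of X/2 - D/r^2 and by half of g m^2, at the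
  price of an integrable error. Integrability of the remaining nonnegative terms gives m -> 0 and f
  -> 1.\<close>

lemma admissible_nice:
 assumes A: "admissible_solution d F g f m" and F: "normal_core_profile d F" and d: "d ~= 0" and g: "0 < g"
 shows "nice ((of_int d)^2) g f (deriv f) (deriv (deriv f)) m (deriv m) (deriv (deriv m))"
proof -
 define D where "D = (real_of_int d)^2"
 define f' where "f' = deriv f"
 define m' where "m' = deriv m"
 have D1: "1 <= D" using d unfolding D_def by (metis of_int_1_le_iff of_int_power zero_less_power2 int_one_le_iff_zero_less)
 have Cf: "C0_twice_diff f" and Cm: "C0_twice_diff m" using A by (auto simp: admissible_solution_def)
 have G: "GLsol D g f f' (deriv f') m m' (deriv m')"
  unfolding D_def f'_def m'_def using A by (intro GL_system_GLsol) (auto simp: admissible_solution_def)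
 note dd = GLsolD[OF G] and c = GLsol_cont[OF G]
 have cF: "continuous_on {0<..} F" using F by (auto simp: normal_core_profile_def C0_twice_diff_def elim: continuous_on_subset)
 define X where "X r = 1 - (f r)^2 - (m r)^2" for r
 define h where "h = energy_density D g F f f' m m'"
 note ac = acd_C1[OF dd(1) c(2)] acd_C1[OF dd(3) c(4)]
 have "ereal (1 / 2) * ext_integral {0<..} h < \<infinity>" using A GL_energy_acd[OF ac, of d F g] by (simp add: admissible_solution_def h_def D_def)
 then have fin: "ext_integral {0<..} h < \<infinity>" by (cases "ext_integral {0<..} h") auto
 have "nice D 1 F (deriv F) (deriv (deriv F)) (\<lambda>r. 0) (\<lambda>r. 0) (\<lambda>r. 0)" unfolding D_def by (rule profile_nice[OF F d]) simp
 then obtain C where C: "C > 0" and F1: "!!r. 0 < r ==> 0 < F r" "!!r. 0 < r ==> F r <= 1" and F2: "!!r. 0 < r ==> (F r)^2 <= C * r"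
  by (rule nice_elim) blast
 \<comment> \<open>Beyond R the inequality D/r^2 <= g/2 holds, so half of g m^2 pays for the term D
   m^2/r^2.\<close>
 define R where "R = 1 + 2 * D / g"
 have R: "1 <= R" using D1 g by (simp add: R_def)
 define \<Gamma> where "\<Gamma> r = ((f' r)^2 + (m' r)^2 + g / 2 * (m r)^2 + 1 / 4 * (X r)^2) * r" for r
 have \<Gamma>0: "0 <= \<Gamma> r" if "0 < r" for r using that g by (simp add: \<Gamma>_def)
 have c\<Gamma>: "continuous_on {0<..} \<Gamma>" unfolding \<Gamma>_def[abs_def] X_def[abs_def] by (intro continuous_intros c)
 have ch: "continuous_on {0<..} h" unfolding h_def energy_density_def[abs_def] by (intro continuous_intros c cF) auto
 \<comment> \<open>The summand with C compensates D F^2/r <= D C on r <= R; the summand 2 D^2 covers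
   the error D^2/r^3 left by completing the square beyond R.\<close>
 define K where "K = D * C * (1 + R^2) + 2 * D^2"
 have K0: "0 <= K" using D1 C by (simp add: K_def)
 have lb: "indicator {R<..} r * \<Gamma> r <= h r + K / (1 + r^2)" if r: "0 < r" for r
 proof (cases "R < r")
  case False
  have p: "0 < 1 + r^2" by (simp add: add_pos_nonneg)
  have "r^2 <= R^2" using False r by (intro power_mono) auto
  then have "D * C * (1 + r^2) <= K" unfolding K_def using D1 C by (intro order_trans[OF mult_left_mono[of "1 + r^2" "1 + R^2"]]) auto
  then have k: "D * C <= K / (1 + r^2)" using p by (simp add: pos_le_divide_eq)
  have "0 <= ((f' r)^2 + (m' r)^2 + g * (m r)^2 + D / r^2 * (f r)^2 + 1 / 2 * (X r)^2) * r" using r g D1 by simp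
  also have "... = h r + D * ((F r)^2 / r)" using r by (simp add: h_def energy_density_def X_def field_simps power2_eq_square)
  also have "D * ((F r)^2 / r) <= D * C" using F2[OF r] r D1 by (intro mult_left_mono) (auto simp: pos_divide_le_eq)
  finally show ?thesis using k False by simp
 next
  case True
  have r1: "1 <= r" using True R by simp
  define c where "c = D / r^2"
  have c0: "0 <= c" using D1 by (simp add: c_def)
  have rr: "r <= r^2" using r1 by (simp add: power2_eq_square)
  have "2 * D / g <= r^2" using True rr by (simp add: R_def)
  then have cg: "c <= g / 2" using g r by (simp add: c_def pos_divide_le_eq mult.commute)
  have "c * (F r)^2 <= c * 1" using c0 F1[OF r] by (intro mult_left_mono) (auto simp: power_le_one)
  moreover have "c * (m r)^2 <= g / 2 * (m r)^2" using cg by (intro mult_right_mono) auto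
  moreover have "0 <= (X r / 2 - c)^2" by simp
  moreover have "(X r / 2 - c)^2 = 1 / 4 * (X r)^2 - c * X r + c^2" by (simp add: power2_eq_square field_simps)
  moreover have "c * ((f r)^2 - (F r)^2) = c - c * (F r)^2 - c * X r - c * (m r)^2" by (simp add: X_def algebra_simps)
  ultimately have "(f' r)^2 + (m' r)^2 + g / 2 * (m r)^2 + 1 / 4 * (X r)^2 <= ((f' r)^2 + (m' r)^2 + g * (m r)^2 + c * ((f r)^2 - (F r)^2) + 1 / 2 * (X r)^2) + c^2"
   by linarith
  then have "\<Gamma> r <= (((f' r)^2 + (m' r)^2 + g * (m r)^2 + c * ((f r)^2 - (F r)^2) + 1 / 2 * (X r)^2) + c^2) * r"
   unfolding \<Gamma>_def using r by (intro mult_right_mono) auto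
  also have "... = h r + c^2 * r" by (simp add: h_def energy_density_def X_def c_def distrib_right)
  also have "c^2 * r <= K / (1 + r^2)"
  proof -
   have p: "0 < 1 + r^2" by (simp add: add_pos_nonneg)
   have "c^2 * r = D^2 / (r^2 * r)" using r by (simp add: c_def power2_eq_square)
   also have "... <= D^2 / ((1 + r^2) / 2)"
   proof (intro divide_left_mono)
    have "r^2 * 1 <= r^2 * r" using r1 by (intro mult_left_mono) auto
    moreover have "1 <= r^2" using rr r1 by linarith
    ultimately show "(1 + r^2) / 2 <= r^2 * r" by simp
   qed (use r p in auto)
   also have "... = 2 * D^2 / (1 + r^2)" by simp
   also have "... <= K / (1 + r^2)" using p D1 C by (intro divide_right_mono) (auto simp: K_def)
   finally show ?thesis .
  qed
  finally show ?thesis using True by simp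
 qed
 have ik: "integrable_pos (\<lambda>r::real. K / (1 + r^2))"
  using K0 by (intro decay_integrable[where K=K]) (auto intro!: continuous_intros simp: add_nonneg_eq_0_iff)
 have ih: "integrable_pos h"
 proof (rule ext_integral_integrable[OF _ ik _ fin])
  show "measurable_pos h" by (rule borel_measurable_continuous_on_indicator[OF _ ch]) simp
  fix r :: real assume r: "0 < r"
  have "0 <= indicator {R<..} r * \<Gamma> r" using \<Gamma>0[OF r] by (simp add: indicator_def)
  then show "- (K / (1 + r^2)) <= h r" using lb[OF r] by linarith
 qed
 have i\<Gamma>: "set_integrable lborel {R<..} \<Gamma>"
 proof -
  have e: "(\<lambda>r. indicator {0<..} r *\<^sub>R (indicator {R<..} r * \<Gamma> r)) = (\<lambda>r. indicator {R<..} r *\<^sub>R \<Gamma> r)"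
   using R by (auto simp: fun_eq_iff indicator_def)
  have "integrable_pos (\<lambda>r. indicator {R<..} r * \<Gamma> r)"
  proof (rule set_integrable_bounded_by[OF set_integral_add(1)[OF ih ik]])
   show "measurable_pos (\<lambda>r. indicator {R<..} r * \<Gamma> r)"
    unfolding e by (intro borel_measurable_continuous_on_indicator continuous_on_subset[OF c\<Gamma>]) (use R in auto)
   show "\<bar>indicator {R<..} r * \<Gamma> r\<bar> <= h r + K / (1 + r^2)" if "0 < r" for r
    using lb[OF that] \<Gamma>0[OF that] by (simp add: indicator_def)
  qed
  then show ?thesis unfolding set_integrable_def e .
 qed
 define S where "S r = (f' r)^2 + (m' r)^2 + g / 2 * (m r)^2 + 1 / 4 * (X r)^2" for r
 have S: "S r <= \<Gamma> r" "(f' r)^2 <= S r" "(m' r)^2 <= S r" "(m r)^2 <= 2 / g * S r" "(X r)^2 <= 4 * S r" if r: "1 <= r" for r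
 proof -
  have s: "0 <= S r" using g by (simp add: S_def)
  have "S r * 1 <= S r * r" using s r by (intro mult_left_mono) auto
  then show "S r <= \<Gamma> r" by (simp add: \<Gamma>_def S_def)
  have p: "0 <= g / 2 * (m r)^2" using g by simp
  then show "(f' r)^2 <= S r" "(m' r)^2 <= S r"
   using zero_le_power2[of "f' r"] zero_le_power2[of "m' r"] zero_le_power2[of "X r"] unfolding S_def by linarith+
  have "1 / 4 * (X r)^2 <= S r" using p zero_le_power2[of "f' r"] zero_le_power2[of "m' r"] unfolding S_def by linarith
  then show "(X r)^2 <= 4 * S r" by simp
  have "g / 2 * (m r)^2 <= S r" unfolding S_def using zero_le_power2[of "f' r"] zero_le_power2[of "m' r"] zero_le_power2[of "X r"] by linarith
  then have "2 / g * (g / 2 * (m r)^2) <= 2 / g * S r" using g by (intro mult_left_mono) auto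
  then show "(m r)^2 <= 2 / g * S r" using g by simp
 qed
 have "((\<lambda>r. (m r)^2) \<longlongrightarrow> 0) at_top"
 proof (rule integrable_tail_decay[OF R, where F' = "\<lambda>r. 2 * m r * m' r" and G = "\<lambda>r. (1 + 2 / g) * \<Gamma> r"])
  show "set_integrable lborel {R<..} (\<lambda>r. (1 + 2 / g) * \<Gamma> r)" by (rule set_integrable_mult_right[OF i\<Gamma>])
  show "continuous_on {0<..} (\<lambda>r. (1 + 2 / g) * \<Gamma> r)" by (intro continuous_intros c\<Gamma>)
  show "0 <= (1 + 2 / g) * \<Gamma> r" if "0 < r" for r using \<Gamma>0[OF that] g by simp
  fix r assume "R < r"
  then have r: "0 < r" "1 <= r" using R by auto
  have g': "0 < 2 / g" using g by simp
  have G1: "S r + 2 / g * S r <= (1 + 2 / g) * \<Gamma> r" using mult_left_mono[OF S(1)[OF r(2)], of "1 + 2 / g"] g by (simp add: algebra_simps)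
  show "DERIV (\<lambda>r. (m r)^2) r :> 2 * m r * m' r" by (auto intro!: derivative_eq_intros dd(3)[OF r(1)])
  have "\<bar>2 * m r * m' r\<bar> <= (m r)^2 + (m' r)^2" using abs_product_le[of "m r" "m' r"] by (simp add: abs_mult)
  then show "\<bar>2 * m r * m' r\<bar> <= (1 + 2 / g) * \<Gamma> r" using S(3,4)[OF r(2)] G1 by linarith
  have "0 <= S r" using S(2)[OF r(2)] zero_le_power2[of "f' r"] by linarith
  then show "(m r)^2 <= (1 + 2 / g) * \<Gamma> r" using S(4)[OF r(2)] G1 by linarith
 qed simp
 then have "((\<lambda>r. sqrt ((m r)^2)) \<longlongrightarrow> sqrt 0) at_top" by (rule tendsto_real_sqrt)
 then have s0: "((\<lambda>r. \<bar>m r\<bar>) \<longlongrightarrow> 0) at_top" by simp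
 then have m0: "(m \<longlongrightarrow> 0) at_top" by (simp add: tendsto_rabs_zero_iff)
 have "\<forall>\<^sub>F r in at_top. \<bar>m r\<bar> < 1" by (rule order_tendstoD(2)[OF s0]) simp
 then obtain R2 where R2: "!!r. R2 <= r ==> \<bar>m r\<bar> < 1" unfolding eventually_at_top_linorder by auto
 define R3 where "R3 = max R R2"
 have R3: "1 <= R3" using R by (simp add: R3_def)
 \<comment> \<open>E is the integral of 1 - t^2 from f to 1. Its derivative is -(1 - f^2) f', a
   product of two quantities whose squares are controlled by the energy, and E bounds (1 - f)^2
   because f >= 0.\<close>
 define E where "E r = (1 - f r)^2 * (2 + f r) / 3" for r
 have "(E \<longlongrightarrow> 0) at_top"
 proof (rule integrable_tail_decay[OF R3, where F' = "\<lambda>r. - ((1 - (f r)^2) * f' r)" and G = "\<lambda>r. (9 + 4 / g) * \<Gamma> r"])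
  show "set_integrable lborel {R3<..} (\<lambda>r. (9 + 4 / g) * \<Gamma> r)"
   by (intro set_integrable_mult_right set_integrable_subset[OF i\<Gamma>]) (auto simp: R3_def)
  show "continuous_on {0<..} (\<lambda>r. (9 + 4 / g) * \<Gamma> r)" by (intro continuous_intros c\<Gamma>)
  show "0 <= (9 + 4 / g) * \<Gamma> r" if "0 < r" for r using \<Gamma>0[OF that] g by simp
  fix r assume "R3 < r"
  then have r: "0 < r" "1 <= r" "R2 <= r" using R3 by (auto simp: R3_def)
  have f0: "0 <= f r" by (rule dd(7)[OF r(1)])
  have s0: "0 <= S r" using S(2)[OF r(2)] zero_le_power2[of "f' r"] by linarith
  have "((1 - (f r)^2)^2) <= 2 * (X r)^2 + 2 * ((m r)^2)^2" using square_add_le[of "X r" "(m r)^2"] by (simp add: X_def)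
  moreover have "(m r)^2 * (m r)^2 <= 1 * (m r)^2" using R2[OF r(3)] by (intro mult_right_mono) (auto simp: abs_square_le_1 less_imp_le)
  ultimately have W: "(1 - (f r)^2)^2 <= 8 * S r + 2 * (2 / g * S r)" using S(4,5)[OF r(2)] unfolding power2_eq_square[of "(m r)^2"] by linarith
  have G1: "9 * S r + 2 * (2 / g * S r) <= (9 + 4 / g) * \<Gamma> r" using mult_left_mono[OF S(1)[OF r(2)], of "9 + 4 / g"] g by (simp add: algebra_simps)
  show "DERIV E r :> - ((1 - (f r)^2) * f' r)"
  proof -
   have "DERIV E r :> ((2 * (1 - f r) * (0 - f' r)) * (2 + f r) + (0 + f' r) * (1 - f r)^2) / 3"
    unfolding E_def by (auto intro!: derivative_eq_intros dd(1)[OF r(1)] simp: power2_eq_square field_simps)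
   moreover have "((2 * (1 - f r) * (0 - f' r)) * (2 + f r) + (0 + f' r) * (1 - f r)^2) / 3 = - ((1 - (f r)^2) * f' r)"
    by (simp add: power2_eq_square field_simps)
   ultimately show ?thesis by simp
  qed
  have "\<bar>- ((1 - (f r)^2) * f' r)\<bar> <= ((1 - (f r)^2)^2 + (f' r)^2) / 2" unfolding abs_minus_cancel by (rule abs_product_le)
  also have "... <= (1 - (f r)^2)^2 + (f' r)^2" by (rule half_sum_le(1)) auto
  finally show "\<bar>- ((1 - (f r)^2) * f' r)\<bar> <= (9 + 4 / g) * \<Gamma> r" using W G1 S(2)[OF r(2)] by linarith
  show "0 <= E r" using f0 by (simp add: E_def)
  have "(2 + f r) / 3 <= (1 + f r)^2" using f0 zero_le_power2[of "f r"] by (simp add: power2_eq_square algebra_simps)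
  then have "(1 - f r)^2 * ((2 + f r) / 3) <= (1 - f r)^2 * (1 + f r)^2" by (intro mult_left_mono) auto
  also have "... = (1 - (f r)^2)^2" by (simp add: power_mult_distrib[symmetric] power2_eq_square[of "f r"] algebra_simps)
  finally show "E r <= (9 + 4 / g) * \<Gamma> r" using W G1 s0 by (simp add: E_def)
 qed
 then have "((\<lambda>r. sqrt (3 / 2 * E r)) \<longlongrightarrow> sqrt (3 / 2 * 0)) at_top" by (intro tendsto_intros)
 then have e0: "((\<lambda>r. sqrt (3 / 2 * E r)) \<longlongrightarrow> 0) at_top" by simp
 have "\<forall>\<^sub>F r in at_top. norm (f r - 1) <= sqrt (3 / 2 * E r)"
  using eventually_gt_at_top[of 0]
 proof eventually_elim
  case (elim r)
  have "(1 - f r)^2 * 1 <= (1 - f r)^2 * ((2 + f r) / 2)" using dd(7)[OF elim] by (intro mult_left_mono) auto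
  then have "(f r - 1)^2 <= 3 / 2 * E r" by (simp add: E_def power2_commute mult.commute)
  then show ?case by (simp add: real_le_rsqrt)
 qed
 then have "((\<lambda>r. f r - 1) \<longlongrightarrow> 0) at_top" using e0 by (rule Lim_null_comparison)
 then have f1: "(f \<longlongrightarrow> 1) at_top" by (rule LIM_zero_cancel)
 obtain M1 where M1: "!!r. 0 < r ==> r <= 1 ==> f r <= M1" by (rule C0_twice_diff_bounded[OF Cf]) blast
 obtain M2 where M2: "!!r. 0 < r ==> r <= 1 ==> m r <= M2" by (rule C0_twice_diff_bounded[OF Cm]) blast
 have "nice D g f f' (deriv f') m m' (deriv m')"
 proof (rule GLsol_nice[OF G D1 g _ _ f1 m0, where ?r1.0 = 1 and M = "max M1 M2"])
  show "f r <= max M1 M2 \<and> m r <= max M1 M2" if "0 < r" "r <= 1" for r using M1[OF that] M2[OF that] by auto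
 qed simp
 then show ?thesis by (simp add: D_def f'_def m'_def)
qed


section \<open>Minimality and extension to the origin\<close>

lemma nice_GL_energy_finite:
 assumes N: "nice ((of_int d)^2) g f f' f'' m m' m''" and N0: "nice ((of_int d)^2) h F F' F'' M M' M''"
  and e: "!!r. 0 < r ==> p r = f r" "!!r. 0 < r ==> q r = m r"
 shows "GL_energy d F g p q = ereal (1 / 2 * (LBINT r:{0<..}. energy_density ((of_int d)^2) g F f f' m m' r))"
proof -
 have "GL_energy d F g p q = ereal (1 / 2) * ext_integral {0<..} (energy_density ((of_int d)^2) g F f f' m m')"
 proof (rule GL_energy_eq)
  have 1: "acd p f'" using nice_acd(1)[OF N] e by (simp add: acd_def)
  have 2: "acd q m'" using nice_acd(2)[OF N] e by (simp add: acd_def)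
  show "weak_gradient_on {0<..} p f'" "weak_gradient_on {0<..} q m'" by (rule acd_weak_gradient[OF 1], rule acd_weak_gradient[OF 2])
 qed (use e in auto)
 then show ?thesis using ext_integral_eq[OF nice_energy_integrable[OF N N0]] by simp
qed

text \<open>The competitor is replaced by absolutely continuous representatives, which leaves its
  energy unchanged. Its difference to f splits into the part from X and the difference of two
  profiles, both with the required norms. Its energy may be infinite, so the final comparison is one
  of extended integrals.\<close>

lemma nice_minimizer:
 assumes N: "nice ((of_int d)^2) g f f' f'' m m' m''" and N0: "nice ((of_int d)^2) h F F' F'' M M' M''"
  and form: "!!U v. radH U v ==> 0 <= second_variation g f m U v"
  and Z: "(p, q) \<in> Z_rad F"
 shows "GL_energy d F g f m <= GL_energy d F g p q"
proof -
 let ?D = "(real_of_int d)^2"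
 have D: "0 <= ?D" by simp
 obtain u where p: "p = (\<lambda>r. F r + u r)" and u: "u \<in> X_rad" and q: "q \<in> H_rad" using Z by (auto simp: Z_rad_def)
 have u': "u \<in> H_rad" and u0: "integrable_pos (\<lambda>r. (u r)^2 / r^2 * r)" using u by (auto simp: X_rad_def)
 obtain U v where U: "radH U v" and uU: "AE r in lborel. 0 < r --> u r = U r" and wu: "weak_gradient_on {0<..} u v" by (rule H_rad_radH[OF u'])
 obtain Q w where Q: "radH Q w" and qQ: "AE r in lborel. 0 < r --> q r = Q r" and wq: "weak_gradient_on {0<..} q w" by (rule H_rad_radH[OF q])
 have aU: "acd U v" and iU: "integrable_pos (\<lambda>r. (U r)^2 * r)" and iv: "integrable_pos (\<lambda>r. (v r)^2 * r)" using U by (auto simp: radH_def)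
 define P where "P r = F r + U r" for r
 define P' where "P' r = F' r + v r" for r
 have aP: "acd P P'" unfolding P_def[abs_def] P'_def[abs_def] by (rule acd_add[OF nice_acd(1)[OF N0 D] aU])
 note cF = nice_continuous[OF N0 D] and cf = nice_continuous[OF N D] and cU = acd_continuous[OF aU]
 have mv: "measurable_pos v" by (rule loc_integrable_measurable[OF acdD(1)[OF aU]])
 have iU0: "integrable_pos (\<lambda>r. (U r)^2 / r)"
 proof -
  have "integrable lborel (\<lambda>r. indicator {0<..} r *\<^sub>R ((U r)^2 / r))"
  proof (rule integrable_cong_AE_imp[OF u0[unfolded set_integrable_def]])
   show "(\<lambda>r. indicator {0<..} r *\<^sub>R ((U r)^2 / r)) \<in> borel_measurable lborel"
   proof -
    have "continuous_on {0<..} (\<lambda>r. (U r)^2 / r)" by (intro continuous_intros cU) auto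
    then have "measurable_pos (\<lambda>r. (U r)^2 / r)"
     by (intro borel_measurable_continuous_on_indicator) auto
    then show ?thesis by simp
   qed
   show "AE r in lborel. indicator {0<..} r *\<^sub>R ((u r)^2 / r^2 * r) = indicator {0<..} r *\<^sub>R ((U r)^2 / r)"
    using uU by eventually_elim (auto simp: indicator_def power2_eq_square)
  qed
  then show ?thesis by (simp add: set_integrable_def)
 qed
 note df = nice_difference[OF N0 N D]
 have V2: "integrable_pos (\<lambda>r. (P r - f r)^2 * r)"
 proof (rule set_integrable_bounded_by[OF set_integral_add(1)[OF set_integrable_mult_right[OF df(1), of 2] set_integrable_mult_right[OF iU, of 2]]])
  show "measurable_pos (\<lambda>r. (P r - f r)^2 * r)"
   unfolding P_def by (intro borel_measurable_continuous_on_indicator continuous_intros cF cf cU) auto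
  fix r :: real assume r: "0 < r"
  have "(P r - f r)^2 * r <= (2 * (F r - f r)^2 + 2 * (U r)^2) * r"
   using square_add_le[of "F r - f r" "U r"] r by (intro mult_right_mono) (auto simp: P_def algebra_simps)
  then show "\<bar>(P r - f r)^2 * r\<bar> <= 2 * ((F r - f r)^2 * r) + 2 * ((U r)^2 * r)" using r by (simp add: distrib_right)
 qed
 have V0: "integrable_pos (\<lambda>r. (P r - f r)^2 / r)"
 proof (rule set_integrable_bounded_by[OF set_integral_add(1)[OF set_integrable_mult_right[OF df(2), of 2] set_integrable_mult_right[OF iU0, of 2]]])
  show "measurable_pos (\<lambda>r. (P r - f r)^2 / r)"
   unfolding P_def by (intro borel_measurable_continuous_on_indicator continuous_intros cF cf cU) auto
  fix r :: real assume r: "0 < r"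
  have "(P r - f r)^2 / r <= (2 * (F r - f r)^2 + 2 * (U r)^2) / r"
   using square_add_le[of "F r - f r" "U r"] r by (intro divide_right_mono) (auto simp: P_def algebra_simps)
  then show "\<bar>(P r - f r)^2 / r\<bar> <= 2 * ((F r - f r)^2 / r) + 2 * ((U r)^2 / r)" using r by (simp add: add_divide_distrib)
 qed
 have v2: "integrable_pos (\<lambda>r. (P' r - f' r)^2 * r)"
 proof (rule set_integrable_bounded_by[OF set_integral_add(1)[OF set_integrable_mult_right[OF df(3), of 2] set_integrable_mult_right[OF iv, of 2]]])
  have "(\<lambda>r. (indicator {0<..} r *\<^sub>R (F' r - f' r) + indicator {0<..} r *\<^sub>R v r)^2 * r) \<in> borel_measurable borel"
   by (intro borel_measurable_times borel_measurable_power borel_measurable_add mv borel_measurable_continuous_on_indicator continuous_intros cF cf measurable_ident_sets) auto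
  moreover have "(\<lambda>r. (indicator {0<..} r *\<^sub>R (F' r - f' r) + indicator {0<..} r *\<^sub>R v r)^2 * r) = (\<lambda>r. indicator {0<..} r *\<^sub>R ((P' r - f' r)^2 * r))"
   by (auto simp: fun_eq_iff indicator_def P'_def algebra_simps)
  ultimately show "measurable_pos (\<lambda>r. (P' r - f' r)^2 * r)" by simp
  fix r :: real assume r: "0 < r"
  have "(P' r - f' r)^2 * r <= (2 * (F' r - f' r)^2 + 2 * (v r)^2) * r"
   using square_add_le[of "F' r - f' r" "v r"] r by (intro mult_right_mono) (auto simp: P'_def algebra_simps)
  then show "\<bar>(P' r - f' r)^2 * r\<bar> <= 2 * ((F' r - f' r)^2 * r) + 2 * ((v r)^2 * r)" using r by (simp add: distrib_right)
 qed
 obtain L where L: "integrable_pos L" "0 <= (LBINT r:{0<..}. L r)"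
  "!!F r. 0 < r ==> energy_density ?D g F P P' Q w r = energy_density ?D g F f f' m m' r + L r
    + 1 / 2 * ((P r)^2 + (Q r)^2 - ((f r)^2 + (m r)^2))^2 * r"
  by (rule energy_comparison[OF N D aP V2 V0 v2 Q form[OF Q]]) blast
 have pP: "AE r in lborel. 0 < r --> p r = P r" using uU by (auto simp: p P_def)
 have wp: "weak_gradient_on {0<..} p P'"
 proof (rule weak_gradient_cong_AE[OF acd_weak_gradient[OF aP] pP])
  fix a b :: real assume ab: "0 < a" "a <= b"
  have 1: "set_integrable lborel {a..b} F" by (intro borel_integrable_atLeastAtMost' continuous_on_subset[OF cF(1)]) (use ab in auto)
  show "set_integrable lborel {a..b} p" unfolding p by (rule set_integral_add(1)[OF 1 weak_gradient_realD(1)[OF wu ab]])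
 qed
 have iE: "integrable_pos (energy_density ?D g F f f' m m')" by (rule nice_energy_integrable[OF N N0 D])
 note iL = set_integral_add[OF iE L(1)]
 have "ereal (LBINT r:{0<..}. energy_density ?D g F f f' m m' r) <= ereal (LBINT r:{0<..}. energy_density ?D g F f f' m m' r + L r)"
  using iL(2) L(2) by simp
 also have "... = ext_integral {0<..} (\<lambda>r. energy_density ?D g F f f' m m' r + L r)" by (rule ext_integral_eq[OF iL(1), symmetric])
 also have "... <= ext_integral {0<..} (energy_density ?D g F P P' Q w)"
  using L(3) by (intro ext_integral_mono_AE AE_I2 impI) simp
 finally have "ereal (1 / 2) * ereal (LBINT r:{0<..}. energy_density ?D g F f f' m m' r) <= ereal (1 / 2) * ext_integral {0<..} (energy_density ?D g F P P' Q w)"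
  by (intro ereal_mult_left_mono) auto
 then show ?thesis unfolding GL_energy_eq[OF pP wp qQ wq] using nice_GL_energy_finite[OF N N0, of f m] by simp
qed

text \<open>Near 0 the function m + C r^2/2 is nondecreasing and m - C r^2/2 is nonincreasing, so
  the infimum of the former serves as the value at the origin, with a quadratic error.\<close>

lemma even_limit:
 fixes m m' :: "real => real"
 assumes d: "!!r. 0 < r ==> DERIV m r :> m' r" and b: "\<forall>\<^sub>F r in at_right 0. \<bar>m' r\<bar> <= C * r" and C: "0 < C"
  and p: "!!r. 0 < r ==> 0 <= m r"
 shows "\<exists>m0 r1. 0 < r1 \<and> (\<forall>r. 0 < r --> r <= r1 --> \<bar>m r - m0\<bar> <= C * r^2)"
proof -
 obtain r2 where r2: "0 < r2" "!!r. 0 < r ==> r < r2 ==> \<bar>m' r\<bar> <= C * r" using b unfolding eventually_at_right_field by auto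
 define r1 where "r1 = r2 / 2"
 have r1: "0 < r1" "!!r. 0 < r ==> r <= r1 ==> \<bar>m' r\<bar> <= C * r" using r2 by (auto simp: r1_def)
 have inc: "m s + C * s^2 / 2 <= m r + C * r^2 / 2" and dec: "m r - C * r^2 / 2 <= m s - C * s^2 / 2" if "0 < s" "s <= r" "r <= r1" for s r
 proof -
  show "m s + C * s^2 / 2 <= m r + C * r^2 / 2"
  proof (rule DERIV_nonneg_imp_nondecreasing[OF that(2)])
   fix x assume x: "s <= x" "x <= r"
   have "DERIV (\<lambda>x. m x + C * x^2 / 2) x :> m' x + C * x" using x that by (auto intro!: derivative_eq_intros d)
   then show "\<exists>y. DERIV (\<lambda>x. m x + C * x^2 / 2) x :> y \<and> 0 <= y" using r1(2)[of x] x that by (intro exI[of _ "m' x + C * x"]) auto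
  qed
  show "m r - C * r^2 / 2 <= m s - C * s^2 / 2"
  proof (rule DERIV_nonpos_imp_nonincreasing[OF that(2)])
   fix x assume x: "s <= x" "x <= r"
   have "DERIV (\<lambda>x. m x - C * x^2 / 2) x :> m' x - C * x" using x that by (auto intro!: derivative_eq_intros d)
   then show "\<exists>y. DERIV (\<lambda>x. m x - C * x^2 / 2) x :> y \<and> y <= 0" using r1(2)[of x] x that by (intro exI[of _ "m' x - C * x"]) auto
  qed
 qed
 define A where "A = (\<lambda>r. m r + C * r^2 / 2) ` {0<..r1}"
 have ne: "A ~= {}" using r1 by (auto simp: A_def)
 have bdd: "bdd_below A" using p C by (intro bdd_belowI[of _ 0]) (auto simp: A_def)
 show ?thesis
 proof (rule exI[of _ "Inf A"], rule exI[of _ r1], intro conjI allI impI)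
  show "0 < r1" by (rule r1(1))
  fix r assume r: "0 < r" "r <= r1"
  have 1: "Inf A <= m r + C * r^2 / 2" using r by (intro cInf_lower bdd) (auto simp: A_def)
  have 2: "m r - C * r^2 / 2 <= Inf A"
  proof (rule cInf_greatest[OF ne])
   fix y assume "y \<in> A"
   then obtain s where s: "0 < s" "s <= r1" "y = m s + C * s^2 / 2" by (auto simp: A_def)
   have c: "0 <= C * r^2 / 2" "0 <= C * s^2 / 2" using C by auto
   show "m r - C * r^2 / 2 <= y"
   proof (cases "s <= r")
    case True
    then show ?thesis using dec[OF s(1) True r(2)] c s(3) by linarith
   next
    case False
    then show ?thesis using inc[OF r(1) _ s(2)] c s(3) by linarith
   qed
  qed
  have "C * r^2 / 2 <= C * r^2" using C by simp
  then show "\<bar>m r - Inf A\<bar> <= C * r^2" using 1 2 by linarith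
 qed
qed

lemma DERIV_extend_zero:
 fixes f :: "real => real"
 assumes "DERIV f r :> D" "0 < r"
 shows "DERIV (\<lambda>r. if r <= 0 then a else f r) r :> D"
proof -
 have "\<forall>\<^sub>F x in nhds r. 0 < x" using eventually_nhds_in_open[of "{0<..}" r] assms(2) by simp
 then have "\<forall>\<^sub>F x in nhds r. (if x <= 0 then a else f x) = f x" by eventually_elim simp
 then have "DERIV (\<lambda>r. if r <= 0 then a else f r) r :> D \<longleftrightarrow> DERIV f r :> D"
  by (intro DERIV_cong_ev) auto
 then show ?thesis using assms by simp
qed

text \<open>The profiles live on r > 0 only, and values at 0 have to be supplied. The bound f^2 <= C
  r forces f(0) = 0, and the quadratic error of \<open>even_limit\<close> gives both continuity of m
  and m'(0) = 0.\<close>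

lemma nice_admissible:
 assumes N: "nice ((of_int d)^2) g f f' f'' m m' m''" and N0: "nice ((of_int d)^2) h F F' F'' M M' M''"
  and b: "0 < b" "0 < \<rho>" "!!r. 0 < r ==> 0 < m r" "!!r. 0 < r ==> r <= \<rho> ==> b <= m r"
 obtains p q where "admissible_solution d F g p q" "!!r. 0 < r ==> p r = f r" "!!r. 0 < r ==> q r = m r" "!!r. 0 <= r ==> 0 < q r"
proof -
 obtain C where G: "GLsol ((of_int d)^2) g f f' f'' m m' m''" and C: "C > 0" and f0: "!!r. 0 < r ==> 0 < f r" and
  f2: "!!r. 0 < r ==> (f r)^2 <= C * r" and m'b: "\<forall>\<^sub>F r in at_right 0. \<bar>m' r\<bar> <= C * r"
  by (rule nice_elim[OF N]) blast
 note dd = GLsolD[OF G]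
 obtain m0 r1 :: real where r1: "0 < r1" "!!r. 0 < r ==> r <= r1 ==> \<bar>m r - m0\<bar> <= C * r^2"
  using even_limit[OF dd(3) m'b C dd(8)] by auto
 define p where "p r = (if r <= 0 then 0 else f r)" for r
 define q where "q r = (if r <= 0 then m0 else m r)" for r
 have pe: "p r = f r" and qe: "q r = m r" if "0 < r" for r using that by (auto simp: p_def q_def)
 have dp: "DERIV p r :> f' r" if r: "0 < r" for r unfolding p_def by (rule DERIV_extend_zero[OF dd(1)[OF r] r])
 have dq: "DERIV q r :> m' r" if r: "0 < r" for r unfolding q_def by (rule DERIV_extend_zero[OF dd(3)[OF r] r])
 have dq0: "(q has_real_derivative 0) (at 0 within {0..})"
  unfolding has_field_derivative_iff
 proof (rule Lim_null_comparison)
  show "\<forall>\<^sub>F y in at 0 within {0..}. norm ((q y - q 0) / (y - 0)) <= C * y"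
   unfolding eventually_at
  proof (intro exI[of _ r1] conjI ballI impI r1(1))
   fix y :: real assume y: "y \<in> {0..}" "y ~= 0 \<and> dist y 0 < r1"
   then have y0: "0 < y" "y <= r1" by auto
   have "\<bar>q y - q 0\<bar> / y <= C * y" using r1(2)[OF y0] y0(1) by (simp add: q_def pos_divide_le_eq power2_eq_square mult.assoc)
   then show "norm ((q y - q 0) / (y - 0)) <= C * y" using y0 by simp
  qed
  have "((\<lambda>y. C * y) \<longlongrightarrow> C * 0) (at 0 within {0..})" by (intro tendsto_intros)
  then show "((\<lambda>y. C * y) \<longlongrightarrow> 0) (at 0 within {0..})" by simp
 qed
 have cq: "continuous_on {0..} q" unfolding continuous_on_eq_continuous_within
 proof
  fix x :: real assume x: "x \<in> {0..}"
  show "continuous (at x within {0..}) q"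
  proof (cases "x = 0")
   case True
   then show ?thesis using DERIV_continuous[OF dq0] by simp
  next
   case False
   then have "0 < x" using x by simp
   then show ?thesis by (rule continuous_at_imp_continuous_at_within[OF DERIV_isCont[OF dq]])
  qed
 qed
 have cp: "continuous_on {0..} p" unfolding continuous_on_eq_continuous_within
 proof
  fix x :: real assume x: "x \<in> {0..}"
  show "continuous (at x within {0..}) p"
  proof (cases "x = 0")
   case True
   have "(p \<longlongrightarrow> 0) (at 0 within {0..})"
   proof (rule Lim_null_comparison)
    show "\<forall>\<^sub>F y in at 0 within {0..}. norm (p y) <= sqrt (C * y)"
     unfolding eventually_at
    proof (intro exI[of _ 1] conjI ballI impI)
     fix y :: real assume y: "y \<in> {0..}" "y ~= 0 \<and> dist y 0 < 1"
     then have y0: "0 < y" by auto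
     show "norm (p y) <= sqrt (C * y)" using f2[OF y0] f0[OF y0] y0 by (simp add: p_def real_le_rsqrt)
    qed simp
    have "((\<lambda>y. sqrt (C * y)) \<longlongrightarrow> sqrt (C * 0)) (at 0 within {0..})" by (intro tendsto_intros)
    then show "((\<lambda>y. sqrt (C * y)) \<longlongrightarrow> 0) (at 0 within {0..})" by simp
   qed
   then show ?thesis using True by (simp add: continuous_within p_def)
  next
   case False
   then have "0 < x" using x by simp
   then show ?thesis by (rule continuous_at_imp_continuous_at_within[OF DERIV_isCont[OF dp]])
  qed
 qed
 have Cp: "C0_twice_diff p" "!!r. 0 < r ==> deriv p r = f' r" "!!r. 0 < r ==> deriv (deriv p) r = f'' r"
  using C0_twice_diffI[OF cp dp dd(2)] by auto
 have Cq: "C0_twice_diff q" "!!r. 0 < r ==> deriv q r = m' r" "!!r. 0 < r ==> deriv (deriv q) r = m'' r"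
  using C0_twice_diffI[OF cq dq dd(4)] by auto
 have m0: "0 < m0"
 proof -
  \<comment> \<open>At s the quadratic error is at most b/2, so m0 >= b/2.\<close>
  define s where "s = min (min r1 \<rho>) (min 1 (b / (2 * C)))"
  have s: "0 < s" "s <= r1" "s <= \<rho>" "s <= 1" "s <= b / (2 * C)" using r1 b C by (auto simp: s_def)
  have "C * s^2 <= C * s" using s C by (simp add: power2_eq_square mult_left_le)
  moreover have "2 * (C * s) <= b" using s(5) C by (simp add: pos_le_divide_eq mult_ac)
  ultimately show ?thesis using r1(2)[OF s(1,2)] b(4)[OF s(1,3)] b(1) by linarith
 qed
 have qp: "0 < q r" if "0 <= r" for r using m0 b(3)[of r] by (auto simp: q_def)
 have "GL_system d g p q"
  unfolding GL_system_def
 proof (intro allI impI)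
  fix r :: real assume r: "0 < r"
  have "f'' r = ((of_int d)^2 / r^2 - (1 - (f r)^2 - (m r)^2)) * f r - f' r / r" "m'' r = (g - (1 - (f r)^2 - (m r)^2)) * m r - m' r / r"
   using dd(5,6)[OF r] by linarith+
  then show "- deriv (deriv p) r - 1 / r * deriv p r + (of_int d)^2 / r^2 * p r = (1 - (p r)^2 - (q r)^2) * p r \<and>
    - deriv (deriv q) r - 1 / r * deriv q r + g * q r = (1 - (p r)^2 - (q r)^2) * q r"
   unfolding Cp(2,3)[OF r] Cq(2,3)[OF r] pe[OF r] qe[OF r] by (simp only:) (simp add: algebra_simps)
 qed
 moreover have "GL_energy d F g p q < \<infinity>" using nice_GL_energy_finite[OF N N0 pe qe] by simp
 moreover have "0 <= p r \<and> 0 <= q r" if "0 <= r" for r using qp[OF that] dd(7)[of r] by (simp add: p_def)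
 ultimately have "admissible_solution d F g p q" using Cp(1) Cq(1) dq0 by (simp add: admissible_solution_def)
 then show ?thesis by (rule that[OF _ pe qe qp])
qed

text \<open>Positivity up to r = 0 gives, by compactness of [0,1], the lower bound near the origin
  that \<open>nice_positive_form\<close> asks for.\<close>

lemma admissible_positive_form:
 assumes A: "admissible_solution d F g f m" and F: "normal_core_profile d F" and d: "d ~= 0" and g: "0 < g"
  and m: "!!r. 0 <= r ==> 0 < m r" and U: "radH U v"
 shows "0 <= second_variation g f m U v"
proof -
 have "continuous_on {0..1} m" by (rule continuous_on_subset[of "{0..}"]) (use A in \<open>auto simp: admissible_solution_def C0_twice_diff_def\<close>)
 then obtain x where x: "x \<in> {0..1}" "!!y. y \<in> {0..1} ==> m x <= m y" using continuous_attains_inf[of "{0..1::real}" m] by auto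
 show ?thesis
  by (rule nice_positive_form[OF admissible_nice[OF A F d g] _ _ _ _ _ g U, where b = "m x" and \<rho> = 1]) (use m x in auto)
qed

section \<open>Uniqueness and the core solution among admissible pairs\<close>

lemma admissible_unique:
 assumes F: "normal_core_profile d F" and d: "d ~= 0" and g: "0 < g"
  and A: "admissible_solution d F g f m" and B: "admissible_solution d F g p q"
  and h: "0 <= second_variation g f m q (deriv q)"
   "0 <= second_variation g p q m (deriv m)"
  and r: "0 <= r"
 shows "f r = p r \<and> m r = q r"
proof -
 have e: "f r = p r" "m r = q r" if "0 < r" for r
  using nice_unique[OF admissible_nice[OF A F d g] admissible_nice[OF B F d g] _ h that] by auto
 have "f 0 = p 0" by (rule eq_at_zero[OF _ _ e(1)]) (use A B in \<open>auto simp: admissible_solution_def\<close>)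
 moreover have "m 0 = q 0" by (rule eq_at_zero[OF _ _ e(2)]) (use A B in \<open>auto simp: admissible_solution_def\<close>)
 ultimately show ?thesis using e[of r] r by (cases "r = 0") auto
qed


text \<open>Membership in Z is not part of admissibility; \<open>nice_difference\<close> provides it
  by comparing f with the core profile.\<close>

lemma admissible_Z_rad:
 assumes A: "admissible_solution d F g f m" and F: "normal_core_profile d F" and d: "d ~= 0" and g: "0 < g"
 shows "(f, m) \<in> Z_rad F"
proof -
 note N = admissible_nice[OF A F d g] and N0 = profile_nice[OF F d g]
 have D: "0 <= (real_of_int d)^2" by simp
 note df = nice_difference[OF N N0 D]
 have "C0_twice_diff f" "C0_twice_diff F" using A F by (auto simp: admissible_solution_def normal_core_profile_def)
 then have dd: "DERIV (\<lambda>r. f r - F r) r :> deriv f r - deriv F r" if "0 < r" for r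
  using that by (intro DERIV_diff C0_twice_diff_DERIV(1))
 have "(\<lambda>r. f r - F r) \<in> H_rad"
  by (rule radH_C1_H_rad[OF dd continuous_on_diff[OF nice_continuous(2)[OF N D] nice_continuous(2)[OF N0 D]] df(1,3)])
 moreover have "integrable_pos (\<lambda>r. (f r - F r)^2 / r^2 * r) = integrable_pos (\<lambda>r. (f r - F r)^2 / r)"
  by (rule set_integrable_cong) (auto simp: power2_eq_square)
 ultimately have "(\<lambda>r. f r - F r) \<in> X_rad" using df(2) by (simp add: X_rad_def)
 moreover have "m \<in> H_rad" by (rule nice_m_radH(2)[OF N D])
 ultimately show ?thesis unfolding Z_rad_def by (intro CollectI exI[of _ "\<lambda>r. f r - F r"] exI[of _ m]) auto
qed

lemma core_admissible:
 assumes F: "normal_core_profile d F" and d: "d ~= 0" and g: "0 < g"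
 shows "admissible_solution d F g F (\<lambda>r. 0)"
proof -
 have z: "deriv (\<lambda>r::real. 0::real) = (\<lambda>r. 0)" by (simp add: fun_eq_iff)
 note N = profile_nice[OF F d g]
 have "GL_energy d F g F (\<lambda>r. 0) < \<infinity>" using nice_GL_energy_finite[OF N N, of F "\<lambda>r. 0"] by simp
 moreover have "C0_twice_diff (\<lambda>r. 0)" by (simp add: C0_twice_diff_def z)
 moreover have "GL_system d g F (\<lambda>r. 0)" using F by (simp add: GL_system_def normal_core_profile_def z)
 moreover have "0 <= F r" if "0 <= r" for r
  using F that by (cases "r = 0") (auto simp: normal_core_profile_def less_imp_le)
 ultimately show ?thesis using F by (simp add: admissible_solution_def normal_core_profile_def)
qed

theorem theorem4p5:
  fixes d :: int and finf :: "real \<Rightarrow> real"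
  assumes "d \<noteq> 0" and "normal_core_profile d finf"
  shows
    "(\<forall>g::real. g \<ge> g_star finf \<longrightarrow>
        admissible_solution d finf g finf (\<lambda>r. 0) \<and>
        (\<forall>f m. admissible_solution d finf g f m \<longrightarrow> (\<forall>r\<ge>0. f r = finf r \<and> m r = 0))) \<and>
     (\<forall>g::real. 0 < g \<and> g < g_star finf \<longrightarrow>
        (\<exists>f m. admissible_solution d finf g f m \<and> (\<forall>r\<ge>0. m r > 0) \<and>
           (\<forall>f' m'. admissible_solution d finf g f' m' \<and> (\<forall>r\<ge>0. m' r > 0) \<longrightarrow>
              (\<forall>r\<ge>0. f' r = f r \<and> m' r = m r)) \<and>
           (f, m) \<in> Z_rad finf \<and>
           (\<forall>(p, q) \<in> Z_rad finf. GL_energy d finf g f m \<le> GL_energy d finf g p q)))"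
proof -
 note d = assms(1) and F = assms(2)
 let ?D = "(real_of_int d)^2"
 have D: "0 <= ?D" by simp
 have cF: "continuous_on {0<..} finf"
  using F by (auto simp: normal_core_profile_def C0_twice_diff_def elim: continuous_on_subset)
 note F1 = profile_less_1[OF F d]
 have F01: "0 <= finf r \<and> finf r <= 1" if "0 < r" for r
  using F F1[OF that] that by (auto simp: normal_core_profile_def less_imp_le)
 have gs: "nonzeroH ~= {}" "0 < g_star finf" "g_star finf <= 1"
  using g_star_range[OF cF F01 F1] by auto
 \<comment> \<open>For the core solution as competitor the second component is zero, and its form
   vanishes at every potential.\<close>
 have zero: "(LBINT r:{0<..}. ((deriv (\<lambda>r. 0) r)^2 + c r * 0^2) * r) = 0" for c :: "real => real"
  by (simp add: set_lebesgue_integral_def)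
 \<comment> \<open>Of the two forms in \<open>admissible_unique\<close>, the one at the core is
   nonnegative by the definition of \<open>g_star\<close>, and the other is evaluated at the zero
   function.\<close>
 have part1: "f r = finf r \<and> m r = 0" if g: "g_star finf <= g" and A: "admissible_solution d finf g f m" and r: "0 <= r" for g f m r
 proof -
  have g0: "0 < g" using g gs by linarith
  note N = admissible_nice[OF A F d g0]
  have "0 <= (LBINT r:{0<..}. ((deriv m r)^2 + (g - (1 - (finf r)^2)) * (m r)^2) * r)"
   by (rule g_star_nonneg_form[OF cF F01 g nice_m_radH(2)[OF N D] nice_m_radH(1)[OF N D]])
  then show ?thesis
   using admissible_unique[OF F d g0 A core_admissible[OF F d g0] _ _ r] zero by simp
 qed
 have part2: "\<exists>f m. admissible_solution d finf g f m \<and> (\<forall>r\<ge>0. m r > 0)" if g: "0 < g" "g < g_star finf" for g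
 proof -
  \<comment> \<open>From \<open>g_star finf <= 1\<close>; the starting constant sqrt(1 - g) of the
    iteration needs g < 1.\<close>
  have g1: "g < 1" using g gs by linarith
  \<comment> \<open>Only d^2 enters the equations, while the power r^n in \<open>phi\<close> needs a
    natural exponent.\<close>
  define n where "n = nat \<bar>d\<bar>"
  have n: "1 <= n" "(real n)^2 = ?D" using d by (auto simp: n_def)
  note N0 = profile_nice[OF F d g(1)]
  have N1: "nice ((real n)^2) 1 finf (deriv finf) (deriv (deriv finf)) (\<lambda>r. 0) (\<lambda>r. 0) (\<lambda>r. 0)"
   unfolding n(2) by (rule profile_nice[OF F d]) simp
  have lim: "(finf \<longlongrightarrow> 1) at_top" using F by (simp add: normal_core_profile_def)
  obtain f f' f'' m m' m'' where N: "nice ?D g f f' f'' m m' m''"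
   and form: "!!U v. radH U v ==> 0 <= second_variation g f m U v"
   and alt: "(\<forall>r>0. m r = 0) \<or> (\<exists>b>0. (\<forall>r>0. 0 < m r) \<and> (\<forall>r>0. r <= 1 --> b <= m r))"
   by (rule coexistence_solution[OF n(1) g(1) g1 N1 lim, unfolded n(2)]) blast
  from alt show ?thesis
  proof
   \<comment> \<open>A limit with m = 0 would be the core solution by \<open>nice_unique\<close>,
     but for g below \<open>g_star\<close> the form there has a negative direction, against
     \<open>form\<close>.\<close>
   assume m0: "\<forall>r>0. m r = 0"
   have G: "GLsol ?D g f f' f'' m m' m''" using N by (simp add: nice_def)
   have m'0: "m' r = 0" if r: "0 < r" for r
   proof -
    have "\<forall>\<^sub>F x in nhds r. 0 < x" using eventually_nhds_in_open[of "{0<..}" r] r by simp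
    then have "\<forall>\<^sub>F x in nhds r. m x = 0" by eventually_elim (use m0 in simp)
    then have "DERIV m r :> m' r \<longleftrightarrow> DERIV (\<lambda>x. 0) r :> m' r" by (intro DERIV_cong_ev) auto
    then have "DERIV (\<lambda>x. 0) r :> m' r" using GLsolD(3)[OF G r] by simp
    then show ?thesis by (rule DERIV_unique) simp
   qed
   have "(LBINT r:{0<..}. ((m' r)^2 + (g - (1 - (finf r)^2 - 0^2)) * (m r)^2) * r) = (LBINT r:{0::real<..}. 0)"
    by (rule set_lebesgue_integral_cong) (use m0 m'0 in auto)
   then have h: "0 <= (LBINT r:{0<..}. ((m' r)^2 + (g - (1 - (finf r)^2 - 0^2)) * (m r)^2) * r)" by simp
   have h': "0 <= (LBINT r:{0<..}. (0^2 + (g - (1 - (f r)^2 - (m r)^2)) * 0^2) * r)"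
    by (simp add: set_lebesgue_integral_def)
   have eq: "f r = finf r" if "0 < r" for r by (rule nice_unique(1)[OF N N0 D h' h that])
   obtain U v where U: "radH U v" "(LBINT r:{0<..}. ((v r)^2 + (g - (1 - (finf r)^2)) * (U r)^2) * r) < 0"
    by (rule g_star_negative_form[OF cF F01 g(2) gs(1)])
   have "second_variation g f m U v =
     (LBINT r:{0<..}. ((v r)^2 + (g - (1 - (finf r)^2)) * (U r)^2) * r)"
    by (rule set_lebesgue_integral_cong) (use m0 eq in auto)
   then show ?thesis using form[OF U(1)] U(2) by simp
  next
   assume "\<exists>b>0. (\<forall>r>0. 0 < m r) \<and> (\<forall>r>0. r <= 1 --> b <= m r)"
   then obtain b where b: "0 < b" "!!r. 0 < r ==> 0 < m r" "!!r. 0 < r ==> r <= 1 ==> b <= m r" by auto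
   show ?thesis
   proof (rule nice_admissible[OF N N0 b(1) zero_less_one b(2,3)])
    fix p q assume "admissible_solution d finf g p q" "!!r. 0 <= r ==> 0 < q r"
    then show ?thesis by (intro exI[of _ p] exI[of _ q]) auto
   qed
  qed
 qed
 \<comment> \<open>Both forms are nonnegative because each belongs to a solution with positive m,
   whatever competitor is inserted.\<close>
 have part3: "f' r = f r \<and> m' r = m r"
  if g: "0 < g" and A: "admissible_solution d finf g f m" "\<forall>r\<ge>0. m r > 0"
   and B: "admissible_solution d finf g f' m'" "\<forall>r\<ge>0. m' r > 0" and r: "0 <= r" for g f m f' m' r
 proof -
  have mp: "0 < m r" "0 < m' r" if "0 <= r" for r using A(2) B(2) that by auto
  have "0 <= second_variation g f' m' m (deriv m)"
   by (rule admissible_positive_form[OF B(1) F d g mp(2) nice_m_radH(1)[OF admissible_nice[OF A(1) F d g] D]])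
  moreover have "0 <= second_variation g f m m' (deriv m')"
   by (rule admissible_positive_form[OF A(1) F d g mp(1) nice_m_radH(1)[OF admissible_nice[OF B(1) F d g] D]])
  ultimately show ?thesis by (rule admissible_unique[OF F d g B(1) A(1) _ _ r])
 qed
 have part4: "GL_energy d finf g f m <= GL_energy d finf g p q"
  if g: "0 < g" and A: "admissible_solution d finf g f m" "\<forall>r\<ge>0. m r > 0" and Z: "(p, q) \<in> Z_rad finf" for g f m p q
 proof (rule nice_minimizer[OF admissible_nice[OF A(1) F d g] profile_nice[OF F d g] _ Z])
  fix U v assume "radH U v"
  then show "0 <= second_variation g f m U v"
   by (intro admissible_positive_form[OF A(1) F d g]) (use A(2) in auto)
 qed
 show ?thesis
 proof (intro conjI allI impI)
  fix g assume g: "g_star finf <= g"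
  then have "0 < g" using gs by linarith
  then show "admissible_solution d finf g finf (\<lambda>r. 0)" by (rule core_admissible[OF F d])
  fix f m r assume "admissible_solution d finf g f m" "(0::real) <= r"
  then show "f r = finf r" "m r = 0" using part1[OF g] by auto
 next
  fix g assume g: "0 < g \<and> g < g_star finf"
  then obtain f m where A: "admissible_solution d finf g f m" "\<forall>r\<ge>0. m r > 0" using part2 by blast
  have g0: "0 < g" using g by simp
  show "\<exists>f m. admissible_solution d finf g f m \<and> (\<forall>r\<ge>0. m r > 0) \<and>
      (\<forall>f' m'. admissible_solution d finf g f' m' \<and> (\<forall>r\<ge>0. m' r > 0) -->
       (\<forall>r\<ge>0. f' r = f r \<and> m' r = m r)) \<and>
      (f, m) \<in> Z_rad finf \<and>
      (\<forall>(p, q) \<in> Z_rad finf. GL_energy d finf g f m <= GL_energy d finf g p q)"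
  proof (rule exI[of _ f], rule exI[of _ m], intro conjI)
   show "\<forall>f' m'. admissible_solution d finf g f' m' \<and> (\<forall>r\<ge>0. m' r > 0) --> (\<forall>r\<ge>0. f' r = f r \<and> m' r = m r)"
   proof (intro allI impI)
    fix f' m' r assume "admissible_solution d finf g f' m' \<and> (\<forall>r\<ge>0. m' r > 0)" "(0::real) <= r"
    then show "f' r = f r \<and> m' r = m r" by (intro part3[OF g0 A]) auto
   qed
   show "\<forall>(p, q) \<in> Z_rad finf. GL_energy d finf g f m <= GL_energy d finf g p q"
    using part4[OF g0 A] by auto
  qed (fact A admissible_Z_rad[OF A(1) F d g0])+
 qed
qed

end
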